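(* Let $n$ be a positive integer and let $f,g\in M_{1}(\mathbb{C})$. Let $S_{1}=\{\alpha_1,\alpha_2,\ldots,\alpha_n\}$ and $S_{2}=\{\beta_{1},\beta_{2}\}$, where $\alpha_1,\ldots,\alpha_n,\beta_{1},\beta_{2}$ are $n+2$ distinct non-zero complex constants. Let $P$ be the polynomial associated with $S_1$, let $\Gamma_1$ be the number of distinct zeros of $P$, and let $k$ be the number of distinct zeros of $P'$ (all as defined in the context). Suppose that $n>\max\{2k+2,\,2\Gamma_{1}\}$, $k\geq 2$ and $\Gamma_{1}\geq 3$. Suppose moreover that $$(\beta_{1}-\alpha_{1})(\beta_{1}-\alpha_{2})\cdots(\beta_{1}-\alpha_{n})\neq(\beta_{2}-\alpha_{1})(\beta_{2}-\alpha_{2})\cdots(\beta_{2}-\alpha_{n})$$ and that $f$ is of non-integer finite order. If $f$ and $g$ share $(S_{1},2)$ and share $S_{2}$ IM, then $f\equiv g$.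
   Context: $M_{1}(\mathbb{C})$ denotes the class of meromorphic functions in $\mathbb{C}$ which have finitely many poles in $\mathbb{C}$. The order of a meromorphic function $f$ is $\rho(f)=\limsup_{r\to\infty}\frac{\ln T(r,f)}{\ln r}$, where $T(r,f)$ is the Nevanlinna characteristic; "$f$ is of non-integer finite order" means that $\rho(f)$ is finite and is not an integer. Sharing of sets. For a meromorphic $f$, a value $a\in\mathbb{C}\cup\{\infty\}$ and $l$ a non-negative integer or $\infty$, $E_{l}(a;f)$ denotes the collection of all $a$-points of $f$ (in $\mathbb{C}$), where an $a$-point of multiplicity $m$ is counted $m$ times if $m\le l$ and $l+1$ times if $m>l$. For a non-empty set $S\subset\mathbb{C}\cup\{\infty\}$ put $E_f(S,l)=\bigcup_{a\in S}E_l(a;f)$ (with these counts). Two meromorphic functions $f,g$ share $(S,l)$ if $E_f(S,l)=E_g(S,l)$. They share $S$ IM if $\overline{E}_f(S)=\overline{E}_g(S)$, where $\overline{E}_f(S)$ is the set of distinct points $z$ with $f(z)\in S$ (this is the case $l=0$). Polynomial attached to $S_1$. For distinct non-zero complex constants $\alpha_1,\ldots,\alpha_n$, set $$P(z)=\frac{z^{n}-\left(\sum\alpha_{i}\right)z^{n-1}+\cdots+(-1)^{n-1}\left(\sum \alpha_{i_{1}}\alpha_{i_{2}}\cdots\alpha_{i_{n-1}}\right)z}{(-1)^{n+1}\alpha_{1}\alpha_{2}\cdots\alpha_{n}},$$ i.e. $(z-\alpha_1)\cdots(z-\alpha_n)=(-1)^{n+1}\alpha_1\cdots\alpha_n\,(P(z)-1)$.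 Let $m_1$ be the number of simple zeros of $P$ and $m_2$ the number of (distinct) multiple zeros of $P$; then $\Gamma_1:=m_1+m_2$. The integer $k$ is the number of distinct zeros of $P'(z)$. *)

theory Defs
  imports "HOL-Complex_Analysis.Complex_Analysis" "HOL-Library.Extended_Nat"
begin

section \<open>Meromorphic functions with finitely many poles\<close>

text \<open>
  A meromorphic function in the plane is represented by its canonical representative
  \<open>complex \<Rightarrow> complex\<close>: continuous off the poles, and with the dummy value 0 at the poles.
  Identity of meromorphic functions is then equality of these representatives. The dummy
  value must not be mistaken for a zero, so poles are excluded explicitly below wherever values
  of the function are tested.
\<close>

definition M1 :: "(complex \<Rightarrow> complex) set" where
  "M1 = {f. f nicely_meromorphic_on UNIV \<and> finite {z. is_pole f z}}"

section \<open>The Nevanlinna characteristic and the order\<close>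

definition log_plus :: "real \<Rightarrow> real" where
  "log_plus x = max 0 (ln x)"

definition proximity :: "(complex \<Rightarrow> complex) \<Rightarrow> real \<Rightarrow> real" where
  "proximity f r =
     1 / (2 * pi) * integral {0..2 * pi} (\<lambda>\<theta>. log_plus (cmod (f (of_real r * cis \<theta>))))"

text \<open>The number of poles in the closed disc of radius \<open>t\<close>, counted with multiplicity.\<close>

definition pole_count :: "(complex \<Rightarrow> complex) \<Rightarrow> real \<Rightarrow> nat" where
  "pole_count f t = (\<Sum>z | is_pole f z \<and> cmod z \<le> t. nat (- zorder f z))"

text \<open>
  The integrand below vanishes near \<open>t = 0\<close>, because the poles of a meromorphic function are
  isolated.
\<close>

definition pole_counting :: "(complex \<Rightarrow> complex) \<Rightarrow> real \<Rightarrow> real" where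
  "pole_counting f r =
     integral {0..r} (\<lambda>t. (real (pole_count f t) - real (pole_count f 0)) / t)
       + real (pole_count f 0) * ln r"

definition nevanlinna_T :: "(complex \<Rightarrow> complex) \<Rightarrow> real \<Rightarrow> real" where
  "nevanlinna_T f r = proximity f r + pole_counting f r"

text \<open>
  Since \<open>ln 0 = 0\<close> in HOL, a function with identically vanishing characteristic (a constant of
  modulus at most 1) gets order 0.
\<close>

definition nevanlinna_order :: "(complex \<Rightarrow> complex) \<Rightarrow> ereal" where
  "nevanlinna_order f = Limsup at_top (\<lambda>r::real. ereal (ln (nevanlinna_T f r) / ln r))"

definition non_integer_finite_order :: "(complex \<Rightarrow> complex) \<Rightarrow> bool" where
  "non_integer_finite_order f \<longleftrightarrow>
     \<bar>nevanlinna_order f\<bar> \<noteq> \<infinity> \<and> real_of_ereal (nevanlinna_order f) \<notin> \<int>"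

section \<open>Sharing of sets\<close>

text \<open>
  Only sets of finite values are considered, the value \<open>\<infinity>\<close> is left out.
  The multiplicity of \<open>z\<close> as an \<open>a\<close>-point of \<open>f\<close>, for a finite value \<open>a\<close>; it is 0 if \<open>z\<close> is not an
  \<open>a\<close>-point, and \<open>\<infinity>\<close> if \<open>f\<close> is the constant \<open>a\<close>.
\<close>

definition a_point_mult :: "(complex \<Rightarrow> complex) \<Rightarrow> complex \<Rightarrow> complex \<Rightarrow> enat" where
  "a_point_mult f a z =
     (if is_pole f z \<or> f z \<noteq> a then 0
      else if eventually (\<lambda>w. f w = a) (at z) then \<infinity>
      else enat (nat (zorder (\<lambda>w. f w - a) z)))"

definition truncated_mult :: "enat \<Rightarrow> enat \<Rightarrow> enat" where
  "truncated_mult l m = (if m \<le> l then m else l + 1)"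

text \<open>
  A collection of points in which \<open>z\<close> is counted \<open>c z\<close> times is encoded as the set of all pairs
  \<open>(z, i)\<close> with \<open>i < c z\<close>. For different values \<open>a\<close> the collections of \<open>a\<close>-points are
  disjoint, so the union over \<open>a \<in> S\<close> keeps the counts.
\<close>

definition E_val :: "enat \<Rightarrow> complex \<Rightarrow> (complex \<Rightarrow> complex) \<Rightarrow> (complex \<times> nat) set" where
  "E_val l a f = {(z, i). enat i < truncated_mult l (a_point_mult f a z)}"

definition E_set :: "(complex \<Rightarrow> complex) \<Rightarrow> complex set \<Rightarrow> enat \<Rightarrow> (complex \<times> nat) set" where
  "E_set f S l = (\<Union>a\<in>S. E_val l a f)"

definition share_weighted ::
    "(complex \<Rightarrow> complex) \<Rightarrow> (complex \<Rightarrow> complex) \<Rightarrow> complex set \<Rightarrow> enat \<Rightarrow> bool" where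
  "share_weighted f g S l \<longleftrightarrow> E_set f S l = E_set g S l"

definition E_bar :: "(complex \<Rightarrow> complex) \<Rightarrow> complex set \<Rightarrow> complex set" where
  "E_bar f S = {z. \<not> is_pole f z \<and> f z \<in> S}"

definition share_IM :: "(complex \<Rightarrow> complex) \<Rightarrow> (complex \<Rightarrow> complex) \<Rightarrow> complex set \<Rightarrow> bool" where
  "share_IM f g S \<longleftrightarrow> E_bar f S = E_bar g S"

section \<open>The polynomial attached to a finite set\<close>

definition elem_sym :: "nat \<Rightarrow> (nat \<Rightarrow> complex) \<Rightarrow> nat \<Rightarrow> complex" where
  "elem_sym n \<alpha> j = (\<Sum>I | I \<subseteq> {1..n} \<and> card I = j. \<Prod>i\<in>I. \<alpha> i)"

definition attached_poly :: "nat \<Rightarrow> (nat \<Rightarrow> complex) \<Rightarrow> complex poly" where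
  "attached_poly n \<alpha> =
     smult (1 / ((-1) ^ (n + 1) * (\<Prod>i\<in>{1..n}. \<alpha> i)))
       (\<Sum>j<n. monom ((-1) ^ j * elem_sym n \<alpha> j) (n - j))"

lemma poly_attached_poly:
  assumes "\<And>i. i \<in> {1..n} \<Longrightarrow> \<alpha> i \<noteq> 0"
  shows "(\<Prod>i\<in>{1..n}. z - \<alpha> i) =
         (-1) ^ (n + 1) * (\<Prod>i\<in>{1..n}. \<alpha> i) * (poly (attached_poly n \<alpha>) z - 1)"
proof -
  let ?A = "{1..n}" and ?p = "\<Prod>i\<in>{1..n}. \<alpha> i"
  let ?t = "\<lambda>j. (-1) ^ j * elem_sym n \<alpha> j * z ^ (n - j)"
  have nz: "?p \<noteq> 0" using assms by simp
  have "(\<Prod>i\<in>?A. z - \<alpha> i) = (\<Prod>i\<in>?A. - \<alpha> i + z)" by simp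
  also have "\<dots> = (\<Sum>I\<in>Pow ?A. (\<Prod>i\<in>I. - \<alpha> i) * (\<Prod>i\<in>?A - I. z))"
    by (rule prod_add) simp
  also have "\<dots> = (\<Sum>I\<in>Pow ?A. (-1) ^ card I * (\<Prod>i\<in>I. \<alpha> i) * z ^ (n - card I))"
    by (intro sum.cong refl) (auto simp: card_Diff_subset finite_subset prod_uminus)
  also have "\<dots> = (\<Sum>j\<le>n. \<Sum>I\<in>{I \<in> Pow ?A. card I = j}.
                      (-1) ^ card I * (\<Prod>i\<in>I. \<alpha> i) * z ^ (n - card I))"
    by (rule sum.group[symmetric]) (auto dest: card_mono[rotated])
  also have "\<dots> = (\<Sum>j\<le>n. ?t j)"
    unfolding elem_sym_def sum_distrib_left sum_distrib_right by (intro sum.cong) auto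
  also have "\<dots> = (\<Sum>j<n. ?t j) + ?t n"
    by (simp add: lessThan_Suc_atMost[symmetric])
  also have "elem_sym n \<alpha> n = ?p"
  proof -
    have "{I. I \<subseteq> ?A \<and> card I = n} = {?A}"
      using card_subset_eq[of ?A] by auto
    then show ?thesis by (simp add: elem_sym_def)
  qed
  finally have *: "(\<Prod>i\<in>?A. z - \<alpha> i) = (\<Sum>j<n. ?t j) + (-1) ^ n * ?p" by simp
  have "poly (attached_poly n \<alpha>) z = (\<Sum>j<n. ?t j) / ((-1) ^ (n + 1) * ?p)"
    by (simp add: attached_poly_def poly_sum poly_monom)
  then have "(\<Sum>j<n. ?t j) = (-1) ^ (n + 1) * ?p * poly (attached_poly n \<alpha>) z"
    using nz by simp
  then show ?thesis unfolding * by (simp only:) (simp add: algebra_simps)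
qed

definition num_simple_zeros :: "complex poly \<Rightarrow> nat" where
  "num_simple_zeros p = card {z. poly p z = 0 \<and> order z p = 1}"

definition num_multiple_zeros :: "complex poly \<Rightarrow> nat" where
  "num_multiple_zeros p = card {z. poly p z = 0 \<and> order z p \<ge> 2}"

end

theory Submission
  imports Defs "HOL-Real_Asymp.Real_Asymp" "HOL-Computational_Algebra.Fundamental_Theorem_Algebra"
begin

text \<open>
  Let \<open>u = P \<circ> f - 1\<close> and \<open>v = P \<circ> g - 1\<close>, which up to a constant are the products of all \<open>f - \<alpha>\<^sub>i\<close> and of
  all \<open>g - \<alpha>\<^sub>i\<close>. Since the \<open>\<alpha>\<^sub>i\<close> are simple roots of \<open>P - 1\<close>, the hypothesis on \<open>S\<^sub>1\<close> says that \<open>u\<close> and \<open>v\<close>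
  have the same zeros, with multiplicities that are equal or both at least 3. Following Nevanlinna
  theory, one compares \<open>1 / u\<close> with \<open>1 / v\<close> through \<open>H = u'' / u' - 2 u' / u - (v'' / v' - 2 v' / v)\<close>.

  If \<open>H\<close> does not vanish identically, then \<open>f\<close> has order 0 (\<open>weighted_sharing_order_0\<close>); this needs
  \<open>n \<ge> 2 k + 3\<close>. If \<open>H = 0\<close>, integrating twice gives \<open>1 / u = a / v + b\<close>
  (\<open>inv_pre_schwarzian_eq_imp_moebius\<close>), and there are three cases. For \<open>b \<noteq> 0\<close> the function \<open>P \<circ> f\<close>
  omits a value, which \<open>P\<close> takes at two points or more since \<open>k \<ge> 2\<close>, so \<open>f\<close> omits two values and has
  order 0 (\<open>omits_two_values_order_0\<close>); for \<open>b = 0\<close>, \<open>a \<noteq> 1\<close> the functions \<open>P \<circ> f\<close> and \<open>P \<circ> g\<close> are related by an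
  affine map that does not fix 0, and \<open>f\<close> has order 0 because \<open>P\<close> has few distinct zeros
  (\<open>affinely_related_order_0\<close>). As 0 is an integer, none of this can happen. There remains \<open>P \<circ> f = P \<circ> g\<close>.
  Here \<open>f\<close> and \<open>g\<close> share \<open>\<beta>\<^sub>1\<close> and \<open>\<beta>\<^sub>2\<close> separately, both quotients \<open>(f - \<beta>\<^sub>i) / (g - \<beta>\<^sub>i)\<close> are
  exponentials of polynomials of degree less than the order of \<open>f\<close>, and \<open>f \<noteq> g\<close> would express \<open>f\<close> by
  them (\<open>same_poly_values_uniqueness\<close>).

  The three statements on order 0 come from one criterion (\<open>order_0_criterion\<close>), which does without
  the main theorems of Nevanlinna theory. Suppose that \<open>\<Psi>\<close> is not identically zero, has finitely many poles, and
  that \<open>\<bar>\<Psi>\<bar> (1 + \<bar>f\<bar> + \<bar>g\<bar>)\<close> is bounded by a power of logarithmic derivatives of functions built from \<open>f\<close> and \<open>g\<close>.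
  On suitable circles logarithmic derivatives are bounded by a power of \<open>log M(R)\<close>, where \<open>M\<close> is the
  maximum modulus (\<open>log_deriv_bound_family\<close>); dividing by \<open>\<Psi>\<close> (\<open>quotient_bound\<close>) gives a bound of
  \<open>log M(r)\<close> by \<open>log log M(R) + log R\<close> times a power of \<open>R / (R - r)\<close>. Such an inequality forces
  \<open>log M(r) \<le> (log r)\<^sup>2\<close> for large \<open>r\<close> (\<open>growth_dichotomy\<close>). The characteristic itself enters only in
  the translation between maximum modulus and order: an upper bound is immediate, and Poisson's
  inequality yields the lower one.
\<close>

section \<open>Zeros and growth of entire functions\<close>

lemma entire_factor_point:
  assumes F: "F holomorphic_on UNIV" and w: "F w \<noteq> (0::complex)"
  obtains m h where "h holomorphic_on UNIV" "h a \<noteq> 0" "\<And>z. F z = (z - a) ^ m * h z"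
proof (cases "F a = 0")
  case False
  show ?thesis by (rule that[of F 0]) (use F False in auto)
next
  case True
  have "\<not> F constant_on UNIV"
    using True w by (metis UNIV_I constant_on_def)
  then obtain g r m where gr: "0 < m" "0 < r" "g holomorphic_on ball a r"
      "\<And>z. z \<in> ball a r \<Longrightarrow> F z = (z - a) ^ m * g z" "\<And>z. z \<in> ball a r \<Longrightarrow> g z \<noteq> 0"
    using holomorphic_factor_zero_nonconstant[OF F open_UNIV connected_UNIV UNIV_I True]
    by (metis (no_types, lifting))
  define h where "h z = (if z = a then g a else F z / (z - a) ^ m)" for z
  have eq: "h z = g z" if "z \<in> ball a r" for z
    using gr(4)[OF that] by (auto simp: h_def)
  have "h holomorphic_on ball a r"
    using gr(3) eq by (metis holomorphic_transform)
  moreover have "h holomorphic_on (- {a})"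
  proof -
    have "(\<lambda>z. F z / (z - a) ^ m) holomorphic_on (- {a})"
      by (intro holomorphic_intros holomorphic_on_subset[OF F]) auto
    then show ?thesis
      by (rule holomorphic_transform) (auto simp: h_def)
  qed
  ultimately have "h holomorphic_on (ball a r \<union> - {a})"
    by (intro holomorphic_on_Un) auto
  moreover have "ball a r \<union> - {a} = UNIV"
    using gr(2) by auto
  ultimately have "h holomorphic_on UNIV" by simp
  moreover have "h a \<noteq> 0" using gr(2) gr(5)[of a] by (simp add: h_def)
  moreover have "F z = (z - a) ^ m * h z" for z
    using True gr(1) by (auto simp: h_def)
  ultimately show ?thesis using that by blast
qed

lemma entire_factor_finite_set:
  assumes "finite Z" and F: "F holomorphic_on UNIV" and w: "F w \<noteq> (0::complex)"
  shows "\<exists>bs h. set bs \<subseteq> Z \<and> h holomorphic_on UNIV \<and> (\<forall>z\<in>Z. h z \<noteq> 0) \<and>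
               (\<forall>z. F z = (\<Prod>b\<leftarrow>bs. z - b) * h z)"
  using assms(1)
proof induction
  case empty
  show ?case by (rule exI[of _ "[]"], rule exI[of _ F]) (use F in auto)
next
  case (insert a Z)
  then obtain bs h where bh: "set bs \<subseteq> Z" "h holomorphic_on UNIV" "\<And>z. z \<in> Z \<Longrightarrow> h z \<noteq> 0"
      "\<And>z. F z = (\<Prod>b\<leftarrow>bs. z - b) * h z" by blast
  have "h w \<noteq> 0" using w bh(4)[of w] by auto
  then obtain m k where k: "k holomorphic_on UNIV" "k a \<noteq> 0" "\<And>z. h z = (z - a) ^ m * k z"
    using entire_factor_point[OF bh(2)] by metis
  have "(\<Prod>b\<leftarrow>replicate m a @ bs. z - b) * k z = F z" for z
    by (simp add: bh(4) k(3) map_replicate prod_list_replicate)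
  then show ?case
    using bh k
    by (intro exI[of _ "replicate m a @ bs"] exI[of _ k]) (auto split: if_splits)
qed

text \<open>
  This replaces infinite products: in all growth estimates only the zeros in one disc have to be
  divided out, and the remaining factor has a logarithm there.
\<close>
lemma entire_factor_cball:
  assumes F: "F holomorphic_on UNIV" and w: "F w \<noteq> (0::complex)"
  obtains bs h where "\<And>b. b \<in> set bs \<Longrightarrow> norm b \<le> \<rho> \<and> F b = 0" "h holomorphic_on UNIV"
    "\<And>z. norm z \<le> \<rho> \<Longrightarrow> h z \<noteq> 0" "\<And>z. F z = (\<Prod>b\<leftarrow>bs. z - b) * h z"
proof -
  define Z where "Z = {z \<in> cball 0 \<rho>. F z = 0}"
  have "finite Z"
  proof (cases "F constant_on UNIV")
    case True
    then have "Z = {}" using w by (auto simp: Z_def constant_on_def)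
    then show ?thesis by simp
  next
    case False
    show ?thesis unfolding Z_def
      by (rule holomorphic_compact_finite_zeros[OF F _ connected_UNIV]) (use False in auto)
  qed
  from entire_factor_finite_set[OF this F w] obtain bs h where
    bh: "set bs \<subseteq> Z" "h holomorphic_on UNIV" "\<And>z. z \<in> Z \<Longrightarrow> h z \<noteq> 0"
      "\<And>z. F z = (\<Prod>b\<leftarrow>bs. z - b) * h z" by blast
  show ?thesis
  proof (rule that[OF _ bh(2) _ bh(4)])
    show "norm b \<le> \<rho> \<and> F b = 0" if "b \<in> set bs" for b
      using bh(1) that by (auto simp: Z_def)
    show "h z \<noteq> 0" if "norm z \<le> \<rho>" for z
      using bh(3)[of z] bh(4)[of z] that by (auto simp: Z_def)
  qed
qed

lemma max_modulus_cball:
  assumes F: "F holomorphic_on UNIV" and R: "0 < R"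
    and B: "\<And>z. norm z = R \<Longrightarrow> norm (F z) \<le> B" and z: "norm z \<le> R"
  shows "norm (F z) \<le> B"
proof (rule maximum_modulus_frontier[of F "cball 0 R"])
  show "continuous_on (closure (cball 0 R)) F"
    using F holomorphic_on_imp_continuous_on holomorphic_on_subset by blast
qed (use F R B z in \<open>auto intro: holomorphic_on_subset simp: frontier_cball\<close>)

text \<open>
  Schwarz's lemma for \<open>u / (2 a - u)\<close>, where \<open>u = G - G 0\<close> is rescaled to the unit disc and \<open>a\<close>
  bounds its real part: the half plane \<open>Re u < a\<close> is the set of points closer to 0 than to \<open>2 a\<close>.
\<close>
lemma borel_caratheodory:
  assumes G: "G holomorphic_on ball 0 R" and A: "\<And>z. norm z < R \<Longrightarrow> Re (G z) < A"
    and z: "norm z \<le> r" "0 \<le> r" "r < R"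
  shows "norm (G z - G 0) \<le> 2 * r / (R - r) * (A - Re (G 0))"
proof -
  define a where "a = A - Re (G 0)"
  have a: "a > 0" using A[of 0] z by (simp add: a_def)
  define u where "u w = G (of_real R * w) - G 0" for w
  define \<phi> where "\<phi> w = u w / (2 * of_real a - u w)" for w
  have inb: "norm (of_real R * w :: complex) < R" if "norm w < 1" for w :: complex
    using that z by (simp add: norm_mult)
  have lt: "norm (u w) < norm (2 * of_real a - u w)" if "norm w < 1" for w
  proof -
    have "Re (u w) < a" using A[OF inb[OF that]] by (simp add: u_def a_def)
    then have "(Re (u w))\<^sup>2 + (Im (u w))\<^sup>2 < (2 * a - Re (u w))\<^sup>2 + (Im (u w))\<^sup>2"
      using a by (simp add: power2_eq_square algebra_simps)
    then show ?thesis by (simp add: cmod_def)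
  qed
  have u: "u holomorphic_on ball 0 1"
    unfolding u_def using inb
    by (intro holomorphic_intros holomorphic_on_compose_gen[OF _ G, unfolded o_def]) auto
  have \<phi>: "\<phi> holomorphic_on ball 0 1"
    unfolding \<phi>_def using lt by (intro holomorphic_intros u) fastforce
  define \<xi> where "\<xi> = z / of_real R"
  have R: "R > 0" using z by linarith
  have \<xi>: "norm \<xi> \<le> r / R" "norm \<xi> < 1" using z R by (auto simp: \<xi>_def norm_divide field_simps)
  have s: "norm (\<phi> \<xi>) \<le> norm \<xi>"
  proof (rule Schwarz_Lemma(1)[OF \<phi> _ _ \<xi>(2)])
    show "\<phi> 0 = 0" by (simp add: \<phi>_def u_def)
    show "norm (\<phi> w) < 1" if "norm w < 1" for w
    proof -
      have "norm (2 * of_real a - u w) > 0" using lt[OF that] norm_ge_zero[of "u w"] by linarith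
      then show ?thesis
      unfolding \<phi>_def norm_divide using lt[OF that] by (simp add: divide_simps)
    qed
  qed
  have ne: "2 * of_real a - u \<xi> \<noteq> 0" using lt[OF \<xi>(2)] by auto
  then have "u \<xi> = \<phi> \<xi> * (2 * of_real a - u \<xi>)" by (simp add: \<phi>_def)
  then have "norm (u \<xi>) \<le> norm \<xi> * norm (2 * of_real a - u \<xi>)"
    using s by (metis norm_mult mult_right_mono norm_ge_zero)
  also have "\<dots> \<le> norm \<xi> * (2 * a + norm (u \<xi>))"
    using norm_triangle_ineq4[of "2 * of_real a" "u \<xi>"] a
    by (intro mult_left_mono) (auto simp: norm_mult)
  also have "\<dots> \<le> r / R * (2 * a + norm (u \<xi>))"
    using \<xi>(1) a by (intro mult_right_mono) auto
  finally have "norm (u \<xi>) * (R - r) \<le> 2 * r * a"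
    using R by (simp add: field_simps)
  then have "norm (u \<xi>) \<le> 2 * r * a / (R - r)"
    using z by (simp add: field_simps)
  moreover have "u \<xi> = G z - G 0" using R by (simp add: u_def \<xi>_def)
  ultimately show ?thesis by (simp add: a_def)
qed

text \<open>
  The factor belonging to a zero \<open>b\<close> vanishes only at the reflection \<open>R\<^sup>2 / cnj b\<close> of \<open>b\<close> in the
  circle \<open>\<bar>z\<bar> = R\<close>, and on this circle it has the modulus of \<open>z - b\<close>. Replacing \<open>z - b\<close> by it is the
  same as dividing by a Blaschke factor.
\<close>
definition reflected_product :: "real \<Rightarrow> complex list \<Rightarrow> complex \<Rightarrow> complex" where
  "reflected_product R bs z = (\<Prod>b\<leftarrow>bs. (of_real (R\<^sup>2) - cnj b * z) / of_real R)"

lemma reflected_product_holomorphic [holomorphic_intros]: "reflected_product R bs holomorphic_on S"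
  unfolding reflected_product_def
  by (induction bs) (auto intro!: holomorphic_intros)

lemma norm_reflected_product_sphere:
  assumes "norm z = R" "R > 0"
  shows "norm (reflected_product R bs z) = norm (\<Prod>b\<leftarrow>bs. z - b)"
proof -
  have "norm ((of_real (R\<^sup>2) - cnj b * z) / of_real R) = norm (z - b)" for b
  proof -
    have "of_real (R\<^sup>2) = cnj z * z"
      using assms(1) by (metis complex_norm_square mult.commute)
    then have "of_real (R\<^sup>2) - cnj b * z = cnj (z - b) * z"
      by (simp add: algebra_simps)
    then show ?thesis using assms by (simp only: norm_divide norm_mult complex_mod_cnj) simp
  qed
  note eq = this
  show ?thesis
    unfolding reflected_product_def
  proof (induction bs)
    case (Cons b bs)
    then show ?case by (simp only: list.map prod_list.Cons norm_mult eq)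
  qed simp
qed

lemma reflected_product_nonzero:
  assumes "\<And>b. b \<in> set bs \<Longrightarrow> norm b < R" "norm z \<le> R" "R > 0"
  shows "reflected_product R bs z \<noteq> 0"
proof -
  have "of_real (R\<^sup>2) - cnj b * z \<noteq> 0" if "b \<in> set bs" for b
  proof
    assume "of_real (R\<^sup>2) - cnj b * z = 0"
    then have "norm (of_real (R\<^sup>2) :: complex) = norm (cnj b * z)" by simp
    then have "R * R = norm b * norm z" using assms(3) by (simp add: norm_mult power2_eq_square norm_power)
    moreover have "norm b * norm z \<le> norm b * R" using assms by (intro mult_left_mono) auto
    moreover have "norm b * R < R * R" using assms that by simp
    ultimately show False by linarith
  qed
  then show ?thesis
    using assms(3) unfolding reflected_product_def by (auto simp: prod_list_zero_iff)
qed

lemma norm_reflected_product_0: "R > 0 \<Longrightarrow> norm (reflected_product R bs 0) = R ^ length bs"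
  unfolding reflected_product_def by (induction bs) (auto simp: norm_mult norm_divide norm_power power2_eq_square)

lemma norm_prod_list_roots_0:
  "(\<And>b. b \<in> set bs \<Longrightarrow> norm b \<le> \<rho>) \<Longrightarrow> 0 \<le> \<rho> \<Longrightarrow> norm (\<Prod>b\<leftarrow>bs. 0 - b :: complex) \<le> \<rho> ^ length bs"
  by (induction bs) (auto simp: norm_mult intro!: mult_mono)

text \<open>
  Reflecting in the circle \<open>\<bar>z\<bar> = R\<close> the zeros with \<open>\<bar>z\<bar> \<le> \<rho>\<close> leaves \<open>\<bar>F\<bar>\<close> unchanged on that circle and
  enlarges it at 0 by a factor of at least \<open>R / \<rho>\<close> for each zero. Together with the maximum principle,
  the last but one conclusion is Jensen's inequality, which bounds the number of zeros.
\<close>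
lemma reflect_zeros:
  assumes F: "F holomorphic_on UNIV" and w: "F w \<noteq> (0::complex)" and \<rho>: "0 \<le> \<rho>" "\<rho> < R"
  obtains bs h where "\<And>b. b \<in> set bs \<Longrightarrow> norm b \<le> \<rho>" "h holomorphic_on UNIV"
    "\<And>z. norm z \<le> \<rho> \<Longrightarrow> h z \<noteq> 0" "\<And>z. F z = (\<Prod>b\<leftarrow>bs. z - b) * h z"
    "\<And>z. norm z = R \<Longrightarrow> norm (h z * reflected_product R bs z) = norm (F z)"
    "\<And>z. norm z \<le> \<rho> \<Longrightarrow> h z * reflected_product R bs z \<noteq> 0"
    "norm (F 0) * (R / \<rho>) ^ length bs \<le> norm (h 0 * reflected_product R bs 0)"
    "norm (F 0) \<le> norm (h 0 * reflected_product R bs 0)"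
proof -
  obtain bs h where bh: "\<And>b. b \<in> set bs \<Longrightarrow> norm b \<le> \<rho> \<and> F b = 0" "h holomorphic_on UNIV"
    "\<And>z. norm z \<le> \<rho> \<Longrightarrow> h z \<noteq> 0" "\<And>z. F z = (\<Prod>b\<leftarrow>bs. z - b) * h z"
    using entire_factor_cball[OF F w] by metis
  have R: "R > 0" using \<rho> by linarith
  have p: "norm (\<Prod>b\<leftarrow>bs. 0 - b) \<le> \<rho> ^ length bs"
    using norm_prod_list_roots_0[of bs \<rho>] bh(1) \<rho> by blast
  have F0: "norm (F 0) = norm (\<Prod>b\<leftarrow>bs. 0 - b) * norm (h 0)" by (simp only: bh(4) norm_mult)
  have g0: "norm (h 0 * reflected_product R bs 0) = norm (h 0) * R ^ length bs"
    by (simp add: norm_mult norm_reflected_product_0 R)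
  show ?thesis
  proof (rule that[of bs h])
    show "norm (h z * reflected_product R bs z) = norm (F z)" if "norm z = R" for z
      using norm_reflected_product_sphere[OF that R] by (simp only: bh(4) norm_mult mult.commute)
    show "h z * reflected_product R bs z \<noteq> 0" if "norm z \<le> \<rho>" for z
      using bh(3)[OF that] reflected_product_nonzero[of bs R z] bh(1) that \<rho> R by fastforce
    show "norm (F 0) \<le> norm (h 0 * reflected_product R bs 0)"
    proof -
      have "norm (\<Prod>b\<leftarrow>bs. 0 - b) \<le> R ^ length bs"
        using p \<rho> by (meson order.trans power_mono less_imp_le)
      then show ?thesis unfolding F0 g0 by (metis mult.commute mult_left_mono norm_ge_zero)
    qed
    show "norm (F 0) * (R / \<rho>) ^ length bs \<le> norm (h 0 * reflected_product R bs 0)"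
    proof (cases "\<rho> = 0")
      case False
      have "norm (F 0) * (R / \<rho>) ^ length bs \<le> \<rho> ^ length bs * norm (h 0) * (R / \<rho>) ^ length bs"
        unfolding F0 using \<rho> R by (intro mult_right_mono p) auto
      then show ?thesis using False \<rho> by (simp add: g0 power_divide field_simps)
    next
      case True
      then show ?thesis using F0 p R by (cases "length bs") (auto simp: norm_mult norm_reflected_product_0 mult.commute)
    qed
  qed (use bh in auto)
qed

text \<open>
  After its zeros have been reflected, \<open>b\<close> is, in a smaller disc, the exponential of a function \<open>G\<close>,
  and a lower bound for \<open>Re G\<close> follows from the upper one by the Borel-Caratheodory inequality. This
  plays the part that the first main theorem has in Nevanlinna theory. The factor \<open>4 r / (R - r)\<close> is
  the price for working with the maximum modulus.
\<close>
lemma quotient_bound: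
  assumes b: "b holomorphic_on UNIV" and q: "q holomorphic_on UNIV" and b0: "b 0 \<noteq> 0"
    and r: "0 < r" "r < R"
    and \<beta>: "\<And>z. norm z = R \<Longrightarrow> norm (b z) \<le> exp \<beta>"
    and A: "\<And>z. norm z = R \<Longrightarrow> norm (q z * b z) \<le> exp A"
    and z: "norm z \<le> r"
  shows "norm (q z) \<le> exp (A - ln (norm (b 0)) + 4 * r / (R - r) * (\<beta> + 1 - ln (norm (b 0))))"
proof -
  \<comment> \<open>Only the zeros in this intermediate disc are reflected.\<close>
  define \<rho> where "\<rho> = (r + R) / 2"
  have \<rho>: "0 < \<rho>" "r < \<rho>" "\<rho> < R" using r by (auto simp: \<rho>_def)
  obtain bs h where bh: "h holomorphic_on UNIV"
    "\<And>z. norm z \<le> \<rho> \<Longrightarrow> h z \<noteq> 0"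
    "\<And>z. norm z = R \<Longrightarrow> norm (h z * reflected_product R bs z) = norm (b z)"
    "\<And>z. norm z \<le> \<rho> \<Longrightarrow> h z * reflected_product R bs z \<noteq> 0"
    "norm (b 0) \<le> norm (h 0 * reflected_product R bs 0)"
    using reflect_zeros[OF b b0, of \<rho> R] \<rho> by (metis less_imp_le)
  define g where "g z = h z * reflected_product R bs z" for z
  have g: "g holomorphic_on UNIV" unfolding g_def by (intro holomorphic_intros bh)
  have gR: "norm (g z) = norm (b z)" if "norm z = R" for z using bh(3) that by (simp add: g_def)
  have gn: "g z \<noteq> 0" if "norm z \<le> \<rho>" for z using bh(4) that by (simp add: g_def)
  have g\<beta>: "norm (g z) \<le> exp \<beta>" if "norm z \<le> R" for z
    by (rule max_modulus_cball[OF g _ _ that]) (use gR \<beta> r in auto)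
  have qg: "norm (q z * g z) \<le> exp A" if "norm z \<le> R" for z
    by (rule max_modulus_cball[OF _ _ _ that]) (use gR A r in \<open>auto simp: norm_mult intro!: holomorphic_intros q g\<close>)
  obtain G where G: "G holomorphic_on ball 0 \<rho>" "\<And>z. z \<in> ball 0 \<rho> \<Longrightarrow> exp (G z) = g z"
    using holomorphic_logarithm_exists[of "ball 0 \<rho>" g 0] g gn \<rho>
    by (metis convex_ball open_ball holomorphic_on_subset subset_UNIV mem_ball_0 less_imp_le centre_in_ball)
  have ReG: "exp (Re (G z)) = norm (g z)" if "norm z < \<rho>" for z
    using G(2)[of z] that by (metis mem_ball_0 norm_exp_eq_Re)
  have "Re (G z) < \<beta> + 1" if "norm z < \<rho>" for z
    using g\<beta>[of z] ReG[OF that] \<rho> that by (smt (verit) exp_le_cancel_iff)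
  from borel_caratheodory[OF G(1) this z] \<rho> r
  have BC: "norm (G z - G 0) \<le> 2 * r / (\<rho> - r) * (\<beta> + 1 - Re (G 0))" by simp
  have rr: "2 * r / (\<rho> - r) = 4 * r / (R - r)" using r by (simp add: \<rho>_def field_simps)
  have zr: "norm z < \<rho>" using z \<rho> by simp
  have b0': "ln (norm (b 0)) \<le> Re (G 0)"
    using bh(5) b0 ReG[of 0] \<rho> unfolding g_def[symmetric]
    by (metis exp_le_cancel_iff exp_ln norm_zero zero_less_norm_iff)
  have "Re (G 0) - Re (G z) \<le> norm (G z - G 0)"
    using complex_Re_le_cmod[of "G 0 - G z"] by (simp add: norm_minus_commute)
  also have "\<dots> \<le> 4 * r / (R - r) * (\<beta> + 1 - Re (G 0))" using BC rr by simp
  also have "\<dots> \<le> 4 * r / (R - r) * (\<beta> + 1 - ln (norm (b 0)))"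
    using b0' r by (intro mult_left_mono) auto
  finally have fin: "- Re (G z) \<le> - ln (norm (b 0)) + 4 * r / (R - r) * (\<beta> + 1 - ln (norm (b 0)))"
    using b0' by linarith
  have "norm (q z) * norm (g z) \<le> exp A" using qg[of z] z r by (simp add: norm_mult)
  then have "norm (q z) * exp (Re (G z)) \<le> exp A" using ReG[OF zr] by simp
  then have "norm (q z) \<le> exp (A - Re (G z))"
    by (simp add: exp_diff field_simps)
  also have "\<dots> \<le> exp (A - ln (norm (b 0)) + 4 * r / (R - r) * (\<beta> + 1 - ln (norm (b 0))))"
    using fin by simp
  finally show ?thesis .
qed

section \<open>Logarithmic derivatives on circles\<close>

lemma prod_list_deriv:
  fixes z :: complex
  assumes "\<And>b. b \<in> set bs \<Longrightarrow> (f b has_field_derivative f' b) (at z)" "\<And>b. b \<in> set bs \<Longrightarrow> f b z \<noteq> 0"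
  shows "((\<lambda>z. \<Prod>b\<leftarrow>bs. f b z) has_field_derivative (\<Prod>b\<leftarrow>bs. f b z) * (\<Sum>b\<leftarrow>bs. f' b / f b z)) (at z)"
  using assms
proof (induction bs)
  case (Cons b bs)
  have "((\<lambda>z. f b z * (\<Prod>b\<leftarrow>bs. f b z)) has_field_derivative
      f' b * (\<Prod>b\<leftarrow>bs. f b z) + (\<Prod>b\<leftarrow>bs. f b z) * (\<Sum>b\<leftarrow>bs. f' b / f b z) * f b z) (at z)"
    using Cons by (intro DERIV_mult) auto
  moreover have "f b z \<noteq> 0" using Cons.prems by simp
  then have "f' b * (\<Prod>b\<leftarrow>bs. f b z) + (\<Prod>b\<leftarrow>bs. f b z) * (\<Sum>b\<leftarrow>bs. f' b / f b z) * f b z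
      = (\<Prod>b\<leftarrow>b # bs. f b z) * (\<Sum>b\<leftarrow>b # bs. f' b / f b z)"
    by (simp add: field_simps)
  ultimately show ?case by simp
qed simp

lemma norm_sum_list_le:
  fixes f :: "'a \<Rightarrow> complex" and c :: real
  assumes "\<And>b. b \<in> set bs \<Longrightarrow> norm (f b) \<le> c"
  shows "norm (\<Sum>b\<leftarrow>bs. f b) \<le> length bs * c"
  using assms
proof (induction bs)
  case (Cons b bs)
  have "norm (f b + (\<Sum>b\<leftarrow>bs. f b)) \<le> c + length bs * c"
    using Cons by (intro norm_triangle_le add_mono) auto
  then show ?case by (simp add: algebra_simps)
qed simp

text \<open>
  Write \<open>u = (\<Prod>b. z - b) h\<close> and let \<open>g = exp G\<close> be the function with reflected zeros. Then
  \<open>u' / u = (\<Sum>b. 1 / (z - b)) - (\<Sum>b. (log derivative of the reflected factor)) + G'\<close>. The first sum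
  is controlled by the distance \<open>\<delta>\<close> from the zeros, the second by the distance \<open>d\<close> from the reflected
  zeros, and \<open>G'\<close> by Borel-Caratheodory followed by Cauchy's inequality. The radii \<open>r + d\<close>,
  \<open>r + 3/2 d\<close>, \<open>r + 2 d\<close>, \<open>r + 3 d\<close> leave room for one step each. The number of zeros is bounded by
  Jensen's inequality.
\<close>
lemma log_deriv_bound_nonzero_at_0:
  assumes u: "u holomorphic_on UNIV" and u0: "u 0 \<noteq> 0" and r: "0 < r" and d: "d > 0"
    and R: "R = r + 3 * d"
    and L: "\<And>z. norm z = R \<Longrightarrow> norm (u z) \<le> exp L"
  obtains bs where "real (length bs) * (d / R) \<le> L - ln (norm (u 0))"
    "\<And>z \<delta>. norm z \<le> r + d \<Longrightarrow> \<delta> > 0 \<Longrightarrow> (\<And>b. b \<in> set bs \<Longrightarrow> \<delta> \<le> norm (z - b)) \<Longrightarrow>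
        u z \<noteq> 0 \<and> norm (deriv u z / u z) \<le>
          real (length bs) * (1 / \<delta> + 1 / d) + 8 * R / d\<^sup>2 * (L + 1 - ln (norm (u 0)))"
proof -
  define \<rho> where "\<rho> = r + 2 * d"
  have \<rho>: "0 < \<rho>" "r + d < \<rho>" "\<rho> < R" "R > 0" using r d by (auto simp: \<rho>_def R)
  obtain bs h where bh: "\<And>b. b \<in> set bs \<Longrightarrow> norm b \<le> \<rho>" "h holomorphic_on UNIV"
    "\<And>z. norm z \<le> \<rho> \<Longrightarrow> h z \<noteq> 0" "\<And>z. u z = (\<Prod>b\<leftarrow>bs. z - b) * h z"
    "\<And>z. norm z = R \<Longrightarrow> norm (h z * reflected_product R bs z) = norm (u z)"
    "\<And>z. norm z \<le> \<rho> \<Longrightarrow> h z * reflected_product R bs z \<noteq> 0"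
    "norm (u 0) * (R / \<rho>) ^ length bs \<le> norm (h 0 * reflected_product R bs 0)"
    "norm (u 0) \<le> norm (h 0 * reflected_product R bs 0)"
    using reflect_zeros[OF u u0, of \<rho> R] \<rho> by (metis less_imp_le)
  define g where "g z = h z * reflected_product R bs z" for z
  have g: "g holomorphic_on UNIV" unfolding g_def by (intro holomorphic_intros bh)
  have gR: "norm (g z) = norm (u z)" if "norm z = R" for z using bh(5) that by (simp add: g_def)
  have gn: "g z \<noteq> 0" if "norm z \<le> \<rho>" for z using bh(6) that by (simp add: g_def)
  have gL: "norm (g z) \<le> exp L" if "norm z \<le> R" for z
    by (rule max_modulus_cball[OF g _ _ that]) (use gR L \<rho> in auto)
  define c where "c = L + 1 - ln (norm (u 0))"
  have len: "real (length bs) * (d / R) \<le> L - ln (norm (u 0))"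
  proof -
    have "norm (u 0) * (R / \<rho>) ^ length bs \<le> exp L"
      using bh(7) gL[of 0] \<rho> by (simp add: g_def)
    then have "ln (norm (u 0) * (R / \<rho>) ^ length bs) \<le> L"
      using u0 \<rho> by (metis ln_exp ln_mono divide_pos_pos less_trans mult_pos_pos zero_less_norm_iff zero_less_power)
    then have "ln (norm (u 0)) + real (length bs) * ln (R / \<rho>) \<le> L"
      using u0 \<rho> by (simp add: ln_mult ln_realpow)
    moreover have "d / R \<le> ln (R / \<rho>)"
    proof -
      have "ln (\<rho> / R) \<le> \<rho> / R - 1" using \<rho> by (intro ln_le_minus_one) auto
      moreover have "ln (\<rho> / R) = - ln (R / \<rho>)" using \<rho> by (simp add: ln_div)
      moreover have "\<rho> / R - 1 = - (d / R)" using \<rho> by (simp add: \<rho>_def R field_simps)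
      ultimately show ?thesis by simp
    qed
    then have "real (length bs) * (d / R) \<le> real (length bs) * ln (R / \<rho>)"
      by (intro mult_left_mono) auto
    ultimately show ?thesis by linarith
  qed
  obtain G where G: "G holomorphic_on ball 0 \<rho>" "\<And>z. z \<in> ball 0 \<rho> \<Longrightarrow> exp (G z) = g z"
    using holomorphic_logarithm_exists[of "ball 0 \<rho>" g 0] g gn \<rho>
    by (metis convex_ball open_ball holomorphic_on_subset subset_UNIV mem_ball_0 less_imp_le centre_in_ball)
  have ReG: "exp (Re (G z)) = norm (g z)" if "norm z < \<rho>" for z
    using G(2)[of z] that by (metis mem_ball_0 norm_exp_eq_Re)
  have ReGL: "Re (G z) < L + 1" if "norm z < \<rho>" for z
    using gL[of z] ReG[OF that] \<rho> that by (smt (verit) exp_le_cancel_iff)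
  have b0': "ln (norm (u 0)) \<le> Re (G 0)"
    using bh(8) u0 ReG[of 0] \<rho> unfolding g_def[symmetric]
    by (metis exp_le_cancel_iff exp_ln norm_zero zero_less_norm_iff)
  have c0: "c > 0" using b0' ReGL[of 0] \<rho> by (simp add: c_def)
  have GK: "norm (G w - G 0) \<le> 4 * R / d * c" if "norm w \<le> r + 3/2 * d" for w
  proof -
    have "norm (G w - G 0) \<le> 2 * (r + 3/2 * d) / (\<rho> - (r + 3/2 * d)) * (L + 1 - Re (G 0))"
      by (rule borel_caratheodory[OF G(1) ReGL that]) (use r d in \<open>auto simp: \<rho>_def\<close>)
    also have "\<dots> \<le> (4 * R / d) * c"
    proof (rule mult_mono)
      show "2 * (r + 3/2 * d) / (\<rho> - (r + 3/2 * d)) \<le> 4 * R / d"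
        using r d by (simp add: \<rho>_def R field_simps)
      show "L + 1 - Re (G 0) \<le> c" using b0' by (simp add: c_def)
      show "0 \<le> L + 1 - Re (G 0)" using ReGL[of 0] \<rho> by simp
    qed (use \<rho> d in auto)
    finally show ?thesis .
  qed
  show ?thesis
  proof (rule that[OF len])
    fix z \<delta> assume z: "norm z \<le> r + d" and \<delta>: "\<delta> > 0" "\<And>b. b \<in> set bs \<Longrightarrow> \<delta> \<le> norm (z - b)"
    have zb: "z - b \<noteq> 0" if "b \<in> set bs" for b using \<delta>(2)[OF that] \<delta>(1) by auto
    have z\<rho>: "norm z < \<rho>" using z \<rho> by simp
    have uz: "u z \<noteq> 0" using bh(3)[of z] z\<rho> zb by (auto simp: bh(4) prod_list_zero_iff)
    define S1 where "S1 = (\<Sum>b\<leftarrow>bs. 1 / (z - b))"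
    define S2 where "S2 = (\<Sum>b\<leftarrow>bs. (- cnj b / of_real R) / ((of_real (R\<^sup>2) - cnj b * z) / of_real R))"
    have P: "((\<lambda>z. \<Prod>b\<leftarrow>bs. z - b) has_field_derivative (\<Prod>b\<leftarrow>bs. z - b) * S1) (at z)"
      unfolding S1_def using zb by (intro prod_list_deriv) (auto intro!: derivative_eq_intros)
    have Rb: "R * d \<le> norm (of_real (R\<^sup>2) - cnj b * z)" if "b \<in> set bs" for b
    proof -
      have "norm (of_real (R\<^sup>2) :: complex) = R * R" using \<rho> by (simp add: power2_eq_square norm_mult)
      moreover have "norm (cnj b * z) \<le> R * (r + d)"
        unfolding norm_mult using bh(1)[OF that] z \<rho> by (intro mult_mono) auto
      moreover have "R * R - R * (r + d) = 2 * (R * d)" by (simp add: R algebra_simps)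
      moreover have "R * d > 0" using \<rho> d by simp
      ultimately show ?thesis using norm_triangle_ineq2[of "of_real (R\<^sup>2)" "cnj b * z"] by linarith
    qed
    have W: "(reflected_product R bs has_field_derivative reflected_product R bs z * S2) (at z)"
      unfolding S2_def reflected_product_def
    proof (rule prod_list_deriv)
      fix b assume b: "b \<in> set bs"
      show "((\<lambda>z. (of_real (R\<^sup>2) - cnj b * z) / of_real R) has_field_derivative - cnj b / of_real R) (at z)"
        using \<rho> by (auto intro!: derivative_eq_intros)
      show "(of_real (R\<^sup>2) - cnj b * z) / of_real R \<noteq> 0"
        using Rb[OF b] \<rho> d by (smt (verit) divide_eq_0_iff norm_zero of_real_eq_0_iff mult_pos_pos)
    qed
    have Wz: "reflected_product R bs z \<noteq> 0" using gn[of z] z\<rho> by (auto simp: g_def)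
    have hz: "h z \<noteq> 0" using bh(3)[of z] z\<rho> by simp
    have dh: "(h has_field_derivative deriv h z) (at z)"
      using bh(2) holomorphic_derivI open_UNIV by blast
    have "(u has_field_derivative (\<Prod>b\<leftarrow>bs. z - b) * S1 * h z + deriv h z * (\<Prod>b\<leftarrow>bs. z - b)) (at z)"
    proof -
      have "u = (\<lambda>z. (\<Prod>b\<leftarrow>bs. z - b) * h z)" using bh(4) by auto
      then show ?thesis using DERIV_mult[OF P dh] by simp
    qed
    then have du: "deriv u z / u z = S1 + deriv h z / h z"
      using uz hz by (simp add: DERIV_imp_deriv bh(4) field_simps)
    have "(g has_field_derivative deriv h z * reflected_product R bs z + reflected_product R bs z * S2 * h z) (at z)"
      unfolding g_def using DERIV_mult[OF dh W] by simp
    then have dg: "deriv g z / g z = deriv h z / h z + S2"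
      using hz Wz by (simp add: DERIV_imp_deriv g_def field_simps)
    have dG: "deriv G z = deriv g z / g z"
    proof -
      have "(G has_field_derivative deriv G z) (at z)"
        using G(1) z\<rho> holomorphic_derivI open_ball by (metis mem_ball_0)
      then have "((\<lambda>z. exp (G z)) has_field_derivative exp (G z) * deriv G z) (at z)"
        by (auto intro!: derivative_eq_intros)
      then have "(g has_field_derivative exp (G z) * deriv G z) (at z)"
        by (rule has_field_derivative_transform_within_open[of _ _ _ "ball 0 \<rho>"]) (use G z\<rho> in auto)
      then show ?thesis using G(2)[of z] z\<rho> gn[of z] by (simp add: DERIV_imp_deriv field_simps)
    qed
    have nG: "norm (deriv G z) \<le> 8 * R / d\<^sup>2 * c"
    proof -
      have sub: "cball z (d/2) \<subseteq> ball 0 \<rho>"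
      proof
        fix w assume "w \<in> cball z (d/2)"
        then have "norm (w - z) \<le> d / 2" by (simp add: dist_norm norm_minus_commute)
        then have "norm w \<le> norm z + d/2" using norm_triangle_ineq2[of w z] by linarith
        then show "w \<in> ball 0 \<rho>" using z d by (simp add: \<rho>_def)
      qed
      have "norm ((deriv ^^ 1) (\<lambda>w. G w - G 0) z) \<le> fact 1 * (4 * R / d * c) / (d/2) ^ 1"
      proof (rule Cauchy_inequality)
        have "(\<lambda>w. G w - G 0) holomorphic_on ball 0 \<rho>" by (intro holomorphic_intros G)
        then show "(\<lambda>w. G w - G 0) holomorphic_on ball z (d/2)"
            "continuous_on (cball z (d/2)) (\<lambda>w. G w - G 0)"
          using sub ball_subset_cball holomorphic_on_subset holomorphic_on_imp_continuous_on
          by (meson order.trans)+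
        show "norm (G w - G 0) \<le> 4 * R / d * c" if "norm (z - w) = d/2" for w
        proof (rule GK)
          show "norm w \<le> r + 3/2 * d"
            using norm_triangle_ineq2[of w z] that z by (simp add: norm_minus_commute)
        qed
      qed (use d in auto)
      moreover have "deriv (\<lambda>w. G w - G 0) z = deriv G z"
      proof -
        have "G field_differentiable at z"
          using G(1) z\<rho> by (meson holomorphic_on_imp_differentiable_at mem_ball_0 open_ball)
        then show ?thesis by simp
      qed
      ultimately show ?thesis using d by (simp add: power2_eq_square field_simps)
    qed
    have nS1: "norm S1 \<le> length bs * (1 / \<delta>)"
      unfolding S1_def
    proof (rule norm_sum_list_le)
      fix b assume "b \<in> set bs"
      then have "\<delta> \<le> norm (z - b)" by (rule \<delta>(2))
      then show "norm (1 / (z - b)) \<le> 1 / \<delta>" using \<delta>(1) by (simp add: norm_divide frac_le)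
    qed
    have nS2: "norm S2 \<le> length bs * (1 / d)"
      unfolding S2_def
    proof (rule norm_sum_list_le)
      fix b assume b: "b \<in> set bs"
      have "norm (- cnj b / of_real R / ((of_real (R\<^sup>2) - cnj b * z) / of_real R)) = norm b / norm (of_real (R\<^sup>2) - cnj b * z)"
        using \<rho> by (simp only: norm_divide norm_minus_cancel complex_mod_cnj) simp
      also have "\<dots> \<le> R / (R * d)"
        using bh(1)[OF b] \<rho> d Rb[OF b] by (intro frac_le) auto
      finally show "norm (- cnj b / of_real R / ((of_real (R\<^sup>2) - cnj b * z) / of_real R)) \<le> 1 / d"
        using \<rho> by simp
    qed
    have "deriv u z / u z = S1 - S2 + deriv G z" using du dg dG by simp
    then have "norm (deriv u z / u z) \<le> norm S1 + norm S2 + norm (deriv G z)"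
      using norm_triangle_ineq[of "S1 - S2" "deriv G z"] norm_triangle_ineq4[of S1 S2] by simp
    also have "\<dots> \<le> real (length bs) * (1 / \<delta> + 1 / d) + 8 * R / d\<^sup>2 * c"
      using nS1 nS2 nG by (simp add: algebra_simps)
    finally show "u z \<noteq> 0 \<and> norm (deriv u z / u z) \<le>
          real (length bs) * (1 / \<delta> + 1 / d) + 8 * R / d\<^sup>2 * (L + 1 - ln (norm (u 0)))"
      using uz by (simp add: c_def)
  qed
qed

text \<open>
  A zero at the origin is split off, since Jensen's inequality is based at 0. The other constants are
  absorbed into a \<open>c\<close> that depends on \<open>u\<close> but not on the radii.
\<close>
lemma log_deriv_bound_entire:
  assumes u: "u holomorphic_on UNIV" and w: "u w \<noteq> (0::complex)"
  shows "\<exists>c\<ge>1. \<forall>r R L. 1 \<le> r \<longrightarrow> r < R \<longrightarrow> 1 \<le> L \<longrightarrow> (\<forall>z. norm z = R \<longrightarrow> norm (u z) \<le> exp L) \<longrightarrow>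
    (\<exists>bs. real (length bs) \<le> c * (L * R / (R - r)) \<and>
      (\<forall>z \<delta>. r \<le> norm z \<longrightarrow> norm z \<le> r + (R - r) / 3 \<longrightarrow> \<delta> > 0 \<longrightarrow> (\<forall>b\<in>set bs. \<delta> \<le> norm (z - b)) \<longrightarrow>
        u z \<noteq> 0 \<and> norm (deriv u z / u z) \<le> real (length bs) / \<delta> + c * (L * R / (R - r))\<^sup>2))"
proof -
  obtain m v where v: "v holomorphic_on UNIV" "v 0 \<noteq> 0" "\<And>z. u z = (z - 0) ^ m * v z"
    using entire_factor_point[OF u w, of 0] by metis
  define k where "k = 2 + \<bar>ln (norm (v 0))\<bar>"
  \<comment> \<open>The three summands pay for the zero at the origin, for the zeros and their reflections, and for the zero-free part.\<close>
  define c where "c = real m + 12 * k + 72 * k"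
  have k: "k \<ge> 2" by (simp add: k_def)
  show ?thesis
  proof (intro exI[of _ c] conjI allI impI)
    show "1 \<le> c" using k by (simp add: c_def)
    fix r R L :: real
    assume r: "1 \<le> r" "r < R" and L: "1 \<le> L" and uL: "\<forall>z. norm z = R \<longrightarrow> norm (u z) \<le> exp L"
    define d where "d = (R - r) / 3"
    define X where "X = L * R / (R - r)"
    have d: "d > 0" using r by (simp add: d_def)
    have Rd: "R = r + 3 * d" unfolding d_def by argo
    have X1: "R / (R - r) \<le> X" using L r by (auto simp: X_def divide_simps)
    have X2: "1 \<le> R / (R - r)" using r by (simp add: field_simps)
    have X3: "1 / (R - r) \<le> X"
    proof -
      have "1 / (R - r) \<le> R / (R - r)" using r by (intro divide_right_mono) auto
      then show ?thesis using X1 by linarith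
    qed
    have vL: "norm (v z) \<le> exp L" if "norm z = R" for z
    proof -
      have "norm (v z) = 1 * norm (v z)" by simp
      also have "\<dots> \<le> R ^ m * norm (v z)"
        using r by (intro mult_right_mono one_le_power) auto
      also have "\<dots> = norm (u z)" using that by (simp add: v(3) norm_mult norm_power)
      finally show ?thesis using uL that by force
    qed
    have r0: "0 < r" using r by simp
    obtain bs where bs: "real (length bs) * (d / R) \<le> L - ln (norm (v 0))"
      "\<And>z \<delta>. norm z \<le> r + d \<Longrightarrow> \<delta> > 0 \<Longrightarrow> (\<And>b. b \<in> set bs \<Longrightarrow> \<delta> \<le> norm (z - b)) \<Longrightarrow>
        v z \<noteq> 0 \<and> norm (deriv v z / v z) \<le>
          real (length bs) * (1 / \<delta> + 1 / d) + 8 * R / d\<^sup>2 * (L + 1 - ln (norm (v 0)))"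
      using log_deriv_bound_nonzero_at_0[OF v(1,2) r0 d Rd vL] by metis
    have kL: "L + 1 - ln (norm (v 0)) \<le> k * L"
    proof -
      have "L + (1 + \<bar>ln (norm (v 0))\<bar>) * 1 \<le> L + (1 + \<bar>ln (norm (v 0))\<bar>) * L"
        using L by (intro add_left_mono mult_left_mono) auto
      then show ?thesis by (simp add: k_def algebra_simps)
    qed
    have len: "real (length bs) \<le> 3 * k * X"
    proof -
      have "real (length bs) * (d / R) \<le> k * L" using bs(1) kL by linarith
      then have "real (length bs) \<le> k * L * (R / d)" using r d by (simp add: field_simps)
      then show ?thesis using r by (simp add: X_def d_def field_simps)
    qed
    show "\<exists>bs. real (length bs) \<le> c * (L * R / (R - r)) \<and>
      (\<forall>z \<delta>. r \<le> norm z \<longrightarrow> norm z \<le> r + (R - r) / 3 \<longrightarrow> \<delta> > 0 \<longrightarrow> (\<forall>b\<in>set bs. \<delta> \<le> norm (z - b)) \<longrightarrow>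
        u z \<noteq> 0 \<and> norm (deriv u z / u z) \<le> real (length bs) / \<delta> + c * (L * R / (R - r))\<^sup>2)"
      unfolding X_def[symmetric]
    proof (intro exI[of _ bs] conjI allI impI)
      have X0: "X \<ge> 1" using X1 X2 by linarith
      have "3 * k \<le> c" using k by (simp add: c_def)
      then have "3 * k * X \<le> c * X" using X0 by (intro mult_right_mono) auto
      then show "real (length bs) \<le> c * X" using len by linarith
      fix z \<delta> assume z: "r \<le> norm z" "norm z \<le> r + (R - r) / 3" and \<delta>: "0 < \<delta>" "\<forall>b\<in>set bs. \<delta> \<le> norm (z - b)"
      have vz: "v z \<noteq> 0" "norm (deriv v z / v z) \<le>
          real (length bs) * (1 / \<delta> + 1 / d) + 8 * R / d\<^sup>2 * (L + 1 - ln (norm (v 0)))"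
        using bs(2)[of z \<delta>] z \<delta> by (auto simp: d_def)
      have z0: "z \<noteq> 0" using z r by auto
      show "u z \<noteq> 0" using vz z0 by (simp add: v(3))
      have dv: "(v has_field_derivative deriv v z) (at z)"
        using v(1) holomorphic_derivI open_UNIV by blast
      have "u = (\<lambda>z. z ^ m * v z)" using v(3) by auto
      moreover have "((\<lambda>z. z ^ m * v z) has_field_derivative of_nat m * z ^ (m - 1) * v z + deriv v z * z ^ m) (at z)"
        by (rule derivative_eq_intros dv refl)+ (simp add: algebra_simps)
      ultimately have "deriv u z = of_nat m * z ^ (m - 1) * v z + deriv v z * z ^ m"
        by (metis DERIV_imp_deriv)
      also have "of_nat m * z ^ (m - 1) = of_nat m / z * z ^ m"
        using z0 by (cases m) auto
      also have "of_nat m / z * z ^ m * v z + deriv v z * z ^ m = (of_nat m / z + deriv v z / v z) * (z ^ m * v z)"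
        using vz(1) by (simp add: distrib_right)
      also have "z ^ m * v z = u z" by (simp add: v(3))
      finally have "deriv u z / u z = of_nat m / z + deriv v z / v z"
        using \<open>u z \<noteq> 0\<close> by simp
      then have "norm (deriv u z / u z) \<le> norm (of_nat m / z) + norm (deriv v z / v z)"
        using norm_triangle_ineq by metis
      also have "norm (of_nat m / z) \<le> m * X\<^sup>2"
      proof -
        have "norm (of_nat m / z) \<le> real m / 1" using z r
          by (simp only: norm_divide norm_of_nat) (intro divide_left_mono, auto)
        also have "\<dots> \<le> m * X\<^sup>2" using mult_left_mono[of 1 "X\<^sup>2" "real m"] one_le_power[OF X0, of 2] by simp
        finally show ?thesis .
      qed
      also have "norm (deriv v z / v z) \<le> length bs / \<delta> + 9 * k * X\<^sup>2 + 72 * k * X\<^sup>2"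
      proof -
        have "real (length bs) * (1 / d) \<le> 9 * k * X\<^sup>2"
        proof -
          have "real (length bs) * (1 / d) \<le> 3 * k * X * (3 * X)"
            using len X3 d k X0 by (intro mult_mono) (auto simp: d_def)
          then show ?thesis by (simp add: power2_eq_square)
        qed
        moreover have "8 * R / d\<^sup>2 * (L + 1 - ln (norm (v 0))) \<le> 72 * k * X\<^sup>2"
        proof -
          have "8 * R / d\<^sup>2 * (L + 1 - ln (norm (v 0))) \<le> 8 * R / d\<^sup>2 * (k * L)"
            using kL r d by (intro mult_left_mono) auto
          also have "\<dots> = 72 * k * (X * (1 / (R - r)))"
            using r by (simp add: X_def d_def power2_eq_square field_simps)
          also have "\<dots> \<le> 72 * k * (X * X)"
            using X3 X0 k by (intro mult_left_mono) auto
          finally show ?thesis by (simp add: power2_eq_square)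
        qed
        ultimately show ?thesis using vz(2) by (simp add: algebra_simps)
      qed
      also have "real m * X\<^sup>2 + (real (length bs) / \<delta> + 9 * k * X\<^sup>2 + 72 * k * X\<^sup>2) \<le> length bs / \<delta> + c * X\<^sup>2"
        using k by (simp add: c_def algebra_simps)
      finally show "norm (deriv u z / u z) \<le> real (length bs) / \<delta> + c * X\<^sup>2" by simp
    qed
  qed
qed

text \<open>
  Pigeonhole principle: among \<open>card S + 1\<close> points at mutual distance \<open>2 \<delta>\<close> one has distance at least
  \<open>\<delta>\<close> from \<open>S\<close>.
\<close>
lemma avoid_finite_set:
  fixes S :: "real set"
  assumes "finite S" "d > 0"
  shows "\<exists>t\<ge>a. t \<le> a + d \<and> (\<forall>s\<in>S. d / (2 * real (card S) + 2) \<le> \<bar>t - s\<bar>)"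
proof (rule ccontr)
  assume neg: "\<not> ?thesis"
  define N where "N = card S"
  define \<delta> where "\<delta> = d / (2 * real N + 2)"
  define t where "t i = a + 2 * real i * \<delta>" for i :: nat
  have \<delta>: "\<delta> > 0" using assms by (simp add: \<delta>_def)
  have "\<exists>s\<in>S. \<bar>t i - s\<bar> < \<delta>" if "i \<in> {..N}" for i
  proof -
    have "2 * real i * \<delta> \<le> 2 * real N * \<delta>" using that \<delta> by (intro mult_right_mono) auto
    also have "\<dots> \<le> d" using assms by (simp add: \<delta>_def field_simps)
    finally have "t i \<ge> a" "t i \<le> a + d" using \<delta> by (auto simp: t_def)
    then have "\<not> (\<forall>s\<in>S. d / (2 * real (card S) + 2) \<le> \<bar>t i - s\<bar>)" using neg by blast
    then show ?thesis by (auto simp: N_def \<delta>_def not_le)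
  qed
  then obtain s where s: "\<And>i. i \<in> {..N} \<Longrightarrow> s i \<in> S" "\<And>i. i \<in> {..N} \<Longrightarrow> \<bar>t i - s i\<bar> < \<delta>"
    by metis
  have "inj_on s {..N}"
  proof (rule inj_onI, rule ccontr)
    fix i j assume ij: "i \<in> {..N}" "j \<in> {..N}" "s i = s j" "i \<noteq> j"
    have "\<bar>t i - t j\<bar> < 2 * \<delta>" using s(2)[OF ij(1)] s(2)[OF ij(2)] ij(3) by linarith
    moreover have "t i - t j = 2 * \<delta> * (real i - real j)" by (simp add: t_def algebra_simps)
    moreover have "\<bar>real i - real j\<bar> \<ge> 1" using ij(4) by linarith
    then have "2 * \<delta> * 1 \<le> 2 * \<delta> * \<bar>real i - real j\<bar>" using \<delta> by (intro mult_left_mono) auto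
    ultimately show False using \<delta> by (simp add: abs_mult)
  qed
  then have "card {..N} \<le> card S" using s(1) assms(1) by (intro card_inj_on_le[of s]) auto
  then show False by (simp add: N_def)
qed

text \<open>
  A pointwise substitute for the lemma on the logarithmic derivative: on one suitable circle between
  \<open>r\<close> and \<open>R\<close> all members of a finite family are free of zeros and their logarithmic derivatives are
  bounded by a power of \<open>L R / (R - r)\<close>, where \<open>exp L\<close> bounds the functions on \<open>\<bar>z\<bar> = R\<close>. The
  radius has to avoid the moduli of all zeros involved, and there are few enough of them.
\<close>
lemma log_deriv_bound_family:
  assumes "finite U" and U: "\<And>u. u \<in> U \<Longrightarrow> u holomorphic_on UNIV \<and> (\<exists>w. u w \<noteq> (0::complex))"
  shows "\<exists>C\<ge>1. \<forall>r R L. 1 \<le> r \<longrightarrow> r < R \<longrightarrow> 1 \<le> L \<longrightarrow> (\<forall>u\<in>U. \<forall>z. norm z = R \<longrightarrow> norm (u z) \<le> exp L) \<longrightarrow>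
    (\<exists>t. r \<le> t \<and> t < R \<and>
      (\<forall>z::complex. \<forall>u. norm z = t \<longrightarrow> u \<in> U \<longrightarrow> u z \<noteq> 0 \<and> norm (deriv u z / u z) \<le> C * (L * R / (R - r)) ^ 3))"
proof -
  have "\<forall>u\<in>U. \<exists>c\<ge>1. \<forall>r R L. 1 \<le> r \<longrightarrow> r < R \<longrightarrow> 1 \<le> L \<longrightarrow> (\<forall>z. norm z = R \<longrightarrow> norm (u z) \<le> exp L) \<longrightarrow>
    (\<exists>bs. real (length bs) \<le> c * (L * R / (R - r)) \<and>
      (\<forall>z \<delta>. r \<le> norm z \<longrightarrow> norm z \<le> r + (R - r) / 3 \<longrightarrow> \<delta> > 0 \<longrightarrow> (\<forall>b\<in>set bs. \<delta> \<le> norm (z - b)) \<longrightarrow>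
        u z \<noteq> 0 \<and> norm (deriv u z / u z) \<le> real (length bs) / \<delta> + c * (L * R / (R - r))\<^sup>2))"
    using log_deriv_bound_entire U by blast
  from bchoice[OF this] obtain c where c: "\<And>u. u \<in> U \<Longrightarrow> c u \<ge> (1::real)"
    "\<And>u r R L. u \<in> U \<Longrightarrow> 1 \<le> r \<Longrightarrow> r < R \<Longrightarrow> 1 \<le> L \<Longrightarrow> (\<forall>z. norm z = R \<longrightarrow> norm (u z) \<le> exp L) \<Longrightarrow>
    \<exists>bs. real (length bs) \<le> c u * (L * R / (R - r)) \<and>
      (\<forall>z \<delta>. r \<le> norm z \<longrightarrow> norm z \<le> r + (R - r) / 3 \<longrightarrow> \<delta> > 0 \<longrightarrow> (\<forall>b\<in>set bs. \<delta> \<le> norm (z - b)) \<longrightarrow>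
        u z \<noteq> 0 \<and> norm (deriv u z / u z) \<le> real (length bs) / \<delta> + c u * (L * R / (R - r))\<^sup>2)"
    by metis
  define K where "K = 1 + (\<Sum>u\<in>U. c u)"
  have sum0: "(\<Sum>u\<in>U. c u) \<ge> 0" by (rule sum_nonneg) (use c(1) in force)
  have K: "K \<ge> 1" using sum0 by (simp add: K_def)
  have cK: "c u \<le> K" if "u \<in> U" for u
  proof -
    have "c u \<le> (\<Sum>u\<in>U. c u)" by (rule member_le_sum) (use that assms(1) c(1) in force)+
    then show ?thesis by (simp add: K_def)
  qed
  define C where "C = 12 * K ^ 2 + K"
  show ?thesis
  proof (rule exI[of _ C], intro conjI allI impI)
    show "1 \<le> C" unfolding C_def using K zero_le_power2[of K] by linarith
    fix r R L :: real
    assume r: "1 \<le> r" "r < R" and L: "1 \<le> L" and UL: "\<forall>u\<in>U. \<forall>z. norm z = R \<longrightarrow> norm (u z) \<le> exp L"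
    define X where "X = L * R / (R - r)"
    have X1: "R / (R - r) \<le> X" using L r by (auto simp: X_def divide_simps)
    have X2: "1 \<le> R / (R - r)" using r by (simp add: field_simps)
    have X3: "1 / (R - r) \<le> X"
    proof -
      have "1 / (R - r) \<le> R / (R - r)" using r by (intro divide_right_mono) auto
      then show ?thesis using X1 by linarith
    qed
    have X0: "X \<ge> 1" using X1 X2 by linarith
    have "\<forall>u\<in>U. \<exists>bs. real (length bs) \<le> c u * X \<and>
      (\<forall>z \<delta>. r \<le> norm z \<longrightarrow> norm z \<le> r + (R - r) / 3 \<longrightarrow> \<delta> > 0 \<longrightarrow> (\<forall>b\<in>set bs. \<delta> \<le> norm (z - b)) \<longrightarrow>
        u z \<noteq> 0 \<and> norm (deriv u z / u z) \<le> real (length bs) / \<delta> + c u * X\<^sup>2)"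
      unfolding X_def using c(2)[OF _ r L] UL by blast
    from bchoice[OF this] obtain bs where bs: "\<And>u. u \<in> U \<Longrightarrow> real (length (bs u)) \<le> c u * X"
      "\<And>u z \<delta>. u \<in> U \<Longrightarrow> r \<le> norm (z::complex) \<Longrightarrow> norm z \<le> r + (R - r) / 3 \<Longrightarrow> \<delta> > 0 \<Longrightarrow> (\<forall>b\<in>set (bs u). \<delta> \<le> norm (z - b)) \<Longrightarrow>
        u z \<noteq> 0 \<and> norm (deriv u z / u z) \<le> real (length (bs u)) / \<delta> + c u * X\<^sup>2"
      by metis
    define S where "S = (\<Union>u\<in>U. norm ` set (bs u))"
    have S: "finite S" using assms(1) by (simp add: S_def)
    have cS: "real (card S) \<le> K * X"
    proof -
      have "card S \<le> (\<Sum>u\<in>U. card (norm ` set (bs u)))" unfolding S_def by (rule card_UN_le[OF assms(1)])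
      also have "\<dots> \<le> (\<Sum>u\<in>U. length (bs u))"
        by (intro sum_mono) (meson card_image_le card_length finite_set order.trans)
      finally have "real (card S) \<le> (\<Sum>u\<in>U. real (length (bs u)))" by (simp flip: of_nat_sum)
      also have "\<dots> \<le> (\<Sum>u\<in>U. c u * X)" by (intro sum_mono bs)
      also have "\<dots> \<le> K * X" using X0 by (simp add: K_def sum_distrib_right[symmetric] distrib_right)
      finally show ?thesis .
    qed
    define \<delta> where "\<delta> = ((R - r) / 3) / (2 * real (card S) + 2)"
    have \<delta>: "\<delta> > 0" using r by (simp add: \<delta>_def)
    obtain t where t: "t \<ge> r" "t \<le> r + (R - r) / 3" "\<And>s. s \<in> S \<Longrightarrow> \<delta> \<le> \<bar>t - s\<bar>"
      using avoid_finite_set[OF S, of "(R - r) / 3" r] r unfolding \<delta>_def by auto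
    have KX: "1 \<le> K * X" using mult_mono[of 1 K 1 X] K X0 by simp
    have inv\<delta>: "1 / \<delta> \<le> 12 * K * X\<^sup>2"
    proof -
      have "1 / \<delta> = 3 * (1 / (R - r)) * (2 * real (card S) + 2)" using r by (simp add: \<delta>_def field_simps)
      also have "\<dots> \<le> 3 * X * (2 * (K * X) + 2 * (K * X))"
        using X3 cS KX r X0 by (intro mult_mono add_mono) auto
      finally show ?thesis by (simp add: power2_eq_square mult_ac)
    qed
    show "\<exists>t. r \<le> t \<and> t < R \<and>
      (\<forall>z::complex. \<forall>u. norm z = t \<longrightarrow> u \<in> U \<longrightarrow> u z \<noteq> 0 \<and> norm (deriv u z / u z) \<le> C * (L * R / (R - r)) ^ 3)"
      unfolding X_def[symmetric]
    proof (intro exI[of _ t] conjI allI impI)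
      show "r \<le> t" by (rule t(1))
      show "t < R" using t(2) r(2) by argo
      fix z :: complex and u assume z: "norm z = t" and u: "u \<in> U"
      have "\<forall>b\<in>set (bs u). \<delta> \<le> norm (z - b)"
      proof
        fix b assume "b \<in> set (bs u)"
        then have "norm b \<in> S" using u by (auto simp: S_def)
        then have "\<delta> \<le> \<bar>norm z - norm b\<bar>" using t(3) z by simp
        then show "\<delta> \<le> norm (z - b)" using norm_triangle_ineq3[of z b] by linarith
      qed
      from bs(2)[OF u _ _ \<delta> this] z t
      have *: "u z \<noteq> 0" "norm (deriv u z / u z) \<le> real (length (bs u)) / \<delta> + c u * X\<^sup>2" by auto
      show "u z \<noteq> 0" by fact
      have "real (length (bs u)) * (1 / \<delta>) \<le> (K * X) * (12 * K * X\<^sup>2)"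
      proof (rule mult_mono[OF _ inv\<delta>])
        have "c u * X \<le> K * X" using cK[OF u] X0 by (intro mult_right_mono) auto
        then show "real (length (bs u)) \<le> K * X" using bs(1)[OF u] by linarith
      qed (use \<delta> KX in auto)
      moreover have "c u * X\<^sup>2 \<le> K * X ^ 3"
        using cK[OF u] K X0 by (intro mult_mono power_increasing) auto
      ultimately have "norm (deriv u z / u z) \<le> (K * X) * (12 * K * X\<^sup>2) + K * X ^ 3" using *(2) by simp
      also have "\<dots> = C * X ^ 3" by (simp add: C_def power2_eq_square power3_eq_cube algebra_simps)
      finally show "norm (deriv u z / u z) \<le> C * X ^ 3" .
    qed
  qed
qed

section \<open>A growth dichotomy\<close>

text \<open>
  If \<open>\<mu>(r) = exp t\<close> exceeds \<open>(ln r)\<^sup>2\<close> at a large \<open>r\<close>, then \<open>ln R\<close> cannot account for the size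
  of \<open>\<mu>(r)\<close> in the recursion, so \<open>\<mu>(R)\<close> has to be huge: with \<open>R = r (1 + 1 / t\<^sup>2)\<close> the value of \<open>t\<close>
  at least doubles. Iterating, \<open>t\<close> grows like \<open>2 ^ n\<close> while the radii stay below \<open>r exp (\<Sum>n. 1 / 2 ^ n)\<close>,
  so \<open>\<mu>\<close> is unbounded on a bounded interval, which monotonicity forbids.
\<close>
lemma growth_dichotomy:
  fixes \<mu> :: "real \<Rightarrow> real" and K :: real and k :: nat
  assumes mono: "\<And>r R. r \<le> R \<Longrightarrow> \<mu> r \<le> \<mu> R" and pos: "\<And>r. \<mu> r \<ge> 1" and K: "K > 0"
    and rec: "\<And>r R. r0 \<le> r \<Longrightarrow> r < R \<Longrightarrow> R \<le> 2 * r \<Longrightarrow> \<mu> r \<le> K * (R / (R - r)) ^ k * (ln (\<mu> R) + ln R)"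
  shows "\<exists>r1. \<forall>r\<ge>r1. \<mu> r \<le> (ln r)\<^sup>2"
proof -
  have "eventually (\<lambda>t::real. K * (2 * t\<^sup>2) ^ k * (2 * t + exp (t / 2) + 1) < exp t) at_top"
    using K by real_asymp
  then obtain t1 where t1: "\<And>t. t \<ge> t1 \<Longrightarrow> K * (2 * t\<^sup>2) ^ k * (2 * t + exp (t / 2) + 1) < exp t"
    by (auto simp: eventually_at_top_linorder)
  define t0 where "t0 = max 2 t1"
  \<comment> \<open>The condition on \<open>ln r\<close> says that \<open>\<mu> r\<close> is larger than \<open>(ln r)\<^sup>2\<close>.\<close>
  define Q where "Q r \<longleftrightarrow> r \<ge> max 1 r0 \<and> ln (\<mu> r) \<ge> t0 \<and> ln r < exp (ln (\<mu> r) / 2)" for r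
  define nxt where "nxt r = r * (1 + 1 / (ln (\<mu> r))\<^sup>2)" for r
  have step: "Q (nxt r) \<and> ln (\<mu> (nxt r)) \<ge> 2 * ln (\<mu> r)" if Q: "Q r" for r
  proof -
    define t where "t = ln (\<mu> r)"
    define R where "R = nxt r"
    have r: "r \<ge> 1" "r \<ge> r0" and t: "t \<ge> 2" "t \<ge> t1" and lr: "ln r < exp (t / 2)"
      using Q by (auto simp: Q_def t_def t0_def)
    have \<mu>r: "\<mu> r = exp t" using pos[of r] by (simp add: t_def)
    have t2: "1 / t\<^sup>2 \<le> 1" "1 / t\<^sup>2 > 0" "t\<^sup>2 \<ge> 1" using t by (auto simp: power2_eq_square divide_simps intro: mult_ge1_I)
    have R: "R = r * (1 + 1 / t\<^sup>2)" by (simp add: R_def nxt_def t_def)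
    have rR: "r < R" using r t2 by (simp add: R)
    have R2: "R \<le> 2 * r"
    proof -
      have "r * (1 + 1 / t\<^sup>2) \<le> r * 2" using r t2 by (intro mult_left_mono) auto
      then show ?thesis by (simp add: R)
    qed
    have ratio: "R / (R - r) \<le> 2 * t\<^sup>2"
    proof -
      have "R / (R - r) = t\<^sup>2 + 1" using r t by (simp add: R field_simps)
      then show ?thesis using t2 by simp
    qed
    have lnR: "ln R \<le> exp (t / 2) + 1"
    proof -
      have "ln R \<le> ln (2 * r)" using R2 rR r by (intro ln_mono) auto
      also have "\<dots> = ln 2 + ln r" using r by (simp add: ln_mult)
      finally show ?thesis using lr ln_2_less_1 by linarith
    qed
    have lnR0: "ln R \<ge> 0" using rR r by simp
    have l\<mu>: "ln (\<mu> R) \<ge> 0" using pos[of R] by simp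
    have big: "2 * t < ln (\<mu> R)"
    proof (rule ccontr)
      assume "\<not> 2 * t < ln (\<mu> R)"
      then have le: "ln (\<mu> R) + ln R \<le> 2 * t + exp (t / 2) + 1" using lnR by linarith
      have "exp t \<le> K * (R / (R - r)) ^ k * (ln (\<mu> R) + ln R)"
        using rec[OF r(2) rR R2] \<mu>r by simp
      also have "\<dots> \<le> K * (2 * t\<^sup>2) ^ k * (2 * t + exp (t / 2) + 1)"
        using ratio le K rR r lnR0 l\<mu> by (intro mult_mono power_mono mult_left_mono) auto
      also have "\<dots> < exp t" by (rule t1[OF t(2)])
      finally show False by simp
    qed
    have "ln R < exp (ln (\<mu> R) / 2)"
    proof -
      have "exp (t / 2) + 1 \<le> 2 * exp (t / 2)" using t by simp
      also have "\<dots> \<le> exp (t / 2) * exp (t / 2)"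
      proof (rule mult_right_mono)
        show "2 \<le> exp (t / 2)" using t exp_ge_add_one_self[of "t/2"] by linarith
      qed simp
      also have "\<dots> = exp t" by (simp flip: exp_add)
      also have "\<dots> < exp (ln (\<mu> R) / 2)" using big by simp
      finally show ?thesis using lnR by linarith
    qed
    then show ?thesis
      using big t rR r Q unfolding R_def[symmetric] t_def[symmetric] by (auto simp: Q_def t_def)
  qed
  have noQ: "\<not> Q r" for r
  proof
    assume Q: "Q r"
    define s where "s n = (nxt ^^ n) r" for n
    have inv: "Q (s n) \<and> ln (\<mu> (s n)) \<ge> 2 ^ n \<and> s n \<le> r * exp (2 - 2 / 2 ^ n)" for n
    proof (induction n)
      case 0
      then show ?case using Q by (auto simp: s_def Q_def t0_def)
    next
      case (Suc n)
      have eq: "s (Suc n) = nxt (s n)" by (simp add: s_def)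
      define t where "t = ln (\<mu> (s n))"
      have t: "t \<ge> 2 ^ n" "t \<ge> 1" using Suc by (auto simp: t_def Q_def t0_def)
      have sn: "s n > 0" using Suc by (auto simp: Q_def)
      have r0: "r > 0" using Q by (auto simp: Q_def)
      have "1 / t\<^sup>2 \<le> 1 / 2 ^ n"
      proof (rule divide_left_mono)
        have "t * 1 \<le> t * t" using t by (intro mult_left_mono) auto
        then show "2 ^ n \<le> t\<^sup>2" using t(1) by (simp add: power2_eq_square)
      qed (use t in auto)
      then have "1 + 1 / t\<^sup>2 \<le> exp (1 / 2 ^ n)" using exp_ge_add_one_self[of "1 / 2 ^ n :: real"] by linarith
      then have "nxt (s n) \<le> (r * exp (2 - 2 / 2 ^ n)) * exp (1 / 2 ^ n)"
        unfolding nxt_def t_def[symmetric] using Suc sn r0 t by (intro mult_mono) auto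
      also have "\<dots> = r * exp (2 - 2 / 2 ^ Suc n)" by (simp flip: exp_add add: field_simps)
      finally show ?case using step[of "s n"] Suc by (auto simp: eq)
    qed
    have "2 ^ n \<le> ln (\<mu> (r * exp 2))" for n
    proof -
      have r0: "r > 0" using Q by (auto simp: Q_def)
      have "s n \<le> r * exp (2 - 2 / 2 ^ n)" using inv by blast
      also have "\<dots> \<le> r * exp 2" using r0 by (intro mult_left_mono) auto
      finally have "\<mu> (s n) \<le> \<mu> (r * exp 2)" by (rule mono)
      then have "ln (\<mu> (s n)) \<le> ln (\<mu> (r * exp 2))" using pos[of "s n"] by (intro ln_mono) auto
      then show ?thesis using inv[of n] by linarith
    qed
    moreover obtain n where "ln (\<mu> (r * exp 2)) < 2 ^ n" using real_arch_pow[of 2] by auto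
    ultimately show False by (meson not_le)
  qed
  show ?thesis
  proof (intro exI[of _ "max (max 1 r0) (exp (exp t0))"] allI impI)
    fix r assume r: "max (max 1 r0) (exp (exp t0)) \<le> r"
    show "\<mu> r \<le> (ln r)\<^sup>2"
    proof (rule ccontr)
      assume "\<not> \<mu> r \<le> (ln r)\<^sup>2"
      then have lt: "(ln r)\<^sup>2 < \<mu> r" by simp
      have lr: "ln r \<ge> exp t0" using r by (subst ln_ge_iff) auto
      have e: "exp t0 \<ge> 1" by (simp add: t0_def)
      have "1 \<le> ln r" using lr e by linarith
      then have "exp t0 * 1 \<le> ln r * ln r" using lr by (intro mult_mono) auto
      then have "exp t0 \<le> \<mu> r" using lt by (simp add: power2_eq_square)
      then have l: "ln (\<mu> r) \<ge> t0" using pos[of r] by (subst ln_ge_iff) auto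
      have "ln r < exp (ln (\<mu> r) / 2)"
      proof (rule power_less_imp_less_base)
        have "exp (ln (\<mu> r) / 2) ^ 2 = \<mu> r" using pos[of r] by (simp flip: exp_of_nat_mult)
        then show "(ln r)\<^sup>2 < (exp (ln (\<mu> r) / 2))\<^sup>2" using lt by simp
      qed auto
      then have "Q r" using r l by (auto simp: Q_def)
      then show False using noQ by blast
    qed
  qed
qed

section \<open>Functions controlled by a growth scale\<close>

text \<open>
  The denominator of the Weierstrass factorization has finitely many zeros here, so its zero-free part
  can be moved into the numerator.
\<close>
lemma entire_over_poly:
  assumes h: "h nicely_meromorphic_on UNIV" and fin: "finite {z. is_pole h z}"
  obtains E p where "E holomorphic_on UNIV" "p \<noteq> 0" "\<And>z. poly p z = 0 \<longleftrightarrow> is_pole h z"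
    "\<And>z. h z = E z / poly p z"
proof -
  obtain k f1 f2 where k: "k holomorphic_on UNIV" "f1 holomorphic_on UNIV" "f2 holomorphic_on UNIV"
    "\<And>z. f2 z = 0 \<longleftrightarrow> is_pole h z" "\<And>z. h z = k z * f1 z / f2 z"
    using weierstrass_factorization_meromorphic_UNIV[OF h] by metis
  have "{z. is_pole h z} \<noteq> UNIV" using fin infinite_UNIV_char_0 by metis
  then obtain w where "f2 w \<noteq> 0" using k(4) by auto
  from entire_factor_finite_set[OF fin k(3) this] obtain bs g where
    g: "set bs \<subseteq> {z. is_pole h z}" "g holomorphic_on UNIV" "\<And>z. is_pole h z \<Longrightarrow> g z \<noteq> 0"
      "\<And>z. f2 z = (\<Prod>b\<leftarrow>bs. z - b) * g z" by auto
  have gn: "g z \<noteq> 0" for z using g(3)[of z] g(4)[of z] k(4)[of z] by (cases "is_pole h z") auto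
  define p where "p = (\<Prod>b\<leftarrow>bs. [:- b, 1:])"
  have p: "poly p z = (\<Prod>b\<leftarrow>bs. z - b)" for z
    unfolding p_def by (induction bs) (auto simp: algebra_simps)
  have pz: "poly p z = 0 \<longleftrightarrow> is_pole h z" for z
    using g(4)[of z] gn[of z] k(4)[of z] by (simp add: p)
  show ?thesis
  proof (rule that[of "\<lambda>z. k z * f1 z / g z" p])
    show "p \<noteq> 0" unfolding p_def by (auto simp: prod_list_zero_iff)
    show "h z = k z * f1 z / g z / poly p z" for z
      using k(5)[of z] g(4)[of z] by (simp add: p)
  qed (use k gn pz in \<open>auto intro!: holomorphic_intros g\<close>)
qed

text \<open>
  Growth at most that of a power of \<open>M\<close>, read at a slightly larger radius. The factor \<open>R / (R - r)\<close> is
  what a Cauchy estimate costs, so that derivatives stay in the class; the factor \<open>R\<close> admits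
  polynomials.
\<close>
definition controlled :: "(real \<Rightarrow> real) \<Rightarrow> (complex \<Rightarrow> complex) \<Rightarrow> bool" where
  "controlled M u \<longleftrightarrow> u holomorphic_on UNIV \<and>
     (\<exists>N. \<forall>r R z. 1 \<le> r \<longrightarrow> r < R \<longrightarrow> norm z \<le> r \<longrightarrow> norm (u z) \<le> (M R * R * (R / (R - r))) ^ N)"

lemma controlledI:
  assumes "u holomorphic_on UNIV"
    "\<And>r R z. 1 \<le> r \<Longrightarrow> r < R \<Longrightarrow> norm z \<le> r \<Longrightarrow> norm (u z) \<le> (M R * R * (R / (R - r))) ^ N"
  shows "controlled M u"
  using assms unfolding controlled_def by blast

lemma controlled_holomorphic: "controlled M u \<Longrightarrow> u holomorphic_on UNIV"
  by (simp add: controlled_def)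

definition growth_scale :: "(real \<Rightarrow> real) \<Rightarrow> bool" where
  "growth_scale M \<longleftrightarrow> (\<forall>r. 3 \<le> M r) \<and> (\<forall>r R. r \<le> R \<longrightarrow> M r \<le> M R)"

lemma growth_scale_ge3:
  assumes "growth_scale M" "1 \<le> r" "r < R"
  shows "3 \<le> M R * R * (R / (R - r))" "R / (R - r) \<le> M R * R * (R / (R - r))"
    "R \<le> M R * R * (R / (R - r))" "M R \<le> M R * R * (R / (R - r))" "M R * R \<le> M R * R * (R / (R - r))"
proof -
  have a: "3 \<le> M R" using assms by (auto simp: growth_scale_def)
  have b: "1 \<le> R / (R - r)" "1 \<le> R" using assms by (auto simp: field_simps)
  have ab: "3 * 1 \<le> M R * R" using a b by (intro mult_mono) auto
  have "(M R * R) * 1 \<le> (M R * R) * (R / (R - r))" using ab b by (intro mult_left_mono) auto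
  then show c: "M R * R \<le> M R * R * (R / (R - r))" by simp
  then show "3 \<le> M R * R * (R / (R - r))" using ab by simp
  have "1 * (R / (R - r)) \<le> (M R * R) * (R / (R - r))" using ab b by (intro mult_right_mono) auto
  then show "R / (R - r) \<le> M R * R * (R / (R - r))" by simp
  have "M R * 1 \<le> M R * R" using a b by (intro mult_left_mono) auto
  then show "M R \<le> M R * R * (R / (R - r))" using c by simp
  have "1 * R \<le> M R * R" using a b by (intro mult_right_mono) auto
  then show "R \<le> M R * R * (R / (R - r))" using c by simp
qed

lemma controlled_mult:
  assumes "controlled M u" "controlled M v" "growth_scale M"
  shows "controlled M (\<lambda>z. u z * v z)"
proof -
  obtain N N' where N: "\<And>r R z. 1 \<le> r \<Longrightarrow> r < R \<Longrightarrow> norm z \<le> r \<Longrightarrow> norm (u z) \<le> (M R * R * (R / (R - r))) ^ N"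
    "\<And>r R z. 1 \<le> r \<Longrightarrow> r < R \<Longrightarrow> norm z \<le> r \<Longrightarrow> norm (v z) \<le> (M R * R * (R / (R - r))) ^ N'"
    using assms(1,2) unfolding controlled_def by metis
  have "norm (u z * v z) \<le> (M R * R * (R / (R - r))) ^ (N + N')" if "1 \<le> r" "r < R" "norm z \<le> r" for r R z
  proof -
    have "0 \<le> (M R * R * (R / (R - r))) ^ N" using N(1)[OF that] norm_ge_zero order.trans by blast
    then show ?thesis unfolding norm_mult power_add using N(1)[OF that] N(2)[OF that] by (intro mult_mono) auto
  qed
  then show ?thesis
    by (rule controlledI[rotated]) (assumption | intro holomorphic_intros controlled_holomorphic[OF assms(1)] controlled_holomorphic[OF assms(2)])+
qed

lemma controlled_add:
  assumes "controlled M u" "controlled M v" "growth_scale M"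
  shows "controlled M (\<lambda>z. u z + v z)"
proof -
  obtain N N' where N: "\<And>r R z. 1 \<le> r \<Longrightarrow> r < R \<Longrightarrow> norm z \<le> r \<Longrightarrow> norm (u z) \<le> (M R * R * (R / (R - r))) ^ N"
    "\<And>r R z. 1 \<le> r \<Longrightarrow> r < R \<Longrightarrow> norm z \<le> r \<Longrightarrow> norm (v z) \<le> (M R * R * (R / (R - r))) ^ N'"
    using assms(1,2) unfolding controlled_def by metis
  have "norm (u z + v z) \<le> (M R * R * (R / (R - r))) ^ Suc (N + N')" if "1 \<le> r" "r < R" "norm z \<le> r" for r R z
  proof -
    define X where "X = M R * R * (R / (R - r))"
    have X: "X \<ge> 3" unfolding X_def using growth_scale_ge3(1)[OF assms(3) that(1,2)] .
    have "norm (u z + v z) \<le> X ^ N + X ^ N'"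
      using N(1)[OF that] N(2)[OF that] unfolding X_def by (intro norm_triangle_le add_mono)
    also have "\<dots> \<le> X ^ (N + N') + X ^ (N + N')" using X by (intro add_mono power_increasing) auto
    also have "\<dots> = 2 * X ^ (N + N')" by simp
    also have "\<dots> \<le> X ^ Suc (N + N')" using X by (simp add: mult_right_mono)
    finally show ?thesis by (simp add: X_def)
  qed
  then show ?thesis
    by (rule controlledI[rotated]) (assumption | intro holomorphic_intros controlled_holomorphic[OF assms(1)] controlled_holomorphic[OF assms(2)])+
qed

lemma controlled_const:
  assumes "growth_scale M"
  shows "controlled M (\<lambda>z. c)"
proof -
  obtain N where N: "norm c < 3 ^ N" using real_arch_pow[of 3] by auto
  have "norm c \<le> (M R * R * (R / (R - r))) ^ N" if "1 \<le> r" "r < R" for r R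
  proof -
    have "(3::real) ^ N \<le> (M R * R * (R / (R - r))) ^ N"
      using growth_scale_ge3(1)[OF assms that] by (intro power_mono) auto
    then show ?thesis using N by linarith
  qed
  then show ?thesis by (rule controlledI[rotated]) (assumption | intro holomorphic_intros)+
qed

lemma controlled_id:
  assumes "growth_scale M"
  shows "controlled M (\<lambda>z. z)"
proof -
  have "norm z \<le> (M R * R * (R / (R - r))) ^ 1" if "1 \<le> r" "r < R" "norm z \<le> r" for r R and z :: complex
    using growth_scale_ge3(3)[OF assms that(1,2)] that by simp
  then show ?thesis by (rule controlledI[rotated]) (assumption | intro holomorphic_intros)+
qed

lemma controlled_uminus: "controlled M u \<Longrightarrow> controlled M (\<lambda>z. - u z)"
  unfolding controlled_def by (auto intro!: holomorphic_intros)

lemma controlled_diff: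
  assumes "controlled M u" "controlled M v" "growth_scale M"
  shows "controlled M (\<lambda>z. u z - v z)"
  using controlled_add[OF assms(1) controlled_uminus[OF assms(2)] assms(3)] by simp

lemma controlled_deriv:
  assumes "controlled M u" and M: "growth_scale M"
  shows "controlled M (deriv u)"
proof -
  obtain N where N: "\<And>r R z. 1 \<le> r \<Longrightarrow> r < R \<Longrightarrow> norm z \<le> r \<Longrightarrow> norm (u z) \<le> (M R * R * (R / (R - r))) ^ N"
    and u: "u holomorphic_on UNIV" using assms(1) unfolding controlled_def by metis
  have "norm (deriv u z) \<le> (M R * R * (R / (R - r))) ^ (2 * N + 2)" if r: "1 \<le> r" "r < R" "norm z \<le> r" for r R z
  proof -
    define X where "X = M R * R * (R / (R - r))"
    define \<rho> where "\<rho> = (r + R) / 2"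
    have \<rho>: "r < \<rho>" "\<rho> < R" "1 \<le> \<rho>" using r by (auto simp: \<rho>_def)
    have X: "X \<ge> 3" unfolding X_def using growth_scale_ge3(1)[OF M r(1,2)] .
    have X2: "M R * R * (R / (R - \<rho>)) = 2 * X" using r by (simp add: X_def \<rho>_def field_simps)
    have "norm ((deriv ^^ 1) u z) \<le> fact 1 * (2 * X) ^ N / (\<rho> - r) ^ 1"
    proof (rule Cauchy_inequality)
      show "u holomorphic_on ball z (\<rho> - r)" "continuous_on (cball z (\<rho> - r)) u"
        using u holomorphic_on_subset holomorphic_on_imp_continuous_on by blast+
      show "norm (u x) \<le> (2 * X) ^ N" if "norm (z - x) = \<rho> - r" for x
      proof -
        have "norm x \<le> \<rho>" using norm_triangle_ineq2[of x z] that r by (simp add: norm_minus_commute)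
        then show ?thesis using N[of \<rho> R x] \<rho> X2 by simp
      qed
    qed (use \<rho> in auto)
    then have "norm (deriv u z) \<le> (2 * X) ^ N * (2 * (1 / (R - r)))" using r by (simp add: \<rho>_def field_simps)
    also have "\<dots> \<le> (X * X) ^ N * (X * X)"
    proof (intro mult_mono power_mono)
      have "1 / (R - r) \<le> R / (R - r)" using r by (intro divide_right_mono) auto
      then show "1 / (R - r) \<le> X" using growth_scale_ge3(2)[OF M r(1,2)] by (simp add: X_def)
    qed (use X r in auto)
    also have "\<dots> = X ^ (2 * N + 2)" by (simp add: power_add power_mult power2_eq_square power_mult_distrib)
    finally show ?thesis by (simp add: X_def)
  qed
  then show ?thesis by (rule controlledI[rotated]) (assumption | intro holomorphic_deriv u open_UNIV)+
qed

lemma controlled_poly: "growth_scale M \<Longrightarrow> controlled M (poly p)"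
proof (induction p)
  case (pCons a p)
  have "poly (pCons a p) = (\<lambda>z. a + z * poly p z)" by auto
  then show ?case using pCons by (simp only:) (intro controlled_add controlled_mult controlled_const controlled_id, auto)
next
  case 0
  moreover have "poly 0 = (\<lambda>z::complex. 0)" by auto
  ultimately show ?case using controlled_const[of M 0] by simp
qed

text \<open>
  Controlled up to a polynomial denominator with zeros in the exceptional set \<open>X\<close>. The closure
  properties below make every expression built from two tame functions by ring operations and
  differentiation tame, and hence bound its logarithmic derivative on suitable circles.
\<close>
definition tame :: "(real \<Rightarrow> real) \<Rightarrow> complex set \<Rightarrow> (complex \<Rightarrow> complex) \<Rightarrow> bool" where
  "tame M X h \<longleftrightarrow> (\<exists>u p. controlled M u \<and> p \<noteq> 0 \<and> (\<forall>z. poly p z = 0 \<longrightarrow> z \<in> X) \<and> (\<forall>z. z \<notin> X \<longrightarrow> h z = u z / poly p z))"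

lemma tame_const: "growth_scale M \<Longrightarrow> tame M X (\<lambda>z. c)"
  unfolding tame_def by (rule exI[of _ "\<lambda>_. c"], rule exI[of _ 1]) (auto intro: controlled_const)

lemma tame_mult:
  assumes "tame M X h" "tame M X k" "growth_scale M"
  shows "tame M X (\<lambda>z. h z * k z)"
proof -
  obtain u p v q where up: "controlled M u" "p \<noteq> 0" "\<And>z. poly p z = 0 \<Longrightarrow> z \<in> X" "\<And>z. z \<notin> X \<Longrightarrow> h z = u z / poly p z"
     and vq: "controlled M v" "q \<noteq> 0" "\<And>z. poly q z = 0 \<Longrightarrow> z \<in> X" "\<And>z. z \<notin> X \<Longrightarrow> k z = v z / poly q z"
    using assms unfolding tame_def by metis
  show ?thesis unfolding tame_def
    by (rule exI[of _ "\<lambda>z. u z * v z"], rule exI[of _ "p * q"])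
       (use up vq assms(3) in \<open>auto intro: controlled_mult\<close>)
qed

lemma tame_add:
  assumes "tame M X h" "tame M X k" "growth_scale M"
  shows "tame M X (\<lambda>z. h z + k z)"
proof -
  obtain u p v q where up: "controlled M u" "p \<noteq> 0" "\<And>z. poly p z = 0 \<Longrightarrow> z \<in> X" "\<And>z. z \<notin> X \<Longrightarrow> h z = u z / poly p z"
     and vq: "controlled M v" "q \<noteq> 0" "\<And>z. poly q z = 0 \<Longrightarrow> z \<in> X" "\<And>z. z \<notin> X \<Longrightarrow> k z = v z / poly q z"
    using assms unfolding tame_def by metis
  have "h z + k z = (u z * poly q z + v z * poly p z) / poly (p * q) z" if "z \<notin> X" for z
  proof -
    have "poly p z \<noteq> 0" "poly q z \<noteq> 0" using up(3) vq(3) that by blast+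
    then show ?thesis using up(4) vq(4) that by (simp add: field_simps)
  qed
  then show ?thesis unfolding tame_def
    by (intro exI[of _ "\<lambda>z. u z * poly q z + v z * poly p z"] exI[of _ "p * q"])
       (use up vq assms(3) in \<open>auto intro!: controlled_mult controlled_add controlled_poly\<close>)
qed

lemma tame_poly:
  assumes "tame M X h" "growth_scale M"
  shows "tame M X (\<lambda>z. poly p (h z))"
proof (induction p)
  case (pCons a p)
  then show ?case using assms by (simp, intro tame_add tame_mult tame_const)
qed (use assms tame_const in auto)

lemma tame_deriv:
  assumes "tame M X h" "growth_scale M" "finite X"
  shows "tame M X (deriv h)"
proof -
  obtain u p where up: "controlled M u" "p \<noteq> 0" "\<And>z. poly p z = 0 \<Longrightarrow> z \<in> X" "\<And>z. z \<notin> X \<Longrightarrow> h z = u z / poly p z"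
    using assms unfolding tame_def by metis
  have "deriv h z = (deriv u z * poly p z - u z * poly (pderiv p) z) / poly (p * p) z" if z: "z \<notin> X" for z
  proof -
    have "(u has_field_derivative deriv u z) (at z)"
      using up(1) unfolding controlled_def by (meson holomorphic_derivI open_UNIV UNIV_I)
    moreover have "poly p z \<noteq> 0" using up(3) z by blast
    ultimately have "((\<lambda>z. u z / poly p z) has_field_derivative
        (deriv u z * poly p z - u z * poly (pderiv p) z) / poly (p * p) z) (at z)"
      by (auto intro!: derivative_eq_intros simp: poly_DERIV)
    then have "(h has_field_derivative (deriv u z * poly p z - u z * poly (pderiv p) z) / poly (p * p) z) (at z)"
    proof (rule has_field_derivative_transform_within_open)
      show "open (- X)" using assms(3) by (simp add: finite_imp_closed open_Compl)
    qed (use z up(4) in auto)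
    then show ?thesis by (rule DERIV_imp_deriv)
  qed
  then show ?thesis unfolding tame_def
    by (intro exI[of _ "\<lambda>z. deriv u z * poly p z - u z * poly (pderiv p) z"] exI[of _ "p * p"])
       (use up assms(2) in \<open>auto intro!: controlled_mult controlled_diff controlled_poly controlled_deriv\<close>)
qed

text \<open>
  The summand 3 keeps \<open>ln (ln M)\<close> defined and positive; \<open>max 0 r\<close> makes the supremum range over a
  non-empty set also for negative \<open>r\<close>.
\<close>
definition max_mod :: "(complex \<Rightarrow> complex) \<Rightarrow> (complex \<Rightarrow> complex) \<Rightarrow> real \<Rightarrow> real" where
  "max_mod f g r = 3 + (SUP z\<in>cball 0 (max 0 r). norm (f z) + norm (g z))"

lemma
  assumes f: "f holomorphic_on UNIV" and g: "g holomorphic_on UNIV"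
  shows max_mod_upper: "norm z \<le> r \<Longrightarrow> 3 + norm (f z) + norm (g z) \<le> max_mod f g r"
    and growth_scale_max_mod: "growth_scale (max_mod f g)"
    and max_mod_least: "0 \<le> r \<Longrightarrow> (\<And>z. norm z \<le> r \<Longrightarrow> norm (f z) + norm (g z) \<le> B) \<Longrightarrow> max_mod f g r \<le> 3 + B"
proof -
  have bdd: "bdd_above ((\<lambda>z. norm (f z) + norm (g z)) ` cball 0 r)" for r
  proof -
    have "compact ((\<lambda>z. norm (f z) + norm (g z)) ` cball 0 r)"
      using f g by (intro compact_continuous_image continuous_intros compact_cball)
        (auto intro: holomorphic_on_imp_continuous_on holomorphic_on_subset)
    then show ?thesis by (simp add: bounded_imp_bdd_above compact_imp_bounded)
  qed
  show 1: "3 + norm (f z) + norm (g z) \<le> max_mod f g r" if "norm z \<le> r" for z r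
    unfolding max_mod_def using cSUP_upper[OF _ bdd[of "max 0 r"], of z] that by simp
  show "max_mod f g r \<le> 3 + B" if "0 \<le> r" "\<And>z. norm z \<le> r \<Longrightarrow> norm (f z) + norm (g z) \<le> B" for r B
  proof -
    have "cball (0::complex) (max 0 r) \<noteq> {}" by simp
    then have "(SUP z\<in>cball 0 (max 0 r). norm (f z) + norm (g z)) \<le> B"
      by (rule cSUP_least) (use that in auto)
    then show ?thesis by (simp add: max_mod_def)
  qed
  have "max_mod f g r \<le> max_mod f g R" if "r \<le> R" for r R
    unfolding max_mod_def by (intro add_left_mono cSUP_subset_mono bdd) (use that in auto)
  moreover have "3 \<le> max_mod f g r" for r
  proof -
    have "norm (f 0) + norm (g 0) \<le> (SUP z\<in>cball 0 (max 0 r). norm (f z) + norm (g z))"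
      by (rule cSUP_upper[OF _ bdd[of "max 0 r"], of 0]) simp
    then show ?thesis unfolding max_mod_def by (smt (verit) norm_ge_zero)
  qed
  ultimately show "growth_scale (max_mod f g)" by (auto simp: growth_scale_def)
qed

section \<open>Slow growth from an auxiliary function\<close>

lemma poly_growth: "\<exists>n. \<forall>z::complex. 2 \<le> norm z \<longrightarrow> norm (poly p z) \<le> norm z ^ n"
proof (induction p)
  case (pCons a p)
  then obtain n where n: "\<And>z. 2 \<le> norm z \<Longrightarrow> norm (poly p z) \<le> norm z ^ n" by blast
  obtain j where j: "norm a < 2 ^ j" using real_arch_pow[of 2] by auto
  have "norm (poly (pCons a p) z) \<le> norm z ^ (n + j + 2)" if z: "2 \<le> norm z" for z
  proof -
    have "norm (poly (pCons a p) z) \<le> norm a + norm z * norm (poly p z)"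
      using norm_triangle_ineq[of a "z * poly p z"] by (simp add: norm_mult)
    also have "norm a \<le> norm z ^ (n + j + 1)"
    proof -
      have "(2::real) ^ j \<le> norm z ^ j" using z by (intro power_mono) auto
      also have "\<dots> \<le> norm z ^ (n + j + 1)" using z by (intro power_increasing) auto
      finally show ?thesis using j by linarith
    qed
    also have "norm z * norm (poly p z) \<le> norm z ^ (n + j + 1)"
    proof -
      have "norm z * norm (poly p z) \<le> norm z ^ Suc n" using n[OF z] by (simp add: mult_left_mono)
      also have "\<dots> \<le> norm z ^ (n + j + 1)" using z by (intro power_increasing) auto
      finally show ?thesis .
    qed
    also have "norm z ^ (n + j + 1) + norm z ^ (n + j + 1) = 2 * norm z ^ (n + j + 1)" by simp
    also have "\<dots> \<le> norm z * norm z ^ (n + j + 1)" using z by (intro mult_right_mono) auto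
    finally show ?thesis by simp
  qed
  then show ?case by blast
qed (auto intro: exI[of _ 0])

lemma eventually_log_deriv_poly: "p \<noteq> 0 \<Longrightarrow> eventually (\<lambda>z::complex. norm (poly (pderiv p) z / poly p z) \<le> 1) at_infinity"
proof (cases "degree p = 0")
  case True
  then have "pderiv p = 0" by (simp add: pderiv_eq_0_iff)
  then show ?thesis by simp
next
  case False
  then have "((\<lambda>z. poly (pderiv p) z / poly p z) \<longlongrightarrow> 0) at_infinity"
    by (intro poly_divide_tendsto_0_at_infinity) (simp add: degree_pderiv)
  from tendstoD[OF this, of 1] show ?thesis by (auto elim: eventually_mono)
qed

text \<open>
  The engine of the whole argument. Let \<open>M\<close> be the maximum modulus of the numerators \<open>f0\<close>, \<open>g0\<close>. On a
  circle of radius \<open>t\<close> between \<open>r\<close> and \<open>R\<close> the logarithmic derivatives on the right-hand side are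
  bounded by a power of \<open>log M(R)\<close>, up to powers of \<open>R\<close> and \<open>R / (R - r)\<close>, hence so are \<open>\<psi> / q\<close> and
  its products with \<open>f\<close> and \<open>g\<close>.
  Dividing by \<open>\<psi>\<close> transfers the bound to \<open>f0\<close> and \<open>g0\<close> on \<open>\<bar>z\<bar> \<le> r\<close>:
  \<open>log M(r)\<close> is at most a constant times \<open>(R / (R - r))\<^sup>2 (log log M(R) + log R)\<close>, and the growth
  dichotomy applies.
\<close>
lemma slow_growth:
  assumes X: "finite X"
    and f0: "f0 holomorphic_on UNIV" and g0: "g0 holomorphic_on UNIV"
    and p: "p \<noteq> 0" "\<And>z. poly p z = 0 \<Longrightarrow> z \<in> X"
    and f: "\<And>z. z \<notin> X \<Longrightarrow> f z = f0 z / poly p z" and g: "\<And>z. z \<notin> X \<Longrightarrow> g z = g0 z / poly p z"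
    and hs: "finite hs" "\<And>h. h \<in> hs \<Longrightarrow> tame (max_mod f0 g0) X h" "\<And>h. h \<in> hs \<Longrightarrow> \<exists>z. z \<notin> X \<and> h z \<noteq> 0"
    and \<psi>: "\<psi> holomorphic_on UNIV" "\<psi> w \<noteq> 0" and q: "\<And>z. poly q z = 0 \<Longrightarrow> z \<in> X"
    and bound: "\<And>z. z \<notin> X \<Longrightarrow> (\<And>h. h \<in> hs \<Longrightarrow> h z \<noteq> 0) \<Longrightarrow>
      norm (\<psi> z / poly q z) * (1 + norm (f z) + norm (g z)) \<le> C * (1 + (\<Sum>h\<in>hs. norm (deriv h z / h z))) ^ N'"
  shows "\<exists>r1. \<forall>r\<ge>r1. ln (max_mod f0 g0 r) \<le> (ln r)\<^sup>2"
proof -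
  define M where "M = max_mod f0 g0"
  have M: "growth_scale M" unfolding M_def by (rule growth_scale_max_mod[OF f0 g0])
  have M3: "M r \<ge> 3" for r using M by (auto simp: growth_scale_def)
  have mono: "r \<le> R \<Longrightarrow> M r \<le> M R" for r R using M by (auto simp: growth_scale_def)
  have ln3: "ln (3::real) > 1"
    using e_less_272 by (subst exp_less_cancel_iff[symmetric]) simp
  have \<mu>1: "ln (M r) \<ge> 1" for r
    using ln_mono[of 3 "M r"] ln3 M3[of r] by linarith
  define Q where "Q h v pp N \<longleftrightarrow> v holomorphic_on UNIV \<and>
      (\<forall>r R z. 1 \<le> r \<longrightarrow> r < R \<longrightarrow> norm z \<le> r \<longrightarrow> norm (v z) \<le> (M R * R * (R / (R - r))) ^ N) \<and>
      pp \<noteq> 0 \<and> (\<forall>z. poly pp z = 0 \<longrightarrow> z \<in> X) \<and> (\<forall>z. z \<notin> X \<longrightarrow> h z = v z / poly pp z)"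
    for h v :: "complex \<Rightarrow> complex" and pp N
  have "\<forall>h\<in>hs. \<exists>x. Q h (fst x) (fst (snd x)) (snd (snd x))"
  proof
    fix h assume "h \<in> hs"
    then obtain v pp N where "Q h v pp N"
      using hs(2)[of h] unfolding tame_def controlled_def M_def Q_def by blast
    then show "\<exists>x. Q h (fst x) (fst (snd x)) (snd (snd x))"
      by (intro exI[of _ "(v, pp, N)"]) simp
  qed
  from bchoice[OF this] obtain x where x: "\<And>h. h \<in> hs \<Longrightarrow> Q h (fst (x h)) (fst (snd (x h))) (snd (snd (x h)))"
    by blast
  define u where "u h = fst (x h)" for h
  define pp where "pp h = fst (snd (x h))" for h
  define Nh where "Nh h = snd (snd (x h))" for h
  have Qh: "Q h (u h) (pp h) (Nh h)" if "h \<in> hs" for h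
    using x[OF that] by (simp add: u_def pp_def Nh_def)
  have u: "\<And>h. h \<in> hs \<Longrightarrow> u h holomorphic_on UNIV"
     "\<And>h r R z. h \<in> hs \<Longrightarrow> 1 \<le> r \<Longrightarrow> r < R \<Longrightarrow> norm z \<le> r \<Longrightarrow> norm (u h z) \<le> (M R * R * (R / (R - r))) ^ (Nh h)"
     "\<And>h. h \<in> hs \<Longrightarrow> pp h \<noteq> 0" "\<And>h z. h \<in> hs \<Longrightarrow> poly (pp h) z = 0 \<Longrightarrow> z \<in> X"
     "\<And>h z. h \<in> hs \<Longrightarrow> z \<notin> X \<Longrightarrow> h z = u h z / poly (pp h) z"
    using Qh unfolding Q_def by blast+
  define N where "N = (\<Sum>h\<in>hs. Nh h)"
  have N: "Nh h \<le> N" if "h \<in> hs" for h unfolding N_def using that hs(1) by (intro member_le_sum) auto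
  obtain C1 where C1: "C1 \<ge> 1" "\<And>r R L. 1 \<le> r \<Longrightarrow> r < R \<Longrightarrow> 1 \<le> L \<Longrightarrow> (\<forall>v\<in>u ` hs. \<forall>z. norm z = R \<longrightarrow> norm (v z) \<le> exp L) \<Longrightarrow>
    (\<exists>t. r \<le> t \<and> t < R \<and>
      (\<forall>z::complex. \<forall>v. norm z = t \<longrightarrow> v \<in> u ` hs \<longrightarrow> v z \<noteq> 0 \<and> norm (deriv v z / v z) \<le> C1 * (L * R / (R - r)) ^ 3))"
  proof -
    have "\<And>v. v \<in> u ` hs \<Longrightarrow> v holomorphic_on UNIV \<and> (\<exists>w. v w \<noteq> 0)"
      using u(1,5) hs(3) by fastforce
    from log_deriv_bound_family[OF finite_imageI[OF hs(1)] this] show ?thesis using that by blast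
  qed
  obtain m \<psi>1 where \<psi>1: "\<psi>1 holomorphic_on UNIV" "\<psi>1 0 \<noteq> 0" "\<And>z. \<psi> z = (z - 0) ^ m * \<psi>1 z"
    using entire_factor_point[OF \<psi>, of 0] by metis
  obtain kp where kp: "\<And>z. 2 \<le> norm z \<Longrightarrow> norm (poly p z) \<le> norm z ^ kp" using poly_growth by blast
  obtain kq where kq: "\<And>z. 2 \<le> norm z \<Longrightarrow> norm (poly q z) \<le> norm z ^ kq" using poly_growth by blast
  define k where "k = kp + kq"
  have "eventually (\<lambda>z. \<forall>h\<in>hs. norm (poly (pderiv (pp h)) z / poly (pp h) z) \<le> 1) at_infinity"
    using u(3) by (intro eventually_ball_finite hs eventually_log_deriv_poly ballI)
  moreover have "eventually (\<lambda>z. z \<notin> X) at_infinity"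
    using finite_imp_bounded[OF X] unfolding bounded_pos eventually_at_infinity
    by (metis add.commute add_le_same_cancel1 dual_order.trans le_numeral_extra(4) not_one_le_zero)
  ultimately have "eventually (\<lambda>z. z \<notin> X \<and> (\<forall>h\<in>hs. norm (poly (pderiv (pp h)) z / poly (pp h) z) \<le> 1)) at_infinity"
    by eventually_elim auto
  then obtain b where b: "\<And>z. b \<le> norm z \<Longrightarrow> z \<notin> X"
     "\<And>z h. b \<le> norm z \<Longrightarrow> h \<in> hs \<Longrightarrow> norm (poly (pderiv (pp h)) z / poly (pp h) z) \<le> 1"
    unfolding eventually_at_infinity by metis
  define r0 where "r0 = max 3 b"
  define l where "l = ln (norm (\<psi>1 0))"
  define n where "n = real (card hs)"
  define C' where "C' = max 1 C"
  define D where "D = (1 + 2 * n) * C1 * (4 * (real N + 1)) ^ 3"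
  define K0 where "K0 = \<bar>ln C'\<bar> + N' * \<bar>ln D\<bar> + 3 + \<bar>l\<bar>"
  define K1 where "K1 = 15 * real N' + 2 * real k"
  have rec: "ln (M r) \<le> (9 * (K0 + 2 * K1) + 1) * (R / (R - r)) ^ 2 * (ln (ln (M R)) + ln R)"
    if r: "r0 \<le> r" "r < R" "R \<le> 2 * r" for r R
  proof -
    \<comment> \<open>Of four steps of equal width, two separate the circle from \<open>r\<close>, one is for its choice, and one is for reading the growth of the \<open>u h\<close> from \<open>M R\<close>.\<close>
    define d where "d = (R - r) / 4"
    define E where "E = R / (R - r)"
    define r2 where "r2 = r + 2 * d"
    define r3 where "r3 = r + 3 * d"
    have r3': "r \<ge> 3" "r \<ge> b" using r by (auto simp: r0_def)
    have d: "d > 0" using r by (simp add: d_def)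
    have R4: "R = r + 4 * d" unfolding d_def by argo
    have Rr: "R - r = 4 * d" using R4 by linarith
    have Ed: "E = R / (4 * d)" by (simp add: E_def Rr)
    have E2: "E \<ge> 1" using r r3' by (simp add: E_def field_simps)
    define Y where "Y = M R * R * (4 * E)"
    have Yeq: "M R * R * (R / (R - r3)) = Y"
    proof -
      have "R - r3 = d" using R4 by (simp add: r3_def)
      moreover have "4 * E = R / d" using d by (simp add: Ed)
      ultimately show ?thesis by (simp only: Y_def)
    qed
    have RR: "R > 3" using r r3' by simp
    have lnR: "ln R \<ge> 1" using ln_mono[of 3 R] ln3 RR by linarith
    have Y1: "Y \<ge> 3"
    proof -
      have "3 * 1 \<le> M R * R" using M3[of R] RR by (intro mult_mono) auto
      then have "(3 * 1) * 1 \<le> (M R * R) * (4 * E)" using E2 by (intro mult_mono[of "3 * 1" "M R * R"]) auto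
      then show ?thesis by (simp add: Y_def)
    qed
    \<comment> \<open>The functions \<open>u h\<close> are bounded by \<open>exp ((N + 1) T)\<close>, where \<open>T\<close> is \<open>log M(R)\<close> up to logarithmic terms.\<close>
    define T where "T = ln Y"
    have T1: "T \<ge> 1" using ln_mono[of 3 Y] ln3 Y1 unfolding T_def by linarith
    define \<mu> where "\<mu> = ln (M R)"
    have \<mu>: "\<mu> \<ge> 1" using \<mu>1 by (simp add: \<mu>_def)
    have MR: "M R > 0" using M3[of R] by linarith
    have Teq: "T = \<mu> + ln R + ln (4 * E)"
      using MR RR E2 by (simp add: T_def Y_def \<mu>_def ln_mult)
    have ln4E: "0 \<le> ln (4 * E)" "ln (4 * E) \<le> 4 * E" using E2 ln_le_minus_one[of "4 * E"] by auto
    \<comment> \<open>This is where the second logarithm of \<open>M R\<close> comes from.\<close>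
    have lnT: "ln T \<le> ln \<mu> + ln R + 4 * E"
    proof -
      have "1 * (ln R + ln (4 * E)) \<le> \<mu> * (ln R + ln (4 * E))"
        using \<mu> lnR ln4E by (intro mult_right_mono) auto
      then have "T \<le> \<mu> * (1 + (ln R + ln (4 * E)))" unfolding Teq by (simp add: algebra_simps)
      then have "ln T \<le> ln (\<mu> * (1 + (ln R + ln (4 * E))))" using T1 by (intro ln_mono) auto
      also have "\<dots> = ln \<mu> + ln (1 + (ln R + ln (4 * E)))" using \<mu> lnR ln4E by (subst ln_mult) auto
      also have "ln (1 + (ln R + ln (4 * E))) \<le> ln R + ln (4 * E)"
        using lnR ln4E by (intro ln_add_one_self_le_self) auto
      finally show ?thesis using ln4E by linarith
    qed
    define L where "L = (real N + 1) * T"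
    have L1: "L \<ge> 1" using mult_mono[of 1 "real N + 1" 1 T] T1 by (simp add: L_def)
    have "\<exists>t\<ge>r2. t < r3 \<and> (\<forall>z::complex. \<forall>v. norm z = t \<longrightarrow> v \<in> u ` hs \<longrightarrow> v z \<noteq> 0 \<and> norm (deriv v z / v z) \<le> C1 * (L * r3 / (r3 - r2)) ^ 3)"
    proof (rule C1(2)[of r2 r3 L])
      show "1 \<le> r2" "r2 < r3" "1 \<le> L" using r3' d L1 by (auto simp: r2_def r3_def)
      show "\<forall>v\<in>u ` hs. \<forall>z. norm z = r3 \<longrightarrow> norm (v z) \<le> exp L"
      proof (intro ballI allI impI)
        fix v and z :: complex assume "v \<in> u ` hs" and z: "norm z = r3"
        then obtain h where h: "h \<in> hs" and v: "v = u h" by blast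
        have "norm (u h z) \<le> (M R * R * (R / (R - r3))) ^ (Nh h)"
          using z d r3' by (intro u(2)[OF h]) (auto simp: r3_def R4)
        also have "\<dots> = Y ^ Nh h" using Yeq by simp
        also have "\<dots> \<le> Y ^ (N + 1)" using N[OF h] Y1 by (intro power_increasing) auto
        also have "\<dots> = exp L"
        proof -
          have "Y = exp T" using Y1 by (simp add: T_def)
          then show ?thesis by (simp only: exp_of_nat_mult[symmetric] L_def of_nat_add of_nat_1)
        qed
        finally show "norm (v z) \<le> exp L" unfolding v .
      qed
    qed
    then obtain t where t: "r2 \<le> t" "t < r3"
      "\<And>z h. norm z = t \<Longrightarrow> h \<in> hs \<Longrightarrow> u h z \<noteq> 0 \<and> norm (deriv (u h) z / u h z) \<le> C1 * (L * r3 / (r3 - r2)) ^ 3"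
      by blast
    define \<Lambda> where "\<Lambda> = C1 * (L * (4 * E)) ^ 3"
    have r3E: "L * r3 / (r3 - r2) \<le> L * (4 * E)"
    proof -
      have "r3 / (r3 - r2) = r3 / d" by (simp add: r3_def r2_def)
      also have "\<dots> \<le> R / d" using d by (intro divide_right_mono) (auto simp: r3_def R4)
      also have "R / d = 4 * E" using d by (simp add: Ed)
      finally have "r3 / (r3 - r2) \<le> 4 * E" .
      then have "L * (r3 / (r3 - r2)) \<le> L * (4 * E)" using L1 by (intro mult_left_mono) auto
      then show ?thesis by simp
    qed
    have t2: "t \<ge> 2" "t \<ge> b" "t \<le> R" "t > 0" "t \<ge> 1" "t > r" using t r3' d by (auto simp: r2_def r3_def R4)
    have logd: "h z \<noteq> 0 \<and> norm (deriv h z / h z) \<le> \<Lambda> + 1" if z: "norm z = t" and h: "h \<in> hs" for z h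
    proof -
      have zX: "z \<notin> X" using b(1) t2 z by simp
      have uz: "u h z \<noteq> 0" "norm (deriv (u h) z / u h z) \<le> \<Lambda>"
      proof -
        show "u h z \<noteq> 0" using t(3)[OF z h] by simp
        have "C1 * (L * r3 / (r3 - r2)) ^ 3 \<le> \<Lambda>"
          unfolding \<Lambda>_def using r3E C1 L1 r3' d by (intro mult_left_mono power_mono) (auto simp: r3_def r2_def)
        then show "norm (deriv (u h) z / u h z) \<le> \<Lambda>" using t(3)[OF z h] by linarith
      qed
      have pz: "poly (pp h) z \<noteq> 0" using u(4)[OF h] zX by blast
      have "(u h has_field_derivative deriv (u h) z) (at z)"
        using u(1)[OF h] by (meson holomorphic_derivI open_UNIV UNIV_I)
      then have "((\<lambda>z. u h z / poly (pp h) z) has_field_derivative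
          (deriv (u h) z * poly (pp h) z - u h z * poly (pderiv (pp h)) z) / (poly (pp h) z * poly (pp h) z)) (at z)"
        using pz by (auto intro!: derivative_eq_intros simp: poly_DERIV)
      then have "(h has_field_derivative (deriv (u h) z * poly (pp h) z - u h z * poly (pderiv (pp h)) z) / (poly (pp h) z * poly (pp h) z)) (at z)"
      proof (rule has_field_derivative_transform_within_open)
        show "open (- X)" using X by (simp add: finite_imp_closed open_Compl)
      qed (use zX u(5)[OF h] in auto)
      then have "deriv h z / h z = deriv (u h) z / u h z - poly (pderiv (pp h)) z / poly (pp h) z"
        using pz uz(1) u(5)[OF h zX] by (simp add: DERIV_imp_deriv field_simps)
      then have "norm (deriv h z / h z) \<le> \<Lambda> + 1"
        using norm_triangle_ineq4[of "deriv (u h) z / u h z" "poly (pderiv (pp h)) z / poly (pp h) z"] uz(2) b(2)[of z h] h t2 z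
        by simp
      then show ?thesis using u(5)[OF h zX] uz(1) pz by simp
    qed
    define W where "W = C' * (1 + n * (\<Lambda> + 1)) ^ N'"
    define A where "A = ln W + 2 * k * ln R"
    have C'1: "C' \<ge> 1" "C \<le> C'" by (auto simp: C'_def)
    have n0: "n \<ge> 0" by (simp add: n_def)
    have LE1: "L * (4 * E) \<ge> 1" using mult_mono[of 1 L 1 "4 * E"] L1 E2 by simp
    have \<Lambda>1: "\<Lambda> \<ge> 1" using mult_mono[of 1 C1 1 "(L * (4 * E)) ^ 3"] C1(1) LE1 by (simp add: \<Lambda>_def one_le_power)
    have base1: "1 + n * (\<Lambda> + 1) \<ge> 1" using n0 \<Lambda>1 by simp
    have W1: "W \<ge> 1" unfolding W_def using mult_mono[of 1 C' 1 "(1 + n * (\<Lambda> + 1)) ^ N'"] C'1 base1 by (simp add: one_le_power)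
    have expA: "exp A = W * R ^ (2 * k)"
    proof -
      have "exp (real (2 * k) * ln R) = R ^ (2 * k)" using RR by (subst exp_of_nat_mult) simp
      then show ?thesis using W1 by (simp add: A_def exp_add)
    qed
    \<comment> \<open>\<open>\<psi>1\<close> is \<open>\<psi>\<close> without its zero at the origin, as the quotient bound needs a value at 0.\<close>
    have key: "norm (\<psi>1 z) * (1 + norm (f z) + norm (g z)) \<le> W * norm (poly q z)" if z: "norm z = t" for z
    proof -
      have zX: "z \<notin> X" using b(1) t2 z by simp
      have "norm (\<psi> z / poly q z) * (1 + norm (f z) + norm (g z)) \<le> C * (1 + (\<Sum>h\<in>hs. norm (deriv h z / h z))) ^ N'"
        using bound[OF zX] logd[OF z] by blast
      also have "\<dots> \<le> C' * (1 + n * (\<Lambda> + 1)) ^ N'"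
      proof (rule mult_mono[OF C'1(2) power_mono])
        have "(\<Sum>h\<in>hs. norm (deriv h z / h z)) \<le> (\<Sum>h\<in>hs. \<Lambda> + 1)" using logd[OF z] by (intro sum_mono) auto
        then show "1 + (\<Sum>h\<in>hs. norm (deriv h z / h z)) \<le> 1 + n * (\<Lambda> + 1)" by (simp add: n_def)
        have "0 \<le> (\<Sum>h\<in>hs. norm (deriv h z / h z))" by (intro sum_nonneg) auto
        then show "0 \<le> 1 + (\<Sum>h\<in>hs. norm (deriv h z / h z))" "0 \<le> (1 + (\<Sum>h\<in>hs. norm (deriv h z / h z))) ^ N'" by auto
      qed (use C'1 in auto)
      finally have "norm (\<psi> z / poly q z) * (1 + norm (f z) + norm (g z)) \<le> W" by (simp add: W_def)
      moreover have "poly q z \<noteq> 0" using q zX by blast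
      ultimately have "norm (\<psi> z) * (1 + norm (f z) + norm (g z)) \<le> W * norm (poly q z)"
        by (simp add: norm_divide field_simps)
      moreover have "norm (\<psi>1 z) \<le> norm (\<psi> z)"
        using mult_right_mono[of 1 "norm z ^ m" "norm (\<psi>1 z)"] t2 z by (simp add: \<psi>1 norm_mult norm_power one_le_power)
      then have "norm (\<psi>1 z) * (1 + norm (f z) + norm (g z)) \<le> norm (\<psi> z) * (1 + norm (f z) + norm (g z))"
        by (intro mult_right_mono) auto
      ultimately show ?thesis by linarith
    qed
    have qp: "norm (poly q z) \<le> R ^ (2 * k)" "norm (poly p z) * norm (poly q z) \<le> R ^ (2 * k)" if z: "norm z = t" for z
    proof -
      have "norm (poly p z) \<le> R ^ kp" using kp[of z] z t2 power_mono[of t R kp] by force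
      moreover have q': "norm (poly q z) \<le> R ^ kq" using kq[of z] z t2 power_mono[of t R kq] by force
      ultimately have "norm (poly p z) * norm (poly q z) \<le> R ^ kp * R ^ kq"
        using RR by (intro mult_mono) auto
      also have "\<dots> \<le> R ^ (2 * k)" unfolding power_add[symmetric] using RR by (intro power_increasing) (auto simp: k_def)
      finally show "norm (poly p z) * norm (poly q z) \<le> R ^ (2 * k)" .
      have "R ^ kq \<le> R ^ (2 * k)" using RR by (intro power_increasing) (auto simp: k_def)
      then show "norm (poly q z) \<le> R ^ (2 * k)" using q' by linarith
    qed
    have \<psi>A: "norm (\<psi>1 z) \<le> exp A" if z: "norm z = t" for z
    proof -
      have "norm (\<psi>1 z) * 1 \<le> norm (\<psi>1 z) * (1 + norm (f z) + norm (g z))" by (intro mult_left_mono) auto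
      also have "\<dots> \<le> W * norm (poly q z)" by (rule key[OF z])
      also have "\<dots> \<le> W * R ^ (2 * k)" using qp(1)[OF z] W1 by (intro mult_left_mono) auto
      finally show ?thesis by (simp add: expA)
    qed
    have FA: "norm (F z * \<psi>1 z) \<le> exp A" if z: "norm z = t" and F: "norm (F z) \<le> (1 + norm (f z) + norm (g z)) * norm (poly p z)" for z and F :: "complex \<Rightarrow> complex"
    proof -
      have "norm (F z * \<psi>1 z) \<le> (1 + norm (f z) + norm (g z)) * norm (poly p z) * norm (\<psi>1 z)"
        unfolding norm_mult using F by (intro mult_right_mono) auto
      also have "\<dots> = (norm (\<psi>1 z) * (1 + norm (f z) + norm (g z))) * norm (poly p z)" by (simp add: mult_ac)
      also have "\<dots> \<le> (W * norm (poly q z)) * norm (poly p z)" using key[OF z] by (intro mult_right_mono) auto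
      also have "\<dots> = W * (norm (poly p z) * norm (poly q z))" by (simp add: mult_ac)
      also have "\<dots> \<le> W * R ^ (2 * k)" using qp(2)[OF z] W1 by (intro mult_left_mono) auto
      finally show ?thesis by (simp add: expA)
    qed
    have fg: "norm (f0 z) \<le> (1 + norm (f z) + norm (g z)) * norm (poly p z)"
             "norm (g0 z) \<le> (1 + norm (f z) + norm (g z)) * norm (poly p z)" if z: "norm z = t" for z
    proof -
      have zX: "z \<notin> X" using b(1) t2 z by simp
      then have pz: "poly p z \<noteq> 0" using p(2) by blast
      have "norm (f0 z) = norm (f z) * norm (poly p z)" using f[OF zX] pz by (simp add: norm_divide)
      also have "\<dots> \<le> (1 + norm (f z) + norm (g z)) * norm (poly p z)" by (intro mult_right_mono) auto
      finally show "norm (f0 z) \<le> (1 + norm (f z) + norm (g z)) * norm (poly p z)" .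
      have "norm (g0 z) = norm (g z) * norm (poly p z)" using g[OF zX] pz by (simp add: norm_divide)
      also have "\<dots> \<le> (1 + norm (f z) + norm (g z)) * norm (poly p z)" by (intro mult_right_mono) auto
      finally show "norm (g0 z) \<le> (1 + norm (f z) + norm (g z)) * norm (poly p z)" .
    qed
    define Z where "Z = (8 * E + 1) * (A + 1 + \<bar>l\<bar>)"
    have A0: "A \<ge> 0" using W1 lnR by (simp add: A_def)
    have Z0: "Z \<ge> 0" using A0 E2 by (simp add: Z_def)
    have Fb: "norm (F z) \<le> exp Z" if z: "norm z \<le> r" and F: "F holomorphic_on UNIV" "\<And>z. norm z = t \<Longrightarrow> norm (F z * \<psi>1 z) \<le> exp A" for z F
    proof -
      have "norm (F z) \<le> exp (A - ln (norm (\<psi>1 0)) + 4 * r / (t - r) * (A + 1 - ln (norm (\<psi>1 0))))"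
        by (rule quotient_bound[OF \<psi>1(1) F(1) \<psi>1(2) _ _ \<psi>A F(2) z]) (use r3' t2 in auto)
      also have "\<dots> \<le> exp Z"
      proof -
        have "4 * r / (t - r) \<le> 8 * E"
        proof -
          have "4 * r / (t - r) \<le> 4 * R / (2 * d)" using t2 t(1) r r3' d by (intro frac_le) (auto simp: r2_def)
          also have "\<dots> = 8 * E" by (simp add: Ed)
          finally show ?thesis .
        qed
        then have "4 * r / (t - r) * (A + 1 - ln (norm (\<psi>1 0))) \<le> 8 * E * (A + 1 + \<bar>l\<bar>)"
          using A0 E2 t2 r3' by (intro order.trans[OF mult_left_mono mult_right_mono]) (auto simp: l_def)
        moreover have "A - ln (norm (\<psi>1 0)) \<le> 1 * (A + 1 + \<bar>l\<bar>)" by (simp add: l_def)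
        ultimately show ?thesis by (simp add: Z_def algebra_simps)
      qed
      finally show ?thesis .
    qed
    have "M r \<le> 3 + 2 * exp Z"
      unfolding M_def
    proof (rule max_mod_least[OF f0 g0])
      fix z :: complex assume z: "norm z \<le> r"
      have "norm (f0 z) \<le> exp Z" by (rule Fb[OF z f0]) (use FA fg in blast)
      moreover have "norm (g0 z) \<le> exp Z" by (rule Fb[OF z g0]) (use FA fg in blast)
      ultimately show "norm (f0 z) + norm (g0 z) \<le> 2 * exp Z" by simp
    qed (use r3' in simp)
    also have "\<dots> \<le> 5 * exp Z" using Z0 by simp
    also have "\<dots> \<le> exp 2 * exp Z" using exp_lower_Taylor_quadratic[of 2] by (intro mult_right_mono) auto
    finally have "ln (M r) \<le> 2 + Z" using M3[of r] by (subst exp_le_cancel_iff[symmetric]) (simp add: exp_add)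
    also have "\<dots> \<le> 9 * E * (A + 3 + \<bar>l\<bar>)"
    proof -
      have "1 * (A + 3 + \<bar>l\<bar>) \<le> E * (A + 3 + \<bar>l\<bar>)" using E2 A0 by (intro mult_right_mono) auto
      moreover have "8 * E * (A + 1 + \<bar>l\<bar>) \<le> 8 * E * (A + 3 + \<bar>l\<bar>)" using E2 by (intro mult_left_mono) auto
      ultimately show ?thesis by (simp add: Z_def algebra_simps)
    qed
    also have "9 * E * (A + 3 + \<bar>l\<bar>) \<le> 9 * E * (K0 + K1 * (ln \<mu> + ln R + E))"
    proof (rule mult_left_mono)
      have "1 + n * (\<Lambda> + 1) \<le> D * (T * E) ^ 3"
      proof -
        have "1 + n * (\<Lambda> + 1) \<le> \<Lambda> + n * (\<Lambda> + \<Lambda>)" using \<Lambda>1 n0 by (intro add_mono mult_left_mono) auto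
        also have "\<dots> = D * (T * E) ^ 3" by (simp only: \<Lambda>_def D_def L_def power_mult_distrib) (simp add: algebra_simps)
        finally show ?thesis .
      qed
      moreover have D0: "D > 0" using n0 C1(1) by (auto simp: D_def intro!: mult_pos_pos)
      ultimately have "ln (1 + n * (\<Lambda> + 1)) \<le> ln (D * (T * E) ^ 3)" using base1 by (intro ln_mono) auto
      also have "\<dots> = ln D + 3 * (ln T + ln E)"
        using D0 T1 E2 by (simp add: ln_mult ln_realpow)
      also have "\<dots> \<le> \<bar>ln D\<bar> + 15 * (ln \<mu> + ln R + E)"
      proof -
        have "ln E \<le> E" using ln_le_minus_one[of E] E2 by linarith
        moreover have "ln \<mu> \<ge> 0" using \<mu> by simp
        moreover have "3 * (ln \<mu> + ln R + 4 * E + E) \<le> 15 * (ln \<mu> + ln R + E)"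
          using calculation lnR by simp
        ultimately show ?thesis using lnT by argo
      qed
      finally have "N' * ln (1 + n * (\<Lambda> + 1)) \<le> N' * (\<bar>ln D\<bar> + 15 * (ln \<mu> + ln R + E))"
        by (intro mult_left_mono) auto
      moreover have "ln W = ln C' + N' * ln (1 + n * (\<Lambda> + 1))"
        using C'1 base1 by (simp add: W_def ln_mult ln_realpow)
      moreover have "2 * real k * ln R \<le> 2 * real k * (ln \<mu> + ln R + E)"
        using \<mu> E2 by (intro mult_left_mono) auto
      ultimately show "A + 3 + \<bar>l\<bar> \<le> K0 + K1 * (ln \<mu> + ln R + E)" by (simp add: A_def K0_def K1_def algebra_simps)
    qed (use E2 in simp)
    also have "9 * E * (K0 + K1 * (ln \<mu> + ln R + E)) \<le> (9 * (K0 + 2 * K1) + 1) * E ^ 2 * (ln \<mu> + ln R)"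
    proof -
      define S where "S = ln \<mu> + ln R"
      have S: "S \<ge> 1" using \<mu> lnR ln_ge_zero[of \<mu>] unfolding S_def by linarith
      have ES: "E * S \<ge> 1" "E * S \<ge> S" "E * S \<ge> E" using mult_mono[of 1 E 1 S] mult_mono[of 1 E S S] mult_mono[of E E 1 S] E2 S by auto
      have K: "K0 \<ge> 0" "K1 \<ge> 0" by (auto simp: K0_def K1_def)
      have "K0 * 1 \<le> K0 * (E * S)" using K ES by (intro mult_left_mono) auto
      moreover have "K1 * (S + E) \<le> K1 * (2 * (E * S))" using K ES by (intro mult_left_mono) auto
      ultimately have "K0 + K1 * (S + E) \<le> (K0 + 2 * K1) * (E * S)" by (simp add: algebra_simps)
      then have "9 * E * (K0 + K1 * (S + E)) \<le> 9 * E * ((K0 + 2 * K1) * (E * S))" using E2 by (intro mult_left_mono) auto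
      also have "\<dots> \<le> (9 * (K0 + 2 * K1) + 1) * E ^ 2 * S" using S E2 by (simp add: power2_eq_square algebra_simps)
      finally show ?thesis by (simp add: S_def)
    qed
    finally show ?thesis by (simp add: E_def \<mu>_def)
  qed
  have "K0 \<ge> 0" "K1 \<ge> 0" by (auto simp: K0_def K1_def)
  then have K: "9 * (K0 + 2 * K1) + 1 > 0" by (intro add_nonneg_pos) auto
  have "\<exists>r1. \<forall>r\<ge>r1. ln (M r) \<le> (ln r)\<^sup>2"
  proof (rule growth_dichotomy[where K="9 * (K0 + 2 * K1) + 1" and k=2, OF _ \<mu>1 K rec])
    fix r R :: real assume "r \<le> R"
    then show "ln (M r) \<le> ln (M R)" using mono M3[of r] by (intro ln_mono) auto
  qed
  then show ?thesis by (simp add: M_def)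
qed

section \<open>Poisson's inequality and the order of growth\<close>

lemma log_plus_nonneg [simp]: "0 \<le> log_plus x"
  by (simp add: log_plus_def)

lemma ln_le_log_plus: "ln x \<le> log_plus x"
  by (simp add: log_plus_def)

lemma norm_prod_roots_le_reflected_product:
  assumes b: "\<And>b. b \<in> set bs \<Longrightarrow> norm b < R" and R: "R > 0" and z: "norm z \<le> R"
  shows "norm (\<Prod>b\<leftarrow>bs. z - b) \<le> norm (reflected_product R bs z)"
proof -
  define Q where "Q w = (\<Prod>b\<leftarrow>bs. w - b) / reflected_product R bs w" for w
  have nz: "reflected_product R bs w \<noteq> 0" if "norm w \<le> R" for w
    using reflected_product_nonzero[OF b that R] .
  have hol: "(\<lambda>w. \<Prod>b\<leftarrow>bs. w - b) holomorphic_on S" for S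
    by (induction bs) (auto intro!: holomorphic_intros)
  have Q: "Q holomorphic_on cball 0 R"
    unfolding Q_def using nz by (intro holomorphic_intros hol) auto
  have "norm (Q z) \<le> 1"
  proof (rule maximum_modulus_frontier[of Q "cball 0 R"])
    show "Q holomorphic_on interior (cball 0 R)"
      using Q by (rule holomorphic_on_subset) auto
    show "continuous_on (closure (cball 0 R)) Q"
      using Q by (simp add: holomorphic_on_imp_continuous_on)
    show "norm (Q w) \<le> 1" if "w \<in> frontier (cball 0 R)" for w
    proof -
      have w: "norm w = R" using that R by (simp add: frontier_cball)
      show ?thesis using norm_reflected_product_sphere[OF w R, of bs] nz[of w] w
        by (simp add: Q_def norm_divide)
    qed
  qed (use z in auto)
  then show ?thesis using nz[OF z] by (simp add: Q_def norm_divide field_simps)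
qed

lemma poisson_formula:
  assumes R: "0 < R" "R < R'" and G: "G holomorphic_on ball 0 R'" and z: "norm z < R"
  shows "((\<lambda>\<theta>. Re (G (of_real R * cis \<theta>)) * ((R\<^sup>2 - (norm z)\<^sup>2) / (norm (of_real R * cis \<theta> - z))\<^sup>2))
           has_integral 2 * pi * Re (G z)) {0..2 * pi}"
proof -
  define c where "c = (of_real (R\<^sup>2 - (norm z)\<^sup>2) :: complex)"
  define F where "F w = G w * (c / (of_real (R\<^sup>2) - cnj z * w))" for w
  have nz: "of_real (R\<^sup>2) - cnj z * w \<noteq> 0" if "norm w \<le> R" for w
    using reflected_product_nonzero[of "[z]" R w] z R that by (auto simp: reflected_product_def)
  have F: "F holomorphic_on cball 0 R"
    unfolding F_def using nz R by (intro holomorphic_intros holomorphic_on_subset[OF G]) auto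
  have cz: "c = of_real (R\<^sup>2) - cnj z * z"
    unfolding c_def of_real_diff complex_norm_square by (simp only: mult.commute)
  have Fz: "F z = G z" using nz[of z] z by (simp add: F_def cz)
  have "((\<lambda>u. F u / (u - z)) has_contour_integral (2 * of_real pi * \<i> * F z)) (circlepath 0 R)"
    using z by (intro Cauchy_integral_circlepath_simple[OF F]) auto
  then have "((\<lambda>u. F u / (u - z)) has_contour_integral (2 * of_real pi * \<i> * G z)) (part_circlepath 0 R 0 (2 * pi))"
    by (simp add: circlepath_def Fz)
  then have "((\<lambda>t. F (of_real R * cis t) / (of_real R * cis t - z) * of_real R * \<i> * cis t) has_integral (2 * of_real pi * \<i> * G z)) {0..2 * pi}"
    by (subst (asm) has_contour_integral_part_circlepath_iff) auto
  from has_integral_mult_right[OF this, of "- \<i>"]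
  have "((\<lambda>t. - \<i> * (F (of_real R * cis t) / (of_real R * cis t - z) * of_real R * \<i> * cis t)) has_integral (2 * of_real pi * G z)) {0..2 * pi}"
    by (simp add: algebra_simps)
  moreover have "- \<i> * (F (of_real R * cis t) / (of_real R * cis t - z) * of_real R * \<i> * cis t) =
      G (of_real R * cis t) * of_real ((R\<^sup>2 - (norm z)\<^sup>2) / (norm (of_real R * cis t - z))\<^sup>2)" for t
  proof -
    define w where "w = of_real R * cis t"
    have nw: "norm w = R" using R by (simp add: w_def norm_mult)
    have wz: "w - z \<noteq> 0" using nw z by auto
    have w0: "w \<noteq> 0" using nw R by auto
    have "of_real (R\<^sup>2) = w * cnj w" unfolding nw[symmetric] by (rule complex_norm_square)
    then have e1: "of_real (R\<^sup>2) - cnj z * w = w * cnj (w - z)" by (simp add: algebra_simps)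
    have e2: "of_real ((norm (w - z))\<^sup>2) = (w - z) * cnj (w - z)" by (rule complex_norm_square)
    have cw: "cnj (w - z) \<noteq> 0" using wz by (metis complex_cnj_zero_iff)
    have gen1: "- \<i> * (x * of_real R * \<i> * y) = x * (of_real R * y)" for x y by (simp add: algebra_simps)
    have gen2: "a * (b / (x * v)) / d * x = a * b / (d * v)" if "x \<noteq> 0" "v \<noteq> 0" "d \<noteq> 0" for a b x v d :: complex
      using that by (simp add: field_simps)
    have "- \<i> * (F w / (w - z) * of_real R * \<i> * cis t) = F w / (w - z) * w"
      unfolding gen1 w_def ..
    also have "\<dots> = G w * c / ((w - z) * cnj (w - z))"
      unfolding F_def e1 using w0 cw wz by (rule gen2)
    also have "\<dots> = G w * of_real ((R\<^sup>2 - (norm z)\<^sup>2) / (norm (w - z))\<^sup>2)"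
      unfolding of_real_divide e2 c_def[symmetric] by simp
    finally show ?thesis unfolding w_def .
  qed
  ultimately have "((\<lambda>t. G (of_real R * cis t) * of_real ((R\<^sup>2 - (norm z)\<^sup>2) / (norm (of_real R * cis t - z))\<^sup>2)) has_integral (2 * of_real pi * G z)) {0..2 * pi}"
    by simp
  from has_integral_Re[OF this] show ?thesis by simp
qed

lemma poisson_kernel_bound:
  assumes "norm (z::complex) \<le> r" "r < R" "norm w = R"
  shows "0 \<le> (R\<^sup>2 - (norm z)\<^sup>2) / (norm (w - z))\<^sup>2" "(R\<^sup>2 - (norm z)\<^sup>2) / (norm (w - z))\<^sup>2 \<le> (R + r) / (R - r)"
proof -
  have R: "0 < R" "norm z < R" using assms norm_ge_zero[of z] by linarith+
  have a: "R - norm z \<le> norm (w - z)" using norm_triangle_ineq2[of w z] assms by simp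
  have sq: "R\<^sup>2 - (norm z)\<^sup>2 = (R + norm z) * (R - norm z)" by (simp add: power2_eq_square algebra_simps)
  show "0 \<le> (R\<^sup>2 - (norm z)\<^sup>2) / (norm (w - z))\<^sup>2" unfolding sq using R by simp
  have "(R\<^sup>2 - (norm z)\<^sup>2) / (norm (w - z))\<^sup>2 \<le> (R\<^sup>2 - (norm z)\<^sup>2) / (R - norm z)\<^sup>2"
    unfolding sq using R a by (intro divide_left_mono power_mono mult_pos_pos zero_less_power) auto
  also have "\<dots> = (R + norm z) / (R - norm z)" unfolding sq using R by (simp add: power2_eq_square)
  also have "\<dots> \<le> (R + r) / (R - r)" using R assms norm_ge_zero[of z] by (intro frac_le) linarith+
  finally show "(R\<^sup>2 - (norm z)\<^sup>2) / (norm (w - z))\<^sup>2 \<le> (R + r) / (R - r)" .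
qed

text \<open>
  The one link from the characteristic back to pointwise growth. With all zeros in \<open>\<bar>z\<bar> < R\<close> reflected,
  \<open>log \<bar>g\<bar>\<close> is harmonic near the closed disc, dominates \<open>log \<bar>F\<bar>\<close> inside and equals it on the circle, so
  Poisson's formula and the bound for the kernel give the estimate.
\<close>
lemma poisson_inequality:
  assumes F: "F holomorphic_on UNIV" and R: "0 \<le> r" "r < R" and nz: "\<And>w. norm w = R \<Longrightarrow> F w \<noteq> 0"
    and z: "norm z \<le> r" and Fz: "F z \<noteq> 0"
  shows "ln (norm (F z)) \<le> (R + r) / (R - r) * proximity F R"
proof -
  obtain bs h where bh: "\<And>b. b \<in> set bs \<Longrightarrow> norm b \<le> R \<and> F b = 0" "h holomorphic_on UNIV"
    "\<And>z. norm z \<le> R \<Longrightarrow> h z \<noteq> 0" "\<And>z. F z = (\<Prod>b\<leftarrow>bs. z - b) * h z"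
    using entire_factor_cball[OF F Fz, of R] by metis
  have R0: "R > 0" using R by simp
  have b: "norm b < R" if "b \<in> set bs" for b
    using bh(1)[OF that] nz[of b] by fastforce
  define g where "g w = h w * reflected_product R bs w" for w
  have g: "g holomorphic_on UNIV" unfolding g_def by (intro holomorphic_intros bh)
  have gn: "g w \<noteq> 0" if "norm w \<le> R" for w
    using bh(3)[OF that] reflected_product_nonzero[of bs R, OF b that R0] by (simp add: g_def)
  have gR: "norm (g w) = norm (F w)" if "norm w = R" for w
    using norm_reflected_product_sphere[OF that R0, of bs] unfolding g_def bh(4) by (simp add: norm_mult)
  have Fg: "norm (F z) \<le> norm (g z)"
    using norm_prod_roots_le_reflected_product[of bs R z, OF b R0] z R unfolding g_def bh(4)
    by (simp add: norm_mult mult.commute[of _ "cmod (h z)"] mult_left_mono)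
  have "open {w. g w \<noteq> 0}"
    by (intro open_Collect_neq continuous_intros holomorphic_on_imp_continuous_on[OF g])
  moreover have "cball 0 R \<subseteq> {w. g w \<noteq> 0}" using gn by auto
  ultimately obtain e where e: "e > 0" "(\<Union>x\<in>cball 0 R. ball x e) \<subseteq> {w. g w \<noteq> 0}"
    using compact_subset_open_imp_ball_epsilon_subset[OF compact_cball] by metis
  \<comment> \<open>A logarithm of \<open>g\<close> is needed on a neighbourhood of the closed disc, for the mean value in Poisson's formula to be taken over \<open>\<bar>z\<bar> = R\<close> itself.\<close>
  have gn': "g w \<noteq> 0" if "w \<in> ball 0 (R + e)" for w
  proof (cases "norm w \<le> R")
    case False
    define x where "x = of_real (R / norm w) * w"
    have nw: "norm w > 0" using False R0 by linarith
    have "norm x = R" using nw R0 by (simp add: x_def norm_mult norm_divide)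
    moreover have "dist x w < e"
    proof -
      have "x - w = of_real (R / norm w - 1) * w" by (simp add: x_def algebra_simps)
      then have "dist x w = \<bar>R / norm w - 1\<bar> * norm w" by (simp only: dist_norm norm_mult norm_of_real)
      also have "\<dots> = norm w - R" using False nw R0 by (simp add: abs_if field_simps)
      finally show ?thesis using that by simp
    qed
    ultimately have "w \<in> (\<Union>x\<in>cball 0 R. ball x e)" by (intro UN_I[of x]) auto
    then show ?thesis using e(2) by blast
  qed (use gn in auto)
  have g': "g holomorphic_on ball 0 (R + e)" and c0: "0 \<in> ball (0::complex) (R + e)"
    using holomorphic_on_subset[OF g] R0 e(1) by auto
  obtain G where G: "G holomorphic_on ball 0 (R + e)" "\<And>z. z \<in> ball 0 (R + e) \<Longrightarrow> exp (G z) = g z"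
    using holomorphic_logarithm_exists[of "ball 0 (R + e)" g 0, OF convex_ball open_ball g' gn' c0] by blast
  have ReG: "Re (G w) = ln (norm (g w))" if "norm w \<le> R" for w
  proof -
    have "norm (g w) = exp (Re (G w))" using G(2)[of w] that e norm_exp_eq_Re[of "G w"] by simp
    then show ?thesis by simp
  qed
  define K where "K \<theta> = (R\<^sup>2 - (norm z)\<^sup>2) / (norm (of_real R * cis \<theta> - z))\<^sup>2" for \<theta>
  have nR: "norm (of_real R * cis \<theta>) = R" for \<theta> using R0 by (simp add: norm_mult)
  have P: "((\<lambda>\<theta>. Re (G (of_real R * cis \<theta>)) * K \<theta>) has_integral 2 * pi * Re (G z)) {0..2 * pi}"
    unfolding K_def by (rule poisson_formula[OF R0 _ G(1)]) (use e z R in auto)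
  have "continuous_on {0..2*pi} (\<lambda>\<theta>. log_plus (cmod (F (of_real R * cis \<theta>))))"
    unfolding log_plus_def
    by (intro continuous_intros continuous_on_compose2[OF holomorphic_on_imp_continuous_on[OF F]] continuous_on_ln)
       (use nz nR in auto)
  then have int: "((\<lambda>\<theta>. log_plus (cmod (F (of_real R * cis \<theta>)))) has_integral integral {0..2*pi} (\<lambda>\<theta>. log_plus (cmod (F (of_real R * cis \<theta>))))) {0..2*pi}"
    by (intro integrable_integral integrable_continuous_real)
  have "2 * pi * Re (G z) \<le> integral {0..2*pi} (\<lambda>\<theta>. log_plus (cmod (F (of_real R * cis \<theta>)))) * ((R + r) / (R - r))"
  proof (rule has_integral_le[OF P has_integral_mult_left[OF int]])
    fix \<theta> :: real
    have "Re (G (of_real R * cis \<theta>)) \<le> log_plus (cmod (F (of_real R * cis \<theta>)))"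
      using ReG[of "of_real R * cis \<theta>"] gR[OF nR] nR ln_le_log_plus by (metis order_refl)
    then show "Re (G (of_real R * cis \<theta>)) * K \<theta> \<le> log_plus (cmod (F (of_real R * cis \<theta>))) * ((R + r) / (R - r))"
      unfolding K_def using poisson_kernel_bound[OF z R(2) nR[of \<theta>]] by (intro mult_mono) auto
  qed
  moreover have gen: "x \<le> c * (1 / (2 * pi) * I)" if "2 * pi * x \<le> I * c" for x c I :: real
    using that pi_gt_zero by (simp add: field_simps)
  ultimately have "Re (G z) \<le> (R + r) / (R - r) * proximity F R"
    unfolding proximity_def by blast
  moreover have "ln (norm (F z)) \<le> ln (norm (g z))"
    using Fg Fz by (intro ln_mono) auto
  then have "ln (norm (F z)) \<le> Re (G z)"
    using ReG[of z] z R by simp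
  ultimately show ?thesis by linarith
qed

lemma proximity_nonneg: "0 \<le> proximity f r"
proof -
  have "0 \<le> integral {0..2 * pi} (\<lambda>\<theta>. log_plus (cmod (f (of_real r * cis \<theta>))))"
    by (cases "(\<lambda>\<theta>. log_plus (cmod (f (of_real r * cis \<theta>)))) integrable_on {0..2*pi}")
       (auto intro: integral_nonneg simp: not_integrable_integral)
  then show ?thesis by (simp add: proximity_def)
qed

lemma proximity_le:
  assumes "\<And>z. norm z = r \<Longrightarrow> log_plus (norm (f z)) \<le> B" "0 \<le> B" "0 \<le> r"
  shows "proximity f r \<le> B"
proof -
  let ?h = "\<lambda>\<theta>. log_plus (cmod (f (of_real r * cis \<theta>)))"
  have "integral {0..2*pi} ?h \<le> 2 * pi * B"
  proof (cases "?h integrable_on {0..2*pi}")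
    case True
    have "((\<lambda>\<theta>::real. B) has_integral (2 * pi - 0) *\<^sub>R B) {0..2*pi}" by (rule has_integral_const_real[where a=0 and b="2*pi", simplified, THEN has_integral_eq_rhs]) auto
    then have "integral {0..2*pi} ?h \<le> (2 * pi - 0) *\<^sub>R B"
      by (rule has_integral_le[OF integrable_integral[OF True]]) (use assms in \<open>auto simp: norm_mult\<close>)
    then show ?thesis by simp
  qed (use assms in \<open>auto simp: not_integrable_integral\<close>)
  then show ?thesis by (simp add: proximity_def field_simps)
qed

lemma has_integral_inverse_from:
  assumes "0 < s" "s \<le> r"
  shows "((\<lambda>t. if s \<le> t then 1 / t else 0) has_integral (ln r - ln s)) {0..r::real}"
proof -
  have "((\<lambda>t. 1 / t) has_integral (ln r - ln s)) {s..r}"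
    using assms by (intro fundamental_theorem_of_calculus)
      (auto intro!: derivative_eq_intros simp: has_real_derivative_iff_has_vector_derivative[symmetric])
  then have "((\<lambda>t. if t \<in> {s..r} then 1 / t else 0) has_integral (ln r - ln s)) {0..r}"
    using assms by (subst has_integral_restrict) auto
  then show ?thesis by (rule has_integral_eq[rotated]) auto
qed

text \<open>
  Beyond the last pole the integrand is \<open>a / t\<close> with a constant \<open>a\<close>, so the counting function is
  exactly affine in \<open>ln r\<close>. Exactness matters: \<open>a \<ge> 1\<close> as soon as there is a pole, and the counting
  function is 0 otherwise.
\<close>
lemma log_pole_counting:
  assumes fin: "finite {z. is_pole f z}" and iso: "\<And>z. isolated_singularity_at f z"
  shows "\<exists>a c r0. 0 \<le> a \<and> ({z. is_pole f z} \<noteq> {} \<longrightarrow> 1 \<le> a) \<and> ({z. is_pole f z} = {} \<longrightarrow> a = 0 \<and> c = 0) \<and>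
      (\<forall>r\<ge>r0. pole_counting f r = a * ln r - c)"
proof -
  define B where "B = {z. is_pole f z}"
  define m where "m z = nat (- zorder f z)" for z
  have B: "finite B" using fin by (simp add: B_def)
  have m1: "m z \<ge> 1" if "z \<in> B" for z
    using isolated_pole_imp_neg_zorder[OF iso, of z] that by (simp add: m_def B_def)
  define a where "a = (\<Sum>z\<in>B. real (m z))"
  define c where "c = (\<Sum>z\<in>B - {0}. real (m z) * ln (norm z))"
  define r0 where "r0 = 1 + (\<Sum>z\<in>B. norm z)"
  have "pole_counting f r = a * ln r - c" if r: "r \<ge> r0" for r
  proof -
    have nr: "norm z \<le> r" if "z \<in> B" for z
      using member_le_sum[OF that, of norm] B r by (simp add: r0_def)
    have pc: "pole_count f t = (\<Sum>z\<in>B. if norm z \<le> t then m z else 0)" for t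
      unfolding pole_count_def m_def B_def using B unfolding B_def
      by (subst sum.inter_filter[symmetric]) (auto intro!: sum.cong)
    have diff: "real (pole_count f t) - real (pole_count f 0) = (\<Sum>z\<in>B - {0}. if norm z \<le> t then real (m z) else 0)"
      if "t \<ge> 0" for t
    proof -
      have "real (pole_count f t) = (\<Sum>z\<in>B. if norm z \<le> t then real (m z) else 0)" for t
        unfolding pc of_nat_sum by (intro sum.cong) auto
      then have "real (pole_count f t) - real (pole_count f 0) =
          (\<Sum>z\<in>B. (if norm z \<le> t then real (m z) else 0) - (if norm z \<le> 0 then real (m z) else 0))"
        by (simp add: sum_subtractf)
      also have "\<dots> = (\<Sum>z\<in>B - {0}. (if norm z \<le> t then real (m z) else 0) - (if norm z \<le> 0 then real (m z) else 0))"
        using B that by (intro sum.mono_neutral_right) auto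
      also have "\<dots> = (\<Sum>z\<in>B - {0}. if norm z \<le> t then real (m z) else 0)"
        by (intro sum.cong) auto
      finally show ?thesis .
    qed
    have "((\<lambda>t. \<Sum>z\<in>B - {0}. (if norm z \<le> t then 1 / t else 0) * real (m z)) has_integral
            (\<Sum>z\<in>B - {0}. (ln r - ln (norm z)) * real (m z))) {0..r}"
      using B nr by (intro has_integral_sum has_integral_mult_left has_integral_inverse_from) auto
    then have "((\<lambda>t. (real (pole_count f t) - real (pole_count f 0)) / t) has_integral
            (\<Sum>z\<in>B - {0}. (ln r - ln (norm z)) * real (m z))) {0..r}"

    proof (rule has_integral_eq[rotated])
      fix t assume "t \<in> {0..r}"
      then show "(\<Sum>z\<in>B - {0}. (if norm z \<le> t then 1 / t else 0) * real (m z)) = (real (pole_count f t) - real (pole_count f 0)) / t"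
        by (simp add: diff sum_divide_distrib if_distrib[of "\<lambda>x. x / t"] if_distrib[of "\<lambda>x. x * _"] cong: if_cong)
    qed
    then have "pole_counting f r = (\<Sum>z\<in>B - {0}. (ln r - ln (norm z)) * real (m z)) + real (pole_count f 0) * ln r"
      unfolding pole_counting_def by (simp add: integral_unique)
    moreover have "real (pole_count f 0) = (\<Sum>z\<in>B \<inter> {0}. real (m z))"
      unfolding pc of_nat_sum using B by (intro sum.mono_neutral_cong_right) auto
    moreover have "a = (\<Sum>z\<in>B - {0}. real (m z)) + (\<Sum>z\<in>B \<inter> {0}. real (m z))"
      unfolding a_def using B by (subst sum.union_disjoint[symmetric]) (auto intro!: sum.cong)
    ultimately show ?thesis
      by (simp add: c_def sum_distrib_right sum_subtractf algebra_simps sum_distrib_left)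
  qed
  moreover have "a \<ge> 1" if "B \<noteq> {}"
  proof -
    from that obtain z where z: "z \<in> B" by blast
    have "1 \<le> real (m z)" using m1[OF z] by simp
    also have "\<dots> \<le> a" unfolding a_def using z B by (intro member_le_sum) auto
    finally show ?thesis .
  qed
  moreover have "a \<ge> 0" unfolding a_def by (intro sum_nonneg) auto
  moreover have "B = {} \<Longrightarrow> a = 0 \<and> c = 0" by (simp add: a_def c_def)
  ultimately show ?thesis unfolding B_def by blast
qed

text \<open>
  \<open>R\<close> is chosen between \<open>2 r\<close> and \<open>3 r\<close> such that \<open>E\<close> has no zeros on \<open>\<bar>z\<bar> = R\<close>. The kernel is then at
  most 3, and passing from \<open>E\<close> to \<open>f = E / p\<close> costs the degree of \<open>p\<close> times \<open>ln R\<close>.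
\<close>
lemma eventually_poisson_growth:
  assumes E: "E holomorphic_on UNIV" "E w \<noteq> 0" and X: "finite X"
    and f: "\<And>z. z \<notin> X \<Longrightarrow> f z = E z / poly p z" and p: "\<And>z. poly p z = 0 \<Longrightarrow> z \<in> X"
    and N: "\<And>z. 2 \<le> norm z \<Longrightarrow> norm (poly p z) \<le> norm z ^ N"
  shows "\<exists>r0. \<forall>r\<ge>r0. \<exists>R\<ge>2 * r. R \<le> 3 * r \<and> (\<forall>z. norm z \<le> r \<longrightarrow> E z \<noteq> 0 \<longrightarrow> ln (norm (E z)) \<le> 3 * (proximity f R + real N * ln R))"
proof -
  define r0 where "r0 = 2 + (\<Sum>z\<in>X. norm z)"
  have X': "norm z < r" if "z \<in> X" "r \<ge> r0" for z r
    using member_le_sum[OF that(1), of norm] X that(2) by (simp add: r0_def)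
  have r02: "r0 \<ge> 2" by (simp add: r0_def sum_nonneg)
  show ?thesis
  proof (rule exI[of _ r0], intro allI impI)
    fix r assume r: "r \<ge> r0"
    obtain bs h where bh: "\<And>b. b \<in> set bs \<Longrightarrow> norm b \<le> 3 * r \<and> E b = 0" "h holomorphic_on UNIV"
      "\<And>z. norm z \<le> 3 * r \<Longrightarrow> h z \<noteq> 0" "\<And>z. E z = (\<Prod>b\<leftarrow>bs. z - b) * h z"
      using entire_factor_cball[OF E, of "3 * r"] by metis
    obtain R where R: "R \<ge> 2 * r" "R \<le> 2 * r + r" "\<And>s. s \<in> norm ` set bs \<Longrightarrow> r / (2 * real (card (norm ` set bs)) + 2) \<le> \<bar>R - s\<bar>"
      using avoid_finite_set[of "norm ` set bs" r "2 * r"] r r02 by auto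
    have pos: "r / (2 * real (card (norm ` set bs)) + 2) > 0" using r r02 by simp
    have nz: "E z \<noteq> 0" if "norm z = R" for z
    proof -
      have "z \<notin> set bs" using R(3)[of "norm z"] that pos by auto
      then show ?thesis using bh(3)[of z] R that by (auto simp: bh(4) prod_list_zero_iff)
    qed
    show "\<exists>R\<ge>2 * r. R \<le> 3 * r \<and> (\<forall>z. norm z \<le> r \<longrightarrow> E z \<noteq> 0 \<longrightarrow> ln (norm (E z)) \<le> 3 * (proximity f R + real N * ln R))"
    proof (intro exI[of _ R] conjI allI impI)
      fix z assume z: "norm z \<le> r" "E z \<noteq> 0"
      have R2: "R > 2" "R \<ge> r0" using R r r02 by auto
      have nR: "norm (of_real R * cis \<theta>) = R" for \<theta> using R2 by (simp add: norm_mult)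
      have "ln (norm (E z)) \<le> (R + r) / (R - r) * proximity E R"
        by (rule poisson_inequality[OF E(1) _ _ nz z]) (use R r r02 in auto)
      also have "\<dots> \<le> 3 * proximity E R"
        using R r r02 proximity_nonneg[of E R] by (intro mult_right_mono) (auto simp: field_simps)
      also have "proximity E R \<le> proximity f R + N * ln R"
      proof -
        have cE: "continuous_on {0..2*pi} (\<lambda>\<theta>. E (of_real R * cis \<theta>))"
          by (intro continuous_intros continuous_on_compose2[OF holomorphic_on_imp_continuous_on[OF E(1)]]) auto
        have nX: "of_real R * cis \<theta> \<notin> X" for \<theta>
        proof
          assume "of_real R * cis \<theta> \<in> X"
          from X'[OF this R2(2)] show False unfolding nR by simp
        qed
        have pz: "poly p (of_real R * cis \<theta>) \<noteq> 0" for \<theta> using p nX by blast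
        have fE: "f (of_real R * cis \<theta>) = E (of_real R * cis \<theta>) / poly p (of_real R * cis \<theta>)" for \<theta>
          using f nX by blast
        have cf: "continuous_on {0..2*pi} (\<lambda>\<theta>. f (of_real R * cis \<theta>))"
          unfolding fE using pz by (intro continuous_intros cE) auto
        have fnz: "f (of_real R * cis \<theta>) \<noteq> 0" for \<theta> using nz[OF nR] pz fE by simp
        have i1: "(\<lambda>\<theta>. log_plus (cmod (E (of_real R * cis \<theta>)))) integrable_on {0..2*pi}"
          unfolding log_plus_def using nz nR
          by (intro integrable_continuous_real continuous_intros cE continuous_on_ln) auto
        have i2: "(\<lambda>\<theta>. log_plus (cmod (f (of_real R * cis \<theta>)))) integrable_on {0..2*pi}"
          unfolding log_plus_def using fnz
          by (intro integrable_continuous_real continuous_intros cf continuous_on_ln) auto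
        have c: "((\<lambda>\<theta>::real. N * ln R) has_integral 2 * pi * (N * ln R)) {0..2*pi}"
          using has_integral_const_real[of "N * ln R" 0 "2 * pi"] by simp
        have "integral {0..2*pi} (\<lambda>\<theta>. log_plus (cmod (E (of_real R * cis \<theta>)))) \<le>
              integral {0..2*pi} (\<lambda>\<theta>. log_plus (cmod (f (of_real R * cis \<theta>)))) + 2 * pi * (N * ln R)"
        proof (rule has_integral_le[OF integrable_integral[OF i1] has_integral_add[OF integrable_integral[OF i2] c]])
          fix \<theta> :: real
          let ?w = "of_real R * cis \<theta>"
          have "norm (E ?w) = norm (f ?w) * norm (poly p ?w)" using fE pz by (simp add: norm_divide)
          then have "ln (norm (E ?w)) = ln (norm (f ?w)) + ln (norm (poly p ?w))"
            using fnz pz by (simp add: ln_mult)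
          also have "ln (norm (poly p ?w)) \<le> ln (R ^ N)"
            using N[of ?w] nR R2 pz by (intro ln_mono) auto
          also have "\<dots> = N * ln R" using R2 by (simp add: ln_realpow)
          finally have "ln (norm (E ?w)) \<le> log_plus (norm (f ?w)) + N * ln R"
            using ln_le_log_plus[of "norm (f ?w)"] by linarith
          moreover have "N * ln R \<ge> 0" using R2 by simp
          ultimately show "log_plus (norm (E ?w)) \<le> log_plus (norm (f ?w)) + N * ln R"
            using log_plus_nonneg[of "norm (f ?w)"] unfolding log_plus_def[of "norm (E ?w)"] by linarith
        qed
        then show ?thesis by (simp add: proximity_def field_simps)
      qed
      finally show "ln (norm (E z)) \<le> 3 * (proximity f R + real N * ln R)" by simp
    qed (use R in auto)
  qed
qed

lemma poly_lower_bound: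
  assumes "p \<noteq> (0 :: complex poly)"
  shows "\<exists>c>0. \<exists>b. \<forall>z. b \<le> norm z \<longrightarrow> c \<le> norm (poly p z)"
proof (cases "degree p = 0")
  case True
  then obtain a where "p = [:a:]" by (auto elim: degree_eq_zeroE)
  then show ?thesis using assms by (intro exI[of _ "norm a"]) auto
next
  case False
  then have "filterlim (poly p) at_infinity at_infinity"
    by (intro filterlim_poly_at_infinity) auto
  then have "eventually (\<lambda>z. 1 \<le> norm (poly p z)) at_infinity"
    by (simp add: filterlim_at_infinity[of 0])
  then show ?thesis unfolding eventually_at_infinity by (intro exI[of _ 1]) auto
qed

lemma M1_nicely_meromorphic: "f \<in> M1 \<Longrightarrow> f nicely_meromorphic_on UNIV"
  and M1_finite_poles: "f \<in> M1 \<Longrightarrow> finite {z. is_pole f z}"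
  by (auto simp: M1_def)

lemma M1_isolated: "f \<in> M1 \<Longrightarrow> isolated_singularity_at f z"
  using M1_nicely_meromorphic[of f] unfolding nicely_meromorphic_on_def meromorphic_on_altdef by blast

lemma M1_analytic: "f \<in> M1 \<Longrightarrow> \<not> is_pole f z \<Longrightarrow> f analytic_on {z}"
  using M1_nicely_meromorphic[of f] nicely_meromorphic_on_imp_analytic_at by blast

text \<open>
  Away from a disc, \<open>\<bar>f\<bar>\<close> is at most a constant times \<open>\<bar>E\<bar>\<close>, and poles contribute a
  multiple of \<open>ln r\<close>.
\<close>
lemma nevanlinna_T_le:
  assumes f: "f \<in> M1" and X: "finite X" and p: "p \<noteq> 0" and E: "\<And>z. z \<notin> X \<Longrightarrow> f z = E z / poly p z"
  shows "\<exists>C\<ge>0. \<exists>r0. \<forall>r\<ge>r0. \<forall>B\<ge>0. (\<forall>z. norm z = r \<longrightarrow> norm (E z) \<le> exp B) \<longrightarrow> nevanlinna_T f r \<le> B + C * ln r"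
proof -
  obtain c b where c: "c > 0" "\<And>z. b \<le> norm z \<Longrightarrow> c \<le> norm (poly p z)" using poly_lower_bound[OF p] by blast
  obtain a c' r1 where a: "a \<ge> 0" "\<And>r. r \<ge> r1 \<Longrightarrow> pole_counting f r = a * ln r - c'"
    using log_pole_counting[OF M1_finite_poles[OF f] M1_isolated[OF f]] by blast
  obtain b' where b': "\<And>z. z \<in> X \<Longrightarrow> norm z \<le> b'" using finite_imp_bounded[OF X] unfolding bounded_iff by blast
  show ?thesis
  proof (rule exI[of _ "\<bar>ln c\<bar> + a + \<bar>c'\<bar>"], rule conjI[rotated], rule exI[of _ "max (max 3 b) (max r1 (b' + 1))"], intro allI impI)
    fix r B assume r: "max (max 3 b) (max r1 (b' + 1)) \<le> r" and B: "0 \<le> B" "\<forall>z. norm z = r \<longrightarrow> norm (E z) \<le> exp B"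
    have "exp 1 \<le> (3::real)" using e_less_272 by simp
    then have lr: "ln r \<ge> 1" using r by (subst ln_ge_iff) auto
    have "proximity f r \<le> B + \<bar>ln c\<bar>"
    proof (rule proximity_le)
      fix z :: complex assume z: "norm z = r"
      have "z \<notin> X" using b'[of z] z r by auto
      then have "norm (f z) = norm (E z) / norm (poly p z)" using E by (simp add: norm_divide)
      also have "\<dots> \<le> exp B / c" using B(2) c z r by (intro frac_le) auto
      finally have le: "norm (f z) \<le> exp B / c" .
      show "log_plus (norm (f z)) \<le> B + \<bar>ln c\<bar>"
      proof (cases "f z = 0")
        case False
        then have "ln (norm (f z)) \<le> ln (exp B / c)" using le by (intro ln_mono) auto
        also have "\<dots> = B - ln c" using c by (simp add: ln_div)
        finally show ?thesis using B by (simp add: log_plus_def)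
      qed (use B in \<open>simp add: log_plus_def\<close>)
    qed (use B r in auto)
    moreover have "pole_counting f r \<le> a * ln r + \<bar>c'\<bar>" using a(2)[of r] r by simp
    moreover have "(\<bar>ln c\<bar> + \<bar>c'\<bar>) * 1 \<le> (\<bar>ln c\<bar> + \<bar>c'\<bar>) * ln r" using lr by (intro mult_left_mono) auto
    ultimately show "nevanlinna_T f r \<le> B + (\<bar>ln c\<bar> + a + \<bar>c'\<bar>) * ln r"
      by (simp add: nevanlinna_T_def algebra_simps)
  qed (use a in auto)
qed

lemma eventually_nevanlinna_T_nonneg:
  assumes f: "f \<in> M1"
  shows "eventually (\<lambda>r. 0 \<le> nevanlinna_T f r \<and> proximity f r \<le> nevanlinna_T f r \<and> ({z. is_pole f z} \<noteq> {} \<longrightarrow> 1 \<le> nevanlinna_T f r)) at_top"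
proof -
  obtain a c r1 where a: "a \<ge> 0" "{z. is_pole f z} \<noteq> {} \<longrightarrow> 1 \<le> a" "{z. is_pole f z} = {} \<longrightarrow> a = 0 \<and> c = 0"
    "\<And>r. r \<ge> r1 \<Longrightarrow> pole_counting f r = a * ln r - c"
    using log_pole_counting[OF M1_finite_poles[OF f] M1_isolated[OF f]] by blast
  have ge: "eventually (\<lambda>r. r \<ge> r1) at_top" by (rule eventually_ge_at_top)
  show ?thesis
  proof (cases "{z. is_pole f z} = {}")
    case True
    show ?thesis using ge
    proof eventually_elim
      case (elim r)
      then show ?case using a True proximity_nonneg[of f r] by (simp add: nevanlinna_T_def)
    qed
  next
    case False
    have "eventually (\<lambda>r::real. ln r \<ge> \<bar>c\<bar> + 1) at_top" by real_asymp
    with ge show ?thesis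
    proof eventually_elim
      case (elim r)
      have "\<bar>c\<bar> + 1 \<le> a * ln r" using mult_mono[of 1 a "\<bar>c\<bar> + 1" "ln r"] a False elim by simp
      then have "1 \<le> pole_counting f r" using a(4)[OF elim(1)] by linarith
      then show ?case using proximity_nonneg[of f r] by (simp add: nevanlinna_T_def)
    qed
  qed
qed

text \<open>
  The factor \<open>(ln r)\<^sup>2\<close> contributes \<open>2 ln (ln r) / ln r\<close>, which tends to 0.
\<close>
lemma nevanlinna_order_le:
  assumes f: "f \<in> M1" and C: "C \<ge> 1" and d: "d \<ge> 0"
    and T: "eventually (\<lambda>r. nevanlinna_T f r \<le> C * r powr d * (ln r)\<^sup>2) at_top"
  shows "nevanlinna_order f \<le> ereal d"
proof -
  let ?Y = "\<lambda>r. ln C / ln r + d + 2 * ln (ln r) / ln r"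
  have "nevanlinna_order f \<le> Limsup at_top (\<lambda>r. ereal (?Y r))"
    unfolding nevanlinna_order_def
  proof (rule Limsup_mono)
    have "eventually (\<lambda>r::real. r \<ge> 3) at_top" by (rule eventually_ge_at_top)
    with T eventually_nevanlinna_T_nonneg[OF f]
    show "eventually (\<lambda>r. ereal (ln (nevanlinna_T f r) / ln r) \<le> ereal (?Y r)) at_top"
    proof eventually_elim
      case (elim r)
      have "exp 1 \<le> (3::real)" using e_less_272 by simp
      then have lr: "ln r \<ge> 1" using elim by (subst ln_ge_iff) auto
      have "ln (nevanlinna_T f r) \<le> ln C + d * ln r + 2 * ln (ln r)"
      proof (cases "nevanlinna_T f r = 0")
        case True
        then show ?thesis using C d lr by simp
      next
        case False
        then have "ln (nevanlinna_T f r) \<le> ln (C * r powr d * (ln r)\<^sup>2)" using elim by (intro ln_mono) auto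
        also have "\<dots> = ln C + d * ln r + 2 * ln (ln r)"
        proof -
          have "r \<noteq> 0" "ln r \<noteq> 0" "ln r > 0" using elim lr by auto
          then show ?thesis using C by (simp add: ln_mult ln_realpow ln_powr)
        qed
        finally show ?thesis .
      qed
      then have "ln (nevanlinna_T f r) / ln r \<le> (ln C + d * ln r + 2 * ln (ln r)) / ln r"
        using lr by (intro divide_right_mono) auto
      also have "\<dots> = ?Y r" using lr by (simp add: field_simps)
      finally show ?case by simp
    qed
  qed
  also have "Limsup at_top (\<lambda>r. ereal (?Y r)) = ereal d"
  proof (rule lim_imp_Limsup)
    have "(?Y \<longlongrightarrow> d) at_top" by real_asymp
    then show "((\<lambda>r. ereal (?Y r)) \<longlongrightarrow> ereal d) at_top" by (intro tendsto_ereal)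
  qed simp
  finally show ?thesis .
qed

lemma eventually_nevanlinna_T_less:
  assumes f: "f \<in> M1" and k: "nevanlinna_order f < ereal \<kappa>"
  shows "eventually (\<lambda>r. nevanlinna_T f r \<le> r powr \<kappa>) at_top"
proof -
  have "eventually (\<lambda>r. ereal (ln (nevanlinna_T f r) / ln r) < ereal \<kappa>) at_top"
    using k unfolding nevanlinna_order_def by (rule Limsup_lessD)
  moreover have "eventually (\<lambda>r::real. r \<ge> 3) at_top" by (rule eventually_ge_at_top)
  ultimately show ?thesis using eventually_nevanlinna_T_nonneg[OF f]
  proof eventually_elim
    case (elim r)
    show ?case
    proof (cases "nevanlinna_T f r = 0")
      case False
      have lr: "ln r > 0" using elim by simp
      have "ln (nevanlinna_T f r) \<le> \<kappa> * ln r" using elim lr by (simp add: field_simps)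
      then have "exp (ln (nevanlinna_T f r)) \<le> exp (\<kappa> * ln r)" by simp
      then show ?thesis using False elim by (simp add: powr_def)
    qed simp
  qed
qed

lemma nevanlinna_T_const: "r \<ge> 0 \<Longrightarrow> nevanlinna_T (\<lambda>_. c) r = log_plus (norm c)"
proof -
  have "\<not> is_pole (\<lambda>_. c) z" for z :: complex by simp
  then have "pole_counting (\<lambda>_. c) r = 0" by (simp add: pole_counting_def pole_count_def)
  moreover have "proximity (\<lambda>_. c) r = log_plus (norm c)" by (simp add: proximity_def)
  ultimately show ?thesis by (simp add: nevanlinna_T_def)
qed

text \<open>
  A negative order would make \<open>T(r, f)\<close> tend to 0. Then \<open>f\<close> has no poles and is bounded by Poisson's
  inequality, hence constant by Liouville's theorem; but the characteristic of a constant is constant.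
  If it vanishes, the order is 0 because of \<open>ln 0 = 0\<close>.
\<close>
lemma nevanlinna_order_nonneg:
  assumes f: "f \<in> M1"
  shows "0 \<le> nevanlinna_order f"
proof (rule ccontr)
  assume "\<not> 0 \<le> nevanlinna_order f"
  then have "nevanlinna_order f < ereal 0" by (simp add: zero_ereal_def)
  then obtain q where q: "nevanlinna_order f < ereal q" "ereal q < ereal 0" using ereal_dense2 by blast
  have "eventually (\<lambda>r. ereal (ln (nevanlinna_T f r) / ln r) < ereal q) at_top"
    using q(1) unfolding nevanlinna_order_def by (rule Limsup_lessD)
  moreover have "eventually (\<lambda>r::real. r \<ge> 3) at_top" by (rule eventually_ge_at_top)
  ultimately have ev: "eventually (\<lambda>r. 0 < nevanlinna_T f r \<and> nevanlinna_T f r < 1 \<and> {z. is_pole f z} = {} \<and> proximity f r \<le> nevanlinna_T f r \<and> r \<ge> 3) at_top"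
    using eventually_nevanlinna_T_nonneg[OF f]
  proof eventually_elim
    case (elim r)
    have lr: "ln r > 0" using elim by simp
    have "ln (nevanlinna_T f r) < q * ln r" using elim lr by (simp add: field_simps)
    also have "\<dots> < 0" using q lr by (simp add: mult_neg_pos)
    finally have neg: "ln (nevanlinna_T f r) < 0" .
    then have "nevanlinna_T f r \<noteq> 0" by auto
    then have "0 < nevanlinna_T f r" using elim by linarith
    moreover from this have "nevanlinna_T f r < 1" using neg by simp
    ultimately show ?case using elim by auto
  qed
  then obtain r1 where r1: "\<And>r. r \<ge> r1 \<Longrightarrow> 0 < nevanlinna_T f r \<and> nevanlinna_T f r < 1 \<and> {z. is_pole f z} = {} \<and> proximity f r \<le> nevanlinna_T f r"
    unfolding eventually_at_top_linorder by blast
  have "\<not> is_pole f z" for z using r1[of r1] by auto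
  then have "f analytic_on UNIV"
    using M1_analytic[OF f] analytic_on_analytic_at[of f UNIV] by blast
  then have hol: "f holomorphic_on UNIV" by (rule analytic_imp_holomorphic)
  have "\<exists>c. \<forall>z. f z = c"
  proof (cases "\<exists>w. f w \<noteq> 0")
    case True
    then obtain w where w: "f w \<noteq> 0" by blast
    have "\<exists>r0. \<forall>r\<ge>r0. \<exists>R\<ge>2 * r. R \<le> 3 * r \<and> (\<forall>z. norm z \<le> r \<longrightarrow> f z \<noteq> 0 \<longrightarrow> ln (norm (f z)) \<le> 3 * (proximity f R + real 0 * ln R))"
      by (rule eventually_poisson_growth[OF hol w, of "{}" f 1]) auto
    then obtain r0 where r0: "\<And>r. r \<ge> r0 \<Longrightarrow> \<exists>R\<ge>2 * r. R \<le> 3 * r \<and> (\<forall>z. norm z \<le> r \<longrightarrow> f z \<noteq> 0 \<longrightarrow> ln (norm (f z)) \<le> 3 * (proximity f R + real 0 * ln R))"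
      by blast
    have r1': "proximity f r < 1" if "r \<ge> r1" for r using r1[OF that] by linarith
    have "norm (f z) \<le> exp 3" for z
    proof (cases "f z = 0")
      case False
      define r where "r = max (max r0 0) (max r1 (norm z))"
      have "r \<ge> r0" by (simp add: r_def)
      from r0[OF this] obtain R where R: "R \<ge> 2 * r" "\<And>z. norm z \<le> r \<Longrightarrow> f z \<noteq> 0 \<Longrightarrow> ln (norm (f z)) \<le> 3 * (proximity f R + real 0 * ln R)"
        by blast
      have "ln (norm (f z)) \<le> 3 * proximity f R" using R(2)[of z] False by (simp add: r_def)
      moreover have "proximity f R < 1" using R(1) by (intro r1') (auto simp: r_def)
      ultimately have "ln (norm (f z)) \<le> 3" by linarith
      then have "exp (ln (norm (f z))) \<le> exp 3" by (simp only: exp_le_cancel_iff)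
      then show ?thesis using False by simp
    qed simp
    then have "bounded (range f)" by (auto simp: bounded_iff)
    from Liouville_theorem[OF hol this] show ?thesis by (metis constant_on_def UNIV_I)
  qed auto
  then obtain c where c: "f = (\<lambda>_. c)" by auto
  have "eventually (\<lambda>r::real. r powr q < \<bar>log_plus (norm c)\<bar> \<or> log_plus (norm c) = 0) at_top"
  proof (cases "log_plus (norm c) = 0")
    case False
    have "((\<lambda>r::real. r powr q) \<longlongrightarrow> 0) at_top" using q(2) by (intro tendsto_neg_powr filterlim_ident) auto
    moreover have "0 < \<bar>log_plus (norm c)\<bar>" using False unfolding zero_less_abs_iff .
    ultimately have "eventually (\<lambda>r::real. r powr q < \<bar>log_plus (norm c)\<bar>) at_top" by (rule order_tendstoD(2))
    then show ?thesis by (rule eventually_mono) blast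
  qed auto
  with ev eventually_nevanlinna_T_less[OF f q(1)] have "eventually (\<lambda>r::real. False) at_top"
  proof eventually_elim
    case (elim r)
    then show ?case using nevanlinna_T_const[of r c] c by auto
  qed
  then show False by simp
qed

lemma order_0_not_non_integer: "nevanlinna_order f = 0 \<Longrightarrow> \<not> non_integer_finite_order f"
  by (simp add: non_integer_finite_order_def)

lemma non_integer_order_not_const:
  assumes f: "f \<in> M1" "non_integer_finite_order f"
  shows "\<exists>z. f z \<noteq> c"
proof (rule ccontr)
  assume "\<not> (\<exists>z. f z \<noteq> c)"
  then have c: "f = (\<lambda>_. c)" by auto
  have "nevanlinna_order f \<le> ereal 0"
  proof (rule nevanlinna_order_le[OF f(1)])
    have "eventually (\<lambda>r::real. r \<ge> 3) at_top" by (rule eventually_ge_at_top)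
    then show "eventually (\<lambda>r. nevanlinna_T f r \<le> (1 + log_plus (norm c)) * r powr 0 * (ln r)\<^sup>2) at_top"
    proof eventually_elim
      case (elim r)
      have "exp 1 \<le> (3::real)" using e_less_272 by simp
      then have lr: "ln r \<ge> 1" using elim by (subst ln_ge_iff) auto
      have "(1 + log_plus (norm c)) * 1 \<le> (1 + log_plus (norm c)) * (ln r)\<^sup>2"
        using lr log_plus_nonneg[of "norm c"] by (intro mult_left_mono one_le_power) auto
      then show ?case using nevanlinna_T_const[of r c] elim c by simp
    qed
  qed auto
  then have "nevanlinna_order f = 0" using nevanlinna_order_nonneg[OF f(1)] by (simp add: zero_ereal_def)
  then show False using f(2) order_0_not_non_integer by blast
qed

lemma slow_growth_imp_order_0:
  assumes f: "f \<in> M1" and f0: "f0 holomorphic_on UNIV" "g0 holomorphic_on UNIV" and X: "finite X" and p: "p \<noteq> 0"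
    and E: "\<And>z. z \<notin> X \<Longrightarrow> f z = f0 z / poly p z"
    and slow: "\<And>r. r \<ge> r1 \<Longrightarrow> ln (max_mod f0 g0 r) \<le> (ln r)\<^sup>2"
  shows "nevanlinna_order f = 0"
proof -
  obtain C r0 where C: "C \<ge> 0" "\<And>r B. r \<ge> r0 \<Longrightarrow> B \<ge> 0 \<Longrightarrow> (\<forall>z. norm z = r \<longrightarrow> norm (f0 z) \<le> exp B) \<Longrightarrow> nevanlinna_T f r \<le> B + C * ln r"
    using nevanlinna_T_le[OF f X p E] by blast
  have "nevanlinna_order f \<le> ereal 0"
  proof (rule nevanlinna_order_le[OF f])
    have "eventually (\<lambda>r::real. r \<ge> max 3 (max r0 r1)) at_top" by (rule eventually_ge_at_top)
    then show "eventually (\<lambda>r. nevanlinna_T f r \<le> (1 + C) * r powr 0 * (ln r)\<^sup>2) at_top"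
    proof eventually_elim
      case (elim r)
      have "exp 1 \<le> (3::real)" using e_less_272 by simp
      then have lr: "ln r \<ge> 1" using elim by (subst ln_ge_iff) auto
      have "norm (f0 z) \<le> exp ((ln r)\<^sup>2)" if "norm z = r" for z
      proof -
        have "norm (f0 z) \<le> max_mod f0 g0 r" using max_mod_upper[OF f0, of z r] that norm_ge_zero[of "g0 z"] by linarith
        also have "\<dots> \<le> exp ((ln r)\<^sup>2)"
        proof -
          have "max_mod f0 g0 r > 0" using growth_scale_max_mod[OF f0] unfolding growth_scale_def by (metis less_le_trans zero_less_numeral)
          then show ?thesis using slow[of r] elim by (metis exp_le_cancel_iff exp_ln max.bounded_iff)
        qed
        finally show ?thesis .
      qed
      then have "nevanlinna_T f r \<le> (ln r)\<^sup>2 + C * ln r" using elim by (intro C(2)) auto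
      also have "\<dots> \<le> (ln r)\<^sup>2 + C * (ln r)\<^sup>2"
        using lr C(1) by (intro add_left_mono mult_left_mono) (auto simp: power2_eq_square)
      finally show ?case using elim by (simp add: algebra_simps)
    qed
  qed (use C in auto)
  then show ?thesis using nevanlinna_order_nonneg[OF f] by (simp add: zero_ereal_def)
qed

section \<open>A criterion for order zero\<close>

text \<open>
  The common denominator lets a single maximum modulus measure both functions.
\<close>
lemma M1_common_denominator:
  assumes f: "f \<in> M1" and g: "g \<in> M1" and X: "\<And>z. is_pole f z \<Longrightarrow> z \<in> X" "\<And>z. is_pole g z \<Longrightarrow> z \<in> X"
  obtains f0 g0 p where "p \<noteq> 0" "\<And>z. poly p z = 0 \<Longrightarrow> z \<in> X" "f0 holomorphic_on UNIV" "g0 holomorphic_on UNIV"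
    "\<And>z. z \<notin> X \<Longrightarrow> f z = f0 z / poly p z" "\<And>z. z \<notin> X \<Longrightarrow> g z = g0 z / poly p z"
proof -
  obtain Ef pf where Ef: "Ef holomorphic_on UNIV" "pf \<noteq> 0" "\<And>z. poly pf z = 0 \<longleftrightarrow> is_pole f z" "\<And>z. f z = Ef z / poly pf z"
    using entire_over_poly[OF M1_nicely_meromorphic[OF f] M1_finite_poles[OF f]] by metis
  obtain Eg pg where Eg: "Eg holomorphic_on UNIV" "pg \<noteq> 0" "\<And>z. poly pg z = 0 \<longleftrightarrow> is_pole g z" "\<And>z. g z = Eg z / poly pg z"
    using entire_over_poly[OF M1_nicely_meromorphic[OF g] M1_finite_poles[OF g]] by metis
  define p where "p = pf * pg"
  define f0 where "f0 z = Ef z * poly pg z" for z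
  define g0 where "g0 z = Eg z * poly pf z" for z
  have p: "p \<noteq> 0" "\<And>z. poly p z = 0 \<Longrightarrow> z \<in> X" using Ef Eg X by (auto simp: p_def)
  have hol: "f0 holomorphic_on UNIV" "g0 holomorphic_on UNIV"
    unfolding f0_def g0_def by (intro holomorphic_intros Ef Eg)+
  have fE: "f z = f0 z / poly p z" and gE: "g z = g0 z / poly p z" if "z \<notin> X" for z
    using p(2)[of z] that Ef(4)[of z] Eg(4)[of z] by (auto simp: f0_def g0_def p_def)
  show ?thesis by (rule that[OF p hol fE gE])
qed

text \<open>
  The criterion through which all cases are settled: it suffices to find an auxiliary function \<open>\<Psi>\<close>,
  not identically zero and with finitely many poles, that is small compared with \<open>1 / (1 + \<bar>f\<bar> + \<bar>g\<bar>)\<close>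
  up to logarithmic derivatives of functions built from \<open>f\<close> and \<open>g\<close>. It takes the place of the second
  main theorem. Tameness is required for every growth scale, so that the maximum modulus need not be
  mentioned.
\<close>
lemma order_0_criterion:
  assumes f: "f \<in> M1" and g: "g \<in> M1" and X: "finite X" "\<And>z. is_pole f z \<Longrightarrow> z \<in> X" "\<And>z. is_pole g z \<Longrightarrow> z \<in> X"
    and hs: "finite hs" "\<And>h M. h \<in> hs \<Longrightarrow> growth_scale M \<Longrightarrow> tame M X f \<Longrightarrow> tame M X g \<Longrightarrow> tame M X h"
      "\<And>h. h \<in> hs \<Longrightarrow> \<exists>z. z \<notin> X \<and> h z \<noteq> 0"
    and \<Psi>: "\<Psi> meromorphic_on UNIV" "\<And>z. z \<notin> X \<Longrightarrow> \<Psi> analytic_on {z}" "w \<notin> X" "\<Psi> w \<noteq> 0"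
    and bound: "\<And>z. z \<notin> X \<Longrightarrow> (\<And>h. h \<in> hs \<Longrightarrow> h z \<noteq> 0) \<Longrightarrow>
      norm (\<Psi> z) * (1 + norm (f z) + norm (g z)) \<le> C * (1 + (\<Sum>h\<in>hs. norm (deriv h z / h z))) ^ N"
  shows "nevanlinna_order f = 0"
proof -
  obtain f0 g0 p where p: "p \<noteq> 0" "\<And>z. poly p z = 0 \<Longrightarrow> z \<in> X" and hol: "f0 holomorphic_on UNIV" "g0 holomorphic_on UNIV"
    and fE: "\<And>z. z \<notin> X \<Longrightarrow> f z = f0 z / poly p z" and gE: "\<And>z. z \<notin> X \<Longrightarrow> g z = g0 z / poly p z"
    using M1_common_denominator[OF f g X(2,3)] by metis
  define M where "M = max_mod f0 g0"
  have M: "growth_scale M" unfolding M_def by (rule growth_scale_max_mod[OF hol])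
  have "controlled M f0 \<and> controlled M g0"
  proof -
    have "norm (f0 z) \<le> (M R * R * (R / (R - r))) ^ 1 \<and> norm (g0 z) \<le> (M R * R * (R / (R - r))) ^ 1"
      if r: "1 \<le> r" "r < R" "norm z \<le> r" for r R z
    proof -
      have "3 + norm (f0 z) + norm (g0 z) \<le> M R" unfolding M_def using r by (intro max_mod_upper hol) auto
      then have "norm (f0 z) \<le> M R" "norm (g0 z) \<le> M R"
        using norm_ge_zero[of "g0 z"] norm_ge_zero[of "f0 z"] by linarith+
      then show ?thesis using growth_scale_ge3(4)[OF M r(1,2)] by simp
    qed
    then show ?thesis using hol unfolding controlled_def by blast
  qed
  then have tame: "tame M X f" "tame M X g"
    using p fE gE unfolding tame_def by blast+
  define \<Phi> where "\<Phi> = remove_sings \<Psi>"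
  have \<Phi>nm: "\<Phi> nicely_meromorphic_on UNIV" unfolding \<Phi>_def by (rule remove_sings_nicely_meromorphic[OF \<Psi>(1)])
  have \<Phi>eq: "\<Phi> z = \<Psi> z" if "z \<notin> X" for z using \<Psi>(2)[OF that] by (simp add: \<Phi>_def)
  have \<Phi>pole: "z \<in> X" if "is_pole \<Phi> z" for z
  proof (rule ccontr)
    assume z: "z \<notin> X"
    have "\<Phi> analytic_on {z}" unfolding \<Phi>_def by (rule remove_sings_analytic_on[OF \<Psi>(2)[OF z]])
    then show False using that analytic_at_imp_no_pole by blast
  qed
  then have "finite {z. is_pole \<Phi> z}" using X(1) by (auto intro: finite_subset)
  then obtain \<psi> q where \<psi>: "\<psi> holomorphic_on UNIV" "q \<noteq> 0" "\<And>z. poly q z = 0 \<longleftrightarrow> is_pole \<Phi> z" "\<And>z. \<Phi> z = \<psi> z / poly q z"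
    using entire_over_poly[OF \<Phi>nm] by metis
  have \<psi>w: "\<psi> w \<noteq> 0" using \<Phi>eq[OF \<Psi>(3)] \<Psi>(4) \<psi>(4)[of w] by auto
  have "\<exists>r1. \<forall>r\<ge>r1. ln (max_mod f0 g0 r) \<le> (ln r)\<^sup>2"
  proof (rule slow_growth[OF X(1) hol p fE gE hs(1) _ hs(3) \<psi>(1) \<psi>w])
    show "tame (max_mod f0 g0) X h" if "h \<in> hs" for h
      using hs(2)[OF that M tame] by (simp add: M_def)
    show "z \<in> X" if "poly q z = 0" for z using \<psi>(3) \<Phi>pole that by blast
    show "norm (\<psi> z / poly q z) * (1 + norm (f z) + norm (g z)) \<le> C * (1 + (\<Sum>h\<in>hs. norm (deriv h z / h z))) ^ N"
      if "z \<notin> X" "\<And>h. h \<in> hs \<Longrightarrow> h z \<noteq> 0" for z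
      using bound[of z] that \<psi>(4)[of z] \<Phi>eq[OF that(1)] by simp
  qed
  then obtain r1 where "\<And>r. r \<ge> r1 \<Longrightarrow> ln (max_mod f0 g0 r) \<le> (ln r)\<^sup>2" by blast
  from slow_growth_imp_order_0[OF f hol X(1) p(1) fE this] show ?thesis .
qed

section \<open>Local behaviour at zeros\<close>

lemma eventually_nhds_imp_at: "eventually P (nhds z) \<Longrightarrow> eventually P (at z)"
  by (simp add: eventually_at_filter eventually_mono)

lemma eventually_nhds_deriv_eq:
  assumes "eventually (\<lambda>z. u z = v z) (nhds z0)"
  shows "eventually (\<lambda>z. deriv u z = deriv v z) (nhds z0)"
proof -
  have "eventually (\<lambda>z. eventually (\<lambda>z. u z = v z) (nhds z)) (nhds z0)"
    using assms by (simp add: eventually_eventually)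
  then show ?thesis by (rule eventually_mono) (intro deriv_cong_ev refl)
qed

lemma eventually_nhds_analytic:
  assumes "u analytic_on {z0}"
  shows "eventually (\<lambda>z. u analytic_on {z}) (nhds z0)"
proof -
  obtain S where S: "open S" "z0 \<in> S" "u analytic_on S"
    using assms by (metis analytic_at analytic_on_open)
  then have "eventually (\<lambda>z. z \<in> S) (nhds z0)" by (intro eventually_nhds_in_open)
  then show ?thesis by (rule eventually_mono) (use S(3) in \<open>auto intro: analytic_on_subset\<close>)
qed

lemma eventually_nhds_nonzero:
  assumes "u analytic_on {z0}" "u z0 \<noteq> (0::complex)"
  shows "eventually (\<lambda>z. u z \<noteq> 0) (nhds z0)"
  using assms analytic_at_imp_isCont tendsto_imp_eventually_ne[of u "u z0" "nhds z0" 0]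
  by (metis isCont_def tendsto_at_iff_tendsto_nhds)

lemma analytic_has_deriv: "u analytic_on {z} \<Longrightarrow> (u has_field_derivative deriv u z) (at z)"
  by (simp add: analytic_on_imp_differentiable_at DERIV_deriv_iff_field_differentiable)

lemma analytic_local_factor:
  assumes u: "u analytic_on {z0}" and nz: "eventually (\<lambda>z. u z \<noteq> (0::complex)) (at z0)"
  obtains m \<phi> where "\<phi> analytic_on {z0}" "\<phi> z0 \<noteq> 0" "eventually (\<lambda>z. u z = (z - z0) ^ m * \<phi> z) (nhds z0)"
    "u z0 = 0 \<Longrightarrow> m = nat (zorder u z0) \<and> 1 \<le> m" "u z0 \<noteq> 0 \<Longrightarrow> m = 0"
proof (cases "u z0 = 0")
  case False
  show ?thesis by (rule that[of u 0]) (use u False in auto)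
next
  case True
  obtain r where r: "r > 0" "u holomorphic_on ball z0 r"
    using u by (auto simp: analytic_on_def)
  have "\<not> u constant_on ball z0 r"
  proof
    assume "u constant_on ball z0 r"
    then have zero: "u z = 0" if "z \<in> ball z0 r" for z
      using that True r(1) unfolding constant_on_def by (metis centre_in_ball)
    have "eventually (\<lambda>z. z \<in> ball z0 r) (at z0)"
      using r(1) by (intro eventually_at_in_open') auto
    with nz have "eventually (\<lambda>z. False) (at z0)" by eventually_elim (use zero in auto)
    then show False by simp
  qed
  from holomorphic_factor_zero_nonconstant[OF r(2) open_ball connected_ball _ True this] r(1)
  obtain g s n where g: "0 < n" "0 < s" "g holomorphic_on ball z0 s"
      "\<And>w. w \<in> ball z0 s \<Longrightarrow> u w = (w - z0) ^ n * g w" "\<And>w. w \<in> ball z0 s \<Longrightarrow> g w \<noteq> 0"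
    by (metis centre_in_ball)
  have ord: "zorder u z0 = int n"
    by (rule zorder_eqI[of "ball z0 s" _ g]) (use g in \<open>auto simp: mult.commute\<close>)
  have ev: "eventually (\<lambda>z. u z = (z - z0) ^ n * g z) (nhds z0)"
    by (rule eventually_mono[OF eventually_nhds_in_open[of "ball z0 s"]]) (use g in auto)
  have ga: "g analytic_on {z0}" using g(2,3) unfolding analytic_on_def by blast
  show ?thesis
  proof (rule that[OF ga _ ev])
    show "g z0 \<noteq> 0" using g(2) g(5)[of z0] by simp
    show "n = nat (zorder u z0) \<and> 1 \<le> n" using ord g(1) by simp
  qed (use True in simp)
qed

text \<open>
  A logarithmic derivative has at most simple poles, and a factor that vanishes at the zeros of \<open>u\<close>
  removes them.
\<close>
lemma log_deriv_times_vanishing: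
  assumes u: "u analytic_on {z0}" and nz: "eventually (\<lambda>z. u z \<noteq> (0::complex)) (at z0)"
    and \<tau>: "\<tau> analytic_on {z0}" "u z0 = 0 \<Longrightarrow> \<tau> z0 = 0"
  shows "\<exists>\<phi>. \<phi> analytic_on {z0} \<and> eventually (\<lambda>z. deriv u z / u z * \<tau> z = \<phi> z) (at z0)"
proof (cases "u z0 = 0")
  case False
  show ?thesis
    by (intro exI[of _ "\<lambda>z. deriv u z / u z * \<tau> z"] conjI analytic_intros u \<tau>) (use False in auto)
next
  case True
  obtain m v where v: "v analytic_on {z0}" "v z0 \<noteq> 0" "eventually (\<lambda>z. u z = (z - z0) ^ m * v z) (nhds z0)"
    "m \<ge> 1"
    using analytic_local_factor[OF u nz] True by metis
  show ?thesis
  proof (cases "eventually (\<lambda>z. \<tau> z \<noteq> 0) (at z0)")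
    case False
    have "\<not> isolated_zero \<tau> z0" using False by (auto simp: isolated_zero_def)
    then have "eventually (\<lambda>z. \<tau> z = 0) (at z0)"
      using non_isolated_zero_imp_eventually_zero[OF \<tau>(1)] \<tau>(2) True by blast
    then show ?thesis by (intro exI[of _ "\<lambda>z. 0"]) (auto elim: eventually_mono)
  next
    case nz\<tau>: True
    obtain j \<tau>' where "\<tau>' analytic_on {z0}" "eventually (\<lambda>z. \<tau> z = (z - z0) ^ j * \<tau>' z) (nhds z0)" "j \<ge> 1"
      using analytic_local_factor[OF \<tau>(1) nz\<tau>] \<tau>(2) True by metis
    then obtain i where \<tau>': "\<tau>' analytic_on {z0}" "eventually (\<lambda>z. \<tau> z = (z - z0) * ((z - z0) ^ i * \<tau>' z)) (nhds z0)"
      by (cases j) (auto simp: mult_ac)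
    define \<tau>1 where "\<tau>1 z = (z - z0) ^ i * \<tau>' z" for z
    define \<phi> where "\<phi> z = of_nat m * \<tau>1 z + (z - z0) * \<tau>1 z * (deriv v z / v z)" for z
    have "\<phi> analytic_on {z0}"
      unfolding \<phi>_def \<tau>1_def using v \<tau>' by (intro analytic_intros) auto
    moreover have "eventually (\<lambda>z. deriv u z / u z * \<tau> z = \<phi> z) (at z0)"
    proof -
      have neq: "eventually (\<lambda>z. z \<noteq> z0) (at z0)" by (rule eventually_neq_at_within)
      note ev = eventually_nhds_imp_at[OF v(3)] eventually_nhds_imp_at[OF eventually_nhds_deriv_eq[OF v(3)]]
        eventually_nhds_imp_at[OF \<tau>'(2)] eventually_nhds_imp_at[OF eventually_nhds_analytic[OF v(1)]]
        eventually_nhds_imp_at[OF eventually_nhds_nonzero[OF v(1,2)]] neq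
      from ev show ?thesis
      proof eventually_elim
        case (elim z)
        have "deriv u z = of_nat m * (z - z0) ^ (m - 1) * v z + deriv v z * (z - z0) ^ m"
          unfolding elim(2)
          by (rule DERIV_imp_deriv) (auto intro!: derivative_eq_intros analytic_has_deriv elim(4))
        also have "(z - z0) ^ m = (z - z0) * (z - z0) ^ (m - 1)" using v(4) by (cases m) auto
        also have "of_nat m * (z - z0) ^ (m - 1) * v z + deriv v z * ((z - z0) * (z - z0) ^ (m - 1))
            = (z - z0) ^ (m - 1) * (of_nat m * v z + (z - z0) * deriv v z)" by (simp add: algebra_simps)
        finally have d: "deriv u z = (z - z0) ^ (m - 1) * (of_nat m * v z + (z - z0) * deriv v z)" .
        have uz: "u z = (z - z0) ^ (m - 1) * ((z - z0) * v z)" unfolding elim(1) using v(4) by (cases m) auto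
        have "(z - z0) ^ (m - 1) \<noteq> 0" "z - z0 \<noteq> 0" using elim by auto
        then show ?case
          unfolding \<phi>_def d uz elim(3) \<tau>1_def[symmetric] using elim(5) by (simp add: field_simps)
      qed
    qed
    ultimately show ?thesis by blast
  qed
qed

text \<open>
  This is \<open>w'' / w'\<close> for \<open>w = 1 / u\<close>, the pre-Schwarzian derivative of \<open>1 / u\<close>. Two functions have the
  same one if and only if their reciprocals are related by an affine map.
\<close>
definition inv_pre_schwarzian :: "(complex \<Rightarrow> complex) \<Rightarrow> complex \<Rightarrow> complex" where
  "inv_pre_schwarzian u z = deriv (deriv u) z / deriv u z - 2 * deriv u z / u z"

text \<open>
  At a zero of order \<open>m\<close> the residue is \<open>(m - 1) - 2 m = - (m + 1)\<close>. For a simple zero the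
  constant coefficient vanishes, since \<open>1 / u\<close> then has a simple pole, whose derivative has no residue.
\<close>
lemma inv_pre_schwarzian_expansion:
  assumes u: "u analytic_on {z0}" and nz: "eventually (\<lambda>z. u z \<noteq> (0::complex)) (at z0)" and u0: "u z0 = 0"
    and m: "m = nat (zorder u z0)"
  obtains \<phi> \<phi>1 \<kappa> where "m \<ge> 1" "\<phi> analytic_on {z0}" "\<phi>1 analytic_on {z0}" "\<kappa> analytic_on {z0}" "\<phi> z0 \<noteq> 0"
    "eventually (\<lambda>z. u z = (z - z0) ^ m * \<phi> z \<and> deriv u z = (z - z0) ^ (m - 1) * \<phi>1 z \<and>
       (z - z0) * inv_pre_schwarzian u z = (z - z0) * \<kappa> z - (of_nat m + 1)) (at z0)"
    "m = 1 \<Longrightarrow> \<kappa> z0 = 0"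
proof -
  obtain \<phi> where m1: "m \<ge> 1" and \<phi>: "\<phi> analytic_on {z0}" "\<phi> z0 \<noteq> 0" "eventually (\<lambda>z. u z = (z - z0) ^ m * \<phi> z) (nhds z0)"
    using analytic_local_factor[OF u nz] u0 m by metis
  define \<phi>1 where "\<phi>1 z = of_nat m * \<phi> z + (z - z0) * deriv \<phi> z" for z
  define \<kappa> where "\<kappa> z = deriv \<phi>1 z / \<phi>1 z - 2 * deriv \<phi> z / \<phi> z" for z
  have d\<phi>: "deriv \<phi> analytic_on {z0}" using \<phi> by (intro analytic_intros)
  have \<phi>1: "\<phi>1 analytic_on {z0}" unfolding \<phi>1_def by (intro analytic_intros \<phi> d\<phi>)
  have \<phi>10: "\<phi>1 z0 \<noteq> 0" using m1 \<phi> by (simp add: \<phi>1_def)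
  have \<kappa>: "\<kappa> analytic_on {z0}" unfolding \<kappa>_def using \<phi>10 \<phi> by (intro analytic_intros \<phi>1) auto
  have du: "eventually (\<lambda>z. deriv u z = (z - z0) ^ (m - 1) * \<phi>1 z) (nhds z0)"
    using eventually_nhds_deriv_eq[OF \<phi>(3)] eventually_nhds_analytic[OF \<phi>(1)]
  proof eventually_elim
    case (elim z)
    have "deriv u z = of_nat m * (z - z0) ^ (m - 1) * \<phi> z + deriv \<phi> z * (z - z0) ^ m"
      unfolding elim(1) by (rule DERIV_imp_deriv) (auto intro!: derivative_eq_intros analytic_has_deriv elim(2))
    also have "(z - z0) ^ m = (z - z0) * (z - z0) ^ (m - 1)" using m1 by (cases m) auto
    finally show ?case by (simp add: \<phi>1_def algebra_simps)
  qed
  have neq: "eventually (\<lambda>z. z \<noteq> z0) (at z0)" by (rule eventually_neq_at_within)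
  have "eventually (\<lambda>z. u z = (z - z0) ^ m * \<phi> z \<and> deriv u z = (z - z0) ^ (m - 1) * \<phi>1 z \<and>
       (z - z0) * inv_pre_schwarzian u z = (z - z0) * \<kappa> z - (of_nat m + 1)) (at z0)"
    using eventually_nhds_imp_at[OF \<phi>(3)] eventually_nhds_imp_at[OF du] eventually_nhds_imp_at[OF eventually_nhds_deriv_eq[OF du]]
      eventually_nhds_imp_at[OF eventually_nhds_analytic[OF \<phi>1]] eventually_nhds_imp_at[OF eventually_nhds_nonzero[OF \<phi>1 \<phi>10]]
      eventually_nhds_imp_at[OF eventually_nhds_nonzero[OF \<phi>(1,2)]] neq
  proof eventually_elim
    case (elim z)
    define \<zeta> where "\<zeta> = z - z0"
    have \<zeta>: "\<zeta> \<noteq> 0" using elim by (simp add: \<zeta>_def)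
    have "deriv (deriv u) z = of_nat (m - 1) * (z - z0) ^ (m - 1 - 1) * \<phi>1 z + deriv \<phi>1 z * (z - z0) ^ (m - 1)"
      unfolding elim(3) by (rule DERIV_imp_deriv) (auto intro!: derivative_eq_intros analytic_has_deriv elim(4))
    then have "\<zeta> * deriv (deriv u) z = of_nat (m - 1) * (\<zeta> * \<zeta> ^ (m - 1 - 1)) * \<phi>1 z + \<zeta> * deriv \<phi>1 z * \<zeta> ^ (m - 1)"
      by (simp add: \<zeta>_def algebra_simps)
    also have "of_nat (m - 1) * (\<zeta> * \<zeta> ^ (m - 1 - 1)) = of_nat (m - 1) * \<zeta> ^ (m - 1)"
      by (cases "m - 1") auto
    finally have d2: "\<zeta> * deriv (deriv u) z = \<zeta> ^ (m - 1) * (of_nat (m - 1) * \<phi>1 z + \<zeta> * deriv \<phi>1 z)"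
      by (simp add: algebra_simps)
    have d1: "deriv u z = \<zeta> ^ (m - 1) * \<phi>1 z" using elim(2) by (simp add: \<zeta>_def)
    have u: "u z = \<zeta> ^ (m - 1) * (\<zeta> * \<phi> z)" using elim(1) m1 by (cases m) (auto simp: \<zeta>_def)
    have nz: "\<zeta> ^ (m - 1) \<noteq> 0" using \<zeta> by simp
    have "\<zeta> * (deriv (deriv u) z / deriv u z) = (\<zeta> * deriv (deriv u) z) / deriv u z" by simp
    also have "\<dots> = of_nat (m - 1) + \<zeta> * (deriv \<phi>1 z / \<phi>1 z)"
      unfolding d2 d1 using nz elim(5) by (simp add: field_simps)
    finally have A: "\<zeta> * (deriv (deriv u) z / deriv u z) = of_nat (m - 1) + \<zeta> * (deriv \<phi>1 z / \<phi>1 z)" .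
    have "\<zeta> * (2 * deriv u z / u z) = 2 * \<phi>1 z / \<phi> z"
      unfolding d1 u using nz \<zeta> elim(6) by (simp add: field_simps)
    also have "\<dots> = 2 * of_nat m + 2 * \<zeta> * (deriv \<phi> z / \<phi> z)"
      using elim(6) by (simp add: \<phi>1_def \<zeta>_def field_simps)
    finally have B: "\<zeta> * (2 * deriv u z / u z) = 2 * of_nat m + 2 * \<zeta> * (deriv \<phi> z / \<phi> z)" .
    have "of_nat (m - 1) = (of_nat m - 1 :: complex)" using m1 by (simp add: of_nat_diff)
    then have "\<zeta> * (deriv (deriv u) z / deriv u z - 2 * deriv u z / u z) = \<zeta> * \<kappa> z - (of_nat m + 1)"
      unfolding right_diff_distrib A B \<kappa>_def by (simp add: algebra_simps)
    then show ?case using elim(1,2) by (simp add: \<zeta>_def inv_pre_schwarzian_def)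
  qed
  moreover have "\<kappa> z0 = 0" if "m = 1"
  proof -
    have "deriv \<phi>1 z0 = 2 * deriv \<phi> z0"
      unfolding \<phi>1_def that
      by (rule DERIV_imp_deriv) (auto intro!: derivative_eq_intros analytic_has_deriv \<phi> d\<phi>)
    then show ?thesis using that \<phi>(2) by (simp add: \<kappa>_def \<phi>1_def)
  qed
  ultimately show ?thesis using that[OF m1 \<phi>(1) \<phi>1 \<kappa> \<phi>(2)] by blast
qed

lemma analytic_vanishing_factor:
  assumes "\<kappa> analytic_on {z0}" "\<kappa> z0 = (0::complex)"
  shows "\<exists>\<kappa>'. \<kappa>' analytic_on {z0} \<and> eventually (\<lambda>z. \<kappa> z = (z - z0) * \<kappa>' z) (at z0)"
proof -
  have "\<exists>\<phi>. \<phi> analytic_on {z0} \<and> eventually (\<lambda>z. deriv (\<lambda>z. z - z0) z / (z - z0) * \<kappa> z = \<phi> z) (at z0)"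
  proof (rule log_deriv_times_vanishing)
    show "eventually (\<lambda>z. z - z0 \<noteq> 0) (at z0)"
      using eventually_neq_at_within[of z0 z0 UNIV] by simp
  qed (use assms in \<open>auto intro!: analytic_intros\<close>)
  then obtain \<phi> where \<phi>: "\<phi> analytic_on {z0}" "eventually (\<lambda>z. deriv (\<lambda>z. z - z0) z / (z - z0) * \<kappa> z = \<phi> z) (at z0)" by blast
  from \<phi>(2) eventually_neq_at_within[of z0 z0 UNIV] have "eventually (\<lambda>z. \<kappa> z = (z - z0) * \<phi> z) (at z0)"
  proof eventually_elim
    case (elim z)
    have "deriv (\<lambda>z. z - z0) z = 1" by (rule DERIV_imp_deriv) (auto intro!: derivative_eq_intros)
    then show ?case using elim(1)[symmetric] elim(2) by simp
  qed
  then show ?thesis using \<phi>(1) by blast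
qed

text \<open>
  This is the use made of sharing with weight two. The quotient by \<open>u v\<close> has a pole of order \<open>m + n\<close>,
  against which \<open>(u' v')\<^sup>2\<close> supplies a zero of order \<open>2 (m + n) - 4\<close>, so \<open>m + n - 4\<close> remains. If
  \<open>m \<noteq> n\<close>, the difference of the pre-Schwarzians has a simple pole, and \<open>m + n \<ge> 6\<close> compensates for
  its square. If \<open>m = n \<ge> 2\<close>, the poles cancel and \<open>m + n \<ge> 4\<close>. If \<open>m = n = 1\<close>, the difference even
  vanishes at the point.
\<close>
lemma weight_two_cancellation:
  fixes u v :: "complex \<Rightarrow> complex"
  assumes u: "u analytic_on {z0}" "eventually (\<lambda>z. u z \<noteq> 0) (at z0)" "u z0 = 0"
    and v: "v analytic_on {z0}" "eventually (\<lambda>z. v z \<noteq> 0) (at z0)" "v z0 = 0"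
    and mult: "zorder u z0 = zorder v z0 \<or> 3 \<le> zorder u z0 \<and> 3 \<le> zorder v z0"
  shows "\<exists>\<phi>. \<phi> analytic_on {z0} \<and> eventually (\<lambda>z. ((inv_pre_schwarzian u z - inv_pre_schwarzian v z) * deriv u z * deriv v z)\<^sup>2 / (u z * v z) = \<phi> z) (at z0)"
proof -
  define m where "m = nat (zorder u z0)"
  define n where "n = nat (zorder v z0)"
  obtain \<phi> \<phi>1 \<kappa> where A: "m \<ge> 1" "\<phi> analytic_on {z0}" "\<phi>1 analytic_on {z0}" "\<kappa> analytic_on {z0}" "\<phi> z0 \<noteq> 0"
    "eventually (\<lambda>z. u z = (z - z0) ^ m * \<phi> z \<and> deriv u z = (z - z0) ^ (m - 1) * \<phi>1 z \<and>
       (z - z0) * inv_pre_schwarzian u z = (z - z0) * \<kappa> z - (of_nat m + 1)) (at z0)"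
    "m = 1 \<Longrightarrow> \<kappa> z0 = 0"
    using inv_pre_schwarzian_expansion[OF u m_def] by blast
  obtain \<gamma> \<gamma>1 \<nu> where C: "n \<ge> 1" "\<gamma> analytic_on {z0}" "\<gamma>1 analytic_on {z0}" "\<nu> analytic_on {z0}" "\<gamma> z0 \<noteq> 0"
    "eventually (\<lambda>z. v z = (z - z0) ^ n * \<gamma> z \<and> deriv v z = (z - z0) ^ (n - 1) * \<gamma>1 z \<and>
       (z - z0) * inv_pre_schwarzian v z = (z - z0) * \<nu> z - (of_nat n + 1)) (at z0)"
    "n = 1 \<Longrightarrow> \<nu> z0 = 0"
    using inv_pre_schwarzian_expansion[OF v n_def] by blast
  have mn: "m = n \<or> 3 \<le> m \<and> 3 \<le> n" using mult by (auto simp: m_def n_def)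
  define \<delta> where "\<delta> z = \<kappa> z - \<nu> z" for z
  have \<delta>: "\<delta> analytic_on {z0}" unfolding \<delta>_def by (intro analytic_intros A C)
  have BB: "eventually (\<lambda>z. (z - z0) * (inv_pre_schwarzian u z - inv_pre_schwarzian v z) = (z - z0) * \<delta> z + (of_nat n - of_nat m)) (at z0)"
    using A(6) C(6)
  proof eventually_elim
    case (elim z)
    have a: "(z - z0) * inv_pre_schwarzian u z = (z - z0) * \<kappa> z - (of_nat m + 1)"
      and b: "(z - z0) * inv_pre_schwarzian v z = (z - z0) * \<nu> z - (of_nat n + 1)"
      using elim by blast+
    have "(z - z0) * (inv_pre_schwarzian u z - inv_pre_schwarzian v z) = (z - z0) * inv_pre_schwarzian u z - (z - z0) * inv_pre_schwarzian v z" by (rule right_diff_distrib)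
    also have "\<dots> = (z - z0) * \<delta> z + (of_nat n - of_nat m)"
      unfolding a b \<delta>_def by (simp add: right_diff_distrib)
    finally show ?case .
  qed
  \<comment> \<open>As \<open>(u' v')\<^sup>2 / (u v)\<close> is \<open>(z - z0) ^ (m + n - 2) / (z - z0)\<^sup>2\<close> times a unit, it remains to absorb the denominator.\<close>
  have "\<exists>\<eta>. \<eta> analytic_on {z0} \<and>
         eventually (\<lambda>z. (inv_pre_schwarzian u z - inv_pre_schwarzian v z)\<^sup>2 * (z - z0) ^ (m + n - 2) = (z - z0) ^ 2 * \<eta> z) (at z0)"
  proof (cases "m = n")
    case False
    then have mn3: "3 \<le> m" "3 \<le> n" using mn by auto
    have "eventually (\<lambda>z. (inv_pre_schwarzian u z - inv_pre_schwarzian v z)\<^sup>2 * (z - z0) ^ (m + n - 2) = (z - z0) ^ 2 * ((z - z0) ^ (m + n - 6) * ((z - z0) * \<delta> z + (of_nat n - of_nat m))\<^sup>2)) (at z0)"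
      using BB
    proof eventually_elim
      case (elim z)
      have "m + n - 2 = 2 + (2 + (m + n - 6))" using mn3 by simp
      then show ?case unfolding elim[symmetric]
        by (simp only: power_add power_mult_distrib power2_eq_square mult_ac)
    qed
    then show ?thesis
      using mn3 by (intro exI[of _ "\<lambda>z. (z - z0) ^ (m + n - 6) * ((z - z0) * \<delta> z + (of_nat n - of_nat m))\<^sup>2"] conjI analytic_intros \<delta>) auto
  next
    case True
    have B\<delta>: "eventually (\<lambda>z. inv_pre_schwarzian u z - inv_pre_schwarzian v z = \<delta> z) (at z0)"
      using BB eventually_neq_at_within[of z0 z0 UNIV] by eventually_elim (use True in auto)
    show ?thesis
    proof (cases "m = 1")
      case m1: True
      have "\<delta> z0 = 0" using A(7) C(7) m1 True by (simp add: \<delta>_def)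
      then obtain \<delta>' where \<delta>': "\<delta>' analytic_on {z0}" "eventually (\<lambda>z. \<delta> z = (z - z0) * \<delta>' z) (at z0)"
        using analytic_vanishing_factor[OF \<delta>] by blast
      have "eventually (\<lambda>z. (inv_pre_schwarzian u z - inv_pre_schwarzian v z)\<^sup>2 * (z - z0) ^ (m + n - 2) = (z - z0) ^ 2 * (\<delta>' z)\<^sup>2) (at z0)"
        using B\<delta> \<delta>'(2) by eventually_elim (use m1 True in \<open>simp add: power_mult_distrib\<close>)
      then show ?thesis using m1 True
        by (intro exI[of _ "\<lambda>z. (\<delta>' z)\<^sup>2"] conjI analytic_intros \<delta>') auto
    next
      case False
      then have m2: "m \<ge> 2" using A(1) by simp
      have "eventually (\<lambda>z. (inv_pre_schwarzian u z - inv_pre_schwarzian v z)\<^sup>2 * (z - z0) ^ (m + n - 2) = (z - z0) ^ 2 * ((z - z0) ^ (m + n - 4) * (\<delta> z)\<^sup>2)) (at z0)"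
        using B\<delta>
      proof eventually_elim
        case (elim z)
        have "m + n - 2 = 2 + (m + n - 4)" using m2 True by simp
        then show ?case unfolding elim by (simp only: power_add power2_eq_square mult_ac)
      qed
      then show ?thesis using m2 True
        by (intro exI[of _ "\<lambda>z. (z - z0) ^ (m + n - 4) * (\<delta> z)\<^sup>2"] conjI analytic_intros \<delta>) auto
    qed
  qed
  then obtain \<eta> where \<eta>: "\<eta> analytic_on {z0}"
    "eventually (\<lambda>z. (inv_pre_schwarzian u z - inv_pre_schwarzian v z)\<^sup>2 * (z - z0) ^ (m + n - 2) = (z - z0) ^ 2 * \<eta> z) (at z0)" by blast
  define \<Phi> where "\<Phi> z = \<eta> z * (\<phi>1 z)\<^sup>2 * (\<gamma>1 z)\<^sup>2 / (\<phi> z * \<gamma> z)" for z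
  have "\<Phi> analytic_on {z0}" unfolding \<Phi>_def using A C by (intro analytic_intros \<eta>) auto
  moreover have "eventually (\<lambda>z. ((inv_pre_schwarzian u z - inv_pre_schwarzian v z) * deriv u z * deriv v z)\<^sup>2 / (u z * v z) = \<Phi> z) (at z0)"
    using A(6) C(6) \<eta>(2) eventually_neq_at_within[of z0 z0 UNIV]
      eventually_nhds_imp_at[OF eventually_nhds_nonzero[OF A(2,5)]] eventually_nhds_imp_at[OF eventually_nhds_nonzero[OF C(2,5)]]
  proof eventually_elim
    case (elim z)
    define \<zeta> where "\<zeta> = z - z0"
    have \<zeta>: "\<zeta> \<noteq> 0" using elim by (simp add: \<zeta>_def)
    define T where "T = inv_pre_schwarzian u z - inv_pre_schwarzian v z"
    have T: "T\<^sup>2 * \<zeta> ^ (m + n - 2) = \<zeta> ^ 2 * \<eta> z" using elim(3) by (simp add: T_def \<zeta>_def)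
    obtain m' n' where mn': "m = Suc m'" "n = Suc n'" using A(1) C(1) by (metis Suc_le_D One_nat_def)
    have T': "T\<^sup>2 * (\<zeta> ^ m' * \<zeta> ^ n') = \<zeta> * \<zeta> * \<eta> z" using T by (simp add: mn' power_add power2_eq_square)
    have "(T * deriv u z * deriv v z)\<^sup>2 / (u z * v z)
        = (T * (\<zeta> ^ m' * \<phi>1 z) * (\<zeta> ^ n' * \<gamma>1 z))\<^sup>2 / ((\<zeta> * \<zeta> ^ m' * \<phi> z) * (\<zeta> * \<zeta> ^ n' * \<gamma> z))"
      using elim(1,2) by (simp add: mn' \<zeta>_def)
    also have "\<dots> = (T\<^sup>2 * (\<zeta> ^ m' * \<zeta> ^ n')) * ((\<zeta> ^ m' * \<zeta> ^ n') * (\<phi>1 z)\<^sup>2 * (\<gamma>1 z)\<^sup>2) / ((\<zeta> * \<zeta>) * (\<zeta> ^ m' * \<zeta> ^ n') * (\<phi> z * \<gamma> z))"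
      by (simp add: power_mult_distrib power2_eq_square mult_ac)
    also have "\<dots> = \<Phi> z"
    proof -
      define \<omega> where "\<omega> = \<zeta> ^ m' * \<zeta> ^ n'"
      have "\<omega> \<noteq> 0" using \<zeta> by (simp add: \<omega>_def)
      moreover have "T\<^sup>2 * \<omega> = \<zeta> * \<zeta> * \<eta> z" using T' by (simp only: \<omega>_def)
      ultimately show ?thesis unfolding \<omega>_def[symmetric] \<Phi>_def using \<zeta> elim(5,6) by (simp add: field_simps)
    qed
    finally show ?case by (simp add: T_def)
  qed
  ultimately show ?thesis by blast
qed

section \<open>Polynomial estimates\<close>

text \<open>
  At most one point of \<open>S\<close> is close to \<open>w\<close>; its distance cancels against the corresponding summand
  \<open>1 / \<bar>w - a\<bar>\<close>, and the other \<open>card S - 1\<close> distances are comparable with \<open>1 + \<bar>w\<bar>\<close>. Multiplied by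
  \<open>\<bar>f'\<bar>\<close> at \<open>w = f z\<close>, the sum becomes a sum of logarithmic derivatives; losing a single power of
  \<open>1 + \<bar>w\<bar>\<close> corresponds to the second main theorem for the values in \<open>S\<close> and \<open>\<infinity>\<close>.
\<close>
lemma prod_distances_lower_bound:
  fixes S :: "complex set"
  assumes S: "finite S" "S \<noteq> {}"
  shows "\<exists>C>0. \<forall>w. w \<notin> S \<longrightarrow> (1 + norm w) ^ (card S - 1) \<le> C * (\<Prod>a\<in>S. norm (w - a)) * (\<Sum>a\<in>S. 1 / norm (w - a))"
proof -
  obtain \<delta> where \<delta>: "\<delta> > 0" "\<And>a b. a \<in> S \<Longrightarrow> b \<in> S \<Longrightarrow> a \<noteq> b \<Longrightarrow> 2 * \<delta> \<le> norm (a - b)"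
  proof -
    have "\<exists>d>0. \<forall>b\<in>S. b \<noteq> a \<longrightarrow> d \<le> dist a b" for a using finite_set_avoid[OF S(1), of a] by blast
    then obtain d where d: "\<And>a. d a > 0" "\<And>a b. b \<in> S \<Longrightarrow> b \<noteq> a \<Longrightarrow> d a \<le> dist a b" by metis
    define m where "m = Min (d ` S)"
    have "m > 0" using S d(1) by (simp add: m_def)
    moreover have "m \<le> norm (a - b)" if "a \<in> S" "b \<in> S" "a \<noteq> b" for a b
    proof -
      have "m \<le> d a" unfolding m_def using S(1) that(1) by (intro Min_le finite_imageI imageI)
      also have "\<dots> \<le> dist a b" using d(2)[OF that(2), of a] that(3) by simp
      finally show ?thesis by (simp add: dist_norm)
    qed
    ultimately show ?thesis using that[of "m / 2"] by simp
  qed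
  define K where "K = (\<Sum>a\<in>S. (1 + norm a) / \<delta> + 1)"
  have K1: "(1 + norm a) / \<delta> + 1 \<le> K" if "a \<in> S" for a
    unfolding K_def using that S \<delta>(1) by (intro member_le_sum[of a S "\<lambda>a. (1 + norm a) / \<delta> + 1"]) auto
  have K0: "K > 0"
  proof -
    obtain a where "a \<in> S" using S by blast
    then have "(1 + norm a) / \<delta> + 1 \<le> K" by (rule K1)
    moreover have "(1 + norm a) / \<delta> + 1 > 0" using \<delta>(1) by (intro add_nonneg_pos) auto
    ultimately show ?thesis by linarith
  qed
  have far: "1 + norm w \<le> K * norm (w - a)" if "a \<in> S" "\<delta> \<le> norm (w - a)" for w a
  proof -
    have "norm w \<le> norm a + norm (w - a)" using norm_triangle_ineq2[of w a] by linarith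
    moreover have "(1 + norm a) * 1 \<le> (1 + norm a) * (norm (w - a) / \<delta>)"
      using that(2) \<delta>(1) by (intro mult_left_mono) (auto simp: field_simps)
    ultimately have "1 + norm w \<le> ((1 + norm a) / \<delta> + 1) * norm (w - a)" by (simp add: algebra_simps)
    also have "\<dots> \<le> K * norm (w - a)" using K1[OF that(1)] by (intro mult_right_mono) auto
    finally show ?thesis .
  qed
  show ?thesis
  proof (rule exI[of _ "K ^ (card S - 1)"], intro conjI allI impI)
    show "K ^ (card S - 1) > 0" using K0 by simp
    fix w assume w: "w \<notin> S"
    obtain a0 where a0: "a0 \<in> S" "\<And>a. a \<in> S \<Longrightarrow> a \<noteq> a0 \<Longrightarrow> \<delta> \<le> norm (w - a)"
    proof (cases "\<exists>a\<in>S. norm (w - a) < \<delta>")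
      case True
      then obtain a0 where a0: "a0 \<in> S" "norm (w - a0) < \<delta>" by blast
      have "\<delta> \<le> norm (w - a)" if "a \<in> S" "a \<noteq> a0" for a
        using \<delta>(2)[OF a0(1) that(1)] that(2) a0(2) norm_triangle_ineq4[of "w - a" "w - a0"] by fastforce
      then show ?thesis using that a0(1) by blast
    next
      case False
      then show ?thesis using that S by (metis ex_in_conv not_le)
    qed
    have pos: "norm (w - a0) > 0" using a0(1) w by auto
    have "(1 + norm w) ^ (card S - 1) = (\<Prod>a\<in>S - {a0}. 1 + norm w)"
      using S a0(1) by simp
    also have "\<dots> \<le> (\<Prod>a\<in>S - {a0}. K * norm (w - a))"
      using far a0 by (intro prod_mono) auto
    also have "\<dots> = K ^ (card S - 1) * (\<Prod>a\<in>S - {a0}. norm (w - a))"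
      using S a0(1) by (simp add: prod.distrib)
    also have "(\<Prod>a\<in>S - {a0}. norm (w - a)) = (\<Prod>a\<in>S. norm (w - a)) * (1 / norm (w - a0))"
      using pos by (subst prod.remove[OF S(1) a0(1)]) simp
    also have "\<dots> \<le> (\<Prod>a\<in>S. norm (w - a)) * (\<Sum>a\<in>S. 1 / norm (w - a))"
      using S(1) a0(1) by (intro mult_left_mono member_le_sum[of a0 S "\<lambda>a. 1 / norm (w - a)"] prod_nonneg) auto
    finally show "(1 + norm w) ^ (card S - 1) \<le> K ^ (card S - 1) * (\<Prod>a\<in>S. norm (w - a)) * (\<Sum>a\<in>S. 1 / norm (w - a))"
      using K0 by (simp add: mult.assoc)
  qed
qed

lemma prod_distances_upper_bound:
  "(\<Prod>a\<in>S. norm (w - a)) \<le> (\<Prod>a\<in>S. 1 + norm a) * (1 + norm (w::complex)) ^ card S"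
proof -
  have "norm (w - a) \<le> (1 + norm a) * (1 + norm w)" for a
  proof -
    have "(1 + norm a) * (1 + norm w) = 1 + norm a + norm w + norm a * norm w" by (simp add: algebra_simps)
    moreover have "0 \<le> norm a * norm w" by simp
    ultimately show ?thesis using norm_triangle_ineq4[of w a] by linarith
  qed
  then have "(\<Prod>a\<in>S. norm (w - a)) \<le> (\<Prod>a\<in>S. (1 + norm a) * (1 + norm w))" by (intro prod_mono) auto
  then show ?thesis by (simp add: prod.distrib)
qed

lemma poly_norm_upper: "\<exists>C>0. \<forall>w::complex. norm (poly p w) \<le> C * (1 + norm w) ^ degree p"
proof (intro exI[of _ "1 + (\<Sum>i\<le>degree p. norm (coeff p i))"] conjI allI)
  have s: "0 \<le> (\<Sum>i\<le>degree p. norm (coeff p i))" by (intro sum_nonneg) auto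
  then show "0 < 1 + (\<Sum>i\<le>degree p. norm (coeff p i))" by linarith
  fix w :: complex
  have "norm (poly p w) \<le> (\<Sum>i\<le>degree p. norm (coeff p i * w ^ i))"
    unfolding poly_altdef by (rule norm_sum)
  also have "\<dots> \<le> (\<Sum>i\<le>degree p. norm (coeff p i) * (1 + norm w) ^ degree p)"
  proof (rule sum_mono)
    fix i assume i: "i \<in> {..degree p}"
    have "norm w ^ i \<le> (1 + norm w) ^ i" by (intro power_mono) auto
    also have "\<dots> \<le> (1 + norm w) ^ degree p" using i by (intro power_increasing) auto
    finally show "norm (coeff p i * w ^ i) \<le> norm (coeff p i) * (1 + norm w) ^ degree p"
      by (simp add: norm_mult norm_power mult_left_mono)
  qed
  also have "\<dots> \<le> (1 + (\<Sum>i\<le>degree p. norm (coeff p i))) * (1 + norm w) ^ degree p"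
    by (simp add: sum_distrib_right[symmetric] distrib_right)
  finally show "norm (poly p w) \<le> (1 + (\<Sum>i\<le>degree p. norm (coeff p i))) * (1 + norm w) ^ degree p" .
qed

lemma poly_norm_lower:
  assumes "p \<noteq> (0::complex poly)"
  shows "\<exists>C>0. \<forall>w. (1 + norm w) ^ degree p \<le> C * (1 + norm (poly p w))"
proof -
  define l where "l = norm (lead_coeff p)"
  define n where "n = degree p"
  have l: "l > 0" using assms by (simp add: l_def)
  have "((\<lambda>x. poly p x / x ^ degree p) \<longlongrightarrow> lead_coeff p) at_infinity" by (rule poly_divide_tendsto_aux)
  from tendstoD[OF tendsto_norm[OF this], of "l / 2"] l
  obtain b where b: "\<And>x. b \<le> norm x \<Longrightarrow> dist (norm (poly p x / x ^ n)) l < l / 2"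
    unfolding eventually_at_infinity l_def n_def by auto
  define B where "B = max b 1"
  define C where "C = (1 + B) ^ n + 2 ^ n * 2 / l"
  have B1: "B \<ge> 1" by (simp add: B_def)
  have "(1 + norm w) ^ n \<le> C * (1 + norm (poly p w))" for w
  proof (cases "norm w \<le> B")
    case True
    have "(1 + norm w) ^ n * 1 \<le> (1 + B) ^ n * (1 + norm (poly p w))"
      using True B1 by (intro mult_mono power_mono) auto
    also have "\<dots> \<le> C * (1 + norm (poly p w))" unfolding C_def using l by (intro mult_right_mono) auto
    finally show ?thesis by simp
  next
    case False
    have w1: "norm w \<ge> 1" "norm w \<ge> b" using False by (auto simp: B_def)
    have "l / 2 \<le> norm (poly p w / w ^ n)" using b[OF w1(2)] by (simp add: dist_real_def abs_if split: if_splits)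
    moreover have "norm w ^ n > 0" using w1 by (intro zero_less_power) linarith
    ultimately have "l / 2 * norm w ^ n \<le> norm (poly p w)" by (simp add: norm_divide norm_power field_simps)
    then have lw: "norm w ^ n \<le> 2 / l * norm (poly p w)" using l by (simp add: field_simps)
    have "(1 + norm w) ^ n \<le> (2 * norm w) ^ n" using w1 by (intro power_mono) auto
    also have "\<dots> = 2 ^ n * norm w ^ n" by (simp add: power_mult_distrib)
    also have "\<dots> \<le> 2 ^ n * (2 / l * norm (poly p w))" using lw by (intro mult_left_mono) auto
    also have "\<dots> \<le> C * (1 + norm (poly p w))"
    proof -
      have "2 ^ n * (2 / l * norm (poly p w)) \<le> (2 ^ n * 2 / l) * (1 + norm (poly p w))"
        using l by (simp add: divide_right_mono)
      also have "\<dots> \<le> C * (1 + norm (poly p w))" unfolding C_def using B1 by (intro mult_right_mono) auto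
      finally show ?thesis .
    qed
    finally show ?thesis .
  qed
  moreover have "C > 0" unfolding C_def using l B1 by (intro add_pos_pos) auto
  ultimately show ?thesis by (auto simp: n_def)
qed

section \<open>Functions analytic off a finite set\<close>

lemma analytic_on_poly_compose [analytic_intros]:
  "f analytic_on A \<Longrightarrow> (\<lambda>z. poly p (f z)) analytic_on A"
  by (induction p) (auto intro!: analytic_intros)

lemma meromorphic_on_poly_compose [meromorphic_intros]:
  "f meromorphic_on A \<Longrightarrow> (\<lambda>z. poly p (f z)) meromorphic_on A"
  by (induction p) (auto intro!: meromorphic_intros)

lemma deriv_poly_compose:
  assumes "f analytic_on {z}"
  shows "deriv (\<lambda>z. poly p (f z)) z = poly (pderiv p) (f z) * deriv f z"
  by (rule DERIV_imp_deriv, rule DERIV_chain2[OF poly_DERIV analytic_has_deriv[OF assms]])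

lemma deriv_diff_const: "f analytic_on {z} \<Longrightarrow> deriv (\<lambda>z. f z - c) z = deriv f z"
  by (simp add: analytic_on_imp_differentiable_at)

lemma M1_meromorphic: "f \<in> M1 \<Longrightarrow> f meromorphic_on A"
  using M1_nicely_meromorphic[of f] unfolding nicely_meromorphic_on_def by (meson meromorphic_on_subset subset_UNIV)

lemma cofinite_open_connected:
  assumes "finite (X :: complex set)"
  shows "open (- X)" "connected (- X)"
proof -
  show "open (- X)" using assms by (simp add: finite_imp_closed open_Compl)
  have "connected (UNIV - X)"
    by (rule connected_open_diff_countable) (use assms countable_finite in auto)
  then show "connected (- X)" by (simp add: Compl_eq_Diff_UNIV)
qed

lemma eventually_nonzero_cofinite:
  assumes X: "finite X" and h: "h holomorphic_on (- X)" and w: "w \<notin> X" "h w \<noteq> 0" and z: "z \<notin> X"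
  shows "eventually (\<lambda>z. h z \<noteq> (0::complex)) (at z)"
proof (cases "h z = 0")
  case True
  obtain r where r: "r > 0" "\<And>x. x \<in> ball z r - {z} \<Longrightarrow> h x \<noteq> 0"
    using isolated_zeros[OF h cofinite_open_connected[OF X], of z w] True w z by (metis ComplI)
  have "eventually (\<lambda>x. x \<in> ball z r - {z}) (at z)" using r(1) by (intro eventually_at_in_open) auto
  then show ?thesis by (rule eventually_mono) (use r in auto)
next
  case False
  have "h analytic_on {z}" using h z cofinite_open_connected(1)[OF X] holomorphic_on_imp_analytic_at by (metis ComplI)
  from eventually_nhds_imp_at[OF eventually_nhds_nonzero[OF this False]] show ?thesis .
qed

lemma eventually_cofinite_at: "finite X \<Longrightarrow> eventually (\<lambda>w. w \<notin> X) (at (z::complex))"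
  using islimpt_finite islimpt_iff_eventually by blast

lemma analytic_cofinite_holomorphic:
  "(\<And>z. z \<notin> X \<Longrightarrow> h analytic_on {z}) \<Longrightarrow> h holomorphic_on (- X)"
  by (meson ComplD analytic_imp_holomorphic analytic_on_analytic_at)

lemma deriv_nonzero_not_const:
  fixes h :: "complex \<Rightarrow> complex"
  assumes X: "finite X" and w: "w \<notin> X" "deriv h w \<noteq> 0"
  shows "\<exists>z. z \<notin> X \<and> h z \<noteq> c"
proof (rule ccontr)
  assume "\<not> ?thesis"
  then have c: "h z = c" if "z \<notin> X" for z using that by blast
  have "eventually (\<lambda>z. z \<in> - X) (nhds w)"
    using w cofinite_open_connected(1)[OF X] by (intro eventually_nhds_in_open) auto
  then have "eventually (\<lambda>z. h z = c) (nhds w)" by (rule eventually_mono) (use c in auto)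
  then have "deriv h w = deriv (\<lambda>_. c) w" by (rule deriv_cong_ev) simp
  then show False using w by simp
qed

lemma M1_eqI:
  assumes f: "f \<in> M1" and g: "g \<in> M1" and X: "finite X" and eq: "\<And>z. z \<notin> X \<Longrightarrow> f z = g z"
  shows "f = g"
proof
  fix z
  have ev: "eventually (\<lambda>w. f w = g w) (at z)"
    using eventually_cofinite_at[OF X] by (rule eventually_mono) (use eq in auto)
  have pole: "is_pole f z \<longleftrightarrow> is_pole g z" using ev by (rule is_pole_cong) simp
  have fn: "is_pole f z \<and> f z = 0 \<or> f \<midarrow>z\<rightarrow> f z" and gn: "is_pole g z \<and> g z = 0 \<or> g \<midarrow>z\<rightarrow> g z"
    using M1_nicely_meromorphic f g unfolding nicely_meromorphic_on_def by blast+
  show "f z = g z"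
  proof (cases "is_pole f z")
    case True
    have "\<not> f \<midarrow>z\<rightarrow> c" "\<not> g \<midarrow>z\<rightarrow> c" for c
      using True pole not_tendsto_and_filterlim_at_infinity[OF at_neq_bot] unfolding is_pole_def by blast+
    then show ?thesis using fn gn by auto
  next
    case False
    then have "f \<midarrow>z\<rightarrow> f z" "g \<midarrow>z\<rightarrow> g z" using fn gn pole by auto
    moreover from this(1) have "g \<midarrow>z\<rightarrow> f z" by (rule Lim_transform_eventually) (rule ev)
    ultimately show ?thesis using tendsto_unique[OF at_neq_bot] by blast
  qed
qed

lemma M1_const: "(\<lambda>_. c) \<in> M1"
proof -
  have "{z::complex. is_pole (\<lambda>_. c) z} = {}" using not_is_pole_const by blast
  then have "finite {z::complex. is_pole (\<lambda>_. c) z}" by (simp only: finite.emptyI)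
  then show ?thesis unfolding M1_def using nicely_meromorphic_on_const by blast
qed

lemma M1_nonconst_deriv:
  assumes f: "f \<in> M1" and X: "finite X" "\<And>z. is_pole f z \<Longrightarrow> z \<in> X" and nc: "\<And>c. \<exists>z. f z \<noteq> c"
  shows "\<exists>w. w \<notin> X \<and> deriv f w \<noteq> 0"
proof (rule ccontr)
  assume neg: "\<not> ?thesis"
  have an: "f analytic_on {z}" if "z \<notin> X" for z using M1_analytic[OF f] X(2) that by blast
  have "\<forall>z\<in>- X - {}. DERIV f z :> 0"
    using analytic_has_deriv[OF an] neg by (metis ComplD DiffD1)
  then obtain c where c: "\<And>z. z \<in> - X \<Longrightarrow> f z = c"
    using DERIV_zero_connected_constant[OF cofinite_open_connected(2,1)[OF X(1)] finite.emptyI, of f]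
      holomorphic_on_imp_continuous_on[OF analytic_cofinite_holomorphic[OF an]] by metis
  have "f = (\<lambda>_. c)" by (rule M1_eqI[OF f M1_const X(1)]) (use c in auto)
  then show False using nc[of c] by auto
qed

section \<open>Auxiliary functions\<close>

text \<open>
  The version for auxiliary functions given by a formula, which is undefined at certain points off \<open>X\<close>
  where the singularity is removable.
\<close>
lemma order_0_criterion_removable:
  assumes f: "f \<in> M1" and g: "g \<in> M1" and X: "finite X" "\<And>z. is_pole f z \<Longrightarrow> z \<in> X" "\<And>z. is_pole g z \<Longrightarrow> z \<in> X"
    and hs: "finite hs" "\<And>h M. h \<in> hs \<Longrightarrow> growth_scale M \<Longrightarrow> tame M X f \<Longrightarrow> tame M X g \<Longrightarrow> tame M X h"
    and \<Psi>: "\<Psi> meromorphic_on UNIV" "\<And>z0. z0 \<notin> X \<Longrightarrow> \<exists>\<phi>. \<phi> analytic_on {z0} \<and> eventually (\<lambda>z. \<Psi> z = \<phi> z) (at z0)"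
      "\<And>z. z \<notin> X \<Longrightarrow> (\<And>h. h \<in> hs \<Longrightarrow> h z \<noteq> 0) \<Longrightarrow> \<Psi> analytic_on {z}"
    and w: "w \<notin> X" "\<And>h. h \<in> hs \<Longrightarrow> h w \<noteq> 0" "\<Psi> w \<noteq> 0"
    and bound: "\<And>z. z \<notin> X \<Longrightarrow> (\<And>h. h \<in> hs \<Longrightarrow> h z \<noteq> 0) \<Longrightarrow>
      norm (\<Psi> z) * (1 + norm (f z) + norm (g z)) \<le> C * (1 + (\<Sum>h\<in>hs. norm (deriv h z / h z))) ^ N"
  shows "nevanlinna_order f = 0"
proof (rule order_0_criterion[OF f g X hs])
  show "\<exists>z. z \<notin> X \<and> h z \<noteq> 0" if "h \<in> hs" for h using w that by blast
  show "remove_sings \<Psi> meromorphic_on UNIV" using \<Psi>(1) by (rule remove_sings_meromorphic)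
  show "remove_sings \<Psi> analytic_on {z0}" if z0: "z0 \<notin> X" for z0
  proof -
    obtain \<phi> where \<phi>: "\<phi> analytic_on {z0}" "eventually (\<lambda>z. \<Psi> z = \<phi> z) (at z0)" using \<Psi>(2)[OF z0] by blast
    have "\<phi> \<midarrow>z0\<rightarrow> \<phi> z0" using \<phi>(1) analytic_at_imp_isCont isContD by blast
    then have "\<Psi> \<midarrow>z0\<rightarrow> \<phi> z0"
      by (rule Lim_transform_eventually) (use \<phi>(2) in \<open>auto elim: eventually_mono\<close>)
    moreover have "isolated_singularity_at \<Psi> z0" using \<Psi>(1) unfolding meromorphic_on_altdef by blast
    ultimately show ?thesis by (rule remove_sings_analytic_at[rotated])
  qed
  have eq: "remove_sings \<Psi> z = \<Psi> z" if "z \<notin> X" "\<And>h. h \<in> hs \<Longrightarrow> h z \<noteq> 0" for z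
    using \<Psi>(3)[of z] that by simp
  show "w \<notin> X" "remove_sings \<Psi> w \<noteq> 0" using w eq[of w] by auto
  show "norm (remove_sings \<Psi> z) * (1 + norm (f z) + norm (g z)) \<le> C * (1 + (\<Sum>h\<in>hs. norm (deriv h z / h z))) ^ N"
    if "z \<notin> X" "\<And>h. h \<in> hs \<Longrightarrow> h z \<noteq> 0" for z
    using bound[of z] eq[of z] that by simp
qed

lemma tame_diff_const: "growth_scale M \<Longrightarrow> tame M X h \<Longrightarrow> tame M X (\<lambda>z. h z - c)"
  using tame_add[of M X h "\<lambda>_. - c"] tame_const[of M X "- c"] by simp

text \<open>
  Picard's theorem in the form needed here, with the auxiliary function \<open>f' / (\<Prod>a\<in>S. f - a)\<close>, which
  has no poles off \<open>X\<close>.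
\<close>
lemma omits_two_values_order_0:
  assumes f: "f \<in> M1" and X: "finite X" "\<And>z. is_pole f z \<Longrightarrow> z \<in> X" and w: "w \<notin> X" "deriv f w \<noteq> 0"
    and S: "finite S" "2 \<le> card S" "\<And>z. z \<notin> X \<Longrightarrow> f z \<notin> S"
  shows "nevanlinna_order f = 0"
proof -
  define hs where "hs = (\<lambda>a z. f z - a) ` S"
  define \<Psi> where "\<Psi> z = deriv f z / (\<Prod>a\<in>S. f z - a)" for z
  have an: "f analytic_on {z}" if "z \<notin> X" for z using M1_analytic[OF f] X(2) that by blast
  have nz: "(\<Prod>a\<in>S. f z - a) \<noteq> 0" if "z \<notin> X" for z
    using S(1) S(3)[OF that] by auto
  have \<Psi>an: "\<Psi> analytic_on {z}" if "z \<notin> X" for z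
    unfolding \<Psi>_def using nz[OF that] by (intro analytic_intros an that) auto
  have Sne: "S \<noteq> {}" using S by auto
  obtain C where C: "C > 0" "\<And>w. w \<notin> S \<Longrightarrow> (1 + norm w) ^ (card S - 1) \<le> C * (\<Prod>a\<in>S. norm (w - a)) * (\<Sum>a\<in>S. 1 / norm (w - a))"
    using prod_distances_lower_bound[OF S(1) Sne] by blast
  have inj: "inj_on (\<lambda>a z. f z - a) S" by (auto simp: inj_on_def fun_eq_iff)
  show ?thesis
  proof (rule order_0_criterion_removable[OF f f X X(2)])
    show "finite hs" using S by (simp add: hs_def)
    show "tame M X h" if "h \<in> hs" "growth_scale M" "tame M X f" for h M
      using that by (auto simp: hs_def intro: tame_diff_const)
    show "\<Psi> meromorphic_on UNIV" unfolding \<Psi>_def by (intro meromorphic_intros M1_meromorphic f)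
    show "\<exists>\<phi>. \<phi> analytic_on {z0} \<and> eventually (\<lambda>z. \<Psi> z = \<phi> z) (at z0)" if "z0 \<notin> X" for z0
      using \<Psi>an[OF that] by auto
    show "\<Psi> analytic_on {z}" if "z \<notin> X" for z by (rule \<Psi>an[OF that])
    show "w \<notin> X" by (rule w)
    show "\<Psi> w \<noteq> 0" using w nz[OF w(1)] by (simp add: \<Psi>_def)
    show "h w \<noteq> 0" if "h \<in> hs" for h using that S(3)[OF w(1)] by (auto simp: hs_def)
    show "norm (\<Psi> z) * (1 + norm (f z) + norm (f z)) \<le> (2 * C) * (1 + (\<Sum>h\<in>hs. norm (deriv h z / h z))) ^ 1"
      if z: "z \<notin> X" for z
    proof -
      define p where "p = (\<Prod>a\<in>S. norm (f z - a))"
      have p: "p > 0" unfolding p_def using S(3)[OF z] by (intro prod_pos) auto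
      have "1 + norm (f z) \<le> (1 + norm (f z)) ^ (card S - 1)"
        using S(2) by (intro self_le_power) auto
      also have "\<dots> \<le> C * p * (\<Sum>a\<in>S. 1 / norm (f z - a))" unfolding p_def by (rule C(2)[OF S(3)[OF z]])
      finally have le: "1 + norm (f z) \<le> C * p * (\<Sum>a\<in>S. 1 / norm (f z - a))" .
      have "norm (\<Psi> z) = norm (deriv f z) / p" by (simp add: \<Psi>_def p_def norm_divide prod_norm)
      then have "norm (\<Psi> z) * (1 + norm (f z) + norm (f z)) \<le> norm (deriv f z) / p * (2 * (1 + norm (f z)))"
        using p by (intro mult_mono) auto
      also have "\<dots> \<le> norm (deriv f z) / p * (2 * (C * p * (\<Sum>a\<in>S. 1 / norm (f z - a))))"
        using le p by (intro mult_left_mono) auto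
      also have "\<dots> = 2 * C * (\<Sum>a\<in>S. norm (deriv f z) / norm (f z - a))"
        using p by (simp add: sum_distrib_left mult_ac)
      also have "(\<Sum>a\<in>S. norm (deriv f z) / norm (f z - a)) = (\<Sum>h\<in>hs. norm (deriv h z / h z))"
        unfolding hs_def sum.reindex[OF inj] o_def
        by (intro sum.cong refl) (simp add: norm_divide deriv_diff_const[OF an[OF z]])
      also have "2 * C * (\<Sum>h\<in>hs. norm (deriv h z / h z)) \<le> 2 * C * (1 + (\<Sum>h\<in>hs. norm (deriv h z / h z))) ^ 1"
        using C(1) by simp
      finally show ?thesis .
    qed
  qed
qed

text \<open>
  Outside a bounded set both sides of the equation are comparable with the \<open>degree P\<close>-th powers of the norms.
\<close>
lemma poly_values_comparable:
  assumes P: "degree P > 0" and a: "a \<noteq> 0"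
  shows "\<exists>C\<ge>1. \<forall>x y. poly P x = a * poly P y + b \<longrightarrow> 1 + norm y \<le> C * (1 + norm (x::complex))"
proof -
  have P0: "P \<noteq> 0" using P by auto
  define n where "n = degree P"
  obtain C1 where C1: "C1 > 0" "\<And>w. (1 + norm w) ^ n \<le> C1 * (1 + norm (poly P w))"
    using poly_norm_lower[OF P0] by (auto simp: n_def)
  obtain C2 where C2: "C2 > 0" "\<And>w. norm (poly P w) \<le> C2 * (1 + norm w) ^ n"
    using poly_norm_upper[of P] by (auto simp: n_def)
  define C where "C = 1 + C1 * (1 + (C2 + norm b) / norm a)"
  have C: "C \<ge> 1" using C1 C2 by (simp add: C_def)
  have "1 + norm y \<le> C * (1 + norm x)" if e: "poly P x = a * poly P y + b" for x y
  proof -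
    have "norm (poly P y) = norm (poly P x - b) / norm a" using e a by (simp add: norm_mult)
    also have "\<dots> \<le> (norm (poly P x) + norm b) / norm a" using norm_triangle_ineq4 by (intro divide_right_mono) auto
    also have "\<dots> \<le> (C2 * (1 + norm x) ^ n + norm b * (1 + norm x) ^ n) / norm a"
    proof (intro divide_right_mono add_mono C2)
      have "norm b * 1 \<le> norm b * (1 + norm x) ^ n" by (intro mult_left_mono one_le_power) auto
      then show "norm b \<le> norm b * (1 + norm x) ^ n" by simp
    qed auto
    finally have "norm (poly P y) \<le> (C2 + norm b) / norm a * (1 + norm x) ^ n" by (simp add: distrib_right)
    moreover have "1 \<le> (1 + norm x) ^ n" by (intro one_le_power) auto
    moreover have "(1 + (C2 + norm b) / norm a) * (1 + norm x) ^ n = (1 + norm x) ^ n + (C2 + norm b) / norm a * (1 + norm x) ^ n"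
      by (simp only: distrib_right mult_1)
    ultimately have "1 + norm (poly P y) \<le> (1 + (C2 + norm b) / norm a) * (1 + norm x) ^ n" by linarith
    then have "C1 * (1 + norm (poly P y)) \<le> C1 * ((1 + (C2 + norm b) / norm a) * (1 + norm x) ^ n)"
      using C1 by (intro mult_left_mono) auto
    then have "(1 + norm y) ^ n \<le> C1 * ((1 + (C2 + norm b) / norm a) * (1 + norm x) ^ n)"
      using C1(2)[of y] by linarith
    also have "\<dots> = (C1 * (1 + (C2 + norm b) / norm a)) * (1 + norm x) ^ n" by (simp only: mult.assoc)
    also have "\<dots> \<le> C * (1 + norm x) ^ n" unfolding C_def by (intro mult_right_mono) auto
    also have "\<dots> \<le> C ^ n * (1 + norm x) ^ n"
      using C P by (intro mult_right_mono self_le_power) (auto simp: n_def)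
    also have "\<dots> = (C * (1 + norm x)) ^ n" by (simp add: power_mult_distrib)
    finally show ?thesis
      by (rule power_le_imp_le_base[of _ "n - 1" , unfolded Suc_pred'[OF P[folded n_def], symmetric]]) (use C in auto)
  qed
  then show ?thesis using C by blast
qed

text \<open>
  The functions \<open>P \<circ> f\<close> and \<open>P \<circ> g\<close> have the same growth, and both 0 and \<open>b\<close> are values that \<open>F = P \<circ> f\<close>
  takes only where \<open>f\<close> or \<open>g\<close> is one of the few zeros of \<open>P\<close>. Hence \<open>F' / (F (F - b))\<close>, which has simple poles
  there, becomes pole-free after multiplication by the product \<open>\<tau>\<close> of all \<open>f - r\<close> and \<open>g - r\<close>. The
  degree of \<open>\<tau>\<close>, with one more factor \<open>1 + \<bar>f\<bar> + \<bar>g\<bar>\<close>, does not exceed the degree of \<open>P\<close>.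
\<close>
lemma affinely_related_order_0:
  assumes f: "f \<in> M1" and g: "g \<in> M1" and X: "finite X" "\<And>z. is_pole f z \<Longrightarrow> z \<in> X" "\<And>z. is_pole g z \<Longrightarrow> z \<in> X"
    and P: "2 * card {w. poly P w = 0} < degree P" and ab: "a \<noteq> 0" "b \<noteq> 0"
    and rel: "\<And>z. z \<notin> X \<Longrightarrow> poly P (f z) = a * poly P (g z) + b"
    and w: "w \<notin> X" "deriv (\<lambda>z. poly P (f z)) w \<noteq> 0"
  shows "nevanlinna_order f = 0"
proof -
  define R where "R = {w. poly P w = 0}"
  define F where "F z = poly P (f z)" for z
  define hs where "hs = {F, \<lambda>z. F z - b}"
  define \<tau> where "\<tau> z = (\<Prod>r\<in>R. f z - r) * (\<Prod>r\<in>R. g z - r)" for z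
  define \<Psi> where "\<Psi> z = \<tau> z * (deriv F z / (F z * (F z - b)))" for z
  have P0: "P \<noteq> 0" using P by auto
  have R: "finite R" unfolding R_def using poly_roots_finite[OF P0] .
  have fan: "f analytic_on {z}" and gan: "g analytic_on {z}" if "z \<notin> X" for z
    using M1_analytic[OF f] M1_analytic[OF g] X that by blast+
  have Fan: "F analytic_on {z}" if "z \<notin> X" for z
    unfolding F_def by (intro analytic_intros fan that)
  have \<tau>an: "\<tau> analytic_on {z}" if "z \<notin> X" for z
    unfolding \<tau>_def by (intro analytic_intros fan gan that)
  have dF: "deriv (\<lambda>z. F z - b) z = deriv F z" if "z \<notin> X" for z
    by (rule deriv_diff_const[OF Fan[OF that]])
  have Fhol: "F holomorphic_on - X" using analytic_cofinite_holomorphic[OF Fan] .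
  have w': "deriv F w \<noteq> 0" using w(2) by (simp add: F_def[abs_def])
  have Fnz: "eventually (\<lambda>z. F z - c \<noteq> 0) (at z)" if "z \<notin> X" for z c
  proof -
    obtain v where v: "v \<notin> X" "F v \<noteq> c" using deriv_nonzero_not_const[OF X(1) w(1) w'] by blast
    show ?thesis by (rule eventually_nonzero_cofinite[OF X(1) _ v(1) _ that]) (use v in \<open>auto intro!: holomorphic_intros Fhol\<close>)
  qed
  have dFnz: "eventually (\<lambda>z. deriv F z \<noteq> 0) (at z)" if "z \<notin> X" for z
    by (rule eventually_nonzero_cofinite[OF X(1) holomorphic_deriv[OF Fhol cofinite_open_connected(1)[OF X(1)]] w(1) w' that])
  have \<tau>0: "\<tau> z = 0" if "z \<notin> X" "F z = 0 \<or> F z - b = 0" for z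
  proof -
    have "f z \<in> R \<or> g z \<in> R"
      using that rel[OF that(1)] ab by (auto simp: R_def F_def)
    then show ?thesis using R by (auto simp: \<tau>_def)
  qed
  have \<tau>nz: "\<tau> z \<noteq> 0" if "z \<notin> X" "F z \<noteq> 0" "F z \<noteq> b" for z
  proof -
    have "f z \<notin> R" "g z \<notin> R"
      using that rel[OF that(1)] by (auto simp: R_def F_def)
    then show ?thesis using R by (auto simp: \<tau>_def)
  qed
  have "\<exists>v. v \<notin> X \<and> F v \<noteq> 0 \<and> F v \<noteq> b \<and> deriv F v \<noteq> 0"
  proof -
    have "eventually (\<lambda>z. z \<notin> X \<and> F z \<noteq> 0 \<and> F z \<noteq> b \<and> deriv F z \<noteq> 0) (at w)"
      using eventually_cofinite_at[OF X(1), of w] Fnz[OF w(1), of 0] Fnz[OF w(1), of b] dFnz[OF w(1)]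
      by eventually_elim auto
    then show ?thesis using eventually_happens[of _ "at w"] by auto
  qed
  then obtain v where v: "v \<notin> X" "F v \<noteq> 0" "F v \<noteq> b" "deriv F v \<noteq> 0" by blast
  define q where "q = card R"
  define n where "n = degree P"
  obtain C2 where C2: "C2 \<ge> 1" "\<And>x y. poly P x = a * poly P y + b \<Longrightarrow> 1 + norm y \<le> C2 * (1 + norm x)"
    using poly_values_comparable[of P a b] P ab by auto
  obtain C4 where C4: "C4 > 0" "\<And>w. (1 + norm w) ^ n \<le> C4 * (1 + norm (poly P w))"
    using poly_norm_lower[OF P0] by (auto simp: n_def)
  obtain C5 where C5: "C5 > 0" "\<And>x. x \<notin> {0, b} \<Longrightarrow> (1 + norm x) ^ (card {0, b} - 1) \<le> C5 * (\<Prod>r\<in>{0, b}. norm (x - r)) * (\<Sum>r\<in>{0, b}. 1 / norm (x - r))"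
    using prod_distances_lower_bound[of "{0, b}"] by auto
  define C1 where "C1 = (\<Prod>r\<in>R. 1 + norm r)"
  have C1: "C1 \<ge> 0" unfolding C1_def by (intro prod_nonneg) auto
  define K where "K = C1 * (C1 * C2 ^ q) * (1 + C2)"
  have K: "K \<ge> 0" using C1 C2 by (simp add: K_def)
  show ?thesis
  proof (rule order_0_criterion_removable[OF f g X])
    show "finite hs" by (simp add: hs_def)
    show "tame M X h" if "h \<in> hs" "growth_scale M" "tame M X f" for h M
      using that tame_poly[of M X f P] unfolding hs_def F_def[abs_def] by (auto intro: tame_diff_const)
    show "\<Psi> meromorphic_on UNIV" unfolding \<Psi>_def \<tau>_def F_def[abs_def] by (intro meromorphic_intros M1_meromorphic f g)
    show "\<Psi> analytic_on {z}" if "z \<notin> X" "\<And>h. h \<in> hs \<Longrightarrow> h z \<noteq> 0" for z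
      unfolding \<Psi>_def using that(2)[of F] that(2)[of "\<lambda>z. F z - b"]
      by (intro analytic_intros \<tau>an Fan that(1)) (auto simp: hs_def)
    show "v \<notin> X" by (rule v)
    show "h v \<noteq> 0" if "h \<in> hs" for h using that v by (auto simp: hs_def)
    show "\<Psi> v \<noteq> 0" using v \<tau>nz[OF v(1-3)] by (simp add: \<Psi>_def)
    show "\<exists>\<phi>. \<phi> analytic_on {z0} \<and> eventually (\<lambda>z. \<Psi> z = \<phi> z) (at z0)" if z0: "z0 \<notin> X" for z0
    proof -
      have *: "\<exists>\<phi>. \<phi> analytic_on {z0} \<and> eventually (\<lambda>z. deriv (\<lambda>z. F z - c) z / (F z - c) * \<tau> z = \<phi> z) (at z0)"
        if "c = 0 \<or> c = b" for c
        using that by (intro log_deriv_times_vanishing analytic_intros Fan \<tau>an z0 Fnz) (auto intro: \<tau>0[OF z0])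
      from *[of 0] obtain \<phi>1 where \<phi>1: "\<phi>1 analytic_on {z0}" "eventually (\<lambda>z. deriv F z / F z * \<tau> z = \<phi>1 z) (at z0)" by auto
      from *[of b] obtain \<phi>2 where \<phi>2: "\<phi>2 analytic_on {z0}" "eventually (\<lambda>z. deriv (\<lambda>z. F z - b) z / (F z - b) * \<tau> z = \<phi>2 z) (at z0)" by auto
      have "eventually (\<lambda>z. \<Psi> z = (\<phi>2 z - \<phi>1 z) / b) (at z0)"
        using \<phi>1(2) \<phi>2(2) eventually_cofinite_at[OF X(1), of z0] Fnz[OF z0, of 0] Fnz[OF z0, of b]
      proof eventually_elim
        case (elim z)
        have "\<phi>2 z - \<phi>1 z = \<tau> z * (deriv F z / (F z - b) - deriv F z / F z)"
          using elim(1,2) dF[OF elim(3)] by (simp add: algebra_simps)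
        also have "deriv F z / (F z - b) - deriv F z / F z = b * (deriv F z / (F z * (F z - b)))"
          using elim(4,5) by (simp add: field_simps)
        finally show ?case using ab by (simp add: \<Psi>_def)
      qed
      moreover have "(\<lambda>z. (\<phi>2 z - \<phi>1 z) / b) analytic_on {z0}" using ab by (intro analytic_intros \<phi>1 \<phi>2) auto
      ultimately show ?thesis by blast
    qed
    show "norm (\<Psi> z) * (1 + norm (f z) + norm (g z)) \<le> (K * C4 * C5) * (1 + (\<Sum>h\<in>hs. norm (deriv h z / h z))) ^ 1"
      if z: "z \<notin> X" "\<And>h. h \<in> hs \<Longrightarrow> h z \<noteq> 0" for z
    proof -
      have Fz: "F z \<noteq> 0" "F z - b \<noteq> 0" using z(2)[of F] z(2)[of "\<lambda>z. F z - b"] by (auto simp: hs_def)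
      define x where "x = 1 + norm (f z)"
      define s where "s = (\<Sum>h\<in>hs. norm (deriv h z / h z))"
      have x1: "x \<ge> 1" by (simp add: x_def)
      have gx: "1 + norm (g z) \<le> C2 * x" unfolding x_def by (rule C2(2)) (use rel z in auto)
      have t1: "(\<Prod>r\<in>R. norm (f z - r)) \<le> C1 * x ^ q"
        using prod_distances_upper_bound[where w="f z" and S=R] by (simp add: C1_def x_def q_def)
      have t2: "(\<Prod>r\<in>R. norm (g z - r)) \<le> C1 * C2 ^ q * x ^ q"
      proof -
        have "(\<Prod>r\<in>R. norm (g z - r)) \<le> C1 * (1 + norm (g z)) ^ q"
          using prod_distances_upper_bound[where w="g z" and S=R] by (simp add: C1_def q_def)
        also have "\<dots> \<le> C1 * (C2 * x) ^ q" using gx C1 by (intro mult_left_mono power_mono) auto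
        finally show ?thesis by (simp add: power_mult_distrib mult.assoc)
      qed
      have t3: "1 + norm (f z) + norm (g z) \<le> (1 + C2) * x"
        using gx by (simp add: x_def algebra_simps)
      have "norm (\<tau> z) \<le> (C1 * x ^ q) * (C1 * C2 ^ q * x ^ q)"
        unfolding \<tau>_def norm_mult prod_norm[symmetric] using C1 x1 C2
        by (intro mult_mono t1 t2 prod_nonneg) auto
      then have "norm (\<tau> z) * (1 + norm (f z) + norm (g z)) \<le> (C1 * x ^ q) * (C1 * C2 ^ q * x ^ q) * ((1 + C2) * x)"
        using t3 x1 C1 C2 by (intro mult_mono) auto
      also have "\<dots> = K * (x ^ q * x ^ q * x)"
        by (simp add: K_def mult_ac)
      also have "K * (x ^ q * x ^ q * x) = K * x ^ (2 * q + 1)"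
        by (simp only: mult_2 power_add power_one_right)
      also have "\<dots> \<le> K * x ^ n"
        using K x1 P by (intro mult_left_mono power_increasing) (auto simp: q_def n_def R_def)
      also have "\<dots> \<le> K * (C4 * (1 + norm (F z)))"
        using C4(2)[of "f z"] K by (intro mult_left_mono) (auto simp: x_def F_def)
      finally have A: "norm (\<tau> z) * (1 + norm (f z) + norm (g z)) \<le> K * (C4 * (1 + norm (F z)))" .
      have B: "1 + norm (F z) \<le> C5 * (norm (F z) * norm (F z - b)) * (1 / norm (F z) + 1 / norm (F z - b))"
        using C5(2)[of "F z"] Fz ab by simp
      define e where "e = norm (deriv F z) / (norm (F z) * norm (F z - b))"
      have e: "e \<ge> 0" by (simp add: e_def)
      have "norm (\<Psi> z) = norm (\<tau> z) * e" by (simp add: \<Psi>_def e_def norm_mult norm_divide)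
      then have "norm (\<Psi> z) * (1 + norm (f z) + norm (g z)) = (norm (\<tau> z) * (1 + norm (f z) + norm (g z))) * e"
        by (simp add: mult_ac)
      also have "\<dots> \<le> (K * (C4 * (1 + norm (F z)))) * e" using A e by (intro mult_right_mono) auto
      also have "\<dots> = K * C4 * (e * (1 + norm (F z)))" by (simp add: mult_ac)
      also have "\<dots> \<le> K * C4 * (e * (C5 * (norm (F z) * norm (F z - b)) * (1 / norm (F z) + 1 / norm (F z - b))))"
        using B e K C4 by (intro mult_left_mono) auto
      also have "\<dots> = K * C4 * C5 * (norm (deriv F z) / norm (F z) + norm (deriv F z) / norm (F z - b))"
        using Fz by (simp add: e_def field_simps)
      also have "norm (deriv F z) / norm (F z) + norm (deriv F z) / norm (F z - b) = s"
      proof -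
        have "F \<noteq> (\<lambda>z. F z - b)" using ab by (auto simp: fun_eq_iff)
        then show ?thesis unfolding s_def hs_def using dF[OF z(1)] by (simp add: norm_divide)
      qed
      also have "K * C4 * C5 * s \<le> K * C4 * C5 * (1 + s) ^ 1"
        using K C4 C5 by (intro mult_left_mono) auto
      finally show ?thesis by (simp add: s_def)
    qed
  qed
qed

text \<open>
  Two integrations. Equality of the pre-Schwarzians means that the quotient \<open>(1 / u)' / (1 / v)'\<close> has
  derivative 0, so it is a constant \<open>a\<close>, and then \<open>1 / u - a / v\<close> is a constant \<open>b\<close>. The common domain \<open>D\<close>
  stays connected after the removal of the isolated zeros of \<open>u\<close>, \<open>v\<close> and their derivatives. The
  conclusion is cleared of denominators, so that it extends to the removed points by continuity.
\<close>
lemma inv_pre_schwarzian_eq_imp_moebius: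
  fixes u v :: "complex \<Rightarrow> complex"
  assumes X: "finite X" and u: "u holomorphic_on - X" and v: "v holomorphic_on - X"
    and w: "w \<notin> X" "deriv u w \<noteq> 0" "w' \<notin> X" "deriv v w' \<noteq> 0"
    and eq: "\<And>z. z \<notin> X \<Longrightarrow> u z \<noteq> 0 \<Longrightarrow> v z \<noteq> 0 \<Longrightarrow> deriv u z \<noteq> 0 \<Longrightarrow> deriv v z \<noteq> 0 \<Longrightarrow> inv_pre_schwarzian u z = inv_pre_schwarzian v z"
  shows "\<exists>a b. a \<noteq> 0 \<and> (\<forall>z. z \<notin> X \<longrightarrow> v z = u z * (a + b * v z))"
proof -
  note oc = cofinite_open_connected[OF X]
  have du: "deriv u holomorphic_on - X" and dv: "deriv v holomorphic_on - X"
    by (intro holomorphic_deriv u v oc)+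
  have ev: "eventually (\<lambda>z. z \<notin> X \<and> u z \<noteq> 0 \<and> v z \<noteq> 0 \<and> deriv u z \<noteq> 0 \<and> deriv v z \<noteq> 0) (at z)" if z: "z \<notin> X" for z
  proof -
    obtain a where a: "a \<notin> X" "u a \<noteq> 0" using deriv_nonzero_not_const[OF X w(1,2)] by blast
    obtain b where b: "b \<notin> X" "v b \<noteq> 0" using deriv_nonzero_not_const[OF X w(3,4)] by blast
    show ?thesis
      using eventually_cofinite_at[OF X, of z] eventually_nonzero_cofinite[OF X u a z] eventually_nonzero_cofinite[OF X v b z]
        eventually_nonzero_cofinite[OF X du w(1,2) z] eventually_nonzero_cofinite[OF X dv w(3,4) z]
      by eventually_elim auto
  qed
  define h where "h z = u z * v z * deriv u z * deriv v z" for z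
  have h: "h holomorphic_on - X" unfolding h_def by (intro holomorphic_intros u v du dv)
  define D where "D = - X - {z \<in> - X. h z = 0}"
  have D: "z \<in> D \<longleftrightarrow> z \<notin> X \<and> u z \<noteq> 0 \<and> v z \<noteq> 0 \<and> deriv u z \<noteq> 0 \<and> deriv v z \<noteq> 0" for z
    by (auto simp: D_def h_def)
  obtain w0 where w0: "w0 \<in> D" using eventually_happens[OF ev[OF w(1)]] D by auto
  have Dopen: "open D"
  proof -
    have "open (- X \<inter> h -` (- {0}))"
      by (rule continuous_open_preimage[OF holomorphic_on_imp_continuous_on[OF h] oc(1)]) auto
    moreover have "D = - X \<inter> h -` (- {0})" by (auto simp: D_def)
    ultimately show ?thesis by simp
  qed
  have Dconn: "connected D"
  proof -
    have "\<not> z islimpt {z \<in> - X. h z = 0}" if "z \<in> - X" for z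
      unfolding islimpt_iff_eventually not_not
      by (rule eventually_mono[OF ev]) (use that in \<open>auto simp: h_def\<close>)
    then have "{z \<in> - X. h z = 0} sparse_in - X"
      unfolding sparse_in_open[OF oc(1)] by blast
    then show ?thesis unfolding D_def by (intro sparse_imp_connected oc) auto
  qed
  have der: "(u has_field_derivative deriv u z) (at z)" "(v has_field_derivative deriv v z) (at z)"
     "(deriv u has_field_derivative deriv (deriv u) z) (at z)" "(deriv v has_field_derivative deriv (deriv v) z) (at z)"
     if "z \<in> D" for z
    using that D[of z] holomorphic_derivI[OF u oc(1)] holomorphic_derivI[OF v oc(1)] holomorphic_derivI[OF du oc(1)] holomorphic_derivI[OF dv oc(1)] by auto
  define W where "W z = (deriv u z * (v z * v z)) / (deriv v z * (u z * u z))" for z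
  have W': "(W has_field_derivative 0) (at z)" if z: "z \<in> D" for z
  proof -
    note nz = D[THEN iffD1, OF z]
    have "(W has_field_derivative
        ((deriv (deriv u) z * (v z * v z) + (deriv v z * v z + deriv v z * v z) * deriv u z) * (deriv v z * (u z * u z)) -
         (deriv u z * (v z * v z)) * (deriv (deriv v) z * (u z * u z) + (deriv u z * u z + deriv u z * u z) * deriv v z)) /
         ((deriv v z * (u z * u z)) * (deriv v z * (u z * u z)))) (at z)"
      unfolding W_def using nz by (intro DERIV_divide DERIV_mult der z) auto
    moreover have "deriv (deriv u) z = deriv u z * (inv_pre_schwarzian u z + 2 * deriv u z / u z)"
      using nz by (simp add: inv_pre_schwarzian_def field_simps)
    moreover have "deriv (deriv v) z = deriv v z * (inv_pre_schwarzian u z + 2 * deriv v z / v z)"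
      using nz eq[of z] by (simp add: inv_pre_schwarzian_def field_simps)
    ultimately show ?thesis using nz by (simp add: field_simps)
  qed
  obtain a where a: "\<And>z. z \<in> D \<Longrightarrow> W z = a"
  proof -
    have "continuous_on D W" using W' by (meson DERIV_continuous continuous_at_imp_continuous_on)
    from DERIV_zero_connected_constant[OF Dconn Dopen finite.emptyI this] W' show ?thesis using that by auto
  qed
  have a0: "a \<noteq> 0" using a[OF w0] w0[unfolded D] by (auto simp: W_def)
  define Y where "Y z = inverse (u z) - a * inverse (v z)" for z
  have Y': "(Y has_field_derivative 0) (at z)" if z: "z \<in> D" for z
  proof -
    note nz = D[THEN iffD1, OF z]
    have "(Y has_field_derivative - (inverse (u z) * deriv u z * inverse (u z)) - a * (- (inverse (v z) * deriv v z * inverse (v z)))) (at z)"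
      unfolding Y_def using nz by (intro DERIV_diff DERIV_cmult DERIV_inverse' der z) auto
    moreover have "deriv u z * (v z * v z) = a * (deriv v z * (u z * u z))" using a[OF z] nz by (simp add: W_def field_simps)
    then have "- (inverse (u z) * deriv u z * inverse (u z)) - a * (- (inverse (v z) * deriv v z * inverse (v z))) = 0"
      using nz by (simp add: field_simps)
    ultimately show ?thesis by simp
  qed
  obtain b where b: "\<And>z. z \<in> D \<Longrightarrow> Y z = b"
  proof -
    have "continuous_on D Y" using Y' by (meson DERIV_continuous continuous_at_imp_continuous_on)
    from DERIV_zero_connected_constant[OF Dconn Dopen finite.emptyI this] Y' show ?thesis using that by auto
  qed
  define e where "e z = v z - u z * (a + b * v z)" for z
  have eD: "e z = 0" if z: "z \<in> D" for z
    using b[OF z] z[unfolded D] by (simp add: e_def Y_def field_simps)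
  have ehol: "e holomorphic_on - X" unfolding e_def by (intro holomorphic_intros u v)
  have "e z = 0" if z: "z \<notin> X" for z
  proof (rule ccontr)
    assume "e z \<noteq> 0"
    from eventually_nonzero_cofinite[OF X ehol z this z] ev[OF z]
    have "eventually (\<lambda>z. False) (at z)" by eventually_elim (use eD D in auto)
    then show False by simp
  qed
  then show ?thesis using a0 by (auto simp: e_def)
qed

text \<open>
  Count degrees in \<open>\<bar>w\<bar>\<close>: the left-hand side has degree \<open>2 card K + 1\<close>, whereas \<open>P - 1\<close> has degree
  \<open>card S\<close>, of which the square of the sum takes away 2.
\<close>
lemma critical_product_bound:
  fixes P :: "complex poly" and S K :: "complex set"
  assumes c: "c \<noteq> 0" and S: "finite S" and K: "finite K"
    and fac: "\<And>w. poly P w - 1 = c * (\<Prod>a\<in>S. w - a)" and n: "2 * card K + 3 \<le> card S"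
  shows "\<exists>C>0. \<forall>w. w \<notin> S \<longrightarrow> (norm (\<Prod>\<eta>\<in>K. w - \<eta>))\<^sup>2 * (1 + norm w) \<le> C * norm (poly P w - 1) * (\<Sum>a\<in>S. 1 / norm (w - a))\<^sup>2"
proof -
  have Sne: "S \<noteq> {}" using n by auto
  define n' where "n' = card S"
  obtain C where C: "C > 0" "\<And>w. w \<notin> S \<Longrightarrow> (1 + norm w) ^ (n' - 1) \<le> C * (\<Prod>a\<in>S. norm (w - a)) * (\<Sum>a\<in>S. 1 / norm (w - a))"
    using prod_distances_lower_bound[OF S Sne] unfolding n'_def by blast
  define A where "A = (\<Prod>a\<in>S. 1 + norm a)"
  define Q where "Q = (\<Prod>a\<in>K. 1 + norm a)"
  have A: "A > 0" unfolding A_def by (intro prod_pos) (auto intro: add_pos_nonneg)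
  have Q: "Q > 0" unfolding Q_def by (intro prod_pos) (auto intro: add_pos_nonneg)
  show ?thesis
  proof (intro exI[of _ "Q\<^sup>2 * A * C\<^sup>2 / norm c"] conjI allI impI)
    show "Q\<^sup>2 * A * C\<^sup>2 / norm c > 0" using A Q C c by simp
    fix w assume w: "w \<notin> S"
    define x where "x = 1 + norm w"
    define p where "p = (\<Prod>a\<in>S. norm (w - a))"
    define s where "s = (\<Sum>a\<in>S. 1 / norm (w - a))"
    have x1: "x \<ge> 1" by (simp add: x_def)
    have p0: "p > 0" unfolding p_def using w by (intro prod_pos) auto
    have s0: "s \<ge> 0" unfolding s_def by (intro sum_nonneg) auto
    have pA: "p \<le> A * x ^ n'" unfolding p_def A_def x_def n'_def by (rule prod_distances_upper_bound)
    have qQ: "norm (\<Prod>\<eta>\<in>K. w - \<eta>) \<le> Q * x ^ card K"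
      unfolding prod_norm[symmetric] Q_def x_def by (rule prod_distances_upper_bound)
    have low: "x ^ (n' - 1) \<le> C * p * s" using C(2)[OF w] by (simp add: x_def p_def s_def)
    have "(norm (\<Prod>\<eta>\<in>K. w - \<eta>))\<^sup>2 * x * p \<le> (Q * x ^ card K)\<^sup>2 * x * (A * x ^ n')"
      using qQ pA x1 p0 by (intro mult_mono power_mono) auto
    also have "\<dots> = Q\<^sup>2 * A * (x ^ card K * x ^ card K * x * x ^ n')"
      by (simp only: power_mult_distrib power2_eq_square mult_ac)
    also have "\<dots> = Q\<^sup>2 * A * x ^ (2 * card K + 1 + n')"
      by (simp only: mult_2 power_add power_one_right)
    also have "\<dots> \<le> Q\<^sup>2 * A * x ^ (2 * (n' - 1))"
      using A n x1 by (intro mult_left_mono power_increasing) (auto simp: n'_def)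
    also have "x ^ (2 * (n' - 1)) = (x ^ (n' - 1))\<^sup>2" by (simp add: power_mult[symmetric] mult.commute)
    also have "Q\<^sup>2 * A * (x ^ (n' - 1))\<^sup>2 \<le> Q\<^sup>2 * A * (C * p * s)\<^sup>2"
      using low A x1 by (intro mult_left_mono power_mono) auto
    also have "\<dots> = (Q\<^sup>2 * A * C\<^sup>2 * p * s\<^sup>2) * p" by (simp add: power2_eq_square mult_ac)
    finally have "(norm (\<Prod>\<eta>\<in>K. w - \<eta>))\<^sup>2 * x \<le> Q\<^sup>2 * A * C\<^sup>2 * p * s\<^sup>2"
      using p0 by (simp add: mult_le_cancel_right)
    also have "\<dots> = Q\<^sup>2 * A * C\<^sup>2 / norm c * norm (poly P w - 1) * s\<^sup>2"
      using c by (simp add: fac norm_mult p_def prod_norm)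
    finally show "(norm (\<Prod>\<eta>\<in>K. w - \<eta>))\<^sup>2 * (1 + norm w) \<le> Q\<^sup>2 * A * C\<^sup>2 / norm c * norm (poly P w - 1) * (\<Sum>a\<in>S. 1 / norm (w - a))\<^sup>2"
      by (simp add: x_def s_def)
  qed
qed

text \<open>
  With \<open>u = P \<circ> f - 1\<close>, \<open>v = P \<circ> g - 1\<close>, \<open>H\<close> the difference of the pre-Schwarzians and \<open>q\<close> the
  product of the distinct linear factors of \<open>P'\<close>, the auxiliary function is
  \<open>\<Psi> = (H f' q(f) g' q(g))\<^sup>2 / (u v)\<close>. At common zeros of \<open>u\<close> and \<open>v\<close> it has no pole by the
  weight-two cancellation, because there \<open>f' q(f)\<close> differs from \<open>u' = P'(f) f'\<close> by a non-vanishing factor.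
  Elsewhere \<open>H\<close> has at most simple poles, at the zeros of \<open>u'\<close> and \<open>v'\<close>, which are zeros of \<open>f' q(f)\<close> and
  \<open>g' q(g)\<close>. Using \<open>q\<close> instead of \<open>P'\<close> keeps \<open>\<Psi>\<close> small where \<open>f\<close> or \<open>g\<close> is large.
\<close>
lemma weighted_sharing_order_0:
  fixes P :: "complex poly"
  assumes f: "f \<in> M1" and g: "g \<in> M1" and X: "finite X" "\<And>z. is_pole f z \<Longrightarrow> z \<in> X" "\<And>z. is_pole g z \<Longrightarrow> z \<in> X"
    and c: "c \<noteq> 0" and S: "finite S" and fac: "\<And>w. poly P w - 1 = c * (\<Prod>a\<in>S. w - a)"
    and n: "2 * card {w. poly (pderiv P) w = 0} + 3 \<le> card S" and simple: "\<And>a. a \<in> S \<Longrightarrow> poly (pderiv P) a \<noteq> 0"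
    and share: "\<And>z. z \<notin> X \<Longrightarrow> poly P (f z) = 1 \<longleftrightarrow> poly P (g z) = 1"
    and mult: "\<And>z. z \<notin> X \<Longrightarrow> poly P (f z) = 1 \<Longrightarrow>
      zorder (\<lambda>z. poly P (f z) - 1) z = zorder (\<lambda>z. poly P (g z) - 1) z \<or>
      3 \<le> zorder (\<lambda>z. poly P (f z) - 1) z \<and> 3 \<le> zorder (\<lambda>z. poly P (g z) - 1) z"
    and w: "w \<notin> X" "poly P (f w) \<noteq> 1" "poly P (g w) \<noteq> 1" "deriv (\<lambda>z. poly P (f z) - 1) w \<noteq> 0" "deriv (\<lambda>z. poly P (g z) - 1) w \<noteq> 0"
      "inv_pre_schwarzian (\<lambda>z. poly P (f z) - 1) w \<noteq> inv_pre_schwarzian (\<lambda>z. poly P (g z) - 1) w"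
  shows "nevanlinna_order f = 0"
proof -
  define K where "K = {w. poly (pderiv P) w = 0}"
  define u where "u z = poly P (f z) - 1" for z
  define v where "v z = poly P (g z) - 1" for z
  define q where "q t = (\<Prod>\<eta>\<in>K. t - \<eta>)" for t :: complex
  define H where "H z = inv_pre_schwarzian u z - inv_pre_schwarzian v z" for z
  define \<Psi> where "\<Psi> z = (H z * (deriv f z * q (f z)) * (deriv g z * q (g z)))\<^sup>2 / (u z * v z)" for z
  \<comment> \<open>The logarithmic derivatives of the first four bound \<open>H\<close>, those of the others arise from the sums over \<open>S\<close>.\<close>
  define hs where "hs = {u, v, deriv u, deriv v} \<union> ((\<lambda>a z. f z - a) ` S \<union> (\<lambda>a z. g z - a) ` S)"
  have "S \<noteq> {}" using n by auto
  then have dP: "pderiv P \<noteq> 0" using simple by fastforce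
  have K: "finite K" unfolding K_def by (rule poly_roots_finite[OF dP])
  have fan: "f analytic_on {z}" and gan: "g analytic_on {z}" if "z \<notin> X" for z
    using M1_analytic[OF f] M1_analytic[OF g] X that by blast+
  have uan: "u analytic_on {z}" and van: "v analytic_on {z}" if "z \<notin> X" for z
    unfolding u_def v_def by (intro analytic_intros fan gan that)+
  have q_an: "(\<lambda>z. q (h z)) analytic_on A" if "h analytic_on A" for h A
    unfolding q_def by (intro analytic_intros that)
  have dan: "deriv u analytic_on {z}" "deriv v analytic_on {z}" "deriv f analytic_on {z}" "deriv g analytic_on {z}"
     "deriv (deriv u) analytic_on {z}" "deriv (deriv v) analytic_on {z}" if "z \<notin> X" for z
    by (intro analytic_deriv uan van fan gan that)+
  have du: "deriv u z = poly (pderiv P) (f z) * deriv f z" if "z \<notin> X" for z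
    unfolding u_def using deriv_diff_const[OF analytic_on_poly_compose[OF fan[OF that]], of P 1] deriv_poly_compose[OF fan[OF that], of P] by simp
  have dv: "deriv v z = poly (pderiv P) (g z) * deriv g z" if "z \<notin> X" for z
    unfolding v_def using deriv_diff_const[OF analytic_on_poly_compose[OF gan[OF that]], of P 1] deriv_poly_compose[OF gan[OF that], of P] by simp
  have q0: "q t = 0 \<longleftrightarrow> poly (pderiv P) t = 0" for t
    unfolding q_def using K by (auto simp: K_def)
  have u0: "u z = 0 \<longleftrightarrow> f z \<in> S" and v0: "v z = 0 \<longleftrightarrow> g z \<in> S" for z
    unfolding u_def v_def fac using c S by auto
  have w': "u w \<noteq> 0" "v w \<noteq> 0" "deriv u w \<noteq> 0" "deriv v w \<noteq> 0" "H w \<noteq> 0"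
    using w by (auto simp: u_def[abs_def] v_def[abs_def] H_def)
  have uhol: "u holomorphic_on - X" "v holomorphic_on - X" "deriv u holomorphic_on - X" "deriv v holomorphic_on - X"
    by (intro analytic_cofinite_holomorphic uan van dan; assumption)+
  have nz: "eventually (\<lambda>z. u z \<noteq> 0) (at z)" "eventually (\<lambda>z. v z \<noteq> 0) (at z)"
    "eventually (\<lambda>z. deriv u z \<noteq> 0) (at z)" "eventually (\<lambda>z. deriv v z \<noteq> 0) (at z)" if "z \<notin> X" for z
    using eventually_nonzero_cofinite[OF X(1) uhol(1) w(1) w'(1) that] eventually_nonzero_cofinite[OF X(1) uhol(2) w(1) w'(2) that]
      eventually_nonzero_cofinite[OF X(1) uhol(3) w(1) w'(3) that] eventually_nonzero_cofinite[OF X(1) uhol(4) w(1) w'(4) that] by blast+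
  have blockan: "inv_pre_schwarzian u analytic_on {z}" if "z \<notin> X" "u z \<noteq> 0" "deriv u z \<noteq> 0" for z
    unfolding inv_pre_schwarzian_def[abs_def] using that by (intro analytic_intros uan dan) auto
  have blockan': "inv_pre_schwarzian v analytic_on {z}" if "z \<notin> X" "v z \<noteq> 0" "deriv v z \<noteq> 0" for z
    unfolding inv_pre_schwarzian_def[abs_def] using that by (intro analytic_intros van dan) auto
  have \<Psi>an: "\<Psi> analytic_on {z}" if "z \<notin> X" "u z \<noteq> 0" "v z \<noteq> 0" "deriv u z \<noteq> 0" "deriv v z \<noteq> 0" for z
    unfolding \<Psi>_def H_def using that by (intro analytic_intros blockan blockan' uan van dan q_an fan gan) auto
  obtain C where C: "C > 0" "\<And>t. t \<notin> S \<Longrightarrow> (norm (q t))\<^sup>2 * (1 + norm t) \<le> C * norm (poly P t - 1) * (\<Sum>a\<in>S. 1 / norm (t - a))\<^sup>2"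
    using critical_product_bound[OF c S K fac] n unfolding q_def K_def by blast
  have loc: "\<exists>\<phi>. \<phi> analytic_on {z0} \<and> eventually (\<lambda>z. \<Psi> z = \<phi> z) (at z0)" if z0: "z0 \<notin> X" for z0
  proof (cases "u z0 = 0")
    case False
    have v0': "v z0 \<noteq> 0" using share[OF z0] False by (simp add: u_def v_def)
    define \<tau>f where "\<tau>f z = deriv f z * q (f z)" for z
    define \<tau>g where "\<tau>g z = deriv g z * q (g z)" for z
    have \<tau>: "\<tau>f analytic_on {z0}" "\<tau>g analytic_on {z0}"
      unfolding \<tau>f_def \<tau>g_def by (intro analytic_intros dan q_an fan gan z0)+
    have "\<tau>f z0 = 0" if "deriv u z0 = 0" using that du[OF z0] q0 by (auto simp: \<tau>f_def)
    from log_deriv_times_vanishing[OF dan(1)[OF z0] nz(3)[OF z0] \<tau>(1) this]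
    obtain \<phi>1 where \<phi>1: "\<phi>1 analytic_on {z0}" "eventually (\<lambda>z. deriv (deriv u) z / deriv u z * \<tau>f z = \<phi>1 z) (at z0)" by blast
    have "\<tau>g z0 = 0" if "deriv v z0 = 0" using that dv[OF z0] q0 by (auto simp: \<tau>g_def)
    from log_deriv_times_vanishing[OF dan(2)[OF z0] nz(4)[OF z0] \<tau>(2) this]
    obtain \<phi>2 where \<phi>2: "\<phi>2 analytic_on {z0}" "eventually (\<lambda>z. deriv (deriv v) z / deriv v z * \<tau>g z = \<phi>2 z) (at z0)" by blast
    define \<Phi> where "\<Phi> z = (\<phi>1 z * \<tau>g z - 2 * deriv u z / u z * \<tau>f z * \<tau>g z - (\<phi>2 z * \<tau>f z - 2 * deriv v z / v z * \<tau>f z * \<tau>g z))\<^sup>2 / (u z * v z)" for z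
    have "\<Phi> analytic_on {z0}"
      unfolding \<Phi>_def using False v0' by (intro analytic_intros \<phi>1 \<phi>2 \<tau> uan van dan z0) auto
    moreover have "eventually (\<lambda>z. \<Psi> z = \<Phi> z) (at z0)"
      using \<phi>1(2) \<phi>2(2)
    proof eventually_elim
      case (elim z)
      have "H z * \<tau>f z * \<tau>g z = \<phi>1 z * \<tau>g z - 2 * deriv u z / u z * \<tau>f z * \<tau>g z - (\<phi>2 z * \<tau>f z - 2 * deriv v z / v z * \<tau>f z * \<tau>g z)"
        unfolding elim[symmetric] H_def inv_pre_schwarzian_def by (simp add: algebra_simps)
      then show ?case by (simp add: \<Psi>_def \<Phi>_def \<tau>f_def \<tau>g_def mult.assoc)
    qed
    ultimately show ?thesis by blast
  next
    case True
    have v0': "v z0 = 0" using share[OF z0] True by (simp add: u_def v_def)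
    have mm: "zorder u z0 = zorder v z0 \<or> 3 \<le> zorder u z0 \<and> 3 \<le> zorder v z0"
      using mult[OF z0] True by (simp add: u_def[abs_def] v_def[abs_def])
    obtain \<phi> where \<phi>: "\<phi> analytic_on {z0}" "eventually (\<lambda>z. (H z * deriv u z * deriv v z)\<^sup>2 / (u z * v z) = \<phi> z) (at z0)"
      using weight_two_cancellation[OF uan[OF z0] nz(1)[OF z0] True van[OF z0] nz(2)[OF z0] v0' mm]
      unfolding H_def by blast
    define e where "e z = (q (f z) / poly (pderiv P) (f z) * (q (g z) / poly (pderiv P) (g z)))\<^sup>2" for z
    have nf: "poly (pderiv P) (f z0) \<noteq> 0" "poly (pderiv P) (g z0) \<noteq> 0"
      using simple True v0' u0 v0 by blast+
    have "(\<lambda>z. \<phi> z * e z) analytic_on {z0}"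
      unfolding e_def using nf by (intro analytic_intros \<phi> q_an fan gan z0) auto
    moreover have "eventually (\<lambda>z. \<Psi> z = \<phi> z * e z) (at z0)"
      using \<phi>(2) eventually_cofinite_at[OF X(1), of z0]
        eventually_nhds_imp_at[OF eventually_nhds_nonzero[OF analytic_on_poly_compose[OF fan[OF z0], of "pderiv P"] nf(1)]]
        eventually_nhds_imp_at[OF eventually_nhds_nonzero[OF analytic_on_poly_compose[OF gan[OF z0], of "pderiv P"] nf(2)]]
    proof eventually_elim
      case (elim z)
      have "deriv f z * q (f z) = deriv u z * (q (f z) / poly (pderiv P) (f z))" using du[OF elim(2)] elim(3) by simp
      moreover have "deriv g z * q (g z) = deriv v z * (q (g z) / poly (pderiv P) (g z))" using dv[OF elim(2)] elim(4) by simp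
      moreover have "(h * (x * a) * (y * b))\<^sup>2 / d = (h * x * y)\<^sup>2 / d * (a * b)\<^sup>2" for h x a y b d :: complex
        by (simp add: power_mult_distrib mult_ac)
      ultimately have "\<Psi> z = (H z * deriv u z * deriv v z)\<^sup>2 / (u z * v z) * e z"
        unfolding \<Psi>_def e_def by (simp only:)
      then show ?case using elim(1) by simp
    qed
    ultimately show ?thesis by blast
  qed
  show ?thesis
  proof (rule order_0_criterion_removable[OF f g X])
    show fin: "finite hs" using S by (simp add: hs_def)
    show "tame M X h" if h: "h \<in> hs" and M: "growth_scale M" and t: "tame M X f" "tame M X g" for h M
    proof -
      have uv: "tame M X u" "tame M X v"
        unfolding u_def v_def by (intro tame_diff_const tame_poly t M)+
      show ?thesis using h uv t M X(1) unfolding hs_def by (auto intro: tame_diff_const tame_deriv)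
    qed
    show "\<Psi> meromorphic_on UNIV"
      unfolding \<Psi>_def H_def inv_pre_schwarzian_def q_def u_def[abs_def] v_def[abs_def]
      by (intro meromorphic_intros M1_meromorphic f g)
    show "\<exists>\<phi>. \<phi> analytic_on {z0} \<and> eventually (\<lambda>z. \<Psi> z = \<phi> z) (at z0)" if "z0 \<notin> X" for z0 by (rule loc[OF that])
    show "\<Psi> analytic_on {z}" if "z \<notin> X" "\<And>h. h \<in> hs \<Longrightarrow> h z \<noteq> 0" for z
      by (rule \<Psi>an[OF that(1)]) (use that(2) in \<open>auto simp: hs_def\<close>)
    show "w \<notin> X" by (rule w)
    show "h w \<noteq> 0" if "h \<in> hs" for h using that w' u0[of w] v0[of w] by (auto simp: hs_def)
    show "\<Psi> w \<noteq> 0"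
      using w' du[OF w(1)] dv[OF w(1)] q0[of "f w"] q0[of "g w"] by (auto simp: \<Psi>_def)
    show "norm (\<Psi> z) * (1 + norm (f z) + norm (g z)) \<le> (36 * C * C) * (1 + (\<Sum>h\<in>hs. norm (deriv h z / h z))) ^ 6"
      if z: "z \<notin> X" "\<And>h. h \<in> hs \<Longrightarrow> h z \<noteq> 0" for z
    proof -
      define s where "s = (\<Sum>h\<in>hs. norm (deriv h z / h z))"
      have uvz: "u z \<noteq> 0" "v z \<noteq> 0" using z(2) by (auto simp: hs_def)
      have hs_le: "norm (deriv h z / h z) \<le> s" if "h \<in> hs" for h
        unfolding s_def using that fin by (intro member_le_sum) auto
      have s0: "s \<ge> 0" unfolding s_def by (intro sum_nonneg) auto
      have H6: "norm (H z) \<le> 6 * s"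
      proof -
        have "norm (deriv u z / u z) \<le> s" "norm (deriv v z / v z) \<le> s"
          "norm (deriv (deriv u) z / deriv u z) \<le> s" "norm (deriv (deriv v) z / deriv v z) \<le> s"
          by (rule hs_le; simp add: hs_def)+
        moreover have "H z = (deriv (deriv u) z / deriv u z - 2 * (deriv u z / u z)) - (deriv (deriv v) z / deriv v z - 2 * (deriv v z / v z))"
          by (simp add: H_def inv_pre_schwarzian_def)
        moreover have "norm ((a - 2 * b) - (c - 2 * d)) \<le> norm a + 2 * norm b + norm c + 2 * norm d" for a b c d :: complex
          using norm_triangle_ineq4[of "a - 2 * b" "c - 2 * d"] norm_triangle_ineq4[of a "2 * b"] norm_triangle_ineq4[of c "2 * d"]
          by (simp add: norm_mult)
        ultimately show ?thesis by (smt (verit, best))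
      qed
      have part: "(norm (deriv k z * q (k z)))\<^sup>2 * (1 + norm (k z)) \<le> C * norm (poly P (k z) - 1) * s\<^sup>2"
        if k: "k analytic_on {z}" "(\<lambda>a z. k z - a) ` S \<subseteq> hs" "k z \<notin> S" for k
      proof -
        have inj: "inj_on (\<lambda>a z. k z - a) S" by (auto simp: inj_on_def fun_eq_iff)
        have "norm (deriv k z) * (\<Sum>a\<in>S. 1 / norm (k z - a)) = (\<Sum>h\<in>(\<lambda>a z. k z - a) ` S. norm (deriv h z / h z))"
          unfolding sum.reindex[OF inj] o_def sum_distrib_left
          by (intro sum.cong refl) (simp add: norm_divide deriv_diff_const[OF k(1)])
        also have "\<dots> \<le> s" unfolding s_def using fin k(2) by (intro sum_mono2) auto
        finally have ds: "norm (deriv k z) * (\<Sum>a\<in>S. 1 / norm (k z - a)) \<le> s" .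
        have "(norm (deriv k z * q (k z)))\<^sup>2 * (1 + norm (k z)) = (norm (deriv k z))\<^sup>2 * ((norm (q (k z)))\<^sup>2 * (1 + norm (k z)))"
          by (simp add: norm_mult power_mult_distrib)
        also have "\<dots> \<le> (norm (deriv k z))\<^sup>2 * (C * norm (poly P (k z) - 1) * (\<Sum>a\<in>S. 1 / norm (k z - a))\<^sup>2)"
          by (intro mult_left_mono C(2) k) auto
        also have "\<dots> = C * norm (poly P (k z) - 1) * (norm (deriv k z) * (\<Sum>a\<in>S. 1 / norm (k z - a)))\<^sup>2"
          by (simp add: power_mult_distrib mult_ac)
        also have "\<dots> \<le> C * norm (poly P (k z) - 1) * s\<^sup>2"
          using ds C(1) by (intro mult_left_mono power_mono mult_nonneg_nonneg sum_nonneg) auto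
        finally show ?thesis .
      qed
      have pf: "(norm (deriv f z * q (f z)))\<^sup>2 * (1 + norm (f z)) \<le> C * norm (u z) * s\<^sup>2"
        unfolding u_def by (rule part[OF fan[OF z(1)]]) (use u0[of z] uvz in \<open>auto simp: hs_def\<close>)
      have pg: "(norm (deriv g z * q (g z)))\<^sup>2 * (1 + norm (g z)) \<le> C * norm (v z) * s\<^sup>2"
        unfolding v_def by (rule part[OF gan[OF z(1)]]) (use v0[of z] uvz in \<open>auto simp: hs_def\<close>)
      define a where "a = (norm (deriv f z * q (f z)))\<^sup>2"
      define b where "b = (norm (deriv g z * q (g z)))\<^sup>2"
      have ab: "a \<ge> 0" "b \<ge> 0" by (auto simp: a_def b_def)
      have "norm (\<Psi> z) = (norm (H z))\<^sup>2 * a * b / (norm (u z) * norm (v z))"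
        by (simp add: \<Psi>_def a_def b_def norm_mult norm_divide norm_power power_mult_distrib)
      then have "norm (\<Psi> z) * (1 + norm (f z) + norm (g z)) \<le> (norm (H z))\<^sup>2 * a * b / (norm (u z) * norm (v z)) * ((1 + norm (f z)) * (1 + norm (g z)))"
        using ab by (simp only:) (intro mult_left_mono, auto simp: algebra_simps intro!: divide_nonneg_nonneg mult_nonneg_nonneg)
      also have "\<dots> = (norm (H z))\<^sup>2 * ((a * (1 + norm (f z))) * (b * (1 + norm (g z)))) / (norm (u z) * norm (v z))"
        by (simp add: mult_ac)
      also have "\<dots> \<le> (6 * s)\<^sup>2 * ((C * norm (u z) * s\<^sup>2) * (C * norm (v z) * s\<^sup>2)) / (norm (u z) * norm (v z))"
      proof (rule divide_right_mono)
        have h1: "(a * (1 + norm (f z))) * (b * (1 + norm (g z))) \<le> (C * norm (u z) * s\<^sup>2) * (C * norm (v z) * s\<^sup>2)"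
          by (rule mult_mono) (use pf pg ab C(1) in \<open>auto simp: a_def b_def\<close>)
        have h2: "(norm (H z))\<^sup>2 \<le> (6 * s)\<^sup>2" using H6 by (intro power_mono) auto
        show "(norm (H z))\<^sup>2 * ((a * (1 + norm (f z))) * (b * (1 + norm (g z)))) \<le> (6 * s)\<^sup>2 * ((C * norm (u z) * s\<^sup>2) * (C * norm (v z) * s\<^sup>2))"
          by (rule mult_mono[OF h2 h1]) (use ab in auto)
      qed simp
      also have "\<dots> = 36 * C * C * s ^ 6"
      proof -
        have "s ^ 6 = s\<^sup>2 * (s\<^sup>2 * s\<^sup>2)" by (simp flip: power_add)
        then show ?thesis using uvz by (simp add: power_mult_distrib field_simps)
      qed
      also have "\<dots> \<le> 36 * C * C * (1 + s) ^ 6"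
        using C(1) s0 by (intro mult_left_mono power_mono) auto
      finally show ?thesis by (simp add: s_def)
    qed
  qed
qed

section \<open>Functions with equal polynomial values\<close>

lemma local_order_le:
  assumes a: "a analytic_on {z0}" "eventually (\<lambda>z. a z \<noteq> 0) (at z0)" and b: "b analytic_on {z0}" "eventually (\<lambda>z. b z \<noteq> (0::complex)) (at z0)"
    and le: "eventually (\<lambda>z. norm (a z) \<le> C * norm (b z)) (at z0)" and b0: "b z0 = 0"
  shows "a z0 = 0 \<and> zorder b z0 \<le> zorder a z0"
proof -
  obtain m \<alpha> where m: "\<alpha> analytic_on {z0}" "\<alpha> z0 \<noteq> 0" "eventually (\<lambda>z. a z = (z - z0) ^ m * \<alpha> z) (nhds z0)"
    "a z0 = 0 \<Longrightarrow> m = nat (zorder a z0) \<and> 1 \<le> m" "a z0 \<noteq> 0 \<Longrightarrow> m = 0"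
    using analytic_local_factor[OF a] by metis
  obtain n \<gamma> where n: "\<gamma> analytic_on {z0}" "\<gamma> z0 \<noteq> 0" "eventually (\<lambda>z. b z = (z - z0) ^ n * \<gamma> z) (nhds z0)"
    "n = nat (zorder b z0)" "1 \<le> n"
    using analytic_local_factor[OF b] b0 by metis
  have "n \<le> m"
  proof (rule ccontr)
    assume "\<not> n \<le> m"
    then obtain j where j: "n = m + Suc j" using less_imp_Suc_add[of m n] by auto
    have "eventually (\<lambda>z. norm (\<alpha> z) \<le> C * (norm (z - z0) ^ Suc j * norm (\<gamma> z))) (at z0)"
      using le eventually_nhds_imp_at[OF m(3)] eventually_nhds_imp_at[OF n(3)] eventually_neq_at_within[of z0 z0 UNIV]
    proof eventually_elim
      case (elim z)
      have "norm (z - z0) ^ m * norm (\<alpha> z) \<le> C * norm (b z)" using elim(1) unfolding elim(2) by (simp add: norm_mult norm_power)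
      also have "C * norm (b z) = norm (z - z0) ^ m * (C * (norm (z - z0) ^ Suc j * norm (\<gamma> z)))"
        unfolding elim(3) j by (simp only: norm_mult norm_power power_add mult_ac)
      finally show ?case using elim(4) by simp
    qed
    moreover have "((\<lambda>z. norm (\<alpha> z)) \<longlongrightarrow> norm (\<alpha> z0)) (at z0)"
      using m(1) analytic_at_imp_isCont isContD by (blast intro: tendsto_norm)
    moreover have "((\<lambda>z. C * (norm (z - z0) ^ Suc j * norm (\<gamma> z))) \<longlongrightarrow> C * (norm (z0 - z0) ^ Suc j * norm (\<gamma> z0))) (at z0)"
      using n(1) analytic_at_imp_isCont isContD by (intro tendsto_intros) blast
    ultimately have "norm (\<alpha> z0) \<le> C * (norm (z0 - z0) ^ Suc j * norm (\<gamma> z0))"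
      by (intro tendsto_le[OF at_neq_bot])
    then show False using m(2) by simp
  qed
  then have "m \<noteq> 0" using n(5) by simp
  then have "a z0 = 0" using m(5) by blast
  then show ?thesis using m(4) n(4,5) \<open>n \<le> m\<close> by auto
qed

text \<open>
  Two entire functions that bound each other locally have the same zeros with multiplicities.
\<close>
lemma entire_unit_quotient:
  assumes a: "a holomorphic_on UNIV" "a w \<noteq> 0" and b: "b holomorphic_on UNIV" "b w' \<noteq> (0::complex)"
    and le: "\<And>z0. \<exists>C. eventually (\<lambda>z. norm (a z) \<le> C * norm (b z)) (at z0)" "\<And>z0. \<exists>C. eventually (\<lambda>z. norm (b z) \<le> C * norm (a z)) (at z0)"
  obtains Q where "Q holomorphic_on UNIV" "\<And>z. Q z \<noteq> 0" "\<And>z. a z = Q z * b z"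
proof -
  have an: "a analytic_on {z}" "b analytic_on {z}" for z
    using a(1) b(1) holomorphic_on_imp_analytic_at by blast+
  have nz: "eventually (\<lambda>z. a z \<noteq> 0) (at z)" "eventually (\<lambda>z. b z \<noteq> 0) (at z)" for z
    using eventually_nonzero_cofinite[of "{}" a w z] eventually_nonzero_cofinite[of "{}" b w' z] a b by auto
  have 1: "a z = 0 \<and> zorder b z \<le> zorder a z" if "b z = 0" for z
    using local_order_le[OF an(1) nz(1) an(2) nz(2)] le(1)[of z] that by blast
  have 2: "b z = 0 \<and> zorder a z \<le> zorder b z" if "a z = 0" for z
    using local_order_le[OF an(2) nz(2) an(1) nz(1)] le(2)[of z] that by blast
  have zer: "b z = 0 \<longleftrightarrow> a z = 0" for z using 1 2 by blast
  moreover have "zorder b z = zorder a z" for z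
  proof (cases "a z = 0")
    case False
    then have "zorder a z = 0" "zorder b z = 0"
      using zorder_eq_0I[OF an(1)] zorder_eq_0I[OF an(2)] zer by blast+
    then show ?thesis by simp
  qed (use 1 2 in force)
  ultimately obtain h where "h holomorphic_on UNIV" "\<And>z. z \<in> UNIV \<Longrightarrow> h z \<noteq> 0" "\<And>z. z \<in> UNIV \<Longrightarrow> a z = h z * b z"
    using holomorphic_zorder_factorization[OF a(1) open_UNIV connected_UNIV b(1)] by blast
  then show ?thesis using that by simp
qed

text \<open>
  The factor \<open>ln r\<close> makes the class contain all polynomials for every \<open>\<kappa> \<ge> 0\<close> and does not change the
  order.
\<close>
definition growth_le :: "real \<Rightarrow> (complex \<Rightarrow> complex) \<Rightarrow> bool" where
  "growth_le \<kappa> u \<longleftrightarrow> (\<exists>C r0. \<forall>r z. r0 \<le> r \<longrightarrow> norm z \<le> r \<longrightarrow> norm (u z) \<le> exp (C * (r powr \<kappa> * ln r)))"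

lemma ln_ge_1: "3 \<le> r \<Longrightarrow> 1 \<le> ln (r::real)"
  using e_less_272 by (subst ln_ge_iff) auto

lemma powr_ln_ge_1: "0 \<le> \<kappa> \<Longrightarrow> 3 \<le> r \<Longrightarrow> 1 \<le> r powr \<kappa> * ln (r::real)"
  using mult_mono[of 1 "r powr \<kappa>" 1 "ln r"] ln_ge_1[of r] ge_one_powr_ge_zero[of r \<kappa>] by simp

lemma growth_leE:
  assumes "growth_le \<kappa> u" "0 \<le> \<kappa>"
  obtains C r0 where "0 \<le> C" "3 \<le> r0" "\<And>r z. r0 \<le> r \<Longrightarrow> norm z \<le> r \<Longrightarrow> norm (u z) \<le> exp (C * (r powr \<kappa> * ln r))"
proof -
  obtain C r0 where C: "\<And>r z. r0 \<le> r \<Longrightarrow> norm z \<le> r \<Longrightarrow> norm (u z) \<le> exp (C * (r powr \<kappa> * ln r))"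
    using assms(1) unfolding growth_le_def by blast
  show ?thesis
  proof (rule that[of "max 0 C" "max 3 r0"])
    fix r and z :: complex assume r: "max 3 r0 \<le> r" "norm z \<le> r"
    then have "norm (u z) \<le> exp (C * (r powr \<kappa> * ln r))" by (intro C) auto
    also have "\<dots> \<le> exp (max 0 C * (r powr \<kappa> * ln r))"
      using powr_ln_ge_1[OF assms(2), of r] r(1) by (auto intro!: mult_right_mono)
    finally show "norm (u z) \<le> exp (max 0 C * (r powr \<kappa> * ln r))" .
  qed auto
qed

lemma growth_le_mult:
  assumes "growth_le \<kappa> u" "growth_le \<kappa> v" "0 \<le> \<kappa>"
  shows "growth_le \<kappa> (\<lambda>z. u z * v z)"
proof -
  obtain C r0 where C: "\<And>r z. r0 \<le> r \<Longrightarrow> norm z \<le> r \<Longrightarrow> norm (u z) \<le> exp (C * (r powr \<kappa> * ln r))"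
    using growth_leE[OF assms(1,3)] by metis
  obtain D r1 where D: "\<And>r z. r1 \<le> r \<Longrightarrow> norm z \<le> r \<Longrightarrow> norm (v z) \<le> exp (D * (r powr \<kappa> * ln r))"
    using growth_leE[OF assms(2,3)] by metis
  have "norm (u z * v z) \<le> exp ((C + D) * (r powr \<kappa> * ln r))" if "max r0 r1 \<le> r" "norm z \<le> r" for r z
    unfolding norm_mult distrib_right exp_add using that by (intro mult_mono C D) auto
  then show ?thesis unfolding growth_le_def by blast
qed

lemma growth_le_add:
  assumes "growth_le \<kappa> u" "growth_le \<kappa> v" "0 \<le> \<kappa>"
  shows "growth_le \<kappa> (\<lambda>z. u z + v z)"
proof -
  obtain C r0 where C: "0 \<le> C" "3 \<le> r0" "\<And>r z. r0 \<le> r \<Longrightarrow> norm z \<le> r \<Longrightarrow> norm (u z) \<le> exp (C * (r powr \<kappa> * ln r))"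
    using growth_leE[OF assms(1,3)] by metis
  obtain D r1 where D: "0 \<le> D" "\<And>r z. r1 \<le> r \<Longrightarrow> norm z \<le> r \<Longrightarrow> norm (v z) \<le> exp (D * (r powr \<kappa> * ln r))"
    using growth_leE[OF assms(2,3)] by metis
  have "norm (u z + v z) \<le> exp ((C + D + 1) * (r powr \<kappa> * ln r))" if r: "max r0 r1 \<le> r" "norm z \<le> r" for r z
  proof -
    define s where "s = r powr \<kappa> * ln r"
    have s: "s \<ge> 1" unfolding s_def using r C(2) by (intro powr_ln_ge_1 assms(3)) auto
    have "norm (u z + v z) \<le> exp (C * s) + exp (D * s)"
      unfolding s_def using r by (intro norm_triangle_le add_mono C D) auto
    also have "\<dots> \<le> exp ((C + D) * s) + exp ((C + D) * s)"
      using C D s by (intro add_mono) (auto simp: distrib_right)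
    also have "\<dots> = 2 * exp ((C + D) * s)" by simp
    also have "\<dots> \<le> exp s * exp ((C + D) * s)"
    proof (rule mult_right_mono)
      show "2 \<le> exp s" using s exp_ge_add_one_self[of s] by linarith
    qed simp
    also have "\<dots> = exp ((C + D + 1) * s)" by (simp flip: exp_add add: algebra_simps)
    finally show ?thesis by (simp add: s_def)
  qed
  then show ?thesis unfolding growth_le_def by blast
qed

lemma growth_le_poly: "0 \<le> \<kappa> \<Longrightarrow> growth_le \<kappa> (poly p)"
proof -
  assume \<kappa>: "0 \<le> \<kappa>"
  obtain C where C: "C > 0" "\<And>w. norm (poly p w) \<le> C * (1 + norm w) ^ degree p" using poly_norm_upper by blast
  define D where "D = \<bar>ln C\<bar> + 2 * degree p"
  have "norm (poly p z) \<le> exp (D * (r powr \<kappa> * ln r))" if r: "3 \<le> r" "norm z \<le> r" for r z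
  proof -
    have lr: "ln r \<ge> 1" using ln_ge_1 r by simp
    have "norm (poly p z) \<le> C * (r * r) ^ degree p"
    proof -
      have "3 * r \<le> r * r" using r by (intro mult_right_mono) auto
      then have "1 + norm z \<le> r * r" using r by linarith
      then have "C * (1 + norm z) ^ degree p \<le> C * (r * r) ^ degree p" using C by (intro mult_left_mono power_mono) auto
      then show ?thesis using C(2)[of z] by linarith
    qed
    also have "\<dots> = exp (ln C + 2 * degree p * ln r)"
    proof -
      have "exp (ln C + 2 * degree p * ln r) = exp (ln C) * exp (real (2 * degree p) * ln r)" by (simp add: exp_add)
      also have "exp (real (2 * degree p) * ln r) = r ^ (2 * degree p)" using r by (subst exp_of_nat_mult) simp
      finally show ?thesis using C by (simp add: power_mult power2_eq_square)
    qed
    also have "\<dots> \<le> exp (D * (r powr \<kappa> * ln r))"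
    proof -
      have "\<bar>ln C\<bar> * 1 \<le> \<bar>ln C\<bar> * ln r" using lr by (intro mult_left_mono) auto
      then have "ln C + 2 * degree p * ln r \<le> D * ln r" by (simp add: D_def algebra_simps)
      also have "\<dots> \<le> D * (r powr \<kappa> * ln r)"
        using lr ge_one_powr_ge_zero[of r \<kappa>] \<kappa> r mult_right_mono[of 1 "r powr \<kappa>" "ln r"] by (intro mult_left_mono) (auto simp: D_def)
      finally show ?thesis by simp
    qed
    finally show ?thesis .
  qed
  then show ?thesis unfolding growth_le_def by blast
qed

lemma growth_le_const: "0 \<le> \<kappa> \<Longrightarrow> growth_le \<kappa> (\<lambda>z. c)"
proof -
  assume "0 \<le> \<kappa>"
  moreover have "poly [:c:] = (\<lambda>z. c)" by auto
  ultimately show ?thesis using growth_le_poly[of \<kappa> "[:c:]"] by simp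
qed

lemma growth_le_diff:
  assumes "growth_le \<kappa> u" "growth_le \<kappa> v" "0 \<le> \<kappa>"
  shows "growth_le \<kappa> (\<lambda>z. u z - v z)"
  using growth_le_add[OF assms(1) growth_le_mult[OF growth_le_const[OF assms(3), of "-1"] assms(2,3)] assms(3)] by simp

lemma powr_ln_double:
  fixes r :: real
  assumes "0 \<le> \<kappa>" "3 \<le> r"
  shows "(2 * r) powr \<kappa> * ln (2 * r) \<le> 2 powr \<kappa> * 2 * (r powr \<kappa> * ln r)"
proof -
  have "ln (2 * r) \<le> 2 * ln r"
  proof -
    have "ln (2 * r) = ln 2 + ln r" using assms by (simp add: ln_mult)
    moreover have "ln 2 \<le> ln r" using assms by (intro ln_mono) auto
    ultimately show ?thesis by simp
  qed
  moreover have "(2 * r) powr \<kappa> = 2 powr \<kappa> * r powr \<kappa>" using assms by (simp add: powr_mult)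
  ultimately have "(2 * r) powr \<kappa> * ln (2 * r) \<le> (2 powr \<kappa> * r powr \<kappa>) * (2 * ln r)"
    using assms by (simp only:) (intro mult_left_mono, auto)
  then show ?thesis by (simp add: mult_ac)
qed

text \<open>
  The quotient bound between the radii \<open>r\<close> and \<open>2 r\<close>.
\<close>
lemma growth_le_quotient:
  assumes \<kappa>: "0 \<le> \<kappa>" and q: "q holomorphic_on UNIV" and b: "b holomorphic_on UNIV" "b w \<noteq> 0" "growth_le \<kappa> b"
    and qb: "growth_le \<kappa> (\<lambda>z. q z * b z)"
  shows "growth_le \<kappa> q"
proof -
  obtain m b1 where b1: "b1 holomorphic_on UNIV" "b1 0 \<noteq> 0" "\<And>z. b z = (z - 0) ^ m * b1 z"
    using entire_factor_point[OF b(1,2), of 0] by metis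
  obtain C r0 where C: "0 \<le> C" "3 \<le> r0" "\<And>r z. r0 \<le> r \<Longrightarrow> norm z \<le> r \<Longrightarrow> norm (b z) \<le> exp (C * (r powr \<kappa> * ln r))"
    using growth_leE[OF b(3) \<kappa>] by metis
  obtain D r1 where D: "0 \<le> D" "\<And>r z. r1 \<le> r \<Longrightarrow> norm z \<le> r \<Longrightarrow> norm (q z * b z) \<le> exp (D * (r powr \<kappa> * ln r))"
    using growth_leE[OF qb \<kappa>] by metis
  define l where "l = \<bar>ln (norm (b1 0))\<bar>"
  define E where "E = D * (2 powr \<kappa> * 2) + l + 4 * (C * (2 powr \<kappa> * 2) + 1 + l)"
  have "norm (q z) \<le> exp (E * (r powr \<kappa> * ln r))" if r: "max r0 r1 \<le> r" "norm z \<le> r" for r z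
  proof -
    define s where "s = r powr \<kappa> * ln r"
    define S where "S = (2 * r) powr \<kappa> * ln (2 * r)"
    have r3: "r \<ge> 3" using r C(2) by simp
    have s: "s \<ge> 1" unfolding s_def by (rule powr_ln_ge_1[OF \<kappa> r3])
    have S: "S \<le> 2 powr \<kappa> * 2 * s" unfolding s_def S_def by (rule powr_ln_double[OF \<kappa> r3])
    have b1b: "norm (b1 x) \<le> norm (b x)" if "norm x = 2 * r" for x
      using that r3 mult_right_mono[of 1 "norm x ^ m" "norm (b1 x)"] one_le_power[of "norm x" m]
      by (simp add: b1(3) norm_mult norm_power)
    have "norm (q z) \<le> exp (D * S - ln (norm (b1 0)) + 4 * r / (2 * r - r) * (C * S + 1 - ln (norm (b1 0))))"
    proof (rule quotient_bound[OF b1(1) q b1(2)])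
      show "norm (b1 x) \<le> exp (C * S)" if "norm x = 2 * r" for x
        using b1b[OF that] C(3)[of "2 * r" x] that r r3 by (simp add: S_def)
      show "norm (q x * b1 x) \<le> exp (D * S)" if "norm x = 2 * r" for x
      proof -
        have "norm (q x * b1 x) \<le> norm (q x * b x)" unfolding norm_mult by (intro mult_left_mono b1b that) auto
        also have "\<dots> \<le> exp (D * S)" unfolding S_def using that r r3 by (intro D(2)) auto
        finally show ?thesis .
      qed
    qed (use r r3 in auto)
    also have "4 * r / (2 * r - r) = 4" using r3 by simp
    also have "exp (D * S - ln (norm (b1 0)) + 4 * (C * S + 1 - ln (norm (b1 0)))) \<le> exp (E * s)"
    proof -
      have "D * S \<le> D * (2 powr \<kappa> * 2 * s)" "C * S \<le> C * (2 powr \<kappa> * 2 * s)"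
        using S C(1) D(1) by (auto intro: mult_left_mono)
      moreover have "l * 1 \<le> l * s" by (rule mult_left_mono[OF s]) (simp add: l_def)
      moreover have "- ln (norm (b1 0)) \<le> l" by (simp add: l_def)
      ultimately have "D * S - ln (norm (b1 0)) + 4 * (C * S + 1 - ln (norm (b1 0))) \<le>
           D * (2 powr \<kappa> * 2 * s) + l * s + 4 * (C * (2 powr \<kappa> * 2 * s) + s + l * s)" using s by argo
      also have "\<dots> = E * s" by (simp add: E_def algebra_simps)
      finally show ?thesis by simp
    qed
    finally show ?thesis by (simp add: s_def)
  qed
  then show ?thesis unfolding growth_le_def by blast
qed

text \<open>
  \<open>Q = exp u\<close>, and by Borel-Caratheodory \<open>u\<close> grows more slowly than \<open>r ^ (d + 1)\<close>, so it is a polynomial of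
  degree at most \<open>d\<close>. This is why non-integer orders are special.
\<close>
lemma zero_free_integral_order:
  assumes Q: "Q holomorphic_on UNIV" "\<And>z. Q z \<noteq> 0" and \<kappa>: "0 \<le> \<kappa>" "\<kappa> < real d + 1" and gr: "growth_le \<kappa> Q"
  shows "growth_le (real d) Q"
proof -
  obtain u where u: "u holomorphic_on UNIV" "\<And>z. exp (u z) = Q z"
    using holomorphic_logarithm_exists[of UNIV Q 0] Q by auto
  obtain C r0 where C: "0 \<le> C" "3 \<le> r0" "\<And>r z. r0 \<le> r \<Longrightarrow> norm z \<le> r \<Longrightarrow> norm (Q z) \<le> exp (C * (r powr \<kappa> * ln r))"
    using growth_leE[OF gr \<kappa>(1)] by metis
  define E where "E = norm (u 0) + 2 * (C * (2 powr \<kappa> * 2) + 1 + norm (u 0))"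
  have ub: "norm (u z) \<le> E * (r powr \<kappa> * ln r)" if r: "r0 \<le> r" "norm z \<le> r" for r z
  proof -
    define s where "s = r powr \<kappa> * ln r"
    define S where "S = (2 * r) powr \<kappa> * ln (2 * r)"
    have r3: "r \<ge> 3" using r C(2) by simp
    have s: "s \<ge> 1" unfolding s_def by (rule powr_ln_ge_1[OF \<kappa>(1) r3])
    have S: "S \<le> 2 powr \<kappa> * 2 * s" unfolding s_def S_def by (rule powr_ln_double[OF \<kappa>(1) r3])
    have "norm (u z - u 0) \<le> 2 * r / (2 * r - r) * (C * S + 1 - Re (u 0))"
    proof (rule borel_caratheodory)
      show "u holomorphic_on ball 0 (2 * r)" using u(1) holomorphic_on_subset by blast
      fix x :: complex assume x: "norm x < 2 * r"
      have "exp (Re (u x)) = norm (Q x)" using u(2)[of x] norm_exp_eq_Re[of "u x"] by simp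
      also have "\<dots> \<le> exp (C * S)" unfolding S_def using x r r3 by (intro C(3)) auto
      finally show "Re (u x) < C * S + 1" by simp
    qed (use r r3 in auto)
    also have "2 * r / (2 * r - r) = 2" using r3 by simp
    finally have "norm (u z) \<le> norm (u 0) + 2 * (C * S + 1 - Re (u 0))" using norm_triangle_ineq2[of "u z" "u 0"] by linarith
    also have "\<dots> \<le> norm (u 0) + 2 * (C * (2 powr \<kappa> * 2 * s) + 1 + norm (u 0))"
    proof -
      have "- Re (u 0) \<le> norm (u 0)" using abs_Re_le_cmod[of "u 0"] by linarith
      then show ?thesis using mult_left_mono[OF S C(1)] by argo
    qed
    also have "\<dots> \<le> norm (u 0) * s + 2 * (C * (2 powr \<kappa> * 2 * s) + s + norm (u 0) * s)"
      using s mult_left_mono[of 1 s "norm (u 0)"] norm_ge_zero[of "u 0"] by argo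
    also have "\<dots> = E * s" by (simp add: E_def algebra_simps)
    finally show ?thesis by (simp add: s_def)
  qed
  have E0: "E \<ge> 0" using C(1) by (simp add: E_def)
  have lim: "((\<lambda>r::real. E * (r powr \<kappa> * ln r) / r ^ (d + 1)) \<longlongrightarrow> 0) at_top"
  proof -
    have "((\<lambda>r::real. E * (r powr \<kappa> * ln r) / r powr (real d + 1)) \<longlongrightarrow> 0) at_top"
    proof -
      define e where "e = real d + 1 - \<kappa>"
      have "e > 0" using \<kappa> by (simp add: e_def)
      then have "((\<lambda>r::real. E * (ln r * r powr (- e))) \<longlongrightarrow> 0) at_top" by real_asymp
      moreover have "eventually (\<lambda>r::real. E * (ln r * r powr (- e)) = E * (r powr \<kappa> * ln r) / r powr (real d + 1)) at_top"
        using eventually_gt_at_top[of 0]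
        by eventually_elim (simp add: e_def powr_diff field_simps)
      ultimately show ?thesis by (rule Lim_transform_eventually)
    qed
    moreover have "eventually (\<lambda>r::real. E * (r powr \<kappa> * ln r) / r powr (real d + 1) = E * (r powr \<kappa> * ln r) / r ^ (d + 1)) at_top"
      using eventually_gt_at_top[of 0]
    proof eventually_elim
      case (elim r)
      have "r powr (real d + 1) = r powr real (d + 1)" by (simp add: add.commute)
      also have "\<dots> = r ^ (d + 1)" using elim by (rule powr_realpow)
      finally show ?case by simp
    qed
    ultimately show ?thesis by (rule Lim_transform_eventually)
  qed
  have "eventually (\<lambda>r::real. E * (r powr \<kappa> * ln r) / r ^ (d + 1) < 1) at_top"
    using order_tendstoD(2)[OF lim, of 1] by simp
  then obtain r1 where r1: "\<And>r. r \<ge> r1 \<Longrightarrow> E * (r powr \<kappa> * ln r) / r ^ (d + 1) < 1"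
    by (auto simp: eventually_at_top_linorder)
  define c where "c k = (deriv ^^ k) u 0 / fact k" for k
  have expand: "u z = (\<Sum>k\<le>d + 1. c k * z ^ k)" for z
    unfolding c_def
  proof (rule Liouville_polynomial[OF u(1), of "max r0 r1" 1])
    fix x :: complex assume x: "max r0 r1 \<le> norm x"
    have pos: "norm x > 0" using x C(2) by linarith
    have "norm (u x) \<le> E * (norm x powr \<kappa> * ln (norm x))" using x by (intro ub) auto
    also have "\<dots> \<le> 1 * norm x ^ (d + 1)" using r1[of "norm x"] x pos by (simp add: field_simps)
    finally show "norm (u x) \<le> 1 * norm x ^ (d + 1)" .
  qed
  have cd: "c (d + 1) = 0"
  proof -
    have "norm (c (d + 1)) \<le> E * (r powr \<kappa> * ln r) / r ^ (d + 1)" if r: "r \<ge> r0" for r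
    proof -
      have r3: "r \<ge> 3" using r C(2) by simp
      have "norm ((deriv ^^ (d + 1)) u 0) \<le> fact (d + 1) * (E * (r powr \<kappa> * ln r)) / r ^ (d + 1)"
      proof (rule Cauchy_inequality)
        show "u holomorphic_on ball 0 r" "continuous_on (cball 0 r) u"
          using u(1) holomorphic_on_subset holomorphic_on_imp_continuous_on by blast+
        show "norm (u x) \<le> E * (r powr \<kappa> * ln r)" if "norm (0 - x) = r" for x
          using that r by (intro ub) auto
      qed (use r3 in auto)
      then have "norm ((deriv ^^ (d + 1)) u 0) / fact (d + 1) \<le> fact (d + 1) * (E * (r powr \<kappa> * ln r)) / r ^ (d + 1) / fact (d + 1)"
        by (intro divide_right_mono) auto
      also have "\<dots> = E * (r powr \<kappa> * ln r) / r ^ (d + 1)" by (simp del: fact_Suc)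
      finally show ?thesis unfolding c_def norm_divide norm_fact .
    qed
    then have "eventually (\<lambda>r. norm (c (d + 1)) \<le> E * (r powr \<kappa> * ln r) / r ^ (d + 1)) at_top"
      by (auto simp: eventually_at_top_linorder)
    then have "norm (c (d + 1)) \<le> 0" by (rule tendsto_lowerbound[OF lim]) simp
    then show ?thesis by simp
  qed
  define A where "A = (\<Sum>k\<le>d. norm (c k))"
  have "norm (Q z) \<le> exp (A * (r powr real d * ln r))" if r: "3 \<le> r" "norm z \<le> r" for r z
  proof -
    have "norm (u z) \<le> (\<Sum>k\<le>d. norm (c k * z ^ k))"
      using cd norm_sum[of "\<lambda>k. c k * z ^ k" "{..d}"] by (simp add: expand)
    also have "\<dots> \<le> (\<Sum>k\<le>d. norm (c k) * r ^ d)"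
    proof (rule sum_mono)
      fix k assume k: "k \<in> {..d}"
      have "norm z ^ k \<le> r ^ k" using r by (intro power_mono) auto
      also have "\<dots> \<le> r ^ d" using r k by (intro power_increasing) auto
      finally show "norm (c k * z ^ k) \<le> norm (c k) * r ^ d" by (simp add: norm_mult norm_power mult_left_mono)
    qed
    also have "\<dots> = A * r ^ d" by (simp add: A_def sum_distrib_right)
    also have "\<dots> = A * (r powr real d * 1)" using r by (simp add: powr_realpow)
    also have "\<dots> \<le> A * (r powr real d * ln r)"
      using ln_ge_1[OF r(1)] by (intro mult_left_mono) (auto simp: A_def sum_nonneg)
    finally have "norm (u z) \<le> A * (r powr real d * ln r)" .
    then have "Re (u z) \<le> A * (r powr real d * ln r)" using complex_Re_le_cmod[of "u z"] by linarith
    then show ?thesis using u(2)[of z] norm_exp_eq_Re[of "u z"] by simp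
  qed
  then show ?thesis unfolding growth_le_def by blast
qed

lemma degree_diff_const_pos:
  fixes P :: "'a :: ab_group_add poly"
  assumes "degree P > 0"
  shows "degree (P - [:c:]) > 0"
proof -
  have "degree (P + [:- c:]) = degree P" by (rule degree_add_eq_left) (use assms in simp)
  moreover have "P + [:- c:] = P - [:c:]" by simp
  ultimately show ?thesis using assms by simp
qed

text \<open>
  At a pole and at points where the value is not \<open>\<beta>\<close> this holds since \<open>P \<circ> f = P \<circ> g\<close> makes \<open>f\<close> and \<open>g\<close>
  comparable. At a \<open>\<beta>\<close>-point of both, if \<open>P - P \<beta>\<close> has a zero of order \<open>s\<close> at \<open>\<beta>\<close>, the \<open>s\<close>-th powers of
  \<open>f - \<beta>\<close> and \<open>g - \<beta>\<close> agree up to factors that tend to the same non-zero limit.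
\<close>
lemma ratio_locally_bounded:
  assumes f: "f \<in> M1" and g: "g \<in> M1" and X: "finite X"
    and pole: "\<And>z. is_pole f z \<longleftrightarrow> is_pole g z"
    and P: "degree P > 0" "\<And>z. z \<notin> X \<Longrightarrow> poly P (f z) = poly P (g z)"
    and \<beta>: "\<And>z. \<not> is_pole f z \<Longrightarrow> f z = \<beta> \<longleftrightarrow> g z = \<beta>"
  shows "\<exists>C. eventually (\<lambda>z. norm (f z - \<beta>) \<le> C * norm (g z - \<beta>)) (at z0)"
proof -
  obtain C where C: "C \<ge> 1" "\<And>x y. poly P x = poly P y \<Longrightarrow> 1 + norm y \<le> C * (1 + norm x)"
    using poly_values_comparable[OF P(1), of 1 0] by auto
  show ?thesis
  proof (cases "is_pole f z0")
    case True
    then have "filterlim g at_infinity (at z0)" using pole by (simp add: is_pole_def)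
    then have "eventually (\<lambda>z. 2 * norm \<beta> + 1 \<le> norm (g z)) (at z0)"
      by (simp add: filterlim_at_infinity[of 0] add_pos_nonneg add_nonneg_pos)
    with eventually_cofinite_at[OF X, of z0]
    have "eventually (\<lambda>z. norm (f z - \<beta>) \<le> 2 * (1 + norm \<beta>) * C * norm (g z - \<beta>)) (at z0)"
    proof eventually_elim
      case (elim z)
      have "norm (f z - \<beta>) \<le> norm (f z) + norm \<beta>" by (rule norm_triangle_ineq4)
      also have "\<dots> \<le> (1 + norm \<beta>) * (1 + norm (f z))"
        using mult_nonneg_nonneg[of "norm \<beta>" "norm (f z)"] by (simp add: algebra_simps)
      also have "\<dots> \<le> (1 + norm \<beta>) * (C * (1 + norm (g z)))"
        using C(2)[of "g z" "f z"] P(2)[OF elim(1)] by (intro mult_left_mono) auto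
      also have "\<dots> \<le> (1 + norm \<beta>) * (C * (2 * norm (g z - \<beta>)))"
      proof (intro mult_left_mono)
        show "1 + norm (g z) \<le> 2 * norm (g z - \<beta>)"
          using norm_triangle_ineq2[of "g z" \<beta>] elim(2) by linarith
      qed (use C(1) in auto)
      finally show ?case by (simp only: mult_ac)
    qed
    then show ?thesis by blast
  next
    case np: False
    have fan: "f analytic_on {z0}" and gan: "g analytic_on {z0}" using M1_analytic f g np pole by blast+
    have flim: "(f \<longlongrightarrow> f z0) (at z0)" and glim: "(g \<longlongrightarrow> g z0) (at z0)"
      using fan gan analytic_at_imp_isCont isContD by blast+
    show ?thesis
    proof (cases "f z0 = \<beta>")
      case False
      then have gb: "g z0 \<noteq> \<beta>" using \<beta>[OF np] by simp
      have "eventually (\<lambda>z. norm (f z - \<beta>) < norm (f z0 - \<beta>) + 1) (at z0)"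
        using flim by (intro order_tendstoD(2)[of _ "norm (f z0 - \<beta>)"] tendsto_intros) auto
      moreover have "eventually (\<lambda>z. norm (g z0 - \<beta>) / 2 < norm (g z - \<beta>)) (at z0)"
        using glim gb by (intro order_tendstoD(1)[of _ "norm (g z0 - \<beta>)"] tendsto_intros) auto
      ultimately have "eventually (\<lambda>z. norm (f z - \<beta>) \<le> ((norm (f z0 - \<beta>) + 1) / (norm (g z0 - \<beta>) / 2)) * norm (g z - \<beta>)) (at z0)"
      proof eventually_elim
        case (elim z)
        have "norm (f z - \<beta>) \<le> ((norm (f z0 - \<beta>) + 1) / (norm (g z0 - \<beta>) / 2)) * (norm (g z0 - \<beta>) / 2)"
          using elim(1) gb by simp
        also have "\<dots> \<le> ((norm (f z0 - \<beta>) + 1) / (norm (g z0 - \<beta>) / 2)) * norm (g z - \<beta>)"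
          using elim(2) by (intro mult_left_mono) auto
        finally show ?case .
      qed
      then show ?thesis by blast
    next
      case True
      then have gb: "g z0 = \<beta>" using \<beta>[OF np] by simp
      define p where "p = P - [:poly P \<beta>:]"
      have dp: "degree p > 0" unfolding p_def by (rule degree_diff_const_pos[OF P(1)])
      then have p0: "p \<noteq> 0" by auto
      \<comment> \<open>The quotient of the two factors is eventually at most 4, and its \<open>s\<close>-th root all the more.\<close>
      define s where "s = order \<beta> p"
      have s1: "s \<ge> 1" using p0 order_root[of p \<beta>] by (simp add: s_def p_def)
      obtain W where W: "p = [:- \<beta>, 1:] ^ s * W" "\<not> [:- \<beta>, 1:] dvd W"
        using order_decomp[OF p0, of \<beta>] unfolding s_def by blast
      have W0: "poly W \<beta> \<noteq> 0" using W(2) by (simp add: poly_eq_0_iff_dvd)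
      have pe: "poly p x = (x - \<beta>) ^ s * poly W x" for x by (simp add: W(1) poly_power)
      define \<omega> where "\<omega> = norm (poly W \<beta>)"
      have \<omega>: "\<omega> > 0" using W0 by (simp add: \<omega>_def)
      have "((\<lambda>z. poly W (f z)) \<longlongrightarrow> poly W (f z0)) (at z0)" "((\<lambda>z. poly W (g z)) \<longlongrightarrow> poly W (g z0)) (at z0)"
        by (rule isCont_tendsto_compose[OF poly_isCont flim], rule isCont_tendsto_compose[OF poly_isCont glim])
      then have lim: "((\<lambda>z. norm (poly W (f z))) \<longlongrightarrow> \<omega>) (at z0)" "((\<lambda>z. norm (poly W (g z))) \<longlongrightarrow> \<omega>) (at z0)"
        unfolding \<omega>_def using True gb by (auto intro: tendsto_norm)
      have "eventually (\<lambda>z. \<omega> / 2 < norm (poly W (f z))) (at z0)" using order_tendstoD(1)[OF lim(1), of "\<omega> / 2"] \<omega> by simp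
      moreover have "eventually (\<lambda>z. norm (poly W (g z)) < 2 * \<omega>) (at z0)" using order_tendstoD(2)[OF lim(2), of "2 * \<omega>"] \<omega> by simp
      ultimately have "eventually (\<lambda>z. norm (f z - \<beta>) \<le> 4 * norm (g z - \<beta>)) (at z0)"
        using eventually_cofinite_at[OF X, of z0]
      proof eventually_elim
        case (elim z)
        have "poly p (f z) = poly p (g z)" using P(2)[OF elim(3)] by (simp add: p_def)
        then have e: "norm (f z - \<beta>) ^ s * norm (poly W (f z)) = norm (g z - \<beta>) ^ s * norm (poly W (g z))"
          unfolding pe by (metis norm_mult norm_power)
        have "norm (f z - \<beta>) ^ s * (\<omega> / 2) \<le> norm (f z - \<beta>) ^ s * norm (poly W (f z))"
          using elim(1) by (intro mult_left_mono) auto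
        also have "\<dots> \<le> norm (g z - \<beta>) ^ s * (2 * \<omega>)" unfolding e using elim(2) by (intro mult_left_mono) auto
        finally have "norm (f z - \<beta>) ^ s \<le> 4 * norm (g z - \<beta>) ^ s" using \<omega> by (simp add: field_simps)
        also have "\<dots> \<le> 4 ^ s * norm (g z - \<beta>) ^ s" using s1 by (intro mult_right_mono self_le_power) auto
        finally have "norm (f z - \<beta>) ^ s \<le> (4 * norm (g z - \<beta>)) ^ s" by (simp add: power_mult_distrib)
        then show ?case using power_mono_iff[of "norm (f z - \<beta>)" "4 * norm (g z - \<beta>)" s] s1 by simp
      qed
      then show ?thesis by blast
    qed
  qed
qed

lemma same_poly_values_same_poles:
  assumes f: "f \<in> M1" and g: "g \<in> M1" and X: "finite X"
    and P: "degree P > 0" "\<And>z. z \<notin> X \<Longrightarrow> poly P (f z) = poly P (g z)" and pole: "is_pole g z0"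
  shows "is_pole f z0"
proof (rule ccontr)
  assume "\<not> is_pole f z0"
  then have "f analytic_on {z0}" using M1_analytic f by blast
  then have "(f \<longlongrightarrow> f z0) (at z0)" using analytic_at_imp_isCont isContD by blast
  then have evf: "eventually (\<lambda>z. norm (f z) < norm (f z0) + 1) (at z0)"
    by (intro order_tendstoD(2)[of _ "norm (f z0)"] tendsto_intros) auto
  obtain C where C: "C \<ge> 1" "\<And>x y. poly P x = poly P y \<Longrightarrow> 1 + norm y \<le> C * (1 + norm x)"
    using poly_values_comparable[OF P(1), of 1 0] by auto
  define B where "B = C * (norm (f z0) + 2)"
  have B: "B > 0" using C(1) by (auto simp: B_def intro!: mult_pos_pos add_nonneg_pos)
  have "eventually (\<lambda>z. B \<le> norm (g z)) (at z0)"
    using pole B by (simp add: is_pole_def filterlim_at_infinity[of 0])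
  with evf have "eventually (\<lambda>z. False) (at z0)" using eventually_cofinite_at[OF X, of z0]
  proof eventually_elim
    case (elim z)
    have "1 + norm (g z) \<le> C * (1 + norm (f z))" using C(2) P(2)[OF elim(3)] by blast
    also have "\<dots> \<le> B" unfolding B_def using C(1) elim(1) by (intro mult_left_mono) auto
    finally show ?case using elim(2) by linarith
  qed
  then show False by simp
qed

text \<open>
  As \<open>P \<circ> f = P \<circ> g\<close> and \<open>P\<close> separates \<open>\<beta>\<^sub>1\<close> from \<open>\<beta>\<^sub>2\<close>, the functions share both values separately, and
  \<open>(f - \<beta>\<^sub>i) / (g - \<beta>\<^sub>i)\<close> are entire functions \<open>Q\<^sub>i\<close> without zeros. Let \<open>d < \<rho>(f) < d + 1\<close>. All functions
  involved grow at most like order \<open>\<kappa> < d + 1\<close>, so the \<open>Q\<^sub>i\<close> are exponentials of polynomials of degree at most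
  \<open>d\<close>. If \<open>f \<noteq> g\<close>, then \<open>Q\<^sub>1 \<noteq> Q\<^sub>2\<close>, and the two linear equations express \<open>f\<close> and \<open>g\<close> rationally by
  \<open>Q\<^sub>1\<close> and \<open>Q\<^sub>2\<close>, which bounds the order of \<open>f\<close> by \<open>d\<close>.
\<close>
lemma same_poly_values_uniqueness:
  assumes f: "f \<in> M1" and g: "g \<in> M1" and X: "finite X" "\<And>z. is_pole f z \<Longrightarrow> z \<in> X" "\<And>z. is_pole g z \<Longrightarrow> z \<in> X"
    and P: "degree P > 0" "\<And>z. z \<notin> X \<Longrightarrow> poly P (f z) = poly P (g z)"
    and \<beta>: "\<beta>\<^sub>1 \<noteq> \<beta>\<^sub>2" "poly P \<beta>\<^sub>1 \<noteq> poly P \<beta>\<^sub>2" and share: "share_IM f g {\<beta>\<^sub>1, \<beta>\<^sub>2}"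
    and order: "non_integer_finite_order f"
  shows "f = g"
proof (rule ccontr)
  assume fg: "f \<noteq> g"
  have pole: "is_pole f z \<longleftrightarrow> is_pole g z" for z
    using same_poly_values_same_poles[OF f g X(1) P] same_poly_values_same_poles[OF g f X(1) P(1) P(2)[symmetric]] by blast
  have Pall: "poly P (f z) = poly P (g z)" if "\<not> is_pole f z" for z
  proof -
    have an: "f analytic_on {z}" "g analytic_on {z}" using M1_analytic f g that pole by blast+
    have "((\<lambda>w. poly P (f w)) \<longlongrightarrow> poly P (f z)) (at z)" "((\<lambda>w. poly P (g w)) \<longlongrightarrow> poly P (g z)) (at z)"
      using analytic_at_imp_isCont[OF analytic_on_poly_compose[OF an(1)]] analytic_at_imp_isCont[OF analytic_on_poly_compose[OF an(2)]] isContD by blast+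
    moreover have "eventually (\<lambda>w. poly P (f w) = poly P (g w)) (at z)"
      using eventually_cofinite_at[OF X(1)] by (rule eventually_mono) (use P(2) in auto)
    ultimately show ?thesis using tendsto_cong[of "\<lambda>w. poly P (f w)" "\<lambda>w. poly P (g w)" "at z"] tendsto_unique[OF at_neq_bot] by metis
  qed
  have sh: "f z \<in> {\<beta>\<^sub>1, \<beta>\<^sub>2} \<longleftrightarrow> g z \<in> {\<beta>\<^sub>1, \<beta>\<^sub>2}" if "\<not> is_pole f z" for z
    using share that pole[of z] unfolding share_IM_def E_bar_def by blast
  have b1: "f z = \<beta>\<^sub>1 \<longleftrightarrow> g z = \<beta>\<^sub>1" and b2: "f z = \<beta>\<^sub>2 \<longleftrightarrow> g z = \<beta>\<^sub>2" if "\<not> is_pole f z" for z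
    using sh[OF that] Pall[OF that] \<beta> by auto
  obtain f0 g0 p where p: "p \<noteq> 0" "\<And>z. poly p z = 0 \<Longrightarrow> z \<in> X" and hol: "f0 holomorphic_on UNIV" "g0 holomorphic_on UNIV"
    and fE': "\<And>z. z \<notin> X \<Longrightarrow> f z = f0 z / poly p z" and gE': "\<And>z. z \<notin> X \<Longrightarrow> g z = g0 z / poly p z"
    using M1_common_denominator[OF f g X(2,3)] by metis
  have fE: "f0 z = f z * poly p z" and gE: "g0 z = g z * poly p z" if "z \<notin> X" for z
    using fE'[OF that] gE'[OF that] p(2)[of z] that by auto
  define a where "a \<beta> z = f0 z - \<beta> * poly p z" for \<beta> z
  define b where "b \<beta> z = g0 z - \<beta> * poly p z" for \<beta> z
  have ahol: "a \<beta> holomorphic_on UNIV" and bhol: "b \<beta> holomorphic_on UNIV" for \<beta>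
    unfolding a_def b_def by (intro holomorphic_intros hol)+
  have af: "a \<beta> z = (f z - \<beta>) * poly p z" and bg: "b \<beta> z = (g z - \<beta>) * poly p z" if "z \<notin> X" for \<beta> z
    using fE[OF that] gE[OF that] by (simp_all add: a_def b_def algebra_simps)
  obtain w where w: "w \<notin> X" "deriv f w \<noteq> 0"
    using M1_nonconst_deriv[OF f X(1,2)] non_integer_order_not_const[OF f order] by blast
  have anz: "\<exists>w. a \<beta> w \<noteq> 0" for \<beta>
  proof -
    obtain v where v: "v \<notin> X" "f v \<noteq> \<beta>" using deriv_nonzero_not_const[OF X(1) w] by blast
    then have "a \<beta> v \<noteq> 0" using af[OF v(1)] p(2)[of v] by auto
    then show ?thesis by blast
  qed
  have gconst: "\<exists>v. v \<notin> X \<and> g v \<noteq> \<beta>" for \<beta>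
  proof (rule ccontr)
    assume "\<not> ?thesis"
    then have gb: "g z = \<beta>" if "z \<notin> X" for z using that by blast
    have "poly P (f z) = poly P \<beta>" if "z \<notin> X" for z using P(2)[OF that] gb[OF that] by simp
    then have val: "f z \<in> {x. poly (P - [:poly P \<beta>:]) x = 0}" if "z \<notin> X" for z using that by simp
    have "P - [:poly P \<beta>:] \<noteq> 0" using degree_diff_const_pos[OF P(1), of "poly P \<beta>"] by auto
    then have roots: "finite {x. poly (P - [:poly P \<beta>:]) x = 0}" by (rule poly_roots_finite)
    have "eventually (\<lambda>z. \<forall>c\<in>{x. poly (P - [:poly P \<beta>:]) x = 0}. f z - c \<noteq> 0) (at w)"
    proof (intro eventually_ball_finite roots ballI)
      fix c
      obtain v where v: "v \<notin> X" "f v \<noteq> c" using deriv_nonzero_not_const[OF X(1) w] by blast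
      have "f holomorphic_on - X" by (rule analytic_cofinite_holomorphic) (use M1_analytic[OF f] X(2) in blast)
      then show "eventually (\<lambda>z. f z - c \<noteq> 0) (at w)"
        by (intro eventually_nonzero_cofinite[OF X(1) _ v(1) _ w(1)] holomorphic_intros) (use v in auto)
    qed
    then have "eventually (\<lambda>z. False) (at w)" using eventually_cofinite_at[OF X(1), of w]
      by eventually_elim (use val in fastforce)
    then show False by simp
  qed
  have bnz: "\<exists>w. b \<beta> w \<noteq> 0" for \<beta>
  proof -
    obtain v where v: "v \<notin> X" "g v \<noteq> \<beta>" using gconst by blast
    then have "b \<beta> v \<noteq> 0" using bg[OF v(1)] p(2)[of v] by auto
    then show ?thesis by blast
  qed
  have unit: "\<exists>Q. Q holomorphic_on UNIV \<and> (\<forall>z. Q z \<noteq> 0) \<and> (\<forall>z. a \<beta> z = Q z * b \<beta> z)"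
    if \<beta>': "\<And>z. \<not> is_pole f z \<Longrightarrow> f z = \<beta> \<longleftrightarrow> g z = \<beta>" for \<beta>
  proof -
    obtain v v' where v: "a \<beta> v \<noteq> 0" "b \<beta> v' \<noteq> 0" using anz bnz by blast
    have 1: "\<exists>C. eventually (\<lambda>z. norm (a \<beta> z) \<le> C * norm (b \<beta> z)) (at z0)" for z0
    proof -
      obtain C where C: "eventually (\<lambda>z. norm (f z - \<beta>) \<le> C * norm (g z - \<beta>)) (at z0)"
        using ratio_locally_bounded[OF f g X(1) pole P \<beta>'] by blast
      have "eventually (\<lambda>z. norm (a \<beta> z) \<le> C * norm (b \<beta> z)) (at z0)"
        using C eventually_cofinite_at[OF X(1), of z0]
        by eventually_elim (simp add: af bg norm_mult mult_right_mono flip: mult.assoc)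
      then show ?thesis by blast
    qed
    have 2: "\<exists>C. eventually (\<lambda>z. norm (b \<beta> z) \<le> C * norm (a \<beta> z)) (at z0)" for z0
    proof -
      have "\<exists>C. eventually (\<lambda>z. norm (g z - \<beta>) \<le> C * norm (f z - \<beta>)) (at z0)"
        by (rule ratio_locally_bounded[OF g f X(1) pole[symmetric] P(1) P(2)[symmetric]]) (use \<beta>' pole in blast)+
      then obtain C where C: "eventually (\<lambda>z. norm (g z - \<beta>) \<le> C * norm (f z - \<beta>)) (at z0)" by blast
      have "eventually (\<lambda>z. norm (b \<beta> z) \<le> C * norm (a \<beta> z)) (at z0)"
        using C eventually_cofinite_at[OF X(1), of z0]
        by eventually_elim (simp add: af bg norm_mult mult_right_mono flip: mult.assoc)
      then show ?thesis by blast
    qed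
    from entire_unit_quotient[OF ahol v(1) bhol v(2) 1 2] show ?thesis by metis
  qed
  obtain Q1 where Q1: "Q1 holomorphic_on UNIV" "\<And>z. Q1 z \<noteq> 0" "\<And>z. a \<beta>\<^sub>1 z = Q1 z * b \<beta>\<^sub>1 z" using unit[OF b1] by blast
  obtain Q2 where Q2: "Q2 holomorphic_on UNIV" "\<And>z. Q2 z \<noteq> 0" "\<And>z. a \<beta>\<^sub>2 z = Q2 z * b \<beta>\<^sub>2 z" using unit[OF b2] by blast
  define \<rho> where "\<rho> = real_of_ereal (nevanlinna_order f)"
  have fin: "\<bar>nevanlinna_order f\<bar> \<noteq> \<infinity>" and nint: "\<rho> \<notin> \<int>" using order by (auto simp: non_integer_finite_order_def \<rho>_def)
  have ord: "nevanlinna_order f = ereal \<rho>" using fin by (simp add: \<rho>_def ereal_real)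
  have \<rho>0: "\<rho> \<ge> 0" using nevanlinna_order_nonneg[OF f] ord by simp
  define d where "d = nat \<lfloor>\<rho>\<rfloor>"
  have d1: "real d < \<rho>" "\<rho> < real d + 1"
  proof -
    have "real d = of_int \<lfloor>\<rho>\<rfloor>" using \<rho>0 by (simp add: d_def)
    moreover have "of_int \<lfloor>\<rho>\<rfloor> \<noteq> \<rho>" using nint by (metis Ints_of_int)
    ultimately show "real d < \<rho>" "\<rho> < real d + 1"
      using of_int_floor_le[of \<rho>] floor_correct[of \<rho>] by linarith+
  qed
  define \<kappa> where "\<kappa> = (\<rho> + (real d + 1)) / 2"
  have \<kappa>: "\<rho> < \<kappa>" "\<kappa> < real d + 1" "0 \<le> \<kappa>" using d1 \<rho>0 by (auto simp: \<kappa>_def)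
  have T: "eventually (\<lambda>r. nevanlinna_T f r \<le> r powr \<kappa>) at_top"
    by (rule eventually_nevanlinna_T_less[OF f]) (use ord \<kappa> in auto)
  \<comment> \<open>The numerator of \<open>f\<close> grows at most like order \<open>\<kappa>\<close>, by Poisson's inequality; that of \<open>g\<close> because \<open>P \<circ> f = P \<circ> g\<close>.\<close>
  have f0gr: "growth_le \<kappa> f0"
  proof -
    obtain v where v: "f0 v \<noteq> 0" using anz[of 0] by (auto simp: a_def)
    obtain N where N: "\<And>z. 2 \<le> norm z \<Longrightarrow> norm (poly p z) \<le> norm z ^ N" using poly_growth by blast
    obtain r0 where r0: "\<And>r. r \<ge> r0 \<Longrightarrow> \<exists>R\<ge>2 * r. R \<le> 3 * r \<and> (\<forall>z. norm z \<le> r \<longrightarrow> f0 z \<noteq> 0 \<longrightarrow> ln (norm (f0 z)) \<le> 3 * (proximity f R + real N * ln R))"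
      using eventually_poisson_growth[OF hol(1) v X(1) fE' p(2) N] by metis
    obtain r1 where r1: "\<And>r. r \<ge> r1 \<Longrightarrow> proximity f r \<le> r powr \<kappa>"
      using eventually_conj[OF T eventually_nevanlinna_T_nonneg[OF f]] unfolding eventually_at_top_linorder by fastforce
    define C where "C = 3 * (3 powr \<kappa> + 2 * real N)"
    have "norm (f0 z) \<le> exp (C * (r powr \<kappa> * ln r))" if r: "max 3 (max r0 r1) \<le> r" "norm z \<le> r" for r z
    proof (cases "f0 z = 0")
      case False
      obtain R where R: "R \<ge> 2 * r" "R \<le> 3 * r" "ln (norm (f0 z)) \<le> 3 * (proximity f R + real N * ln R)"
        using r0[of r] r False by auto
      have lr: "ln r \<ge> 1" using ln_ge_1 r by simp
      have s: "1 \<le> r powr \<kappa>" using r \<kappa> by (intro ge_one_powr_ge_zero) auto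
      have "proximity f R \<le> R powr \<kappa>" using R(1) r by (intro r1) auto
      also have "\<dots> \<le> (3 * r) powr \<kappa>" using R r \<kappa> by (intro powr_mono2) auto
      also have "\<dots> = 3 powr \<kappa> * r powr \<kappa>" using r by (simp add: powr_mult)
      also have "\<dots> \<le> 3 powr \<kappa> * (r powr \<kappa> * ln r)" using mult_left_mono[OF lr, of "r powr \<kappa>"] by (intro mult_left_mono) auto
      finally have A: "proximity f R \<le> 3 powr \<kappa> * (r powr \<kappa> * ln r)" .
      have "3 * r \<le> r * r" using r by (intro mult_right_mono) auto
      then have "R \<le> r * r" using R(2) by linarith
      then have "ln R \<le> ln (r * r)" using R(1) r by (intro ln_mono) auto
      also have "\<dots> = 2 * ln r" using r by (simp add: ln_mult)
      also have "\<dots> \<le> 2 * (r powr \<kappa> * ln r)" using s lr mult_right_mono[of 1 "r powr \<kappa>" "ln r"] by simp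
      finally have "real N * ln R \<le> real N * (2 * (r powr \<kappa> * ln r))" by (intro mult_left_mono) auto
      then have "ln (norm (f0 z)) \<le> C * (r powr \<kappa> * ln r)" using A R(3) by (simp add: C_def algebra_simps)
      then have "exp (ln (norm (f0 z))) \<le> exp (C * (r powr \<kappa> * ln r))" by simp
      then show ?thesis using False by simp
    qed simp
    then show ?thesis unfolding growth_le_def by blast
  qed
  have g0gr: "growth_le \<kappa> g0"
  proof -
    obtain C where C: "C \<ge> 1" "\<And>x y. poly P x = poly P y \<Longrightarrow> 1 + norm y \<le> C * (1 + norm x)"
      using poly_values_comparable[OF P(1), of 1 0] by auto
    obtain B where B: "\<And>z. z \<in> X \<Longrightarrow> norm z \<le> B" using finite_imp_bounded[OF X(1)] unfolding bounded_iff by blast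
    define D where "D = ln C"
    obtain C1 r1 where C1: "0 \<le> C1" "3 \<le> r1" "\<And>r z. r1 \<le> r \<Longrightarrow> norm z \<le> r \<Longrightarrow> norm (f0 z) \<le> exp (C1 * (r powr \<kappa> * ln r))"
      using growth_leE[OF f0gr \<kappa>(3)] by metis
    obtain C2 r2 where C2: "0 \<le> C2" "\<And>r z. r2 \<le> r \<Longrightarrow> norm z \<le> r \<Longrightarrow> norm (poly p z) \<le> exp (C2 * (r powr \<kappa> * ln r))"
      using growth_leE[OF growth_le_poly \<kappa>(3)] \<kappa>(3) by metis
    have "norm (g0 z) \<le> exp ((ln C + 1 + C1 + C2) * (r powr \<kappa> * ln r))" if r: "max (B + 1) (max r1 r2) \<le> r" "norm z \<le> r" for r z
    proof (rule max_modulus_cball[OF hol(2) _ _ r(2)])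
      show "r > 0" using r C1(2) by simp
      fix x :: complex assume x: "norm x = r"
      define s where "s = r powr \<kappa> * ln r"
      have s: "s \<ge> 1" unfolding s_def using r C1(2) \<kappa> by (intro powr_ln_ge_1) auto
      have xX: "x \<notin> X" using B[of x] x r by auto
      have lC: "ln C \<ge> 0" using C(1) by simp
      have "norm (g0 x) \<le> (1 + norm (g x)) * norm (poly p x)" using gE[OF xX] by (simp add: norm_mult mult_right_mono)
      also have "\<dots> \<le> C * (1 + norm (f x)) * norm (poly p x)" using C(2)[of "f x" "g x"] P(2)[OF xX] by (intro mult_right_mono) auto
      also have "\<dots> = C * (norm (poly p x) + norm (f0 x))" using fE[OF xX] by (simp add: norm_mult algebra_simps)
      also have "\<dots> \<le> C * (exp (C2 * s) + exp (C1 * s))"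
        unfolding s_def using C(1) C1(3)[of r x] C2(2)[of r x] r x by (intro mult_left_mono add_mono) auto
      also have "\<dots> \<le> C * (exp ((C1 + C2) * s) + exp ((C1 + C2) * s))"
        using C(1) C1 C2 s by (intro mult_left_mono add_mono) (auto simp: distrib_right)
      also have "\<dots> = C * (2 * exp ((C1 + C2) * s))" by simp
      also have "\<dots> \<le> exp (ln C * s) * (exp s * exp ((C1 + C2) * s))"
      proof (intro mult_mono)
        have "ln C * 1 \<le> ln C * s" using lC s by (intro mult_left_mono) auto
        then have "exp (ln C) \<le> exp (ln C * s)" by simp
        then show "C \<le> exp (ln C * s)" using C(1) by simp
        show "2 \<le> exp s" using s exp_ge_add_one_self[of s] by linarith
      qed auto
      also have "\<dots> = exp ((ln C + 1 + C1 + C2) * s)" by (simp flip: exp_add add: algebra_simps)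
      finally show "norm (g0 x) \<le> exp ((ln C + 1 + C1 + C2) * (r powr \<kappa> * ln r))" by (simp add: s_def)
    qed
    then show ?thesis unfolding growth_le_def by blast
  qed
  have agr: "growth_le \<kappa> (a \<beta>)" and bgr: "growth_le \<kappa> (b \<beta>)" for \<beta>
    unfolding a_def b_def by (intro growth_le_diff growth_le_mult growth_le_const growth_le_poly f0gr g0gr \<kappa>)+
  have Qgr: "growth_le (real d) Q" if Q: "Q holomorphic_on UNIV" "\<And>z. Q z \<noteq> 0" "\<And>z. a \<beta> z = Q z * b \<beta> z" for Q \<beta>
  proof -
    obtain v where v: "b \<beta> v \<noteq> 0" using bnz by blast
    have "(\<lambda>z. Q z * b \<beta> z) = a \<beta>" using Q(3) by auto
    then have "growth_le \<kappa> Q" using growth_le_quotient[OF \<kappa>(3) Q(1) bhol v bgr] agr by simp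
    then show ?thesis using zero_free_integral_order[OF Q(1,2) \<kappa>(3,2)] by blast
  qed
  have Q1gr: "growth_le (real d) Q1" and Q2gr: "growth_le (real d) Q2" using Qgr[OF Q1] Qgr[OF Q2] by blast+
  \<comment> \<open>Eliminate \<open>f0\<close> from the two equations \<open>f0 - \<beta>\<^sub>i p = Q\<^sub>i (g0 - \<beta>\<^sub>i p)\<close>.\<close>
  have lin: "g0 z * (Q1 z - Q2 z) = poly p z * ((\<beta>\<^sub>2 - \<beta>\<^sub>1) + \<beta>\<^sub>1 * Q1 z - \<beta>\<^sub>2 * Q2 z)" for z
    using Q1(3)[of z] Q2(3)[of z] unfolding a_def b_def by algebra
  have "\<exists>v. Q1 v - Q2 v \<noteq> 0"
  proof (rule ccontr)
    assume "\<not> ?thesis"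
    then have eq: "Q1 z = Q2 z" for z by simp
    have "f z = g z" if z: "z \<notin> X" for z
    proof -
      have pz: "poly p z \<noteq> 0" using p(2) z by blast
      have "poly p z * ((\<beta>\<^sub>2 - \<beta>\<^sub>1) * (1 - Q1 z)) = 0" using lin[of z] eq[of z] by algebra
      then have "(\<beta>\<^sub>2 - \<beta>\<^sub>1) * (1 - Q1 z) = 0" using pz by simp
      then have "Q1 z = 1" using \<beta>(1) by simp
      then have "a \<beta>\<^sub>1 z = b \<beta>\<^sub>1 z" using Q1(3)[of z] by simp
      then show ?thesis using af[OF z] bg[OF z] pz by simp
    qed
    then show False using M1_eqI[OF f g X(1)] fg by blast
  qed
  then obtain v where v: "Q1 v - Q2 v \<noteq> 0" by blast
  have g0d: "growth_le (real d) g0"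
  proof (rule growth_le_quotient[where b = "\<lambda>z. Q1 z - Q2 z", OF _ hol(2) _ v])
    show "growth_le (real d) (\<lambda>z. g0 z * (Q1 z - Q2 z))"
      unfolding lin by (intro growth_le_mult growth_le_poly growth_le_diff growth_le_add growth_le_const Q1gr Q2gr) auto
  qed (auto intro!: holomorphic_intros Q1 Q2 growth_le_diff Q1gr Q2gr)
  have "f0 = (\<lambda>z. Q1 z * (g0 z - \<beta>\<^sub>1 * poly p z) + \<beta>\<^sub>1 * poly p z)"
    using Q1(3) by (auto simp: a_def b_def fun_eq_iff algebra_simps)
  moreover have "growth_le (real d) (\<lambda>z. Q1 z * (g0 z - \<beta>\<^sub>1 * poly p z) + \<beta>\<^sub>1 * poly p z)"
    by (intro growth_le_mult growth_le_poly growth_le_diff growth_le_add growth_le_const Q1gr g0d) auto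
  ultimately have "growth_le (real d) f0" by simp
  then obtain C r0 where C: "0 \<le> C" "3 \<le> r0" "\<And>r z. r0 \<le> r \<Longrightarrow> norm z \<le> r \<Longrightarrow> norm (f0 z) \<le> exp (C * (r powr real d * ln r))"
    using growth_leE[of "real d" f0] by (metis of_nat_0_le_iff)
  obtain D r1 where D: "D \<ge> 0" "\<And>r B. r \<ge> r1 \<Longrightarrow> B \<ge> 0 \<Longrightarrow> (\<forall>z. norm z = r \<longrightarrow> norm (f0 z) \<le> exp B) \<Longrightarrow> nevanlinna_T f r \<le> B + D * ln r"
    using nevanlinna_T_le[OF f X(1) p(1) fE'] by blast
  have "nevanlinna_order f \<le> ereal (real d)"
  proof (rule nevanlinna_order_le[OF f, of "1 + C + D"])
    have "eventually (\<lambda>r::real. r \<ge> max r0 r1) at_top" by (rule eventually_ge_at_top)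
    then show "eventually (\<lambda>r. nevanlinna_T f r \<le> (1 + C + D) * r powr real d * (ln r)\<^sup>2) at_top"
    proof eventually_elim
      case (elim r)
      have r3: "r \<ge> 3" using elim C(2) by simp
      have lr: "ln r \<ge> 1" using ln_ge_1 r3 by simp
      have rd: "1 \<le> r powr real d" using r3 by (intro ge_one_powr_ge_zero) auto
      have "nevanlinna_T f r \<le> C * (r powr real d * ln r) + D * ln r"
        using elim C(1,3) lr by (intro D(2)) auto
      also have "\<dots> \<le> C * (r powr real d * ln r) + D * (r powr real d * ln r)"
        using D(1) lr mult_right_mono[OF rd, of "ln r"] by (intro add_left_mono mult_left_mono) auto
      also have "\<dots> \<le> (1 + C + D) * (r powr real d * ln r)" using lr by (simp add: algebra_simps)
      also have "\<dots> \<le> (1 + C + D) * (r powr real d * (ln r * ln r))"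
        using C(1) D(1) lr mult_right_mono[of 1 "ln r" "ln r"] by (intro mult_left_mono) auto
      finally show ?case by (simp add: power2_eq_square mult.assoc)
    qed
  qed (use C D in auto)
  then show False using ord d1 by simp
qed

section \<open>Sharing sets\<close>

lemma in_E_set_iff:
  assumes "\<not> is_pole f z"
  shows "(z, i) \<in> E_set f S l \<longleftrightarrow> f z \<in> S \<and> enat i < truncated_mult l (a_point_mult f (f z) z)"
proof -
  have *: "enat i < truncated_mult l (a_point_mult f a z) \<longleftrightarrow> a = f z \<and> enat i < truncated_mult l (a_point_mult f (f z) z)" for a
    by (cases "a = f z") (simp_all add: a_point_mult_def truncated_mult_def)
  have "(z, i) \<in> E_set f S l \<longleftrightarrow> (\<exists>a\<in>S. enat i < truncated_mult l (a_point_mult f a z))"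
    by (simp add: E_set_def E_val_def)
  also have "\<dots> \<longleftrightarrow> f z \<in> S \<and> enat i < truncated_mult l (a_point_mult f (f z) z)"
    using * by metis
  finally show ?thesis .
qed

lemma truncated_mult_2_less_eq: "enat i < truncated_mult 2 (enat m) \<longleftrightarrow> i < min m 3"
proof -
  have e: "(2::enat) = enat 2" "(2::enat) + 1 = enat 3" by (simp_all add: numeral_eq_enat one_enat_def)
  show ?thesis unfolding truncated_mult_def e(2) unfolding e(1) enat_ord_simps by auto
qed

lemma truncated_mult_2_less_iff:
  "(\<forall>i. enat i < truncated_mult 2 (enat m) \<longleftrightarrow> enat i < truncated_mult 2 (enat n)) \<longleftrightarrow> m = n \<or> 3 \<le> m \<and> 3 \<le> n"
proof -
  have "(\<forall>i. i < min m 3 \<longleftrightarrow> i < min n 3) \<longleftrightarrow> min m 3 = min n 3"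
  proof
    assume a: "\<forall>i. i < min m 3 \<longleftrightarrow> i < min n 3"
    from a[rule_format, of "min m 3"] a[rule_format, of "min n 3"] show "min m 3 = min n 3" by linarith
  qed simp
  also have "\<dots> \<longleftrightarrow> m = n \<or> 3 \<le> m \<and> 3 \<le> n" by linarith
  finally show ?thesis unfolding truncated_mult_2_less_eq .
qed

text \<open>
  Weight 2 counts a point at most three times, so it only distinguishes the multiplicities 1, 2 and
  \<open>\<ge> 3\<close>.
\<close>
lemma weight_two_sharing:
  assumes sh: "share_weighted f g S 2" and f: "\<not> is_pole f z" and g: "\<not> is_pole g z"
    and fa: "f analytic_on {z}" and ga: "g analytic_on {z}"
    and fn: "\<And>c. eventually (\<lambda>w. f w - c \<noteq> 0) (at z)" and gn: "\<And>c. eventually (\<lambda>w. g w - c \<noteq> 0) (at z)"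
  shows "f z \<in> S \<longleftrightarrow> g z \<in> S"
    and "f z \<in> S \<Longrightarrow> zorder (\<lambda>w. f w - f z) z = zorder (\<lambda>w. g w - g z) z \<or>
           3 \<le> zorder (\<lambda>w. f w - f z) z \<and> 3 \<le> zorder (\<lambda>w. g w - g z) z"
proof -
  have mult: "a_point_mult h (h z) z = enat (nat (zorder (\<lambda>w. h w - h z) z)) \<and> 1 \<le> nat (zorder (\<lambda>w. h w - h z) z)"
    if h: "\<not> is_pole h z" "h analytic_on {z}" "\<And>c. eventually (\<lambda>w. h w - c \<noteq> 0) (at z)" for h
  proof -
    have "\<not> eventually (\<lambda>w. h w = h z) (at z)"
    proof
      assume "eventually (\<lambda>w. h w = h z) (at z)"
      with h(3)[of "h z"] have "eventually (\<lambda>w. False) (at z)" by eventually_elim simp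
      then show False by simp
    qed
    moreover have "(\<lambda>w. h w - h z) analytic_on {z}" by (intro analytic_intros h)
    from analytic_local_factor[OF this h(3)] have "1 \<le> nat (zorder (\<lambda>w. h w - h z) z)" by (metis diff_self)
    ultimately show ?thesis using h(1) by (simp add: a_point_mult_def)
  qed
  define m where "m = nat (zorder (\<lambda>w. f w - f z) z)"
  define n where "n = nat (zorder (\<lambda>w. g w - g z) z)"
  have m: "a_point_mult f (f z) z = enat m" "1 \<le> m" and n: "a_point_mult g (g z) z = enat n" "1 \<le> n"
    using mult[OF f fa fn] mult[OF g ga gn] by (auto simp: m_def n_def)
  have eq: "f z \<in> S \<and> enat i < truncated_mult 2 (enat m) \<longleftrightarrow> g z \<in> S \<and> enat i < truncated_mult 2 (enat n)" for i
    using sh in_E_set_iff[OF f, of i S 2] in_E_set_iff[OF g, of i S 2] m n by (simp add: share_weighted_def)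
  have pos: "enat 0 < truncated_mult 2 (enat k)" if "1 \<le> k" for k
    using that truncated_mult_2_less_eq[of 0 k] by simp
  show 1: "f z \<in> S \<longleftrightarrow> g z \<in> S" using eq[of 0] pos[OF m(2)] pos[OF n(2)] by blast
  show "zorder (\<lambda>w. f w - f z) z = zorder (\<lambda>w. g w - g z) z \<or>
           3 \<le> zorder (\<lambda>w. f w - f z) z \<and> 3 \<le> zorder (\<lambda>w. g w - g z) z" if "f z \<in> S"
  proof -
    have "m = n \<or> 3 \<le> m \<and> 3 \<le> n" using truncated_mult_2_less_iff[of m n] eq 1 that by blast
    then show ?thesis using m(2) n(2) by (auto simp: m_def n_def)
  qed
qed

lemma zorder_poly_compose_simple:
  assumes f: "f analytic_on {z}" "eventually (\<lambda>w. f w - f z \<noteq> 0) (at z)"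
    and P: "poly P (f z) = c" "poly (pderiv P) (f z) \<noteq> 0"
  shows "zorder (\<lambda>w. poly P (f w) - c) z = zorder (\<lambda>w. f w - f z) z"
proof -
  define p where "p = P - [:c:]"
  have "poly p (f z) = 0" using P(1) by (simp add: p_def)
  then obtain W where W: "p = [:- f z, 1:] * W" by (auto simp: poly_eq_0_iff_dvd)
  have "pderiv p = pderiv P" by (simp add: p_def pderiv_diff pderiv_pCons)
  moreover have "pderiv p = [:- f z, 1:] * pderiv W + W * 1" unfolding W by (subst pderiv_mult) (simp add: pderiv_pCons)
  ultimately have "pderiv P = [:- f z, 1:] * pderiv W + W * 1" by (simp only:)
  then have "poly (pderiv P) (f z) = poly W (f z)" by simp
  then have W0: "poly W (f z) \<noteq> 0" using P(2) by simp
  have e: "(\<lambda>w. poly P (f w) - c) = (\<lambda>w. (f w - f z) * poly W (f w))"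
  proof
    fix w
    have "poly P (f w) - c = poly p (f w)" by (simp add: p_def)
    then show "poly P (f w) - c = (f w - f z) * poly W (f w)" by (simp add: W algebra_simps)
  qed
  have an: "(\<lambda>w. f w - f z) analytic_on {z}" "(\<lambda>w. poly W (f w)) analytic_on {z}" by (intro analytic_intros f)+
  have ev: "eventually (\<lambda>w. (f w - f z) * poly W (f w) \<noteq> 0) (at z)"
    using f(2) eventually_nhds_imp_at[OF eventually_nhds_nonzero[OF an(2) W0]] by eventually_elim auto
  have "zorder (\<lambda>w. (f w - f z) * poly W (f w)) z = zorder (\<lambda>w. f w - f z) z + zorder (\<lambda>w. poly W (f w)) z"
    by (rule zorder_times_analytic[OF an ev])
  also have "zorder (\<lambda>w. poly W (f w)) z = 0" using zorder_eq_0I[OF an(2) W0] .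
  finally show ?thesis unfolding e by simp
qed

text \<open>
  If \<open>P\<close> takes the value \<open>c\<close> at one point \<open>v\<close> only, then \<open>P - c\<close> is a multiple of a power of \<open>X - v\<close>, and so is
  \<open>P'\<close>.
\<close>
lemma single_value_preimage_critical:
  assumes "degree P > 0" "card {w. poly P w = (c::complex)} \<le> 1"
  shows "card {w. poly (pderiv P) w = 0} \<le> 1"
proof -
  define p where "p = P - [:c:]"
  have dp: "degree p > 0" unfolding p_def by (rule degree_diff_const_pos[OF assms(1)])
  then have p0: "p \<noteq> 0" by auto
  have roots: "{w. poly P w = c} = {w. poly p w = 0}" by (auto simp: p_def)
  have "\<not> constant (poly p)" using dp by (simp add: constant_degree)
  then obtain v where v: "poly p v = 0" using Fundamental_Theorem_Algebra.fundamental_theorem_of_algebra by blast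
  have fin: "finite {w. poly p w = 0}" by (rule poly_roots_finite[OF p0])
  have "x = v" if "poly p x = 0" for x
    using assms(2) v that fin unfolding roots by (simp add: card_le_Suc0_iff_eq)
  then have single: "poly p x = 0 \<longleftrightarrow> x = v" for x using v by blast
  obtain q where q: "p = [:- v, 1:] ^ order v p * q" "\<not> [:- v, 1:] dvd q" using order_decomp[OF p0] by blast
  have q0: "poly q x \<noteq> 0" for x
  proof
    assume "poly q x = 0"
    moreover from this have "poly p x = 0" by (subst q(1)) simp
    ultimately show False using single q(2) by (simp add: poly_eq_0_iff_dvd)
  qed
  then have "constant (poly q)" using Fundamental_Theorem_Algebra.fundamental_theorem_of_algebra by blast
  then obtain l where l: "q = [:l:]" by (auto simp: constant_degree elim: degree_eq_zeroE)
  have l0: "l \<noteq> 0" using q0[of 0] l by simp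
  have pe: "p = smult l ([:- v, 1:] ^ order v p)" using q(1) l by (simp add: mult.commute)
  define m where "m = order v p"
  have m: "m \<ge> 1" using v p0 order_root[of p v] by (simp add: m_def)
  have "pderiv P = pderiv p" by (simp add: p_def pderiv_diff pderiv_pCons)
  also have "\<dots> = smult l (smult (of_nat m) ([:- v, 1:] ^ (m - 1)))"
    by (subst pe, subst m_def[symmetric]) (use m in \<open>simp add: pderiv_smult pderiv_power pderiv_pCons\<close>)
  finally have "poly (pderiv P) w = l * (of_nat m * (w - v) ^ (m - 1))" for w
    by (simp add: poly_power)
  then have "{w. poly (pderiv P) w = 0} \<subseteq> {v}" using l0 m by auto
  then show ?thesis using card_mono[of "{v}"] by simp
qed

section \<open>The uniqueness theorem\<close>

theorem theorem2p1:
  fixes n k \<Gamma>\<^sub>1 :: nat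
    and f g :: "complex \<Rightarrow> complex"
    and \<alpha> :: "nat \<Rightarrow> complex"
    and \<beta>\<^sub>1 \<beta>\<^sub>2 :: complex
    and S\<^sub>1 S\<^sub>2 :: "complex set"
    and P :: "complex poly"
  assumes "n > 0"
    and "f \<in> M1" and "g \<in> M1"
    and "S\<^sub>1 = \<alpha> ` {1..n}" and "S\<^sub>2 = {\<beta>\<^sub>1, \<beta>\<^sub>2}"
    and "inj_on \<alpha> {1..n}" and "\<beta>\<^sub>1 \<noteq> \<beta>\<^sub>2" and "S\<^sub>1 \<inter> S\<^sub>2 = {}"
    and "0 \<notin> S\<^sub>1" and "0 \<notin> S\<^sub>2"
    and "P = attached_poly n \<alpha>"
    and "\<Gamma>\<^sub>1 = num_simple_zeros P + num_multiple_zeros P"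
    and "k = card {z. poly (pderiv P) z = 0}"
    and "n > max (2 * k + 2) (2 * \<Gamma>\<^sub>1)" and "k \<ge> 2" and "\<Gamma>\<^sub>1 \<ge> 3"
    and "(\<Prod>i\<in>{1..n}. \<beta>\<^sub>1 - \<alpha> i) \<noteq> (\<Prod>i\<in>{1..n}. \<beta>\<^sub>2 - \<alpha> i)"
    and "non_integer_finite_order f"
    and "share_weighted f g S\<^sub>1 2"
    and "share_IM f g S\<^sub>2"
  shows "f = g"
proof -
  note f = assms(2) and g = assms(3)
  have not0: "nevanlinna_order f \<noteq> 0" using order_0_not_non_integer assms(18) by blast
  have S1: "finite S\<^sub>1" "card S\<^sub>1 = n" using assms(4,6) by (auto simp: card_image)
  have \<alpha>0: "\<alpha> i \<noteq> 0" if "i \<in> {1..n}" for i using assms(4,9) that by auto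
  define c where "c = 1 / ((-1) ^ (n + 1) * (\<Prod>i\<in>{1..n}. \<alpha> i))"
  have pnz: "(\<Prod>i\<in>{1..n}. \<alpha> i) \<noteq> 0" using \<alpha>0 by simp
  have c0: "c \<noteq> 0" using pnz by (simp add: c_def)
  have fac': "poly P z - 1 = c * (\<Prod>i\<in>{1..n}. z - \<alpha> i)" for z
    using poly_attached_poly[of n \<alpha> z] \<alpha>0 pnz assms(11) by (simp add: c_def)
  have fac: "poly P z - 1 = c * (\<Prod>a\<in>S\<^sub>1. z - a)" for z
    unfolding fac' assms(4) prod.reindex[OF assms(6)] by (simp add: o_def)
  have PS: "poly P z = 1 \<longleftrightarrow> z \<in> S\<^sub>1" for z
  proof -
    have "(\<Prod>a\<in>S\<^sub>1. z - a) = 0 \<longleftrightarrow> z \<in> S\<^sub>1" using S1(1) by auto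
    then show ?thesis using fac[of z] c0 by (metis eq_iff_diff_eq_0 mult_eq_0_iff)
  qed
  have polyeq: "P - 1 = smult c (\<Prod>a\<in>S\<^sub>1. [:- a, 1:])"
    unfolding poly_eq_poly_eq_iff[symmetric] by (auto simp: fun_eq_iff fac poly_prod)
  have n: "n > 2 * k + 2" "n > 2 * \<Gamma>\<^sub>1" using assms(14) by auto
  have "degree (\<Prod>a\<in>S\<^sub>1. [:- a, 1::complex:]) = (\<Sum>a\<in>S\<^sub>1. degree [:- a, 1::complex:])"
    by (rule degree_prod_sum_eq) simp
  then have "degree (P - 1) = n" unfolding polyeq using c0 S1 by simp
  moreover have "P = (P - 1) + 1" by simp
  ultimately have dP: "degree P = n" using n(1) degree_add_eq_left[of 1 "P - 1"] by simp
  have P0: "P \<noteq> 0" using dP n(1) by auto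
  have \<Gamma>: "card {z. poly P z = 0} = \<Gamma>\<^sub>1"
  proof -
    have fin: "finite {z. poly P z = 0}" by (rule poly_roots_finite[OF P0])
    have "order z P = 1 \<or> order z P \<ge> 2" if "poly P z = 0" for z
      using that P0 order_root[of P z] by linarith
    then have "{z. poly P z = 0} = {z. poly P z = 0 \<and> order z P = 1} \<union> {z. poly P z = 0 \<and> order z P \<ge> 2}" by auto
    also have "card \<dots> = \<Gamma>\<^sub>1" unfolding assms(12) num_simple_zeros_def num_multiple_zeros_def
      by (rule card_Un_disjoint) (auto intro: finite_subset[OF _ fin])
    finally show ?thesis .
  qed
  have simple: "poly (pderiv P) a \<noteq> 0" if a: "a \<in> S\<^sub>1" for a
  proof -
    have "P - 1 = [:- a, 1:] * smult c (\<Prod>a\<in>S\<^sub>1 - {a}. [:- a, 1:])"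
      unfolding polyeq using S1(1) a by (subst prod.remove[of _ a]) (simp_all only: mult_smult_right)
    then have "pderiv (P - 1) = [:- a, 1:] * pderiv (smult c (\<Prod>a\<in>S\<^sub>1 - {a}. [:- a, 1:])) + smult c (\<Prod>a\<in>S\<^sub>1 - {a}. [:- a, 1:]) * pderiv [:- a, 1:]"
      by (simp only: pderiv_mult)
    then have "poly (pderiv (P - 1)) a = c * (\<Prod>x\<in>S\<^sub>1 - {a}. a - x)"
      by (simp add: poly_prod pderiv_pCons)
    moreover have "pderiv (P - 1) = pderiv P" by (simp add: pderiv_diff)
    moreover have "(\<Prod>x\<in>S\<^sub>1 - {a}. a - x) \<noteq> 0" using S1(1) by auto
    ultimately show ?thesis using c0 by simp
  qed
  define X where "X = {z. is_pole f z} \<union> {z. is_pole g z}"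
  have X: "finite X" "\<And>z. is_pole f z \<Longrightarrow> z \<in> X" "\<And>z. is_pole g z \<Longrightarrow> z \<in> X"
    using f g by (auto simp: X_def M1_def)
  have fan: "f analytic_on {z}" and gan: "g analytic_on {z}" if "z \<notin> X" for z
    using M1_analytic[OF f] M1_analytic[OF g] X that by blast+
  have fhol: "f holomorphic_on - X" and ghol: "g holomorphic_on - X"
    by (intro analytic_cofinite_holomorphic fan gan; assumption)+
  obtain wf where wf: "wf \<notin> X" "deriv f wf \<noteq> 0"
    using M1_nonconst_deriv[OF f X(1,2)] non_integer_order_not_const[OF f assms(18)] by blast
  have nonconst: "eventually (\<lambda>z. h z - c \<noteq> 0) (at z)"
    if h: "h holomorphic_on - X" and w: "w \<notin> X" "deriv h w \<noteq> 0" and z: "z \<notin> X" for h w z c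
  proof -
    obtain w' where w': "w' \<notin> X" "h w' \<noteq> c" using deriv_nonzero_not_const[OF X(1) w] by blast
    show ?thesis
      by (rule eventually_nonzero_cofinite[OF X(1) _ w'(1) _ z]) (use w' h in \<open>auto intro!: holomorphic_intros\<close>)
  qed
  note fn = nonconst[OF fhol wf]
  have gE: "(z, 0) \<in> E_set f S\<^sub>1 2 \<longleftrightarrow> (z, 0) \<in> E_set g S\<^sub>1 2" for z using assms(19) by (simp add: share_weighted_def)
  \<comment> \<open>A constant \<open>g\<close> is excluded first: a constant in \<open>S\<^sub>1\<close> would confine \<open>f\<close> to the finite set \<open>S\<^sub>1\<close>, any other constant would make \<open>f\<close> omit \<open>S\<^sub>1\<close>.\<close>
  have "\<exists>z. g z \<noteq> d" for d
  proof (rule ccontr)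
    assume "\<not> ?thesis"
    then have gd: "g z = d" for z by blast
    have fS: "f z \<in> S\<^sub>1 \<longleftrightarrow> d \<in> S\<^sub>1" if z: "z \<notin> X" for z
    proof -
      have pf: "\<not> is_pole f z" "\<not> is_pole g z" using z X by blast+
      have nf: "\<not> eventually (\<lambda>w. f w = f z) (at z)"
      proof
        assume "eventually (\<lambda>w. f w = f z) (at z)"
        with fn[OF z, of "f z"] have "eventually (\<lambda>w. False) (at z)" by eventually_elim simp
        then show False by simp
      qed
      have "(\<lambda>w. f w - f z) analytic_on {z}" by (intro analytic_intros fan z)
      from analytic_local_factor[OF this fn[OF z]] have "1 \<le> nat (zorder (\<lambda>w. f w - f z) z)" by (metis diff_self)
      then have "enat 0 < truncated_mult 2 (a_point_mult f (f z) z)"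
        using pf nf by (simp add: a_point_mult_def truncated_mult_2_less_eq)
      moreover have "enat 0 < truncated_mult 2 (a_point_mult g (g z) z)"
        using pf gd by (simp add: a_point_mult_def truncated_mult_def enat_0)
      ultimately show ?thesis using gE[of z] in_E_set_iff[OF pf(1), of 0 S\<^sub>1 2] in_E_set_iff[OF pf(2), of 0 S\<^sub>1 2] gd[of z] by simp
    qed
    show False
    proof (cases "d \<in> S\<^sub>1")
      case True
      have "eventually (\<lambda>z. \<forall>a\<in>S\<^sub>1. f z - a \<noteq> 0) (at wf)"
        by (intro eventually_ball_finite[OF S1(1)] ballI fn[OF wf(1)])
      then have "eventually (\<lambda>z. False) (at wf)"
        using eventually_cofinite_at[OF X(1), of wf] by eventually_elim (use fS True in force)
      then show False by simp
    next
      case False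
      have "nevanlinna_order f = 0"
        by (rule omits_two_values_order_0[OF f X(1,2) wf S1(1)]) (use S1 n fS False in auto)
      then show False using not0 by blast
    qed
  qed
  then obtain wg where wg: "wg \<notin> X" "deriv g wg \<noteq> 0"
    using M1_nonconst_deriv[OF g X(1,3)] by blast
  note gn = nonconst[OF ghol wg]
  have Pderiv: "\<exists>w. w \<notin> X \<and> deriv (\<lambda>z. poly P (h z)) w \<noteq> 0"
    if h: "\<And>z. z \<notin> X \<Longrightarrow> h analytic_on {z}" "h holomorphic_on - X" and w: "w \<notin> X" "deriv h w \<noteq> 0" for h w
  proof -
    have fin: "finite {z. poly (pderiv P) z = 0}" using assms(13,15) card.infinite by fastforce
    have dh: "deriv h holomorphic_on - X" by (intro holomorphic_deriv h cofinite_open_connected X)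
    have "eventually (\<lambda>z. \<forall>\<eta>\<in>{z. poly (pderiv P) z = 0}. h z - \<eta> \<noteq> 0) (at w)"
      by (intro eventually_ball_finite[OF fin] ballI nonconst[OF h(2) w w(1)])
    then have "eventually (\<lambda>z. z \<notin> X \<and> deriv (\<lambda>z. poly P (h z)) z \<noteq> 0) (at w)"
      using eventually_cofinite_at[OF X(1), of w] eventually_nonzero_cofinite[OF X(1) dh w(1) w(2) w(1)]
    proof eventually_elim
      case (elim z)
      then show ?case using deriv_poly_compose[OF h(1), of z P] by auto
    qed
    then show ?thesis using eventually_happens by fastforce
  qed
  obtain w1 where w1: "w1 \<notin> X" "deriv (\<lambda>z. poly P (f z)) w1 \<noteq> 0" using Pderiv[OF fan fhol wf] by blast
  obtain w2 where w2: "w2 \<notin> X" "deriv (\<lambda>z. poly P (g z)) w2 \<noteq> 0" using Pderiv[OF gan ghol wg] by blast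
  define u where "u z = poly P (f z) - 1" for z
  define v where "v z = poly P (g z) - 1" for z
  have du: "deriv u z = deriv (\<lambda>z. poly P (f z)) z" and dv: "deriv v z = deriv (\<lambda>z. poly P (g z)) z" if "z \<notin> X" for z
    unfolding u_def v_def using deriv_diff_const analytic_on_poly_compose fan gan that by blast+
  have uhol: "u holomorphic_on - X" and vhol: "v holomorphic_on - X"
    unfolding u_def v_def by (intro analytic_cofinite_holomorphic analytic_intros fan gan; assumption)+
  \<comment> \<open>If the pre-Schwarzians differ anywhere, the weight-two sharing already forces order 0.\<close>
  have blocks: "inv_pre_schwarzian u z = inv_pre_schwarzian v z"
    if z: "z \<notin> X" "u z \<noteq> 0" "v z \<noteq> 0" "deriv u z \<noteq> 0" "deriv v z \<noteq> 0" for z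
  proof (rule ccontr)
    assume ne: "inv_pre_schwarzian u z \<noteq> inv_pre_schwarzian v z"
    have wt: "f z \<in> S\<^sub>1 \<longleftrightarrow> g z \<in> S\<^sub>1"
      "f z \<in> S\<^sub>1 \<Longrightarrow> zorder (\<lambda>w. f w - f z) z = zorder (\<lambda>w. g w - g z) z \<or>
           3 \<le> zorder (\<lambda>w. f w - f z) z \<and> 3 \<le> zorder (\<lambda>w. g w - g z) z" if "z \<notin> X" for z
    proof -
      have p: "\<not> is_pole f z" "\<not> is_pole g z" using that X by blast+
      note * = weight_two_sharing[OF assms(19) p fan[OF that] gan[OF that] fn[OF that] gn[OF that]]
      show "f z \<in> S\<^sub>1 \<longleftrightarrow> g z \<in> S\<^sub>1" by (rule *(1))
      show "zorder (\<lambda>w. f w - f z) z = zorder (\<lambda>w. g w - g z) z \<or>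
           3 \<le> zorder (\<lambda>w. f w - f z) z \<and> 3 \<le> zorder (\<lambda>w. g w - g z) z" if "f z \<in> S\<^sub>1" by (rule *(2)[OF that])
    qed
    have "nevanlinna_order f = 0"
    proof (rule weighted_sharing_order_0[OF f g X(1) _ _ c0 S1(1) fac, where w = z])
      show "2 * card {w. poly (pderiv P) w = 0} + 3 \<le> card S\<^sub>1" using n(1) S1(2) assms(13) by simp
      show "poly P (f z) = 1 \<longleftrightarrow> poly P (g z) = 1" if "z \<notin> X" for z unfolding PS by (rule wt(1)[OF that])
      show "zorder (\<lambda>z. poly P (f z) - 1) z = zorder (\<lambda>z. poly P (g z) - 1) z \<or>
          3 \<le> zorder (\<lambda>z. poly P (f z) - 1) z \<and> 3 \<le> zorder (\<lambda>z. poly P (g z) - 1) z"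
        if "z \<notin> X" "poly P (f z) = 1" for z
      proof -
        have fS: "f z \<in> S\<^sub>1" using that(2) by (simp only: PS)
        have gS: "g z \<in> S\<^sub>1" using fS wt(1)[OF that(1)] by blast
        have zf: "zorder (\<lambda>w. poly P (f w) - 1) z = zorder (\<lambda>w. f w - f z) z"
          using zorder_poly_compose_simple[OF fan[OF that(1)] fn[OF that(1)] that(2) simple[OF fS]] .
        have zg: "zorder (\<lambda>w. poly P (g w) - 1) z = zorder (\<lambda>w. g w - g z) z"
          using zorder_poly_compose_simple[OF gan[OF that(1)] gn[OF that(1)] _ simple[OF gS]] gS PS by blast
        show ?thesis unfolding zf zg by (rule wt(2)[OF that(1) fS])
      qed
    qed (use simple X z ne in \<open>auto simp: u_def[abs_def] v_def[abs_def]\<close>)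
    then show False using not0 by blast
  qed
  obtain a b where a0: "a \<noteq> 0" and ab: "\<And>z. z \<notin> X \<Longrightarrow> v z = u z * (a + b * v z)"
    using inv_pre_schwarzian_eq_imp_moebius[OF X(1) uhol vhol w1(1) _ w2(1), unfolded du[OF w1(1)] dv[OF w2(1)], OF w1(2) w2(2)]
      blocks by blast
  show ?thesis
  proof (cases "b = 0")
    case b: False
    \<comment> \<open>\<open>1 / u = a / v + b\<close> with \<open>a / v \<noteq> 0\<close> shows that \<open>u\<close> omits \<open>1 / b\<close>.\<close>
    define V where "V = {w. poly P w = 1 + 1 / b}"
    have V2: "2 \<le> card V"
    proof (rule ccontr)
      assume "\<not> 2 \<le> card V"
      then have "card {w. poly (pderiv P) w = 0} \<le> 1"
        unfolding V_def using dP n(1) by (intro single_value_preimage_critical[of P "1 + 1 / b"]) auto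
      then show False using assms(13,15) by simp
    qed
    have omit: "f z \<notin> V" if z: "z \<notin> X" for z
    proof
      assume "f z \<in> V"
      then have "u z = 1 / b" by (simp add: V_def u_def)
      with ab[OF z] b a0 show False by (simp add: field_simps)
    qed
    have finV: "finite V" using V2 card.infinite by fastforce
    have "nevanlinna_order f = 0"
      by (rule omits_two_values_order_0[OF f X(1) _ wf finV V2]) (use X omit in blast)+
    then show ?thesis using not0 by blast
  next
    case b: True
    show ?thesis
    proof (cases "a = 1")
      case False
      have "nevanlinna_order f = 0"
      proof (rule affinely_related_order_0[OF f g X(1), where P = P and a = "1 / a" and b = "1 - 1 / a" and w = w1])
        show "2 * card {w. poly P w = 0} < degree P" using n(2) dP \<Gamma> by simp
        show "1 / a \<noteq> 0" "1 - 1 / a \<noteq> 0" using a0 False by (auto simp: field_simps)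
        show "poly P (f z) = 1 / a * poly P (g z) + (1 - 1 / a)" if "z \<notin> X" for z
        proof -
          have e: "poly P (g z) = 1 + a * (poly P (f z) - 1)" using ab[OF that] b by (simp add: u_def v_def algebra_simps)
          show ?thesis unfolding e using a0 by (simp add: field_simps)
        qed
      qed (use X w1 in blast)+
      then show ?thesis using not0 by blast
    next
      case True
      have Pb: "poly P \<beta>\<^sub>1 \<noteq> poly P \<beta>\<^sub>2" using fac'[of \<beta>\<^sub>1] fac'[of \<beta>\<^sub>2] assms(17) c0 by auto
      show ?thesis
      proof (rule same_poly_values_uniqueness[OF f g X(1) _ _ _ _ assms(7) Pb _ assms(18)])
        show "degree P > 0" using dP n(1) by simp
        show "poly P (f z) = poly P (g z)" if "z \<notin> X" for z
          using ab[OF that] True b by (simp add: u_def v_def)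
        show "share_IM f g {\<beta>\<^sub>1, \<beta>\<^sub>2}" using assms(5,20) by simp
      qed (use X in blast)+
    qed
  qed
qed

end
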